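(* Let $G=(V,E)$ be a simple (no self-loops, no parallel edges), undirected, connected graph with $n=|V|$ vertices and $m=|E|$ edges, given by adjacency lists, and let $k\in[2,n]$ be an integer. Let $s$ be the number of $k$-subtrees of $G$. There is an algorithm that lists every $k$-subtree of $G$ exactly once (each one output explicitly as its list of $k-1$ edges) in $O(sk)$ total time using $O(m)$ space.
   Context: A $k$-subtree of $G$ is an edge subset $T\subseteq E$ with $|T|=k-1$ that is acyclic and connected and whose edges have exactly $k$ distinct endpoints (i.e. an acyclic connected subgraph of $G$ with $k$ vertices, viewed as an unrooted, unordered free tree). Running times are in the standard RAM model. *)

theory Defs
  imports Main
begin

section \<open>Simple undirected graphs and $k$-subtrees\<close>

text \<open>
  A simple undirected graph is a pair of a finite vertex set and a set of edges, an edge being the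
  two-element set of its endpoints; this excludes self-loops and parallel edges. (The cycles of
  \<^verbatim>\<open>Graph_Theory\<close> are directed: in a symmetric digraph the two arcs of an undirected edge already
  form one.)
\<close>

definition simple_graph :: "'a set \<Rightarrow> 'a set set \<Rightarrow> bool" where
  "simple_graph V E \<longleftrightarrow> finite V \<and> (\<forall>e\<in>E. \<exists>u\<in>V. \<exists>v\<in>V. u \<noteq> v \<and> e = {u, v})"

definition connected_graph :: "'a set \<Rightarrow> 'a set set \<Rightarrow> bool" where
  "connected_graph V E \<longleftrightarrow> V \<noteq> {} \<and> (\<forall>u\<in>V. \<forall>v\<in>V. (u, v) \<in> {(x, y). {x, y} \<in> E}\<^sup>*)"

text \<open>A cycle is given by its vertices in cyclic order; the last one is adjacent to the first.\<close>

definition is_cycle :: "'a set set \<Rightarrow> 'a list \<Rightarrow> bool" where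
  "is_cycle E vs \<longleftrightarrow> length vs \<ge> 3 \<and> distinct vs \<and>
     (\<forall>i < length vs. {vs ! i, vs ! (Suc i mod length vs)} \<in> E)"

definition acyclic_graph :: "'a set set \<Rightarrow> bool" where
  "acyclic_graph E \<longleftrightarrow> \<not> (\<exists>vs. is_cycle E vs)"

definition k_subtrees :: "'a set set \<Rightarrow> nat \<Rightarrow> 'a set set set" where
  "k_subtrees E k =
     {T. T \<subseteq> E \<and> card T = k - 1 \<and> acyclic_graph T \<and> connected_graph (\<Union>T) T \<and> card (\<Union>T) = k}"


section \<open>Random access machines\<close>

text \<open>
  The random access machine of Cook and Reckhow, over the natural numbers with truncated
  subtraction: a finite program, random access memory that is initially zero, a one-way read-only
  input tape and a one-way write-only output tape. Every instruction takes unit time. Operands of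
  instructions are addresses, except for the constant in \<open>SetC\<close> and the jump target in \<open>JPos\<close>.
\<close>

datatype instr =
    SetC nat nat      \<comment> \<open>\<open>SetC i c\<close>: \<open>X[i] \<leftarrow> c\<close>\<close>
  | Add nat nat nat   \<comment> \<open>\<open>Add i j l\<close>: \<open>X[i] \<leftarrow> X[j] + X[l]\<close>\<close>
  | Sub nat nat nat   \<comment> \<open>\<open>Sub i j l\<close>: \<open>X[i] \<leftarrow> X[j] - X[l]\<close>\<close>
  | Load nat nat      \<comment> \<open>\<open>Load i j\<close>: \<open>X[i] \<leftarrow> X[X[j]]\<close>\<close>
  | Store nat nat     \<comment> \<open>\<open>Store i j\<close>: \<open>X[X[i]] \<leftarrow> X[j]\<close>\<close>
  | JPos nat nat      \<comment> \<open>\<open>JPos j p\<close>: continue at instruction \<open>p\<close> if \<open>X[j] > 0\<close>\<close>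
  | Read nat          \<comment> \<open>\<open>Read i\<close>: \<open>X[i] \<leftarrow>\<close> next input word\<close>
  | Print nat         \<comment> \<open>\<open>Print j\<close>: append \<open>X[j]\<close> to the output\<close>
  | Halt

record config =
  pc :: nat
  mem :: "nat \<Rightarrow> nat"
  inp :: "nat list"
  out :: "nat list"

definition init_config :: "nat list \<Rightarrow> config" where
  "init_config xs = \<lparr>pc = 0, mem = (\<lambda>_. 0), inp = xs, out = []\<rparr>"

fun exec_instr :: "instr \<Rightarrow> config \<Rightarrow> config option" where
  "exec_instr (SetC i c) s = Some (s\<lparr>pc := pc s + 1, mem := (mem s)(i := c)\<rparr>)"
| "exec_instr (Add i j l) s = Some (s\<lparr>pc := pc s + 1, mem := (mem s)(i := mem s j + mem s l)\<rparr>)"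
| "exec_instr (Sub i j l) s = Some (s\<lparr>pc := pc s + 1, mem := (mem s)(i := mem s j - mem s l)\<rparr>)"
| "exec_instr (Load i j) s = Some (s\<lparr>pc := pc s + 1, mem := (mem s)(i := mem s (mem s j))\<rparr>)"
| "exec_instr (Store i j) s = Some (s\<lparr>pc := pc s + 1, mem := (mem s)(mem s i := mem s j)\<rparr>)"
| "exec_instr (JPos j p) s = Some (s\<lparr>pc := (if mem s j > 0 then p else pc s + 1)\<rparr>)"
| "exec_instr (Read i) s =
     (case inp s of
        [] \<Rightarrow> None
      | x # xs \<Rightarrow> Some (s\<lparr>pc := pc s + 1, mem := (mem s)(i := x), inp := xs\<rparr>))"
| "exec_instr (Print j) s = Some (s\<lparr>pc := pc s + 1, out := out s @ [mem s j]\<rparr>)"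
| "exec_instr Halt s = None"

definition step :: "instr list \<Rightarrow> config \<Rightarrow> config option" where
  "step P s = (if pc s < length P then exec_instr (P ! pc s) s else None)"

text \<open>Only reaching \<open>Halt\<close> is regular termination; every other configuration without a
  successor is a crash.\<close>

definition halted :: "instr list \<Rightarrow> config \<Rightarrow> bool" where
  "halted P s \<longleftrightarrow> pc s < length P \<and> P ! pc s = Halt"

fun accessed :: "instr \<Rightarrow> config \<Rightarrow> nat set" where
  "accessed (SetC i c) s = {i}"
| "accessed (Add i j l) s = {i, j, l}"
| "accessed (Sub i j l) s = {i, j, l}"
| "accessed (Load i j) s = {i, j, mem s j}"
| "accessed (Store i j) s = {i, j, mem s i}"
| "accessed (JPos j p) s = {j}"
| "accessed (Read i) s = {i}"
| "accessed (Print j) s = {j}"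
| "accessed Halt s = {}"

text \<open>
  \<open>ram_computes P xs ys t S W\<close>: on input \<open>xs\<close>, program \<open>P\<close> halts after exactly \<open>t\<close> instructions with
  output \<open>ys\<close>, never accesses a memory cell with an address \<open>\<ge> S\<close>, and never has a
  memory cell with a content \<open>\<ge> W\<close>. So \<open>S\<close> bounds the space in words (the write-only output is
  not counted), and \<open>W\<close> bounds the word size: without it, a linear number of cells would not be
  linear space, as each could hold an arbitrarily large number.
\<close>

definition ram_computes ::
  "instr list \<Rightarrow> nat list \<Rightarrow> nat list \<Rightarrow> nat \<Rightarrow> nat \<Rightarrow> nat \<Rightarrow> bool" where
  "ram_computes P xs ys t S W \<longleftrightarrow>
     (\<exists>cs :: nat \<Rightarrow> config.
        cs 0 = init_config xs \<and>
        (\<forall>i<t. step P (cs i) = Some (cs (Suc i))) \<and>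
        halted P (cs t) \<and> out (cs t) = ys \<and>
        (\<forall>i<t. accessed (P ! pc (cs i)) (cs i) \<subseteq> {..<S}) \<and>
        (\<forall>i\<le>t. \<forall>a. mem (cs i) a < W))"


section \<open>Input and output of the listing problem\<close>

text \<open>The vertices are \<open>0, \<dots>, n - 1\<close>; each adjacency list is in arbitrary order.\<close>

definition adjacency_lists :: "nat \<Rightarrow> nat set set \<Rightarrow> nat list list \<Rightarrow> bool" where
  "adjacency_lists n E adj \<longleftrightarrow> length adj = n \<and>
     (\<forall>v<n. distinct (adj ! v) \<and> set (adj ! v) = {u. {u, v} \<in> E})"

text \<open>The input tape holds \<open>n\<close>, \<open>k\<close> and the adjacency lists, each preceded by its length.\<close>

definition encode_input :: "nat \<Rightarrow> nat \<Rightarrow> nat list list \<Rightarrow> nat list" where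
  "encode_input n k adj = n # k # concat (map (\<lambda>l. length l # l) adj)"

text \<open>A listed subtree is a list of edges, and an edge is printed as its two endpoints. No separators
  are needed, since all listed subtrees have \<open>k - 1\<close> edges.\<close>

definition encode_output :: "(nat \<times> nat) list list \<Rightarrow> nat list" where
  "encode_output Ts = concat (map (\<lambda>(u, v). [u, v]) (concat Ts))"

definition edge_set :: "('a \<times> 'a) list \<Rightarrow> 'a set set" where
  "edge_set T = (\<lambda>(u, v). {u, v}) ` set T"

text \<open>As the members of \<open>k_subtrees E k\<close> have \<open>k - 1\<close> edges, the length condition excludes repeated
  edges within a listed subtree.\<close>

definition lists_exactly_once :: "(nat \<times> nat) list list \<Rightarrow> nat set set \<Rightarrow> nat \<Rightarrow> bool" where
  "lists_exactly_once Ts E k \<longleftrightarrow>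
     (\<forall>T\<in>set Ts. length T = k - 1) \<and>
     distinct (map edge_set Ts) \<and>
     set (map edge_set Ts) = k_subtrees E k"

end

theory Submission
  imports Defs
begin

text \<open>
  Fix a root \<open>r\<close>. All \<open>k\<close>-subtrees containing \<open>r\<close> are generated by binary branching: the current tree
  either is extended by the first edge \<open>e\<close> that leaves its current vertex, or \<open>e\<close> is deleted. Before each
  branching, a depth-first search that starts from the current tree and stops at \<open>k\<close> vertices tells
  whether \<open>e\<close> is forced: the search pops \<open>e\<close> only after having exhausted all other ways to grow, so it
  uses \<open>e\<close> exactly if fewer than \<open>k\<close> vertices can be reached without \<open>e\<close>. Forced edges are
  added without branching; hence every branching has solutions on both sides, and no time is lost on dead ends.

  A branching costs \<open>O(k)\<close> plus the number of edges that are inspected inside the visited set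
  or deleted because both ends came to lie in the tree. By exchanging an edge of one fixed
  solution for such an edge, each of them, up to \<open>O(k)\<close> exceptions, yields another solution on the
  side that includes \<open>e\<close>, so the time is \<open>O(k)\<close> per solution.

  The roots are taken in reverse order of a depth-first search of \<open>G\<close>, and each is deleted after its turn.
  The remaining vertices are then always connected, so every root has a solution as long as \<open>k\<close>
  vertices are left. Since every edge lies in a \<open>k\<close>-subtree, \<open>m \<le> sk\<close>,
  which pays for reading the input. Adjacency is kept in doubly linked lists whose deletions are undone
  from a log, in \<open>O(m)\<close> cells.
\<close>

section \<open>A structured language on top of the machine\<close>

text \<open>The accounting rests on an asymmetry. Both sides of every branching contain solutions,
  so s solutions for a root mean s - 1 branchings, and O(k) per branching is harmless. The remaining
  cost of a branching, its inspected and deleted edges, can be large; it is charged, O(1) each, to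
  solutions that include the branching edge \<open>e\<close>. Only that side may be charged: a
  solution lies on it at most k - 1 times, because the tree grows each time, whereas the number of
  exclusions above a solution is not O(k). Hence the exchange argument has to produce solutions with
  \<open>e\<close>, although the search delivers one without it. A new search after each forced edge
  would be too expensive as well, since no branching pays for it; a single search serves a whole run
  of forced edges, because adding a forced edge does not change its outcome. The machine has no call
  stack, so the enumeration is a flat loop with a log, and the recursion behind the accounting
  exists only in the proof. Time is measured by the ghost clock of a small structured language,
  whose compilation costs a constant factor.\<close>

datatype reg = Zero | RN | RK | RRoot | RSz | RLp | RMode | RCur | RCnt | RVp | RSp | RE | RZ
  | RU | RI | RA | RB | RL | RJ | RX | RT1 | RT2 | RT3 | RT4

datatype arr = ANext | APrev | AHead | ATwin | APar | AOrd | AStk | ALogE | ALogK | ATree | AVis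

fun reg_no :: "reg \<Rightarrow> nat" where
  "reg_no Zero = 2" | "reg_no RN = 3" | "reg_no RK = 4" | "reg_no RRoot = 5" | "reg_no RSz = 6"
| "reg_no RLp = 7" | "reg_no RMode = 8" | "reg_no RCur = 9" | "reg_no RCnt = 10"
| "reg_no RVp = 11" | "reg_no RSp = 12" | "reg_no RE = 13" | "reg_no RZ = 14" | "reg_no RU = 15"
| "reg_no RI = 16" | "reg_no RA = 17" | "reg_no RB = 18" | "reg_no RL = 19" | "reg_no RJ = 20"
| "reg_no RX = 21" | "reg_no RT1 = 22" | "reg_no RT2 = 23" | "reg_no RT3 = 24" | "reg_no RT4 = 25"

fun arr_no :: "arr \<Rightarrow> nat" where
  "arr_no ANext = 0" | "arr_no APrev = 1" | "arr_no AHead = 2" | "arr_no ATwin = 3"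
| "arr_no APar = 4" | "arr_no AOrd = 5" | "arr_no AStk = 6" | "arr_no ALogE = 7"
| "arr_no ALogK = 8" | "arr_no ATree = 9" | "arr_no AVis = 10"

text \<open>Cells 0 and 1 are scratch cells of compiled code, registers live in cells 2 to 63, and the
  arrays are interleaved above them, so that indexing is four doublings and an addition.\<close>

definition adr :: "arr \<Rightarrow> nat \<Rightarrow> nat" where
  "adr A i = 64 + 16 * i + arr_no A"

datatype bcmd = Cst reg nat | Mov reg reg | Inc reg | Dec reg | Get reg arr reg | Put arr reg reg
  | Rd reg | Pr reg

datatype cond = Pos reg | Lt reg reg | Neq reg reg

datatype com = B bcmd | Seq com com (infixr \<open>;;\<close> 60) | If cond com com | While cond com | Skip

text \<open>The field \<open>tm\<close> is a ghost clock.\<close>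

record st =
  rg :: "reg \<Rightarrow> nat"
  ar :: "arr \<Rightarrow> nat \<Rightarrow> nat"
  ip :: "nat list"
  op :: "nat list"
  tm :: nat

text \<open>Array indices and stored values are bounded by \<open>N\<close>; this keeps the compiled program within
  \<open>64 + 16 * N\<close> cells and words.\<close>

fun okb :: "nat \<Rightarrow> bcmd \<Rightarrow> st \<Rightarrow> bool" where
  "okb N (Cst r c) s \<longleftrightarrow> c < 64"
| "okb N (Mov r a) s \<longleftrightarrow> True"
| "okb N (Inc r) s \<longleftrightarrow> rg s r < N"
| "okb N (Dec r) s \<longleftrightarrow> True"
| "okb N (Get r A i) s \<longleftrightarrow> rg s i < N"
| "okb N (Put A i r) s \<longleftrightarrow> rg s i < N"
| "okb N (Rd r) s \<longleftrightarrow> ip s \<noteq> [] \<and> hd (ip s) \<le> N"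
| "okb N (Pr r) s \<longleftrightarrow> True"

fun upd :: "bcmd \<Rightarrow> st \<Rightarrow> st" where
  "upd (Cst r c) s = s\<lparr>rg := (rg s)(r := c), tm := Suc (tm s)\<rparr>"
| "upd (Mov r a) s = s\<lparr>rg := (rg s)(r := rg s a), tm := Suc (tm s)\<rparr>"
| "upd (Inc r) s = s\<lparr>rg := (rg s)(r := Suc (rg s r)), tm := Suc (tm s)\<rparr>"
| "upd (Dec r) s = s\<lparr>rg := (rg s)(r := rg s r - 1), tm := Suc (tm s)\<rparr>"
| "upd (Get r A i) s = s\<lparr>rg := (rg s)(r := ar s A (rg s i)), tm := Suc (tm s)\<rparr>"
| "upd (Put A i r) s = s\<lparr>ar := (ar s)(A := (ar s A)(rg s i := rg s r)), tm := Suc (tm s)\<rparr>"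
| "upd (Rd r) s = s\<lparr>rg := (rg s)(r := hd (ip s)), ip := tl (ip s), tm := Suc (tm s)\<rparr>"
| "upd (Pr r) s = s\<lparr>op := op s @ [rg s r], tm := Suc (tm s)\<rparr>"

fun holds :: "cond \<Rightarrow> st \<Rightarrow> bool" where
  "holds (Pos r) s \<longleftrightarrow> 0 < rg s r"
| "holds (Lt a b) s \<longleftrightarrow> rg s a < rg s b"
| "holds (Neq a b) s \<longleftrightarrow> rg s a \<noteq> rg s b"

definition tick :: "st \<Rightarrow> st" where
  "tick s = s\<lparr>tm := Suc (tm s)\<rparr>"

inductive run :: "nat \<Rightarrow> com \<Rightarrow> st \<Rightarrow> st \<Rightarrow> bool" for N where
  run_B: "okb N b s \<Longrightarrow> run N (B b) s (upd b s)"
| run_Skip: "run N Skip s s"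
| run_Seq: "run N c s s1 \<Longrightarrow> run N d s1 s2 \<Longrightarrow> run N (c ;; d) s s2"
| run_IfT: "holds g s \<Longrightarrow> run N c (tick s) s1 \<Longrightarrow> run N (If g c d) s s1"
| run_IfF: "\<not> holds g s \<Longrightarrow> run N d (tick s) s1 \<Longrightarrow> run N (If g c d) s s1"
| run_WhileF: "\<not> holds g s \<Longrightarrow> run N (While g c) s (tick s)"
| run_WhileT: "holds g s \<Longrightarrow> run N c (tick s) s1 \<Longrightarrow> run N (While g c) s1 s2 \<Longrightarrow>
    run N (While g c) s s2"

section \<open>Compilation into machine code\<close>

fun comp_addr :: "arr \<Rightarrow> reg \<Rightarrow> instr list" where
  "comp_addr A i =
    [Add 0 (reg_no i) (reg_no i), Add 0 0 0, Add 0 0 0, Add 0 0 0, SetC 1 (64 + arr_no A), Add 0 0 1]"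

fun comp_b :: "bcmd \<Rightarrow> instr list" where
  "comp_b (Cst r c) = [SetC (reg_no r) c]"
| "comp_b (Mov r a) = [SetC 0 0, Add (reg_no r) (reg_no a) 0]"
| "comp_b (Inc r) = [SetC 0 1, Add (reg_no r) (reg_no r) 0]"
| "comp_b (Dec r) = [SetC 0 1, Sub (reg_no r) (reg_no r) 0]"
| "comp_b (Get r A i) = comp_addr A i @ [Load (reg_no r) 0]"
| "comp_b (Put A i r) = comp_addr A i @ [Store 0 (reg_no r)]"
| "comp_b (Rd r) = [Read (reg_no r)]"
| "comp_b (Pr r) = [Print (reg_no r)]"

text \<open>The code leaves a positive number in cell 0 exactly if the condition holds; for an
  inequality this is the sum of both truncated differences. \<open>Pos\<close> and \<open>Lt\<close>
  are padded so that every test has length 3, which makes all jump targets computable from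
  \<open>clen\<close>.\<close>

fun comp_g :: "cond \<Rightarrow> instr list" where
  "comp_g (Pos r) = [SetC 0 0, SetC 1 0, Add 0 (reg_no r) 0]"
| "comp_g (Lt a b) = [SetC 0 0, SetC 1 0, Sub 0 (reg_no b) (reg_no a)]"
| "comp_g (Neq a b) = [Sub 0 (reg_no a) (reg_no b), Sub 1 (reg_no b) (reg_no a), Add 0 0 1]"

fun clen :: "com \<Rightarrow> nat" where
  "clen (B b) = length (comp_b b)"
| "clen Skip = 0"
| "clen (c ;; d) = clen c + clen d"
| "clen (If g c d) = clen c + clen d + 6"
| "clen (While g c) = clen c + 8"

text \<open>Jumps are absolute, hence the position \<open>p\<close>. The machine jumps on positive
  cells only, so the else branch is placed before the then branch, and an unconditional jump is a
  test of cell 1 just after it has been set to 1.\<close>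

fun comp :: "com \<Rightarrow> nat \<Rightarrow> instr list" where
  "comp (B b) p = comp_b b"
| "comp Skip p = []"
| "comp (c ;; d) p = comp c p @ comp d (p + clen c)"
| "comp (If g c d) p =
     comp_g g @ [JPos 0 (p + 6 + clen d)] @ comp d (p + 4) @
     [SetC 1 1, JPos 1 (p + 6 + clen d + clen c)] @ comp c (p + 6 + clen d)"
| "comp (While g c) p =
     comp_g g @ [JPos 0 (p + 6), SetC 1 1, JPos 1 (p + 8 + clen c)] @ comp c (p + 6) @
     [SetC 1 1, JPos 1 p]"

lemma length_comp_g [simp]: "length (comp_g g) = 3"
  by (cases g) auto

lemma length_comp [simp]: "length (comp c p) = clen c"
  by (induction c arbitrary: p) auto

fun code_at :: "instr list \<Rightarrow> nat \<Rightarrow> instr list \<Rightarrow> bool" where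
  "code_at P p [] \<longleftrightarrow> True"
| "code_at P p (x # xs) \<longleftrightarrow> p < length P \<and> P ! p = x \<and> code_at P (Suc p) xs"

lemma code_at_append [simp]:
  "code_at P p (xs @ ys) \<longleftrightarrow> code_at P p xs \<and> code_at P (p + length xs) ys"
  by (induction xs arbitrary: p) auto

lemma code_at_self: "code_at (xs @ ys @ zs) (length xs) ys"
proof (induction ys arbitrary: xs)
  case (Cons y ys)
  from Cons[of "xs @ [y]"] show ?case by (simp add: nth_append)
qed simp

section \<open>Simulation of structured programs by the machine\<close>

fun rsteps :: "instr list \<Rightarrow> nat \<Rightarrow> nat \<Rightarrow> config \<Rightarrow> config \<Rightarrow> bool" where
  "rsteps P M 0 c c' \<longleftrightarrow> c' = c"
| "rsteps P M (Suc t) c c' \<longleftrightarrow> (\<exists>c1. step P c = Some c1 \<and> accessed (P ! pc c) c \<subseteq> {..<M} \<and>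
     (\<forall>a. mem c1 a < M) \<and> rsteps P M t c1 c')"

lemma rsteps_trans:
  "rsteps P M t c c1 \<Longrightarrow> rsteps P M u c1 c2 \<Longrightarrow> rsteps P M (t + u) c c2"
  by (induction t arbitrary: c) auto

text \<open>Cells 0 and 1 are constrained by the word bound only, so compiled code may overwrite
  them between commands.\<close>

definition rel :: "nat \<Rightarrow> st \<Rightarrow> config \<Rightarrow> bool" where
  "rel N s c \<longleftrightarrow> (\<forall>r. mem c (reg_no r) = rg s r) \<and> (\<forall>A i. i < N \<longrightarrow> mem c (adr A i) = ar s A i) \<and>
     inp c = ip s \<and> out c = op s \<and> (\<forall>a. mem c a < 64 + 16 * N)"

lemma reg_no_inj [simp]: "reg_no r = reg_no r' \<longleftrightarrow> r = r'"
  by (cases r; cases r'; simp)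

lemma reg_no_bounds: "2 \<le> reg_no r" "reg_no r < 64"
  by (cases r; simp)+

lemma reg_no_neq [simp]: "reg_no r \<noteq> 0" "reg_no r \<noteq> Suc 0" "0 \<noteq> reg_no r" "Suc 0 \<noteq> reg_no r"
  using reg_no_bounds[of r] by auto

lemma reg_no_less [simp]: "reg_no r < 64 + N"
  using reg_no_bounds[of r] by auto

lemma arr_no_less: "arr_no A < 16"
  by (cases A) auto

lemma adr_inj [simp]: "adr A i = adr A' i' \<longleftrightarrow> A = A' \<and> i = i'"
proof
  assume a: "adr A i = adr A' i'"
  have "(16 * i + arr_no A) mod 16 = (16 * i' + arr_no A') mod 16"
    using a unfolding adr_def by simp
  then have 1: "arr_no A = arr_no A'" using arr_no_less[of A] arr_no_less[of A'] by simp
  then have "A = A'" by (cases A; cases A'; simp)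
  with 1 a show "A = A' \<and> i = i'" by (simp add: adr_def)
qed simp

lemma adr_reg [simp]: "adr A i \<noteq> reg_no r" "reg_no r \<noteq> adr A i"
  using reg_no_bounds[of r] by (auto simp: adr_def)

lemma adr_scratch [simp]: "adr A i \<noteq> 0" "adr A i \<noteq> Suc 0"
  by (auto simp: adr_def)

lemma adr_less: "i < N \<Longrightarrow> adr A i < 64 + 16 * N"
  using arr_no_less[of A] by (auto simp: adr_def)

lemma relD:
  assumes "rel N s c"
  shows "mem c (reg_no r) = rg s r" "i < N \<Longrightarrow> mem c (adr A i) = ar s A i"
    "inp c = ip s" "out c = op s" "mem c a < 64 + 16 * N" "rg s r < 64 + 16 * N"
    "i < N \<Longrightarrow> ar s A i < 64 + 16 * N"
  using assms unfolding rel_def by (blast, blast, blast, blast, blast, metis, metis)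

lemma comp_addr_sim:
  assumes "rel N s c" "code_at P (pc c) (comp_addr A i)" "rg s i < N"
  shows "\<exists>c'. rsteps P (64 + 16 * N) 6 c c' \<and> rel N s c' \<and> pc c' = pc c + 6 \<and>
    mem c' 0 = adr A (rg s i)"
proof -
  have "16 * rg s i + arr_no A < 16 * N" "arr_no A < 16"
    using assms(3) arr_no_less[of A] by auto
  moreover have six: "(6::nat) = Suc (Suc (Suc (Suc (Suc (Suc 0)))))" by simp
  ultimately show ?thesis
    unfolding six using assms relD[OF assms(1)]
    by (simp add: step_def rel_def adr_def fun_upd_def)
qed

lemma comp_b_sim:
  assumes "okb N b s" "rel N s c" "code_at P (pc c) (comp_b b)"
  shows "\<exists>c'. rsteps P (64 + 16 * N) (length (comp_b b)) c c' \<and> rel N (upd b s) c' \<and>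
    pc c' = pc c + length (comp_b b)"
proof (cases b)
  case (Get r A i)
  obtain c1 where c1: "rsteps P (64 + 16 * N) 6 c c1" "rel N s c1" "pc c1 = pc c + 6"
    "mem c1 0 = adr A (rg s i)"
    using comp_addr_sim[of N s c P A i] assms Get by auto
  have "code_at P (pc c1) [Load (reg_no r) 0]"
    using assms(3) Get c1(3) by (simp add: eval_nat_numeral)
  then have "\<exists>c2. rsteps P (64 + 16 * N) 1 c1 c2 \<and> rel N (upd b s) c2 \<and> pc c2 = pc c + 7"
    using c1 assms Get relD[OF c1(2)]
    by (simp add: step_def rel_def adr_less)
  then obtain c2 where "rsteps P (64 + 16 * N) 1 c1 c2" "rel N (upd b s) c2" "pc c2 = pc c + 7"
    by blast
  then show ?thesis
    using rsteps_trans[OF c1(1), of 1 c2] Get by (intro exI[of _ c2]) (simp add: eval_nat_numeral del: rsteps.simps)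
next
  case (Put A i r)
  obtain c1 where c1: "rsteps P (64 + 16 * N) 6 c c1" "rel N s c1" "pc c1 = pc c + 6"
    "mem c1 0 = adr A (rg s i)"
    using comp_addr_sim[of N s c P A i] assms Put by auto
  have "code_at P (pc c1) [Store 0 (reg_no r)]"
    using assms(3) Put c1(3) by (simp add: eval_nat_numeral)
  then have "\<exists>c2. rsteps P (64 + 16 * N) 1 c1 c2 \<and> rel N (upd b s) c2 \<and> pc c2 = pc c + 7"
    using c1 assms Put relD[OF c1(2)]
    by (simp add: step_def rel_def adr_less)
  then obtain c2 where "rsteps P (64 + 16 * N) 1 c1 c2" "rel N (upd b s) c2" "pc c2 = pc c + 7"
    by blast
  then show ?thesis
    using rsteps_trans[OF c1(1), of 1 c2] Put by (intro exI[of _ c2]) (simp add: eval_nat_numeral del: rsteps.simps)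
next
  case (Dec r)
  have "rg s r - Suc 0 < 64 + 16 * N" using relD(6)[OF assms(2), of r] by linarith
  then show ?thesis using assms Dec relD[OF assms(2)] by (simp add: step_def rel_def)
next
  case (Rd r)
  then show ?thesis using assms relD[OF assms(2)]
    by (auto simp: step_def rel_def split: list.splits)
qed (use assms relD[OF assms(2)] in \<open>simp_all add: step_def rel_def\<close>)

lemma comp_g_sim:
  assumes "rel N s c" "code_at P (pc c) (comp_g g)"
  shows "\<exists>c'. rsteps P (64 + 16 * N) 3 c c' \<and> rel N s c' \<and> pc c' = pc c + 3 \<and>
    (mem c' 0 > 0 \<longleftrightarrow> holds g s)"
proof (cases g)
  case (Lt a b)
  have "rg s b - rg s a < 64 + 16 * N" using relD(6)[OF assms(1), of b] by linarith
  then show ?thesis using assms Lt relD[OF assms(1)]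
    by (simp add: numeral_2_eq_2 numeral_3_eq_3 step_def rel_def)
next
  case (Neq a b)
  have "rg s b - rg s a < 64 + 16 * N" "rg s a - rg s b < 64 + 16 * N"
    "rg s a - rg s b + (rg s b - rg s a) < 64 + 16 * N"
    using relD(6)[OF assms(1), of b] relD(6)[OF assms(1), of a] by linarith+
  then show ?thesis using assms Neq relD[OF assms(1)]
    by (simp add: numeral_2_eq_2 numeral_3_eq_3 step_def rel_def) linarith
qed (use assms relD[OF assms(1)] in \<open>simp add: numeral_2_eq_2 numeral_3_eq_3 step_def rel_def\<close>)

lemma jump_sim:
  assumes "rel N s c" "code_at P (pc c) [SetC 1 1, JPos 1 q]"
  shows "\<exists>c'. rsteps P (64 + 16 * N) 2 c c' \<and> rel N s c' \<and> pc c' = q"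
  using assms relD[OF assms(1)] by (simp add: numeral_2_eq_2 numeral_3_eq_3 step_def rel_def)

lemma cond_jump_sim:
  assumes "rel N s c" "code_at P (pc c) (comp_g g @ [JPos 0 q])"
  shows "\<exists>c'. rsteps P (64 + 16 * N) 4 c c' \<and> rel N (tick s) c' \<and>
    pc c' = (if holds g s then q else pc c + 4)"
proof -
  obtain c1 where c1: "rsteps P (64 + 16 * N) 3 c c1" "rel N s c1" "pc c1 = pc c + 3"
    "mem c1 0 > 0 \<longleftrightarrow> holds g s"
    using comp_g_sim[of N s c P g] assms by auto
  have "\<exists>c2. rsteps P (64 + 16 * N) 1 c1 c2 \<and> rel N (tick s) c2 \<and>
    pc c2 = (if holds g s then q else pc c + 4)"
    using c1 assms(2) relD[OF c1(2)] by (simp add: step_def rel_def tick_def)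
  then obtain c2 where "rsteps P (64 + 16 * N) 1 c1 c2" "rel N (tick s) c2"
    "pc c2 = (if holds g s then q else pc c + 4)" by blast
  with rsteps_trans[OF c1(1) this(1)] show ?thesis by auto
qed

lemma tm_upd [simp]: "tm (upd b s) = Suc (tm s)"
  by (cases b) auto

text \<open>One tick pays for at most 8 instructions: the longest basic commands, \<open>Get\<close>
  and \<open>Put\<close>, take 7, and the tests and jumps around a branch or a loop iteration take
  at most 6. Both clocks appear additively, so no truncated subtraction occurs.\<close>

lemma comp_sim:
  assumes "run N com s s'" "rel N s c" "code_at P (pc c) (comp com (pc c))"
  shows "\<exists>c' t. rsteps P (64 + 16 * N) t c c' \<and> rel N s' c' \<and> pc c' = pc c + clen com \<and>
    t + 8 * tm s \<le> 8 * tm s'"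
  using assms
proof (induction arbitrary: c rule: run.induct)
  case (run_B b s)
  have "length (comp_b b) \<le> 8" "tm (upd b s) = Suc (tm s)" by (cases b; simp)+
  with comp_b_sim[of N b s c P] run_B show ?case by fastforce
next
  case (run_Skip s)
  then show ?case by (auto intro!: exI[of _ 0])
next
  case (run_Seq c1 s s1 c2 s2)
  obtain ca t where 1: "rsteps P (64 + 16 * N) t c ca" "rel N s1 ca" "pc ca = pc c + clen c1"
    "t + 8 * tm s \<le> 8 * tm s1" using run_Seq.IH(1)[of c] run_Seq.prems by auto
  obtain cb u where 2: "rsteps P (64 + 16 * N) u ca cb" "rel N s2 cb" "pc cb = pc ca + clen c2"
    "u + 8 * tm s1 \<le> 8 * tm s2" using run_Seq.IH(2)[of ca] run_Seq.prems 1 by auto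
  show ?case
    using rsteps_trans[OF 1(1) 2(1)] 1(3,4) 2(2,3,4)
    by (intro exI[of _ cb] exI[of _ "t + u"]) simp
next
  case (run_IfT g s c1 s1 d)
  have code: "code_at P (pc c) (comp_g g @ [JPos 0 (pc c + 6 + clen d)])"
    "code_at P (pc c + 6 + clen d) (comp c1 (pc c + 6 + clen d))"
    using run_IfT.prems by (simp_all add: ac_simps)
  obtain ca where 1: "rsteps P (64 + 16 * N) 4 c ca" "rel N (tick s) ca"
    "pc ca = pc c + 6 + clen d"
    using cond_jump_sim[OF run_IfT.prems(1) code(1)] run_IfT(1) by auto
  obtain cb u where 2: "rsteps P (64 + 16 * N) u ca cb" "rel N s1 cb" "pc cb = pc ca + clen c1"
    "u + 8 * tm (tick s) \<le> 8 * tm s1" using run_IfT.IH[of ca] 1 code by auto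
  show ?case
    using rsteps_trans[OF 1(1) 2(1)] 1(3) 2(2,3,4)
    by (intro exI[of _ cb] exI[of _ "4 + u"]) (simp add: tick_def)
next
  case (run_IfF g s d s1 c1)
  have code: "code_at P (pc c) (comp_g g @ [JPos 0 (pc c + 6 + clen d)])"
    "code_at P (pc c + 4) (comp d (pc c + 4))"
    "code_at P (pc c + 4 + clen d) [SetC 1 1, JPos 1 (pc c + 6 + clen d + clen c1)]"
    using run_IfF.prems by (simp_all add: ac_simps)
  obtain ca where 1: "rsteps P (64 + 16 * N) 4 c ca" "rel N (tick s) ca" "pc ca = pc c + 4"
    using cond_jump_sim[OF run_IfF.prems(1) code(1)] run_IfF(1) by auto
  obtain cb u where 2: "rsteps P (64 + 16 * N) u ca cb" "rel N s1 cb" "pc cb = pc ca + clen d"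
    "u + 8 * tm (tick s) \<le> 8 * tm s1" using run_IfF.IH[of ca] 1 code by auto
  obtain cc where 3: "rsteps P (64 + 16 * N) 2 cb cc" "rel N s1 cc"
    "pc cc = pc c + 6 + clen d + clen c1"
    using jump_sim[OF 2(2), of P] code(3) 1 2 by auto
  show ?case
    using rsteps_trans[OF 1(1) rsteps_trans[OF 2(1) 3(1)]] 2(4) 3(2,3)
    by (intro exI[of _ cc] exI[of _ "4 + (u + 2)"]) (simp add: tick_def)
next
  case (run_WhileF g s c1)
  have code: "code_at P (pc c) (comp_g g @ [JPos 0 (pc c + 6)])"
    "code_at P (pc c + 4) [SetC 1 1, JPos 1 (pc c + 8 + clen c1)]"
    using run_WhileF.prems by (simp_all add: ac_simps)
  obtain ca where 1: "rsteps P (64 + 16 * N) 4 c ca" "rel N (tick s) ca" "pc ca = pc c + 4"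
    using cond_jump_sim[OF run_WhileF.prems(1) code(1)] run_WhileF(1) by auto
  obtain cc where 3: "rsteps P (64 + 16 * N) 2 ca cc" "rel N (tick s) cc"
    "pc cc = pc c + 8 + clen c1"
    using jump_sim[OF 1(2), of P] code(2) 1 by auto
  show ?case
    using rsteps_trans[OF 1(1) 3(1)] 3(2,3)
    by (intro exI[of _ cc] exI[of _ "4 + 2"]) (simp add: tick_def)
next
  case (run_WhileT g s c1 s1 s2)
  have code: "code_at P (pc c) (comp_g g @ [JPos 0 (pc c + 6)])"
    "code_at P (pc c + 6) (comp c1 (pc c + 6))"
    "code_at P (pc c + 6 + clen c1) [SetC 1 1, JPos 1 (pc c)]"
    using run_WhileT.prems by (simp_all add: ac_simps)
  obtain ca where 1: "rsteps P (64 + 16 * N) 4 c ca" "rel N (tick s) ca" "pc ca = pc c + 6"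
    using cond_jump_sim[OF run_WhileT.prems(1) code(1)] run_WhileT(1) by auto
  obtain cb u where 2: "rsteps P (64 + 16 * N) u ca cb" "rel N s1 cb" "pc cb = pc ca + clen c1"
    "u + 8 * tm (tick s) \<le> 8 * tm s1" using run_WhileT.IH(1)[of ca] 1 code by auto
  obtain cc where 3: "rsteps P (64 + 16 * N) 2 cb cc" "rel N s1 cc" "pc cc = pc c"
    using jump_sim[OF 2(2), of P] code(3) 1 2 by auto
  obtain cd v where 4: "rsteps P (64 + 16 * N) v cc cd" "rel N s2 cd"
    "pc cd = pc c + clen (While g c1)" "v + 8 * tm s1 \<le> 8 * tm s2"
    using run_WhileT.IH(2)[of cc] run_WhileT.prems(2) 3 by metis
  show ?case
    using rsteps_trans[OF 1(1) rsteps_trans[OF 2(1) rsteps_trans[OF 3(1) 4(1)]]] 2(4) 4(2,3,4)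
    by (intro exI[of _ cd] exI[of _ "4 + (u + (2 + v))"]) (simp add: tick_def)
qed

lemma rsteps_trace:
  "rsteps P M t c c' \<Longrightarrow> (\<forall>a. mem c a < M) \<Longrightarrow> \<exists>cs. cs 0 = c \<and> cs t = c' \<and>
    (\<forall>i<t. step P (cs i) = Some (cs (Suc i))) \<and>
    (\<forall>i<t. accessed (P ! pc (cs i)) (cs i) \<subseteq> {..<M}) \<and> (\<forall>i\<le>t. \<forall>a. mem (cs i) a < M)"
proof (induction t arbitrary: c)
  case 0
  then show ?case by (auto intro!: exI[of _ "\<lambda>_. c"])
next
  case (Suc t)
  then obtain c1 where c1: "step P c = Some c1" "accessed (P ! pc c) c \<subseteq> {..<M}"
    "\<forall>a. mem c1 a < M" "rsteps P M t c1 c'" by auto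
  from Suc.IH[OF c1(4,3)] obtain cs where cs: "cs 0 = c1" "cs t = c'"
    "\<forall>i<t. step P (cs i) = Some (cs (Suc i))"
    "\<forall>i<t. accessed (P ! pc (cs i)) (cs i) \<subseteq> {..<M}" "\<forall>i\<le>t. \<forall>a. mem (cs i) a < M" by auto
  have [simp]: "(i < Suc t) = (case i of 0 \<Rightarrow> True | Suc j \<Rightarrow> j < t)"
    "(i \<le> Suc t) = (case i of 0 \<Rightarrow> True | Suc j \<Rightarrow> j \<le> t)" for i
    by (simp_all split: nat.splits)
  show ?case
    using c1 cs Suc.prems(2)
    by (intro exI[of _ "case_nat c cs"]) (simp split: nat.splits)
qed

definition init_st :: "nat list \<Rightarrow> st" where
  "init_st xs = \<lparr>rg = (\<lambda>_. 0), ar = (\<lambda>_ _. 0), ip = xs, op = [], tm = 0\<rparr>"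

lemma run_ram_computes:
  assumes "run N com (init_st xs) s'" "64 + 16 * N \<le> S" "64 + 16 * N \<le> W"
  shows "\<exists>t. ram_computes (comp com 0 @ [Halt]) xs (op s') t S W \<and> t \<le> 8 * tm s'"
proof -
  let ?P = "comp com 0 @ [Halt]" and ?M = "64 + 16 * N"
  have rel: "rel N (init_st xs) (init_config xs)"
    by (simp add: rel_def init_st_def init_config_def)
  have code: "code_at ?P (pc (init_config xs)) (comp com (pc (init_config xs)))"
    using code_at_self[of "[]" "comp com 0" "[Halt]"] by (simp add: init_config_def)
  obtain c' t where c': "rsteps ?P ?M t (init_config xs) c'" "rel N s' c'" "pc c' = clen com"
    "t \<le> 8 * tm s'"
    using comp_sim[OF assms(1) rel code] by (auto simp: init_config_def init_st_def)
  obtain cs where cs: "cs 0 = init_config xs" "cs t = c'"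
    "\<forall>i<t. step ?P (cs i) = Some (cs (Suc i))"
    "\<forall>i<t. accessed (?P ! pc (cs i)) (cs i) \<subseteq> {..<?M}" "\<forall>i\<le>t. \<forall>a. mem (cs i) a < ?M"
    using rsteps_trace[OF c'(1)] by (auto simp: init_config_def)
  have 1: "halted ?P (cs t)" using c'(3) cs(2) by (simp add: halted_def nth_append)
  have 2: "out (cs t) = op s'" using relD(4)[OF c'(2)] cs(2) by simp
  have 3: "\<forall>i<t. accessed (?P ! pc (cs i)) (cs i) \<subseteq> {..<S}"
    using cs(4) assms(2) by (metis lessThan_subset_iff order_trans)
  have 4: "\<forall>i\<le>t. \<forall>a. mem (cs i) a < W" using cs(5) assms(3) less_le_trans by blast
  have "ram_computes ?P xs (op s') t S W"
    unfolding ram_computes_def by (intro exI[of _ cs] conjI) (fact cs(1) cs(3) 1 2 3 4)+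
  with c'(4) show ?thesis by blast
qed

subsection \<open>Symbolic execution\<close>

text \<open>Asking for a run that exists makes this total correctness. The equations below turn it
  into a symbolic interpreter that the simplifier can execute.\<close>

definition wp :: "nat \<Rightarrow> com \<Rightarrow> (st \<Rightarrow> bool) \<Rightarrow> st \<Rightarrow> bool" where
  "wp N c Q s \<longleftrightarrow> (\<exists>s'. run N c s s' \<and> Q s')"

inductive_cases run_BE: "run N (B b) s s'"
inductive_cases run_SkipE: "run N Skip s s'"
inductive_cases run_SeqE: "run N (c ;; d) s s'"
inductive_cases run_IfE: "run N (If g c d) s s'"
inductive_cases run_WhileE: "run N (While g c) s s'"

lemma wp_B [simp]: "wp N (B b) Q s \<longleftrightarrow> okb N b s \<and> Q (upd b s)"
  unfolding wp_def by (blast intro: run_B elim: run_BE)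

lemma wp_Skip [simp]: "wp N Skip Q s \<longleftrightarrow> Q s"
  unfolding wp_def by (blast intro: run_Skip elim: run_SkipE)

lemma wp_Seq [simp]: "wp N (c ;; d) Q = wp N c (wp N d Q)"
  unfolding wp_def by (blast intro: run_Seq elim: run_SeqE)

lemma wp_If [simp]: "wp N (If g c d) Q s \<longleftrightarrow>
    (if holds g s then wp N c Q (tick s) else wp N d Q (tick s))"
  unfolding wp_def by (auto intro: run_IfT run_IfF elim: run_IfE)

lemma wp_While: "wp N (While g c) Q s \<longleftrightarrow>
    (if holds g s then wp N c (wp N (While g c) Q) (tick s) else Q (tick s))"
  unfolding wp_def by (auto intro: run_WhileT run_WhileF elim: run_WhileE)

lemma wp_mono: "wp N c Q s \<Longrightarrow> (\<And>s'. Q s' \<Longrightarrow> R s') \<Longrightarrow> wp N c R s"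
  unfolding wp_def by blast

text \<open>The measure is often \<open>M - tm s\<close>: an invariant that keeps the ghost clock
  below \<open>M\<close> makes the time bound itself the termination argument.\<close>

lemma wp_while_inv:
  fixes f :: "st \<Rightarrow> nat"
  assumes inv: "I s"
    and stop: "\<And>s. I s \<Longrightarrow> \<not> holds g s \<Longrightarrow> Q (tick s)"
    and body: "\<And>s. I s \<Longrightarrow> holds g s \<Longrightarrow> wp N c (\<lambda>s'. I s' \<and> f s' < f s) (tick s)"
  shows "wp N (While g c) Q s"
  using inv
proof (induction "f s" arbitrary: s rule: less_induct)
  case less
  show ?case
  proof (cases "holds g s")
    case True
    have "wp N c (wp N (While g c) Q) (tick s)"
      by (rule wp_mono[OF body[OF less.prems True]]) (use less.hyps in auto)
    with True show ?thesis by (subst wp_While) simp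
  next
    case False
    with stop[OF less.prems] show ?thesis by (subst wp_While) simp
  qed
qed

lemma tick_sel [simp]: "rg (tick s) = rg s" "ar (tick s) = ar s" "ip (tick s) = ip s"
  "op (tick s) = op s" "tm (tick s) = Suc (tm s)"
  by (simp_all add: tick_def)

section \<open>Trees and their growth sequences\<close>

abbreviation walks :: "'a set set \<Rightarrow> ('a \<times> 'a) set" where
  "walks T \<equiv> {(x, y). {x, y} \<in> T}\<^sup>*"

text \<open>The vertex set is explicit because a single root has no edges from which it could be
  recovered, and every enumeration starts from such a tree. The edge count is carried along to meet
  the size condition of \<open>k_subtrees\<close>.\<close>

definition tree :: "'a set \<Rightarrow> 'a set set \<Rightarrow> bool" where
  "tree V T \<longleftrightarrow> finite V \<and> V \<noteq> {} \<and> \<Union>T \<subseteq> V \<and> card T + 1 = card V \<and> acyclic_graph T \<and>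
     (\<forall>u\<in>V. \<forall>v\<in>V. (u, v) \<in> walks T)"

lemma walks_closed:
  assumes "(u, v) \<in> walks T" "u \<in> C" "\<And>x y. {x, y} \<in> T \<Longrightarrow> x \<in> C \<Longrightarrow> y \<in> C"
  shows "v \<in> C"
  using assms by (induction rule: rtrancl_induct) auto

lemma treeD:
  assumes "tree V T"
  shows "finite V" "V \<noteq> {}" "finite T" "\<And>e. e \<in> T \<Longrightarrow> e \<subseteq> V" "card T + 1 = card V"
    "acyclic_graph T" "\<And>u v. u \<in> V \<Longrightarrow> v \<in> V \<Longrightarrow> (u, v) \<in> walks T"
proof -
  show "finite T"
    using assms finite_subset[of T "Pow V"] unfolding tree_def by blast
qed (use assms in \<open>auto simp: tree_def\<close>)

lemma tree_single: "tree {r} {}"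
  by (auto simp: tree_def acyclic_graph_def is_cycle_def intro!: exI[of _ 0])

text \<open>A cycle through \<open>z\<close> would have \<open>x\<close> both before and after
  \<open>z\<close>, as \<open>{x, z}\<close> is the only edge at \<open>z\<close>; but the two
  neighbours on a cycle of length at least 3 differ.\<close>

lemma acyclic_insert_leaf:
  assumes "acyclic_graph T" "z \<notin> \<Union>T"
  shows "acyclic_graph (insert {x, z} T)"
  unfolding acyclic_graph_def
proof
  assume "\<exists>vs. is_cycle (insert {x, z} T) vs"
  then obtain vs where vs: "length vs \<ge> 3" "distinct vs"
    "\<And>i. i < length vs \<Longrightarrow> {vs ! i, vs ! (Suc i mod length vs)} \<in> insert {x, z} T"
    unfolding is_cycle_def by blast
  let ?l = "length vs"
  show False
  proof (cases "z \<in> set vs")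
    case False
    have "{vs ! i, vs ! (Suc i mod ?l)} \<in> T" if "i < ?l" for i
    proof -
      have "Suc i mod ?l < ?l" using vs(1) by (intro mod_less_divisor) linarith
      then have "vs ! i \<in> set vs" "vs ! (Suc i mod ?l) \<in> set vs" using that by auto
      then have "{vs ! i, vs ! (Suc i mod ?l)} \<noteq> {x, z}" using False by (metis insertI1 insert_commute insertE singletonD)
      then show ?thesis using vs(3)[OF that] by auto
    qed
    then have "is_cycle T vs" using vs unfolding is_cycle_def by blast
    then show False using assms(1) unfolding acyclic_graph_def by blast
  next
    case True
    then obtain i where i: "i < ?l" "vs ! i = z" by (auto simp: in_set_conv_nth)
    \<comment> \<open>\<open>j\<close> is the cyclic predecessor of the position \<open>i\<close>,
      and \<open>?k\<close> its successor.\<close>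
    define j where "j = (if i = 0 then ?l - 1 else i - 1)"
    have j: "j < ?l" "Suc j mod ?l = i" using i vs(1) by (auto simp: j_def)
    let ?k = "Suc i mod ?l"
    have k: "?k < ?l" using vs(1) by (intro mod_less_divisor) linarith
    have ne: "?k \<noteq> j" "?k \<noteq> i" using i vs(1)
      by (auto simp: j_def mod_Suc split: if_splits)
    have e: "{z, vs ! ?k} = {x, z}" "{vs ! j, z} = {x, z}"
      using vs(3)[OF i(1)] vs(3)[OF j(1)] i j(2) assms(2) by auto
    have "vs ! ?k \<noteq> z" using nth_eq_iff_index_eq[OF vs(2) k i(1)] ne i by auto
    with e(1) have "vs ! ?k = x" by (auto simp: doubleton_eq_iff)
    moreover have "vs ! j \<noteq> z"
    proof
      assume "vs ! j = z"
      then have "j = i" using nth_eq_iff_index_eq[OF vs(2) j(1) i(1)] i by auto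
      then show False using vs(1) by (auto simp: j_def split: if_splits)
    qed
    with e(2) have "vs ! j = x" by (auto simp: doubleton_eq_iff)
    ultimately show False using nth_eq_iff_index_eq[OF vs(2) k j(1)] ne by auto
  qed
qed

lemma tree_insert:
  assumes "tree V T" "x \<in> V" "z \<notin> V"
  shows "tree (insert z V) (insert {x, z} T)"
proof -
  let ?T = "insert {x, z} T"
  note t = treeD[OF assms(1)]
  have new: "{x, z} \<notin> T" using t(4) assms(3) by blast
  have mono: "walks T \<subseteq> walks ?T" by (rule rtrancl_mono) auto
  have zx: "(z, x) \<in> walks ?T" "(x, z) \<in> walks ?T"
    by (auto simp: insert_commute)
  have "(u, v) \<in> walks ?T" if "u \<in> insert z V" "v \<in> insert z V" for u v
  proof -
    have 1: "(u, x) \<in> walks ?T" using that(1) zx t(7)[of u x] assms(2) mono by auto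
    have "(x, v) \<in> walks ?T" using that(2) zx t(7)[of x v] assms(2) mono by auto
    with 1 show ?thesis by (rule rtrancl_trans)
  qed
  moreover have "acyclic_graph ?T"
    using t(4) assms(3) by (intro acyclic_insert_leaf[OF t(6)]) blast
  ultimately show ?thesis
    using t assms new unfolding tree_def by (auto simp del: Union_insert)
qed

text \<open>The bound \<open>2 \<le> k\<close> excludes the tree without edges, whose only vertex is
  missing from the union of its edges.\<close>

lemma tree_k_subtree:
  assumes "tree V T" "T \<subseteq> E" "card V = k" "2 \<le> k"
  shows "T \<in> k_subtrees E k" "\<Union>T = V"
proof -
  note t = treeD[OF assms(1)]
  show eq: "\<Union>T = V"
  proof
    show "V \<subseteq> \<Union>T"
    proof
      fix v assume v: "v \<in> V"
      have "V \<noteq> {v}" using assms by auto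
      then obtain u where u: "u \<in> V" "u \<noteq> v" using v by blast
      from t(7)[OF u(1) v] u(2) obtain y where "{y, v} \<in> T"
        by (auto elim: rtranclE)
      then show "v \<in> \<Union>T" by blast
    qed
  qed (use t(4) in blast)
  show "T \<in> k_subtrees E k"
  proof -
    have "connected_graph (\<Union>T) T" using t(2,7) unfolding connected_graph_def eq by blast
    moreover have "card (\<Union>T) = k" "card T = k - 1" using assms(3) t(5) eq by auto
    ultimately show ?thesis using t(6) assms(2) unfolding k_subtrees_def by blast
  qed
qed

text \<open>The tree grows vertex by vertex: as long as a vertex is missing, a walk to it supplies
  an edge that leaves the current vertex set.\<close>

lemma spanning_tree:
  assumes "finite V" "V \<noteq> {}" "\<Union>T \<subseteq> V" "\<And>u v. u \<in> V \<Longrightarrow> v \<in> V \<Longrightarrow> (u, v) \<in> walks T"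
  shows "\<exists>T0\<subseteq>T. tree V T0"
proof -
  have "\<exists>V0 T0. V0 \<subseteq> V \<and> card V0 = Suc j \<and> T0 \<subseteq> T \<and> tree V0 T0" if "j < card V" for j
    using that
  proof (induction j)
    case 0
    obtain r where "r \<in> V" using assms(2) by blast
    then show ?case using tree_single[of r] by (intro exI[of _ "{r}"] exI[of _ "{}"]) auto
  next
    case (Suc j)
    then obtain V0 T0 where 0: "V0 \<subseteq> V" "card V0 = Suc j" "T0 \<subseteq> T" "tree V0 T0" by auto
    obtain u v where uv: "u \<in> V0" "v \<in> V" "v \<notin> V0"
    proof -
      have "V0 \<noteq> {}" using treeD(2)[OF 0(4)] .
      moreover have "V0 \<noteq> V" using 0(2) Suc.prems by auto
      ultimately show ?thesis using 0(1) that by blast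
    qed
    have "\<exists>x y. {x, y} \<in> T \<and> x \<in> V0 \<and> y \<notin> V0"
      using walks_closed[OF assms(4)[of u v], of V0] uv 0(1) by blast
    then obtain x y where xy: "{x, y} \<in> T" "x \<in> V0" "y \<notin> V0" by blast
    have "tree (insert y V0) (insert {x, y} T0)" by (rule tree_insert[OF 0(4) xy(2,3)])
    moreover have "insert y V0 \<subseteq> V" using 0 xy assms(3) by blast
    moreover have "card (insert y V0) = Suc (Suc j)"
      using 0 xy treeD(1)[OF 0(4)] by simp
    moreover have "insert {x, y} T0 \<subseteq> T" using 0(3) xy(1) by simp
    ultimately show ?case by (intro exI conjI)
  qed
  from this[of "card V - 1"] assms obtain V0 T0 where
    "V0 \<subseteq> V" "card V0 = card V" "T0 \<subseteq> T" "tree V0 T0" by (auto simp: card_gt_0_iff)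
  then show ?thesis using card_subset_eq[of V V0] assms(1) by auto
qed

text \<open>By counting: the walk inside the subtree would make an extra chord superfluous.\<close>

lemma k_subtree_no_chord:
  assumes T: "T \<in> k_subtrees E k" "1 \<le> k" and S: "tree S T0" "T0 \<subseteq> T" "S \<subseteq> \<Union>T"
    and f: "{a, b} \<in> T" "a \<in> S" "b \<in> S"
  shows "{a, b} \<in> T0"
proof (rule ccontr)
  assume n: "{a, b} \<notin> T0"
  have T': "card T = k - 1" "card (\<Union>T) = k"
    "\<And>u v. u \<in> \<Union>T \<Longrightarrow> v \<in> \<Union>T \<Longrightarrow> (u, v) \<in> walks T"
    using T unfolding k_subtrees_def connected_graph_def by blast+
  have fin: "finite (\<Union>T)" using T T'(2) card.infinite by fastforce
  then have finT: "finite T" by (metis finite_UnionD)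
  let ?T = "T - {{a, b}}"
  have "walks T0 \<subseteq> walks ?T" using S(2) n by (intro rtrancl_mono) auto
  then have "(a, b) \<in> walks ?T" "(b, a) \<in> walks ?T"
    using treeD(7)[OF S(1)] f by auto
  then have "{(x, y). {x, y} \<in> T} \<subseteq> walks ?T"
    by (auto simp: doubleton_eq_iff)
  then have "walks T \<subseteq> walks ?T" by (rule rtrancl_subset_rtrancl)
  then have "(u, v) \<in> walks ?T" if "u \<in> \<Union>T" "v \<in> \<Union>T" for u v
    using T'(3)[OF that] by (rule subsetD)
  moreover have "a \<in> \<Union>T" using f(1) by blast
  then have "\<Union>T \<noteq> {}" "\<Union>?T \<subseteq> \<Union>T" by auto
  ultimately obtain T1 where "T1 \<subseteq> ?T" "tree (\<Union>T) T1"
    using spanning_tree[of "\<Union>T" ?T] fin by metis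
  then have "card T1 \<le> card ?T" "card T1 + 1 = k"
    using finT T'(2) treeD(5) by (auto intro: card_mono)
  moreover have "card ?T < card T" using finT f by (intro psubset_card_mono) auto
  ultimately show False using T'(1) by simp
qed

text \<open>A growth sequence attaches the new vertices one at a time; in each pair the second vertex is
  the new one.\<close>

fun growth :: "'a set \<Rightarrow> ('a \<times> 'a) list \<Rightarrow> bool" where
  "growth S [] \<longleftrightarrow> True"
| "growth S ((x, z) # qs) \<longleftrightarrow> x \<in> S \<and> z \<notin> S \<and> growth (insert z S) qs"

abbreviation heads :: "('a \<times> 'a) list \<Rightarrow> 'a set" where
  "heads qs \<equiv> snd ` set qs"

lemma edge_set_simps [simp]:
  "edge_set [] = {}" "edge_set ((x, z) # qs) = insert {x, z} (edge_set qs)"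
  "edge_set (ps @ qs) = edge_set ps \<union> edge_set qs"
  by (auto simp: edge_set_def)

lemma growth_append:
  "growth S (ps @ qs) \<longleftrightarrow> growth S ps \<and> growth (S \<union> heads ps) qs"
  by (induction S ps rule: growth.induct) auto

lemma growth_heads: "growth S qs \<Longrightarrow> S \<inter> heads qs = {}"
  by (induction S qs rule: growth.induct) auto

lemma growth_card: "growth S qs \<Longrightarrow> finite S \<Longrightarrow> card (S \<union> heads qs) = card S + length qs"
  by (induction S qs rule: growth.induct) auto

lemma growth_edges:
  "growth S qs \<Longrightarrow> f \<in> edge_set qs \<Longrightarrow> f \<subseteq> S \<union> heads qs \<and> \<not> f \<subseteq> S"
  by (induction S qs rule: growth.induct) auto

lemma growth_enlarge: "growth S qs \<Longrightarrow> w \<notin> heads qs \<Longrightarrow> growth (insert w S) qs"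
  by (induction S qs rule: growth.induct) (auto simp: insert_commute)

lemma tree_growth: "tree S T \<Longrightarrow> growth S qs \<Longrightarrow> tree (S \<union> heads qs) (T \<union> edge_set qs)"
proof (induction S qs arbitrary: T rule: growth.induct)
  case (2 S x z qs)
  then show ?case using "2.IH"[of "insert {x, z} T"] tree_insert[of S T x z] by simp
qed simp

text \<open>Later steps depend only on the set of vertices present, so the parent used in a step may
  be any vertex that is already there.\<close>

lemma growth_reattach:
  assumes "growth S (ps @ (x, b) # rs)" "a \<in> S \<union> heads ps"
  shows "growth S (ps @ (a, b) # rs)"
  using assms by (auto simp: growth_append)

lemma growth_remove:
  assumes "growth S (ps @ (x, w) # qs)"
  shows "growth (insert w S) (ps @ qs)"
proof -
  have "w \<notin> heads ps" using assms by (auto simp: growth_append)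
  then show ?thesis using assms growth_enlarge[of S ps w] by (auto simp: growth_append)
qed

text \<open>Of the two ends of a new edge, the one that was attached later gets a new parent.\<close>

lemma growth_exchange:
  assumes g: "growth S qs" and ab: "a \<in> S \<union> heads qs" "b \<in> S \<union> heads qs" "a \<noteq> b"
    and nS: "\<not> {a, b} \<subseteq> S"
  shows "\<exists>qs'. growth S qs' \<and> heads qs' = heads qs \<and> {a, b} \<in> edge_set qs' \<and>
    edge_set qs' \<subseteq> insert {a, b} (edge_set qs)"
proof -
  have swap: ?thesis if "qs = ps @ (x, d) # rs" "c \<in> S \<union> heads ps" "{a, b} = {c, d}"
    for ps x d rs c
    using growth_reattach[of S ps x d rs c] g that
    by (intro exI[of _ "ps @ (c, d) # rs"]) auto
  have split: "\<exists>ps x rs. qs = ps @ (x, d) # rs" if "d \<in> heads qs" for d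
  proof -
    from that obtain x where "(x, d) \<in> set qs" by auto
    then show ?thesis by (metis split_list)
  qed
  consider "a \<in> S" | "b \<in> S" | "a \<notin> S" "b \<notin> S" by blast
  then show ?thesis
  proof cases
    case 1
    then show ?thesis using split[of b] swap[of _ _ b _ a] ab nS by auto
  next
    case 2
    then show ?thesis using split[of a] swap[of _ _ a _ b] ab nS by (auto simp: insert_commute)
  next
    case 3
    then obtain ps x rs where 1: "qs = ps @ (x, a) # rs" using split[of a] ab by auto
    show ?thesis
    proof (cases "b \<in> heads ps")
      case True
      then show ?thesis using swap[OF 1, of b] by (auto simp: insert_commute)
    next
      case False
      then have "b \<in> heads rs" using ab 3 1 by auto
      then obtain rs1 y rs2 where "rs = rs1 @ (y, b) # rs2" by (auto dest!: split_list)
      then show ?thesis using swap[of "ps @ (x, a) # rs1" y b rs2 a] 1 by auto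
    qed
  qed
qed

section \<open>Counting solutions by exchanges\<close>

text \<open>\<open>X\<close> consists of the edges that may still be used. The condition on
  \<open>S\<close> matters when \<open>T0\<close> is empty: it then fixes the root.\<close>

definition sols :: "'a set set \<Rightarrow> nat \<Rightarrow> 'a set \<Rightarrow> 'a set set \<Rightarrow> 'a set set \<Rightarrow> 'a set set set" where
  "sols E k S T0 X = {T \<in> k_subtrees E k. T0 \<subseteq> T \<and> T \<subseteq> T0 \<union> X \<and> S \<subseteq> \<Union>T}"

lemma growth_sols:
  assumes "tree S T0" "T0 \<subseteq> E" "X \<subseteq> E" "growth S qs" "edge_set qs \<subseteq> X"
    "card S + length qs = k" "2 \<le> k"
  shows "T0 \<union> edge_set qs \<in> sols E k S T0 X"
proof -
  have t: "tree (S \<union> heads qs) (T0 \<union> edge_set qs)" by (rule tree_growth) fact+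
  have c: "card (S \<union> heads qs) = k"
    using growth_card[OF assms(4)] treeD(1)[OF assms(1)] assms(6) by simp
  show ?thesis
    using tree_k_subtree[OF t _ c assms(7), of E] assms unfolding sols_def by auto
qed

lemma finite_k_subtrees: "finite E \<Longrightarrow> finite (k_subtrees E k)"
  by (rule finite_subset[of _ "Pow E"]) (auto simp: k_subtrees_def)

lemma finite_sols: "finite E \<Longrightarrow> finite (sols E k S T0 X)"
  by (rule finite_subset[OF _ finite_k_subtrees[of E k]]) (auto simp: sols_def)

lemma card_edge_set: "card (edge_set qs) \<le> length qs"
  unfolding edge_set_def using card_image_le[of "set qs"] card_length[of qs]
  by (meson finite_set le_trans)

text \<open>The sequence \<open>qs\<close> describes one fixed solution. Each counted edge
  \<open>f\<close> outside it can be exchanged into it, which yields a solution that contains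
  \<open>f\<close> and otherwise only edges of the fixed one. So \<open>f\<close> can be read off
  from the new solution, and different edges give different solutions. The exceptions are the at
  most \<open>length qs\<close> edges of \<open>qs\<close> itself.\<close>

lemma count_exchanges:
  assumes E: "finite E" and t: "tree S T0" "T0 \<subseteq> E" "X \<subseteq> E" and g: "growth S qs"
    "edge_set qs \<subseteq> X" "card S + length qs = k" "2 \<le> k"
    and X: "\<And>f. f \<in> X \<Longrightarrow> \<exists>a b. a \<noteq> b \<and> f = {a, b}" "\<And>f. f \<in> X \<Longrightarrow> \<not> f \<subseteq> S"
  shows "card {f \<in> X. f \<subseteq> S \<union> heads qs \<or> (qs \<noteq> [] \<and> f \<inter> S \<noteq> {})}
    \<le> card (sols E k S T0 X) + length qs"
proof -
  let ?F = "{f \<in> X. f \<subseteq> S \<union> heads qs \<or> (qs \<noteq> [] \<and> f \<inter> S \<noteq> {})}"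
  let ?T = "T0 \<union> edge_set qs"
  have fin: "finite X" using E t(3) finite_subset by blast
  have "\<exists>T\<in>sols E k S T0 X. f \<in> T \<and> T \<subseteq> insert f ?T" if f: "f \<in> ?F" for f
  proof -
    obtain a b where ab: "a \<noteq> b" "f = {a, b}" using X(1) f by blast
    have nS: "\<not> {a, b} \<subseteq> S" using X(2) f ab by auto
    have "\<exists>qs'. growth S qs' \<and> card S + length qs' = k \<and> f \<in> edge_set qs' \<and>
      edge_set qs' \<subseteq> insert f (edge_set qs)"
    proof (cases "f \<subseteq> S \<union> heads qs")
      case True
      then obtain qs' where qs': "growth S qs'" "heads qs' = heads qs" "{a, b} \<in> edge_set qs'"
        "edge_set qs' \<subseteq> insert {a, b} (edge_set qs)"
        using growth_exchange[OF g(1) _ _ ab(1) nS] ab by auto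
      have "card S + length qs' = k"
        using growth_card[OF qs'(1)] growth_card[OF g(1)] treeD(1)[OF t(1)] g(3) qs'(2) by simp
      with qs' ab show ?thesis by blast
    next
      \<comment> \<open>An edge from \<open>S\<close> to a vertex that the fixed solution misses
        takes the place of its last step, below which nothing hangs; this is why \<open>qs\<close>
        has to be nonempty.\<close>
      case False
      then obtain c d where cd: "f = {c, d}" "c \<in> S" "d \<notin> S \<union> heads qs" "qs \<noteq> []"
        using f ab by (auto simp: insert_commute)
      obtain ps q where ps: "qs = ps @ [q]" using cd(4) by (cases qs rule: rev_cases) auto
      have "growth S (ps @ [(c, d)])"
        using g(1) cd ps by (auto simp: growth_append)
      then show ?thesis using cd g(3) ps by (intro exI[of _ "ps @ [(c, d)]"]) auto
    qed
    then obtain qs' where qs': "growth S qs'" "card S + length qs' = k" "f \<in> edge_set qs'"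
      "edge_set qs' \<subseteq> insert f (edge_set qs)" by blast
    then have "edge_set qs' \<subseteq> X" using g(2) f by blast
    from growth_sols[OF t qs'(1) this qs'(2) g(4)]
    have "T0 \<union> edge_set qs' \<in> sols E k S T0 X" .
    moreover have "f \<in> T0 \<union> edge_set qs'" "T0 \<union> edge_set qs' \<subseteq> insert f ?T"
      using qs'(3,4) by auto
    ultimately show ?thesis by (intro bexI conjI)
  qed
  then obtain h where h: "\<And>f. f \<in> ?F \<Longrightarrow> h f \<in> sols E k S T0 X \<and> f \<in> h f \<and> h f \<subseteq> insert f ?T"
    by (metis (no_types))
  have nT: "f \<notin> T0" if "f \<in> X" for f using X(2)[OF that] treeD(4)[OF t(1)] by blast
  have "inj_on h (?F - edge_set qs)"
  proof (rule inj_onI)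
    fix f f' assume a: "f \<in> ?F - edge_set qs" "f' \<in> ?F - edge_set qs" "h f = h f'"
    then have "f \<in> insert f' ?T" using h[of f] h[of f'] by blast
    then show "f = f'" using a nT by blast
  qed
  then have "card (?F - edge_set qs) \<le> card (sols E k S T0 X)"
    using h by (intro card_inj_on_le[of h]) (auto simp: finite_sols[OF E])
  moreover have "card ?F \<le> card ((?F - edge_set qs) \<union> edge_set qs)"
    using fin by (intro card_mono) (auto simp: edge_set_def)
  moreover have "\<dots> \<le> card (?F - edge_set qs) + card (edge_set qs)" by (rule card_Un_le)
  ultimately show ?thesis using card_edge_set[of qs] by linarith
qed

text \<open>The solution \<open>qs\<close> avoids the branching edge \<open>{x, w}\<close>. Forcing
  \<open>w\<close> into the tree costs one vertex \<open>l\<close>: \<open>w\<close> itself if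
  \<open>qs\<close> attaches it anyway, since its step is dropped, and otherwise the last vertex of
  \<open>qs\<close>. What remains, \<open>qs1\<close>, gives a solution with the branching edge, to
  which \<open>count_exchanges\<close> applies. The edges missed in this way all meet
  \<open>l\<close> in the first estimate and join \<open>w\<close> to the tree in the second, at
  most \<open>k\<close> in each case; \<open>2 * k\<close> also covers
  \<open>length qs1\<close>.\<close>

lemma count_branch:
  assumes E: "finite E" and t: "tree S T0" "T0 \<subseteq> E" "X \<subseteq> E" and g: "growth S qs"
    "edge_set qs \<subseteq> X" "card S + length qs = k" "2 \<le> k" "card S < k"
    and X: "\<And>f. f \<in> X \<Longrightarrow> \<exists>a b. a \<noteq> b \<and> f = {a, b}" "\<And>f. f \<in> X \<Longrightarrow> \<not> f \<subseteq> S"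
    and e: "x \<in> S" "w \<notin> S" "{x, w} \<in> X" "{x, w} \<notin> edge_set qs"
    and Y: "Y = {f \<in> X - {{x, w}}. \<not> f \<subseteq> insert w S}"
  shows "sols E k (insert w S) (insert {x, w} T0) Y \<noteq> {}"
    and "card {f \<in> X. f \<subseteq> S \<union> heads qs} \<le> card (sols E k (insert w S) (insert {x, w} T0) Y) + 2 * k"
    and "card S + 1 < k \<Longrightarrow> card {f \<in> X. w \<in> f} \<le> card (sols E k (insert w S) (insert {x, w} T0) Y) + 2 * k"
proof -
  let ?S = "insert w S" and ?T = "insert {x, w} T0" and ?V = "S \<union> heads qs"
  let ?N = "card (sols E k ?S ?T Y)"
  have fS: "finite S" using treeD(1)[OF t(1)] .
  have fX: "finite X" using E t(3) finite_subset by blast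
  have t1: "tree ?S ?T" using tree_insert[OF t(1) e(1,2)] .
  have T1: "?T \<subseteq> E" "Y \<subseteq> E" using t e Y by auto
  have qsne: "qs \<noteq> []" using g by auto
  have V: "card ?V = k" "finite ?V" using growth_card[OF g(1) fS] g(3) fS by auto
  have "\<exists>qs1 l. growth ?S qs1 \<and> edge_set qs1 \<subseteq> edge_set qs \<and> card ?S + length qs1 = k \<and>
    insert w ?V - {l} \<subseteq> ?S \<union> heads qs1 \<and> (w \<in> ?V \<longrightarrow> l = w) \<and> l \<in> ?V"
  proof (cases "w \<in> heads qs")
    case True
    then obtain ps y rs where qs: "qs = ps @ (y, w) # rs" by (auto dest!: split_list)
    show ?thesis
      using growth_remove[of S ps y w rs] g(1,3) fS e(2) qs
      by (intro exI[of _ "ps @ rs"] exI[of _ w]) auto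
  next
    case False
    obtain ps y l where qs: "qs = ps @ [(y, l)]" using qsne by (cases qs rule: rev_cases) auto
    have "growth ?S ps"
      using growth_enlarge[of S ps w] g(1) False qs by (auto simp: growth_append)
    then show ?thesis using g(3) qs fS e(2) False by (intro exI[of _ ps] exI[of _ l]) auto
  qed
  then obtain qs1 l where q: "growth ?S qs1" "edge_set qs1 \<subseteq> edge_set qs"
    "card ?S + length qs1 = k" "insert w ?V - {l} \<subseteq> ?S \<union> heads qs1" "w \<in> ?V \<Longrightarrow> l = w" "l \<in> ?V"
    by blast
  have qY: "edge_set qs1 \<subseteq> Y"
    using growth_edges[OF q(1)] q(2) g(2) e(4) unfolding Y by blast
  from growth_sols[OF t1 T1 q(1) qY q(3) g(4)] show "sols E k ?S ?T Y \<noteq> {}" by blast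
  have Yp: "\<And>f. f \<in> Y \<Longrightarrow> \<exists>a b. a \<noteq> b \<and> f = {a, b}" "\<And>f. f \<in> Y \<Longrightarrow> \<not> f \<subseteq> ?S"
    using X(1) unfolding Y by auto
  let ?F = "{f \<in> Y. f \<subseteq> ?S \<union> heads qs1 \<or> (qs1 \<noteq> [] \<and> f \<inter> ?S \<noteq> {})}"
  have cF: "card ?F \<le> ?N + length qs1"
    by (rule count_exchanges[OF E t1 T1 q(1) qY q(3) g(4) Yp])
  have fF: "finite ?F" using fX unfolding Y by auto
  have loop: "f \<in> (\<lambda>s. {s, w}) ` ?V" if f: "f \<in> X" "f \<subseteq> ?S" for f
  proof -
    obtain a b where "a \<noteq> b" "f = {a, b}" using X(1)[OF f(1)] by blast
    then show ?thesis using f X(2)[OF f(1)] by (auto simp: insert_commute)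
  qed
  have cw: "card ((\<lambda>s. {s, w}) ` ?V) \<le> k" "card ((\<lambda>s. {s, l}) ` ?V) \<le> k"
    using card_image_le[OF V(2)] V(1) by metis+
  have A: "{f \<in> X. f \<subseteq> ?V} \<subseteq> ?F \<union> (\<lambda>s. {s, l}) ` ?V"
  proof
    fix f assume "f \<in> {f \<in> X. f \<subseteq> ?V}"
    then have f: "f \<in> X" "f \<subseteq> ?V" by auto
    obtain a b where ab: "a \<noteq> b" "f = {a, b}" using X(1)[OF f(1)] by blast
    show "f \<in> ?F \<union> (\<lambda>s. {s, l}) ` ?V"
    proof (cases "l \<in> f")
      case True
      then show ?thesis using ab f(2) by (auto simp: insert_commute)
    next
      case False
      have "f \<in> Y"
      proof (rule ccontr)
        assume "f \<notin> Y"
        then have "f \<subseteq> insert w S" using f(1) e(1) unfolding Y by auto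
        then have "w \<in> f" using X(2)[OF f(1)] by blast
        then show False using f(2) q(5) False by auto
      qed
      then show ?thesis using f(2) q(4) False by auto
    qed
  qed
  have "card {f \<in> X. f \<subseteq> ?V} \<le> card ?F + card ((\<lambda>s. {s, l}) ` ?V)"
    using card_mono[OF _ A] fF V(2) card_Un_le[of ?F "(\<lambda>s. {s, l}) ` ?V"]
    by (meson finite_UnI finite_imageI le_trans)
  then show "card {f \<in> X. f \<subseteq> ?V} \<le> ?N + 2 * k" using cF q(3) cw(2) by linarith
  assume lt: "card S + 1 < k"
  \<comment> \<open>As a vertex is still missing, the edges from \<open>w\<close> to the outside are
    counted by the second alternative in \<open>?F\<close>.\<close>
  have "qs1 \<noteq> []" using q(3) lt fS e(2) by auto
  then have B: "{f \<in> X. w \<in> f} \<subseteq> ?F \<union> (\<lambda>s. {s, w}) ` ?V"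
    using loop e(1) unfolding Y by blast
  have "card {f \<in> X. w \<in> f} \<le> card ?F + card ((\<lambda>s. {s, w}) ` ?V)"
    using card_mono[OF _ B] fF V(2) card_Un_le[of ?F "(\<lambda>s. {s, w}) ` ?V"]
    by (meson finite_UnI finite_imageI le_trans)
  then show "card {f \<in> X. w \<in> f} \<le> ?N + 2 * k" using cF q(3) cw(1) by linarith
qed

section \<open>Arcs and bounded depth-first search\<close>

text \<open>Each edge is represented by two arcs that are twins of each other; \<open>L0 v\<close> lists the arcs
  leaving \<open>v\<close>. Arcs are numbered from \<open>n\<close> on, so that an arc is never 0, nor a vertex.\<close>

locale arcs =
  fixes n m :: nat and tgt tw :: "nat \<Rightarrow> nat" and L0 :: "nat \<Rightarrow> nat list"
  assumes n_pos: "2 \<le> n"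
    and arc_range: "\<And>v a. v < n \<Longrightarrow> a \<in> set (L0 v) \<Longrightarrow> n \<le> a \<and> a < n + 2 * m"
    and distinct_L0: "\<And>v. v < n \<Longrightarrow> distinct (L0 v)"
    and tgt_tw: "\<And>v a. v < n \<Longrightarrow> a \<in> set (L0 v) \<Longrightarrow> tgt (tw a) = v"
    and tw_L0: "\<And>v a. v < n \<Longrightarrow> a \<in> set (L0 v) \<Longrightarrow>
      tgt a < n \<and> tgt a \<noteq> v \<and> tw a \<in> set (L0 (tgt a)) \<and> tw (tw a) = a"
    and arc_inj: "\<And>v a b. v < n \<Longrightarrow> a \<in> set (L0 v) \<Longrightarrow> b \<in> set (L0 v) \<Longrightarrow> tgt a = tgt b \<Longrightarrow> a = b"
begin

definition AR :: "nat set" where "AR = (\<Union>v<n. set (L0 v))"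

definition src :: "nat \<Rightarrow> nat" where "src a = tgt (tw a)"

definition pr :: "nat \<Rightarrow> nat \<times> nat" where "pr a = (src a, tgt a)"

definition ed :: "nat \<Rightarrow> nat set" where "ed a = {src a, tgt a}"

lemma ARD:
  assumes "a \<in> AR"
  shows "n \<le> a" "a < n + 2 * m" "src a < n" "tgt a < n" "tgt a \<noteq> src a" "tw a \<in> AR"
    "tw (tw a) = a" "a \<in> set (L0 (src a))" "src (tw a) = tgt a" "tgt (tw a) = src a" "tw a \<noteq> a"
    "a \<noteq> 0"
proof -
  from assms obtain v where v: "v < n" "a \<in> set (L0 v)" by (auto simp: AR_def)
  have s: "src a = v" using tgt_tw[OF v] by (simp add: src_def)
  note t = tw_L0[OF v]
  show "n \<le> a" "a < n + 2 * m" "src a < n" "tgt a < n" "tgt a \<noteq> src a" "tw (tw a) = a"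
    "a \<in> set (L0 (src a))" "src (tw a) = tgt a" "tgt (tw a) = src a"
    using v t s arc_range[OF v] by (auto simp: src_def)
  show "tw a \<in> AR" using t by (auto simp: AR_def)
  show "tw a \<noteq> a" using t s by (auto simp: src_def)
  show "a \<noteq> 0" using arc_range[OF v] n_pos by auto
qed

lemma finite_AR: "finite AR" by (simp add: AR_def)

lemma card_AR: "card AR \<le> 2 * m"
proof -
  have "AR \<subseteq> {n..<n + 2 * m}" using ARD(1,2) by auto
  then show ?thesis using card_mono[of "{n..<n + 2 * m}" AR] by simp
qed

lemma AR_inj: "a \<in> AR \<Longrightarrow> b \<in> AR \<Longrightarrow> src a = src b \<Longrightarrow> tgt a = tgt b \<Longrightarrow> a = b"
  using arc_inj[of "src a" a b] ARD(3,8) by metis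

lemma ed_eq: "a \<in> AR \<Longrightarrow> b \<in> AR \<Longrightarrow> ed a = ed b \<longleftrightarrow> b = a \<or> b = tw a"
proof
  assume ab: "a \<in> AR" "b \<in> AR" and "ed a = ed b"
  then consider "src a = src b" "tgt a = tgt b" | "src a = tgt b" "tgt a = src b"
    by (auto simp: ed_def doubleton_eq_iff)
  then show "b = a \<or> b = tw a"
  proof cases
    case 1 then show ?thesis using AR_inj ab by metis
  next
    case 2 then show ?thesis using AR_inj[of b "tw a"] ARD[OF ab(1)] ab by metis
  qed
qed (auto simp: ed_def ARD)

lemma edge_set_pr: "edge_set (map pr qs) = ed ` set qs"
  by (auto simp: edge_set_def pr_def ed_def)

lemma heads_pr: "heads (map pr qs) = tgt ` set qs"
  by (auto simp: pr_def image_image)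

text \<open>Closure under twins means that both arcs of an edge are live or none is, so
  \<open>X\<close> stands for a set of undirected edges.\<close>

definition twcl :: "nat set \<Rightarrow> bool" where
  "twcl X \<longleftrightarrow> X \<subseteq> AR \<and> (\<forall>a\<in>X. tw a \<in> X)"

lemma twclD: "twcl X \<Longrightarrow> a \<in> X \<Longrightarrow> a \<in> AR" "twcl X \<Longrightarrow> a \<in> X \<Longrightarrow> tw a \<in> X" "twcl X \<Longrightarrow> finite X"
  using finite_AR finite_subset by (auto simp: twcl_def)

lemma twcl_remove: "twcl X \<Longrightarrow> e \<in> X \<Longrightarrow> twcl (X - {e, tw e})"
proof -
  assume X: "twcl X" "e \<in> X"
  have "tw a \<in> X - {e, tw e}" if "a \<in> X - {e, tw e}" for a
    using that twclD(1,2)[OF X(1), of a] ARD(7)[of a] ARD(7)[OF twclD(1)[OF X]] by auto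
  moreover have "X - {e, tw e} \<subseteq> AR" using X(1) by (auto simp: twcl_def)
  ultimately show ?thesis unfolding twcl_def by (intro conjI ballI)
qed

definition LX :: "nat set \<Rightarrow> nat \<Rightarrow> nat list" where
  "LX X v = filter (\<lambda>a. a \<in> X) (L0 v)"

lemma set_LX: "twcl X \<Longrightarrow> v < n \<Longrightarrow> set (LX X v) = {a \<in> X. src a = v}"
  unfolding LX_def twcl_def using tgt_tw ARD(8) by (auto simp: src_def)

lemma distinct_LX: "v < n \<Longrightarrow> distinct (LX X v)"
  by (simp add: LX_def distinct_L0)

lemma LX_cong: "(\<And>a. a \<in> AR \<Longrightarrow> src a = v \<Longrightarrow> a \<in> X \<longleftrightarrow> a \<in> Y) \<Longrightarrow> v < n \<Longrightarrow> LX X v = LX Y v"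
  unfolding LX_def using tgt_tw by (intro filter_cong) (auto simp: src_def AR_def)

definition vs :: "(nat \<Rightarrow> nat) \<Rightarrow> nat set" where
  "vs P = {v. v < n \<and> P v \<noteq> 0}"

lemma finite_vs [simp]: "finite (vs P)" by (simp add: vs_def)

lemma vs_upd: "z < n \<Longrightarrow> a \<noteq> 0 \<Longrightarrow> vs (P(z := a)) = insert z (vs P)"
  by (auto simp: vs_def)

section \<open>Bounded depth-first search\<close>

text \<open>The search scans the arcs of a work list. It records in \<open>P z\<close> the arc that discovered \<open>z\<close>,
  and stops when \<open>k\<close> vertices are known. The test \<open>tgt a \<ge> n \<or> a = 0\<close> only ensures termination on
  lists that contain other numbers than arcs.\<close>

function dfs :: "nat \<Rightarrow> nat set \<Rightarrow> nat list \<Rightarrow> (nat \<Rightarrow> nat) \<Rightarrow> nat \<Rightarrow> nat" where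
  "dfs k X [] P = P"
| "dfs k X (a # w) P =
    (if k \<le> card (vs P) then P
     else if P (tgt a) \<noteq> 0 \<or> tgt a \<ge> n \<or> a = 0 then dfs k X w P
     else dfs k X (rev (LX X (tgt a)) @ w) (P(tgt a := a)))"
  by pat_completeness auto

termination
proof (relation "inv_image (less_than <*lex*> less_than)
    (\<lambda>(k, X, w, P). (card {v. v < n \<and> P v = 0}, length w))", goal_cases)
  case (3 k X a w P)
  let ?U = "{v. v < n \<and> P v = 0}"
  have "tgt a \<in> ?U" using 3 by simp
  moreover have "tgt a \<notin> {v. v < n \<and> (P(tgt a := a)) v = 0}" using 3 by simp
  moreover have "{v. v < n \<and> (P(tgt a := a)) v = 0} \<subseteq> ?U" using 3 by (simp add: Collect_mono)
  ultimately have "{v. v < n \<and> (P(tgt a := a)) v = 0} \<subset> ?U" by blast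
  then have "card {v. v < n \<and> (P(tgt a := a)) v = 0} < card ?U"
    by (intro psubset_card_mono) auto
  then show ?case by simp
qed auto

lemma dfs_stop: "k \<le> card (vs P) \<Longrightarrow> dfs k X w P = P"
  by (cases w) auto

text \<open>The work list is a stack, so a search can be cut at any entry: the lower part is resumed
  with the marks left by the upper part.\<close>

lemma dfs_append: "dfs k X (w1 @ w2) P = dfs k X w2 (dfs k X w1 P)"
  by (induction k X w1 P rule: dfs.induct) (simp_all add: dfs_stop fun_upd_def)

text \<open>The discovering arcs, in order of discovery, form a growth sequence. That each of them
  comes from the initial work list or leaves a newly found vertex will show that a particular arc
  cannot have discovered anything.\<close>

lemma dfs_growth:
  assumes "twcl X" "\<forall>a\<in>set w. a \<in> X \<and> src a \<in> vs P" "card (vs P) \<le> k"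
  shows "\<exists>qs. growth (vs P) (map pr qs) \<and> set qs \<subseteq> X \<and> (\<forall>q\<in>set qs. q \<in> set w \<or> src q \<notin> vs P) \<and>
    (\<forall>q\<in>set qs. dfs k X w P (tgt q) = q) \<and>
    (\<forall>v. v \<notin> tgt ` set qs \<longrightarrow> dfs k X w P v = P v) \<and> card (vs (dfs k X w P)) \<le> k"
  using assms
proof (induction k X w P rule: dfs.induct)
  case (1 k X P)
  then show ?case by (intro exI[of _ "[]"]) auto
next
  case (2 k X a w P)
  show ?case
  proof (cases "k \<le> card (vs P)")
    case True
    then show ?thesis using 2 by (intro exI[of _ "[]"]) auto
  next
    case k: False
    show ?thesis
    proof (cases "P (tgt a) \<noteq> 0 \<or> tgt a \<ge> n \<or> a = 0")
      case True
      then show ?thesis using 2 k by auto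
    next
      case False
      let ?z = "tgt a" and ?P = "P(tgt a := a)" and ?w = "rev (LX X (tgt a)) @ w"
      have a: "a \<in> X" "src a \<in> vs P" "a \<in> AR" using 2 twclD by auto
      have vsP: "vs ?P = insert ?z (vs P)" "?z \<notin> vs P" using False by (auto simp: vs_upd vs_def)
      have "\<forall>b\<in>set ?w. b \<in> X \<and> src b \<in> vs ?P"
        using 2(4) set_LX[OF 2(3), of ?z] ARD(4)[OF a(3)] vsP by auto
      moreover have "card (vs ?P) \<le> k" using k vsP by simp
      ultimately obtain qs where qs: "growth (vs ?P) (map pr qs)" "set qs \<subseteq> X"
        "\<forall>q\<in>set qs. q \<in> set ?w \<or> src q \<notin> vs ?P"
        "\<forall>q\<in>set qs. dfs k X ?w ?P (tgt q) = q"
        "\<forall>v. v \<notin> tgt ` set qs \<longrightarrow> dfs k X ?w ?P v = ?P v" "card (vs (dfs k X ?w ?P)) \<le> k"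
        using "2.IH"(2)[OF k False] 2(3) by blast
      have nz: "?z \<notin> tgt ` set qs"
        using growth_heads[OF qs(1)] vsP unfolding heads_pr by auto
      have "dfs k X (a # w) P = dfs k X ?w ?P" using k False by simp
      moreover have "growth (vs P) (map pr (a # qs))" using qs(1) a(2) vsP by (simp add: pr_def)
      moreover have "\<forall>q\<in>set (a # qs). q \<in> set (a # w) \<or> src q \<notin> vs P"
        using qs(3) vsP set_LX[OF 2(3) ARD(4)[OF a(3)]] by auto
      moreover have "dfs k X ?w ?P ?z = a" using qs(5) nz by simp
      ultimately show ?thesis
        using qs(2,4,5,6) a(1) by (intro exI[of _ "a # qs"]) simp
    qed
  qed
qed

lemma dfs_keeps: "P v \<noteq> 0 \<Longrightarrow> dfs k X w P v = P v"
  by (induction k X w P rule: dfs.induct) auto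

lemma vs_dfs: "vs P \<subseteq> vs (dfs k X w P)"
  using dfs_keeps by (auto simp: vs_def)

text \<open>A search that ends with fewer than \<open>k\<close> vertices has emptied its work list,
  so it has scanned all live arcs of the new vertices. About vertices known at the start it says
  only what the work list contained.\<close>

lemma dfs_closed:
  assumes "twcl X" "set w \<subseteq> X" "card (vs (dfs k X w P)) < k"
  shows "(\<forall>a\<in>set w. tgt a \<in> vs (dfs k X w P)) \<and>
    (\<forall>a\<in>X. src a \<in> vs (dfs k X w P) - vs P \<longrightarrow> tgt a \<in> vs (dfs k X w P))"
  using assms
proof (induction k X w P rule: dfs.induct)
  case (2 k X a w P)
  have a: "a \<in> AR" "a \<in> X" using 2 twclD by auto
  note A = ARD[OF a(1)]
  have k: "\<not> k \<le> card (vs P)" using 2(5) by (auto split: if_splits)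
  show ?case
  proof (cases "P (tgt a) \<noteq> 0 \<or> tgt a \<ge> n \<or> a = 0")
    case True
    then have "tgt a \<in> vs P" using A by (auto simp: vs_def)
    then show ?thesis using 2 k True vs_dfs[of P k X w] by auto
  next
    case False
    let ?P = "P(tgt a := a)" and ?w = "rev (LX X (tgt a)) @ w"
    let ?Q = "dfs k X ?w ?P"
    have eq: "dfs k X (a # w) P = ?Q" using k False by simp
    have vsP: "vs ?P = insert (tgt a) (vs P)" using A by (simp add: vs_upd)
    have "set ?w \<subseteq> X" using 2(4) set_LX[OF 2(3) A(4)] by auto
    then have IH: "\<forall>a\<in>set ?w. tgt a \<in> vs ?Q" "\<forall>a\<in>X. src a \<in> vs ?Q - vs ?P \<longrightarrow> tgt a \<in> vs ?Q"
      using "2.IH"(2)[OF k False] 2(3,5) eq by metis+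
    have z: "tgt a \<in> vs ?Q" using vs_dfs[of ?P k X ?w] vsP by auto
    have "tgt b \<in> vs ?Q" if "b \<in> X" "src b \<in> vs ?Q - vs P" for b
    proof (cases "src b = tgt a")
      case True
      then have "b \<in> set ?w" using set_LX[OF 2(3) A(4)] that by auto
      then show ?thesis using IH by blast
    next
      case False
      then show ?thesis using IH that vsP by auto
    qed
    then show ?thesis using eq IH z by auto
  qed
qed auto

text \<open>Marking a vertex in advance that the search would not meet, or deleting arcs into known
  vertices, does not change the search.\<close>

lemma dfs_premark:
  assumes "twcl X" "set w \<subseteq> X" "card (vs (dfs k X w P)) < k" "dfs k X w P z = 0" "z < n" "e \<noteq> 0"
    "\<And>y. y < n \<Longrightarrow> P y = 0 \<Longrightarrow> y \<noteq> z \<Longrightarrow> LX Y y = LX X y"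
  shows "dfs k Y w (P(z := e)) = (dfs k X w P)(z := e)"
  using assms
proof (induction k X w P rule: dfs.induct)
  case (2 k X a w P)
  have a: "a \<in> AR" "a \<in> X" using 2 twclD by auto
  note A = ARD[OF a(1)]
  have k: "\<not> k \<le> card (vs P)" using 2(5) by (auto split: if_splits)
  have "card (vs P) \<noteq> k" using k by auto
  have vse: "vs (P(z := e)) = insert z (vs P)" using 2 by (simp add: vs_upd)
  have zP: "P z = 0" using dfs_keeps[of P z k X "a # w"] 2(6) by auto
  have tz: "tgt a \<noteq> z"
    using dfs_closed[OF 2(3-5)] 2(6) by (auto simp: vs_def)
  show ?case
  proof (cases "k \<le> card (vs (P(z := e)))")
    \<comment> \<open>Marking \<open>z\<close> reaches \<open>k\<close> at once, so the modified
      search stops. The original search already knows \<open>k - 1\<close> vertices and ends below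
      \<open>k\<close>, so it discovers nothing more either.\<close>
    case True
    have lt: "card (vs (dfs k X (a # w) P)) < k" by (rule 2(5))
    have sub: "vs P \<subseteq> vs (dfs k X (a # w) P)" by (rule vs_dfs)
    have zP': "z \<notin> vs P" using zP by (simp add: vs_def)
    have ck: "Suc (card (vs P)) = k" using True k vse zP' by simp
    then have eqc: "vs (dfs k X (a # w) P) = vs P"
      using card_seteq[OF finite_vs sub] lt by simp
    have "dfs k X (a # w) P = P"
    proof
      fix v
      show "dfs k X (a # w) P v = P v"
      proof (cases "P v = 0")
        case True
        show ?thesis
        proof (cases "v < n")
          case True
          have "v \<in> vs (dfs k X (a # w) P) \<longleftrightarrow> v \<in> vs P" using eqc by simp
          then show ?thesis using True \<open>P v = 0\<close> by (simp add: vs_def del: dfs.simps)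
        next
          case False
          have "dfs k' X' w' P' v = P' v" if "\<not> v < n" for k' X' w' P'
            using that by (induction k' X' w' P' rule: dfs.induct) auto
          then show ?thesis using False by blast
        qed
      qed (rule dfs_keeps)
    qed
    then show ?thesis by (simp only: dfs_stop[OF True])
  next
    case kz: False
    show ?thesis
    proof (cases "P (tgt a) \<noteq> 0 \<or> tgt a \<ge> n \<or> a = 0")
      case True
      then show ?thesis using 2 k kz tz by (auto simp: fun_upd_def)
    next
      case False
      let ?P = "P(tgt a := a)" and ?w = "rev (LX X (tgt a)) @ w"
      have eq: "dfs k X (a # w) P = dfs k X ?w ?P" using k False by simp
      have w: "set ?w \<subseteq> X" using 2(4) set_LX[OF 2(3) A(4)] by auto
      have "dfs k Y ?w (?P(z := e)) = (dfs k X ?w ?P)(z := e)"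
        by (rule "2.IH"(2)[OF k False 2(3) w])
          (use 2(5,6,7,8,9) eq tz A False in \<open>auto simp: fun_upd_def split: if_splits\<close>)
      moreover have "LX Y (tgt a) = LX X (tgt a)" using 2(9)[of "tgt a"] False tz by auto
      moreover have "?P(z := e) = (P(z := e))(tgt a := a)" using tz by auto
      moreover have "dfs k Y (a # w) (P(z := e)) =
          dfs k Y (rev (LX Y (tgt a)) @ w) ((P(z := e))(tgt a := a))"
        using kz False tz by (simp add: fun_upd_def)
      ultimately show ?thesis by (simp only: eq)
    qed
  qed
qed simp

lemma dfs_change_arcs:
  assumes "\<And>y. y < n \<Longrightarrow> P y = 0 \<Longrightarrow> LX Y y = LX X y"
  shows "dfs k Y w P = dfs k X w P"
  using assms
proof (induction k X w P rule: dfs.induct)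
  case (2 k X a w P)
  have "LX Y y = LX X y" if "y < n" "(P(tgt a := a)) y = 0" "a \<noteq> 0" for y
    using that 2(3) by (auto split: if_splits)
  with 2 show ?case by (simp add: fun_upd_def)
qed simp

lemma dfs_skip: "P (tgt a) \<noteq> 0 \<Longrightarrow> dfs k X (w1 @ a # w2) P = dfs k X (w1 @ w2) P"
  using dfs_keeps[of P "tgt a" k X w1] by (simp add: dfs_append dfs_stop)

section \<open>States of the enumeration\<close>

text \<open>A state consists of a root \<open>r\<close>, the set \<open>X\<close> of live arcs, the list \<open>TA\<close> of the arcs of the
  current tree (last one first), and the path \<open>\<pi>\<close> from the current vertex up to the root. All live
  arcs that leave the tree start on the path. \<open>PA\<close> maps a tree vertex to the arc leading to it.\<close>

fun PA :: "nat \<Rightarrow> nat list \<Rightarrow> nat \<Rightarrow> nat" where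
  "PA r [] = (\<lambda>_. 0)(r := 1)"
| "PA r (a # ts) = (PA r ts)(tgt a := a)"

definition SS :: "nat \<Rightarrow> nat list \<Rightarrow> nat set" where
  "SS r TA = insert r (tgt ` set TA)"

fun pth :: "nat \<Rightarrow> (nat \<Rightarrow> nat) \<Rightarrow> nat list \<Rightarrow> bool" where
  "pth r P [] \<longleftrightarrow> False"
| "pth r P [v] \<longleftrightarrow> v = r"
| "pth r P (v # u # \<pi>) \<longleftrightarrow> v \<noteq> r \<and> src (P v) = u \<and> pth r P (u # \<pi>)"

text \<open>The reversals put the arcs of the root in front and the first arc of the current vertex,
  the head of \<open>\<pi>\<close>, at the very end. That arc is the candidate for branching, and it
  has to be scanned last. Reading the lists backwards is what previous-pointers can do.\<close>

definition Z :: "nat set \<Rightarrow> nat list \<Rightarrow> nat list" where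
  "Z X \<pi> = concat (map (\<lambda>v. rev (LX X v)) (rev \<pi>))"

text \<open>The last clause, absence of live chords, is claimed for incomplete trees only: when a
  branching completes the tree, no chords are deleted.\<close>

definition good :: "nat \<Rightarrow> nat \<Rightarrow> nat set \<Rightarrow> nat list \<Rightarrow> nat list \<Rightarrow> bool" where
  "good k r X TA \<pi> \<longleftrightarrow> r < n \<and> twcl X \<and> set TA \<subseteq> AR \<and> growth {r} (map pr (rev TA)) \<and>
     pth r (PA r TA) \<pi> \<and> distinct \<pi> \<and> set \<pi> \<subseteq> SS r TA \<and>
     (\<forall>a\<in>X. src a \<in> SS r TA \<longrightarrow> src a \<in> set \<pi>) \<and>
     (length TA + 1 < k \<longrightarrow> (\<forall>a\<in>X. src a \<in> SS r TA \<longrightarrow> tgt a \<notin> SS r TA))"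

lemma goodD:
  assumes "good k r X TA \<pi>"
  shows "r < n" "twcl X" "set TA \<subseteq> AR" "growth {r} (map pr (rev TA))" "pth r (PA r TA) \<pi>"
    "distinct \<pi>" "set \<pi> \<subseteq> SS r TA" "\<And>a. a \<in> X \<Longrightarrow> src a \<in> SS r TA \<Longrightarrow> src a \<in> set \<pi>"
    "\<And>a. a \<in> X \<Longrightarrow> length TA + 1 < k \<Longrightarrow> src a \<in> SS r TA \<Longrightarrow> tgt a \<notin> SS r TA"
  using assms by (auto simp: good_def)

lemma SS_Cons [simp]: "SS r (a # TA) = insert (tgt a) (SS r TA)"
  by (auto simp: SS_def)

lemma PA_outside: "v \<notin> SS r TA \<Longrightarrow> PA r TA v = 0"
  by (induction TA) (auto simp: SS_def)

text \<open>The root carries the mark 1, which is nonzero like the other tree marks, but below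
  \<open>n\<close> and therefore not an arc.\<close>

lemma
  assumes "r < n" "set TA \<subseteq> AR" "growth {r} (map pr (rev TA))"
  shows SS_less: "SS r TA \<subseteq> {..<n}"
    and PA_tree: "a \<in> set TA \<Longrightarrow> PA r TA (tgt a) = a"
    and PA_root: "PA r TA r = 1"
    and vs_PA: "vs (PA r TA) = SS r TA"
    and card_SS: "card (SS r TA) = Suc (length TA)"
    and tree_TA: "tree (SS r TA) (ed ` set TA)"
proof -
  show 1: "SS r TA \<subseteq> {..<n}" using assms ARD(4) by (auto simp: SS_def)
  have "(\<forall>a\<in>set TA. PA r TA (tgt a) = a) \<and> PA r TA r = 1" using assms(3)
  proof (induction TA)
    case (Cons b TA)
    have pr_b: "pr b = (src b, tgt b)" by (simp add: pr_def)
    have g: "growth {r} (map pr (rev TA))" using Cons(2) by (simp add: growth_append)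
    have "tgt b \<notin> {r} \<union> heads (map pr (rev TA))"
      using Cons(2) by (simp add: growth_append pr_b del: set_map set_rev)
    then have "tgt b \<noteq> r" "tgt b \<notin> tgt ` set TA" unfolding heads_pr by auto
    moreover from this have "tgt a \<noteq> tgt b" if "a \<in> set TA" for a
      using that by (metis imageI)
    ultimately show ?case using Cons(1)[OF g] by auto
  qed simp
  then show 2: "a \<in> set TA \<Longrightarrow> PA r TA (tgt a) = a" "PA r TA r = 1" for a by auto
  show "vs (PA r TA) = SS r TA"
  proof
    show "vs (PA r TA) \<subseteq> SS r TA" using PA_outside[of _ r TA] unfolding vs_def by fastforce
    show "SS r TA \<subseteq> vs (PA r TA)"
      using 1 2 assms(2) ARD(12) unfolding vs_def SS_def by force
  qed
  have eq: "SS r TA = {r} \<union> heads (map pr (rev TA))" unfolding heads_pr by (auto simp: SS_def)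
  show "card (SS r TA) = Suc (length TA)"
    unfolding eq using growth_card[OF assms(3)] by simp
  show "tree (SS r TA) (ed ` set TA)"
    unfolding eq using tree_growth[OF tree_single assms(3)] by (simp add: edge_set_pr)
qed

lemma set_Z:
  assumes "good k r X TA \<pi>"
  shows "set (Z X \<pi>) = {a \<in> X. src a \<in> SS r TA}"
proof -
  note g = goodD[OF assms]
  have "set \<pi> \<subseteq> {..<n}" using g(7) SS_less[OF g(1,3,4)] by blast
  then have "set (Z X \<pi>) = {a \<in> X. src a \<in> set \<pi>}"
    unfolding Z_def using set_LX[OF g(2)] by (auto simp: subset_iff)
  then show ?thesis using g(7,8) by auto
qed


section \<open>The solutions of a state\<close>

definition sol :: "nat \<Rightarrow> nat \<Rightarrow> nat set \<Rightarrow> nat list \<Rightarrow> nat set set set" where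
  "sol k r X TA = sols (ed ` AR) k (SS r TA) (ed ` set TA) (ed ` X)"

lemma solD:
  assumes "T \<in> sol k r X TA"
  shows "T \<in> k_subtrees (ed ` AR) k" "ed ` set TA \<subseteq> T" "T \<subseteq> ed ` set TA \<union> ed ` X" "SS r TA \<subseteq> \<Union>T"
  using assms by (auto simp: sol_def sols_def)

lemma finite_sol: "finite (sol k r X TA)"
  unfolding sol_def by (rule finite_sols) (simp add: finite_AR)

text \<open>A solution is connected and contains the root, so it cannot leave a set that is closed
  under live arcs and contains the tree; with fewer than \<open>k\<close> vertices there is no room
  for it.\<close>

lemma closed_sol_empty:
  assumes X: "twcl X" and TA: "set TA \<subseteq> AR" "growth {r} (map pr (rev TA))"
    and C: "SS r TA \<subseteq> C" "\<And>a. a \<in> X \<Longrightarrow> src a \<in> C \<Longrightarrow> tgt a \<in> C" "finite C" "card C < k"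
  shows "sol k r X TA = {}"
proof (rule ccontr)
  assume "sol k r X TA \<noteq> {}"
  then obtain T where T: "T \<in> sol k r X TA" by blast
  note t = solD[OF T]
  have k: "card (\<Union>T) = k" "\<And>u v. u \<in> \<Union>T \<Longrightarrow> v \<in> \<Union>T \<Longrightarrow> (u, v) \<in> walks T"
    using t(1) unfolding k_subtrees_def connected_graph_def by blast+
  have edge: "y \<in> C" if xy: "{x, y} \<in> T" "x \<in> C" for x y
  proof -
    consider a where "a \<in> set TA" "{x, y} = ed a" | a where "a \<in> X" "{x, y} = ed a"
      using subsetD[OF t(3) xy(1)] by blast
    then show ?thesis
    proof cases
      case 1
      then have "ed a \<subseteq> {r} \<union> heads (map pr (rev TA))"
        using growth_edges[OF TA(2), of "ed a"] by (auto simp: edge_set_pr simp del: set_map)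
      then have "ed a \<subseteq> SS r TA" unfolding heads_pr by (simp add: SS_def)
      then show ?thesis using 1 C(1) by auto
    next
      case 2
      then have "(x = src a \<and> y = tgt a) \<or> (x = tgt a \<and> y = src a)"
        by (auto simp: ed_def doubleton_eq_iff)
      then show ?thesis
        using C(2)[of a] C(2)[of "tw a"] 2 xy(2) twclD(1,2)[OF X, of a] ARD[of a] by auto
    qed
  qed
  have "r \<in> \<Union>T" "r \<in> C" using t(4) C(1) by (auto simp: SS_def)
  then have "\<Union>T \<subseteq> C" using walks_closed[OF k(2), of r _ C] edge by blast
  then have "card (\<Union>T) \<le> card C" using C(3) by (rule card_mono[rotated])
  then show False using k C(4) by simp
qed

text \<open>The search settles whether the state has solutions: either it reaches \<open>k\<close>
  vertices and exhibits one, or its visited set is closed and too small for any. Only the set of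
  arcs in \<open>w\<close> matters for this, not their order.\<close>

lemma dfs_from_tree:
  assumes r: "r < n" and X: "twcl X" and TA: "set TA \<subseteq> AR" "growth {r} (map pr (rev TA))"
    and w: "set w = {a \<in> X. src a \<in> SS r TA}"
    and k: "2 \<le> k" "length TA + 1 \<le> k" and P: "P = dfs k X w (PA r TA)"
  shows dfs_small: "card (vs P) < k \<Longrightarrow> a \<in> X \<Longrightarrow> src a \<in> vs P \<Longrightarrow> tgt a \<in> vs P"
    and dfs_large: "sol k r X TA \<noteq> {} \<Longrightarrow> card (vs P) = k"
    and dfs_sol: "card (vs P) = k \<Longrightarrow> \<exists>qs. growth (SS r TA) (map pr qs) \<and> set qs \<subseteq> X \<and>
      (\<forall>q\<in>set qs. P (tgt q) = q) \<and> vs P = SS r TA \<union> tgt ` set qs \<and>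
      length TA + 1 + length qs = k \<and> ed ` set TA \<union> ed ` set qs \<in> sol k r X TA"
proof -
  note vs = vs_PA[OF r TA] and cS = card_SS[OF r TA]
  have w': "set w \<subseteq> X" "\<forall>a\<in>set w. a \<in> X \<and> src a \<in> vs (PA r TA)" using w vs by auto
  have sub: "SS r TA \<subseteq> vs P" using vs_dfs[of "PA r TA"] vs P by auto
  show small: "tgt a \<in> vs P" if "card (vs P) < k" "a \<in> X" "src a \<in> vs P" for a
    using dfs_closed[OF X w'(1), of k "PA r TA"] that vs w unfolding P by blast
  obtain qs where qs: "growth (vs (PA r TA)) (map pr qs)" "set qs \<subseteq> X"
    "\<forall>q\<in>set qs. P (tgt q) = q" "\<forall>v. v \<notin> tgt ` set qs \<longrightarrow> P v = PA r TA v" "card (vs P) \<le> k"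
    using dfs_growth[OF X w'(2), of k] k cS vs unfolding P by auto
  show "card (vs P) = k" if "sol k r X TA \<noteq> {}"
  proof (rule ccontr)
    assume "card (vs P) \<noteq> k"
    then have lt: "card (vs P) < k" using qs(5) by simp
    have "sol k r X TA = {}"
      by (rule closed_sol_empty[OF X TA sub]) (use small lt in auto)
    then show False using that by simp
  qed
  assume full: "card (vs P) = k"
  have vsP: "vs P = SS r TA \<union> tgt ` set qs"
  proof
    show "vs P \<subseteq> SS r TA \<union> tgt ` set qs"
      using qs(4) vs unfolding vs_def by auto
    have "tgt q \<in> vs P" if "q \<in> set qs" for q
      using that qs(2,3) twclD(1)[OF X] ARD(4,12)[of q] unfolding vs_def by auto
    then show "SS r TA \<union> tgt ` set qs \<subseteq> vs P" using sub by auto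
  qed
  have g: "growth (SS r TA) (map pr qs)" using qs(1) vs by simp
  have len: "length TA + 1 + length qs = k"
    using growth_card[OF g] full vsP cS finite_subset[OF sub finite_vs] unfolding heads_pr by simp
  have "ed ` set TA \<union> edge_set (map pr qs) \<in> sols (ed ` AR) k (SS r TA) (ed ` set TA) (ed ` X)"
    by (rule growth_sols[OF tree_TA[OF r TA] _ _ g])
      (use TA X qs(2) len k cS in \<open>auto simp: edge_set_pr twcl_def\<close>)
  then show "\<exists>qs. growth (SS r TA) (map pr qs) \<and> set qs \<subseteq> X \<and>
      (\<forall>q\<in>set qs. P (tgt q) = q) \<and> vs P = SS r TA \<union> tgt ` set qs \<and>
      length TA + 1 + length qs = k \<and> ed ` set TA \<union> ed ` set qs \<in> sol k r X TA"
    using g qs vsP len by (intro exI[of _ qs]) (simp add: sol_def edge_set_pr)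
qed

text \<open>The converse of \<open>closed_sol_empty\<close>. Through it the connectivity of the
  graph enters later without any reference to a search.\<close>

lemma sol_nonempty:
  assumes "r < n" "twcl X" "set TA \<subseteq> AR" "growth {r} (map pr (rev TA))" "2 \<le> k" "length TA + 1 \<le> k"
    and C: "\<And>C. SS r TA \<subseteq> C \<Longrightarrow> (\<And>a. a \<in> X \<Longrightarrow> src a \<in> C \<Longrightarrow> tgt a \<in> C) \<Longrightarrow> finite C \<Longrightarrow> k \<le> card C"
  shows "sol k r X TA \<noteq> {}"
proof -
  have "finite {a \<in> X. src a \<in> SS r TA}" using twclD(3)[OF assms(2)] by simp
  then obtain w where w: "set w = {a \<in> X. src a \<in> SS r TA}" using finite_list by blast
  let ?P = "dfs k X w (PA r TA)"
  have vs: "vs (PA r TA) = SS r TA" by (rule vs_PA) fact+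
  have "\<not> card (vs ?P) < k"
    using C[of "vs ?P"] dfs_small[OF assms(1-4) w assms(5,6) refl] vs_dfs[of "PA r TA"] vs
    by auto
  moreover have "card (vs ?P) \<le> k"
    using dfs_growth[OF assms(2), of w "PA r TA" k] w vs card_SS[OF assms(1,3,4)] assms(6) by auto
  ultimately show ?thesis using dfs_sol[OF assms(1-4) w assms(5,6) refl] by auto
qed

lemma ed_remove:
  assumes "twcl X" "e \<in> X"
  shows "ed ` (X - {e, tw e}) = ed ` X - {ed e}"
proof -
  have "ed a = ed e \<longleftrightarrow> a = e \<or> a = tw e" if "a \<in> X" for a
    using ed_eq[of e a] that twclD(1)[OF assms(1)] assms(2) by auto
  then show ?thesis by blast
qed

lemma sol_split:
  assumes g: "good k r X TA \<pi>" "length TA + 1 < k" and e: "e \<in> X" "src e \<in> SS r TA"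
  shows "sol k r X TA = sol k r (X - {e, tw e}) (e # TA) \<union> sol k r (X - {e, tw e}) TA"
    and "sol k r (X - {e, tw e}) (e # TA) \<inter> sol k r (X - {e, tw e}) TA = {}"
proof -
  note gd = goodD[OF g(1)]
  have ne: "ed e \<notin> ed ` set TA"
  proof
    assume "ed e \<in> ed ` set TA"
    then have "ed e \<subseteq> SS r TA" using treeD(4)[OF tree_TA[OF gd(1,3,4)]] by blast
    then show False using gd(9)[OF e(1) g(2) e(2)] by (auto simp: ed_def)
  qed
  note r = ed_remove[OF gd(2) e(1)]
  have "tgt e \<in> \<Union>T" if "ed e \<in> T" for T using that by (auto simp: ed_def)
  then show "sol k r X TA = sol k r (X - {e, tw e}) (e # TA) \<union> sol k r (X - {e, tw e}) TA"
    unfolding sol_def sols_def r using e by auto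
  show "sol k r (X - {e, tw e}) (e # TA) \<inter> sol k r (X - {e, tw e}) TA = {}"
    unfolding sol_def sols_def r using ne by auto
qed

lemma sol_full:
  assumes r: "r < n" and TA: "set TA \<subseteq> AR" "growth {r} (map pr (rev TA))" "length TA + 1 = k"
    and ne: "sol k r X TA \<noteq> {}"
  shows "sol k r X TA = {ed ` set TA}"
proof -
  have "T = ed ` set TA" if "T \<in> sol k r X TA" for T
  proof -
    note t = solD[OF that]
    have c: "card T = k - 1" "card (\<Union>T) = k" using t(1) by (auto simp: k_subtrees_def)
    have "card (ed ` set TA) + 1 = k" using treeD(5)[OF tree_TA[OF r TA(1,2)]] card_SS[OF r TA(1,2)] TA(3)
      by simp
    moreover have "finite T" using c TA(3) by (metis card.infinite finite_UnionD add_is_0 one_neq_zero)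
    ultimately show ?thesis using c card_subset_eq[of T "ed ` set TA"] t(2) by auto
  qed
  then show ?thesis using ne by blast
qed

definition drop_loops :: "nat set \<Rightarrow> nat set \<Rightarrow> nat set" where
  "drop_loops S X = {a \<in> X. \<not> (src a \<in> S \<and> tgt a \<in> S)}"

lemma twcl_drop_loops: "twcl X \<Longrightarrow> twcl (drop_loops S X)"
  unfolding twcl_def drop_loops_def using ARD(9,10) by auto

text \<open>By \<open>k_subtree_no_chord\<close>, the only edges of a solution between tree vertices
  are the tree edges, so deleting the chords loses no solution.\<close>

lemma sol_drop_loops:
  assumes "r < n" "set TA \<subseteq> AR" "growth {r} (map pr (rev TA))" "2 \<le> k"
  shows "sol k r (drop_loops (SS r TA) X) TA = sol k r X TA"
proof
  show "sol k r (drop_loops (SS r TA) X) TA \<subseteq> sol k r X TA"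
    unfolding sol_def sols_def drop_loops_def by blast
  show "sol k r X TA \<subseteq> sol k r (drop_loops (SS r TA) X) TA"
  proof
    fix T assume T: "T \<in> sol k r X TA"
    note t = solD[OF T]
    have "f \<in> ed ` set TA \<union> ed ` drop_loops (SS r TA) X" if f: "f \<in> T" for f
    proof (rule ccontr)
      assume n: "\<not> ?thesis"
      then obtain a where a: "a \<in> X" "f = ed a" using t(3) f by blast
      then have "src a \<in> SS r TA" "tgt a \<in> SS r TA" using n by (auto simp: drop_loops_def)
      then have "f \<in> ed ` set TA"
        using k_subtree_no_chord[OF t(1) _ tree_TA[OF assms(1-3)] t(2,4), of "src a" "tgt a"]
          f a assms(4) by (auto simp: ed_def)
      then show False using n by blast
    qed
    then show "T \<in> sol k r (drop_loops (SS r TA) X) TA"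
      using t unfolding sol_def sols_def by blast
  qed
qed

lemma good_exclude: "good k r X TA \<pi> \<Longrightarrow> e \<in> X \<Longrightarrow> good k r (X - {e, tw e}) TA \<pi>"
  unfolding good_def using twcl_remove by auto

lemma pth_cong: "(\<And>v. v \<in> set \<pi> \<Longrightarrow> P v = Q v) \<Longrightarrow> pth r P \<pi> = pth r Q \<pi>"
  by (induction r P \<pi> rule: pth.induct) auto

lemma good_include:
  assumes g: "good k r X TA (x # \<pi>)" "length TA + 1 < k" and e: "e \<in> X" "src e = x"
    and Y: "Y \<subseteq> X" "twcl Y"
    and nl: "length TA + 2 < k \<Longrightarrow> \<forall>a\<in>Y. src a \<in> SS r (e # TA) \<longrightarrow> tgt a \<notin> SS r (e # TA)"
  shows "good k r Y (e # TA) (tgt e # x # \<pi>)"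
proof -
  note gd = goodD[OF g(1)]
  have x: "x \<in> SS r TA" using gd(7) by auto
  then have new: "tgt e \<notin> SS r TA" using gd(9)[OF e(1) g(2)] e(2) by auto
  have eA: "e \<in> AR" using e gd(2) twclD by blast
  have "pth r (PA r (e # TA)) (x # \<pi>)"
  proof -
    have "PA r (e # TA) v = PA r TA v" if "v \<in> set (x # \<pi>)" for v
      using that gd(7) new by auto
    then show ?thesis using gd(5) pth_cong by blast
  qed
  moreover have "tgt e \<noteq> r" using new by (auto simp: SS_def)
  moreover have "growth {r} (map pr (rev (e # TA)))"
  proof -
    have "{r} \<union> heads (map pr (rev TA)) = SS r TA" unfolding heads_pr by (auto simp: SS_def)
    moreover have "pr e = (src e, tgt e)" by (simp add: pr_def)
    ultimately show ?thesis using gd(4) x new e(2) by (simp add: growth_append)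
  qed
  moreover have "src a \<in> set (tgt e # x # \<pi>)" if "a \<in> Y" "src a \<in> SS r (e # TA)" for a
    using that gd(8)[of a] Y(1) by auto
  ultimately show ?thesis
    using gd(1,3,5-7) eA new Y nl e unfolding good_def by auto
qed

lemma good_tl:
  assumes "good k r X TA (x # y # \<pi>)" "LX X x = []"
  shows "good k r X TA (y # \<pi>)"
proof -
  note g = goodD[OF assms(1)]
  have "x < n" using g(7) SS_less[OF g(1,3,4)] by auto
  then have "\<forall>a\<in>X. src a \<noteq> x" using set_LX[OF g(2)] assms(2) by force
  then show ?thesis using assms(1) unfolding good_def by auto
qed

lemma Z_Cons: "Z X (x # \<pi>) = Z X \<pi> @ rev (LX X x)"
  by (simp add: Z_def)

lemma Z_remove:
  assumes "twcl X" "e \<in> X" "src e \<notin> set \<pi>" "tgt e \<notin> set \<pi>" "set \<pi> \<subseteq> {..<n}"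
  shows "Z (X - {e, tw e}) \<pi> = Z X \<pi>"
proof -
  have "LX (X - {e, tw e}) v = LX X v" if "v \<in> set \<pi>" for v
    using that assms twclD(1)[OF assms(1,2)] ARD(9) by (intro LX_cong) auto
  then have "map (\<lambda>v. rev (LX (X - {e, tw e}) v)) (rev \<pi>) = map (\<lambda>v. rev (LX X v)) (rev \<pi>)"
    by (intro map_cong) auto
  then show ?thesis by (simp only: Z_def)
qed

lemma LX_remove:
  assumes "twcl X" "LX X x = e # l" "x < n"
  shows "LX (X - {e, tw e}) x = l" "e \<in> X" "src e = x" "e \<notin> set l"
proof -
  have "e \<in> set (LX X x)" using assms(2) by simp
  then show e: "e \<in> X" "src e = x" using set_LX[OF assms(1,3)] by auto
  have d: "distinct (e # l)" using distinct_LX[OF assms(3), of X] assms(2) by simp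
  then show "e \<notin> set l" by simp
  have "LX (X - {e, tw e}) x = filter (\<lambda>a. a \<noteq> e \<and> a \<noteq> tw e) (LX X x)"
    by (simp add: LX_def conj_commute)
  also have "\<dots> = filter (\<lambda>a. a \<noteq> e \<and> a \<noteq> tw e) l" using assms(2) by simp
  also have "\<dots> = l"
  proof (rule filter_True, rule ballI)
    fix a assume a: "a \<in> set l"
    then have "src a = x" using set_LX[OF assms(1,3)] assms(2) by auto
    then show "a \<noteq> e \<and> a \<noteq> tw e"
      using a d ARD(5,9)[OF twclD(1)[OF assms(1) e(1)]] e(2) by auto
  qed
  finally show "LX (X - {e, tw e}) x = l" .
qed

text \<open>The key property of the search: the last arc \<open>e\<close> of the initial work list is popped when
  everything that can be reached without \<open>e\<close> is already known. So if it discovers a vertex, then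
  fewer than \<open>k\<close> vertices can be reached without \<open>e\<close>. Moreover, the rest of the search is the rest
  of the search from the tree extended by \<open>e\<close>.\<close>

lemma forced:
  assumes g: "good k r X TA (x # \<pi>)" "length TA + 1 < k"
    and P: "P = dfs k X (Z X (x # \<pi>)) (PA r TA)"
    and l: "LX X x = e # l" and Pe: "P (tgt e) = e"
  shows "sol k r (X - {e, tw e}) TA = {}"
    and "good k r (X - {e, tw e}) (e # TA) (tgt e # x # \<pi>)"
    and "dfs k (X - {e, tw e}) (Z (X - {e, tw e}) (tgt e # x # \<pi>)) (PA r (e # TA)) = P"
proof -
  note gd = goodD[OF g(1)]
  let ?S = "SS r TA" and ?z = "tgt e" and ?Y = "X - {e, tw e}" and ?P0 = "PA r TA"
  note vs = vs_PA[OF gd(1,3,4)] and cS = card_SS[OF gd(1,3,4)]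
  have Sn: "?S \<subseteq> {..<n}" by (rule SS_less[OF gd(1,3,4)])
  have x: "x \<in> ?S" "x < n" using gd(7) Sn by auto
  note lx = LX_remove[OF gd(2) l x(2)]
  note A = ARD[OF twclD(1)[OF gd(2) lx(2)]]
  have new: "?z \<notin> ?S" using gd(9)[OF lx(2) g(2)] lx(3) x by auto
  define Z1 where "Z1 = Z X \<pi> @ rev l"
  have Z: "Z X (x # \<pi>) = Z1 @ [e]" by (simp add: Z1_def Z_Cons l)
  \<comment> \<open>\<open>P1\<close> holds the marks just before \<open>e\<close> would be
    popped.\<close>
  define P1 where "P1 = dfs k X Z1 ?P0"
  have Pd: "P = dfs k X [e] P1" by (simp add: P Z dfs_append P1_def del: dfs.simps)
  have setZ: "set Z1 \<union> {e} = {a \<in> X. src a \<in> ?S}"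
    using set_Z[OF g(1)] Z by auto
  have xp: "x \<notin> set \<pi>" "set \<pi> \<subseteq> {..<n}" "?z \<notin> set \<pi>" using gd(6,7) Sn new by auto
  have "e \<notin> set (Z X \<pi>)"
    using xp set_LX[OF gd(2)] lx(3) unfolding Z_def by (auto simp: subset_iff)
  then have eZ1: "e \<notin> set Z1" using lx(4) by (simp add: Z1_def)
  have Z1X: "set Z1 \<subseteq> X" "\<forall>a\<in>set Z1. a \<in> X \<and> src a \<in> vs ?P0" using setZ vs by auto
  obtain qs where qs: "\<forall>q\<in>set qs. q \<in> set Z1 \<or> src q \<notin> vs ?P0" "\<forall>q\<in>set qs. P1 (tgt q) = q"
    "\<forall>v. v \<notin> tgt ` set qs \<longrightarrow> P1 v = ?P0 v"
    using dfs_growth[OF gd(2) Z1X(2), of k] g(2) cS vs unfolding P1_def by auto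
  \<comment> \<open>\<open>e\<close> occurs neither in \<open>Z1\<close> nor among the arcs of newly
    found vertices, so it has not discovered \<open>?z\<close> before. Hence the mark
    \<open>e\<close> was set when \<open>e\<close> was popped, at a time when fewer than
    \<open>k\<close> vertices were known.\<close>
  have P1z: "P1 ?z \<noteq> e"
  proof
    assume e1: "P1 ?z = e"
    have "?P0 ?z = 0" by (rule PA_outside[OF new])
    then have "?z \<in> tgt ` set qs" using qs(3) e1 A(12) by (metis)
    then have "e \<in> set qs" using qs(2) e1 by auto
    then show False using qs(1) eZ1 lx(3) x vs by auto
  qed
  have k: "\<not> k \<le> card (vs P1)" using Pd Pe P1z dfs_stop by metis
  then have ck: "card (vs P1) < k" by simp
  have z0: "P1 ?z = 0" using Pd Pe P1z k by (auto split: if_splits)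
  have c1: "a \<in> X \<Longrightarrow> a \<noteq> e \<Longrightarrow> src a \<in> vs P1 \<Longrightarrow> tgt a \<in> vs P1" for a
    using dfs_closed[OF gd(2) Z1X(1) ck[unfolded P1_def]] setZ vs unfolding P1_def by blast
  have sub: "?S \<subseteq> vs P1" using vs_dfs[of ?P0 k X Z1] vs unfolding P1_def by simp
  have zn: "?z \<notin> vs P1" using z0 by (simp add: vs_def)
  note tY = twcl_remove[OF gd(2) lx(2)]
  show "sol k r ?Y TA = {}"
    by (rule closed_sol_empty[OF tY gd(3,4) sub]) (use c1 ck in auto)
  \<comment> \<open>No chord appears with \<open>?z\<close>: another live arc between the tree and
    \<open>?z\<close> would have led the search to \<open>?z\<close> without
    \<open>e\<close>.\<close>
  have nl: "\<forall>a\<in>?Y. src a \<in> SS r (e # TA) \<longrightarrow> tgt a \<notin> SS r (e # TA)"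
  proof (intro ballI impI notI)
    fix a assume a: "a \<in> ?Y" "src a \<in> SS r (e # TA)" "tgt a \<in> SS r (e # TA)"
    then have aX: "a \<in> X" "a \<noteq> e" "a \<noteq> tw e" by auto
    note B = ARD[OF twclD(1)[OF gd(2) aX(1)]]
    have twa: "tw a \<in> X" "tw a \<noteq> e" using twclD(2)[OF gd(2) aX(1)] aX A(7) B(7) by auto
    have 1: "src a \<in> ?S \<Longrightarrow> tgt a \<notin> insert ?z ?S"
      using gd(9)[OF aX(1) g(2)] c1[OF aX(1,2)] sub zn by auto
    have 2: "src (tw a) \<in> ?S \<Longrightarrow> tgt (tw a) \<notin> insert ?z ?S"
      using gd(9)[OF twa(1) g(2)] c1[OF twa] sub zn by auto
    show False using a 1 2 B(5,9,10) by auto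
  qed
  show gd': "good k r ?Y (e # TA) (?z # x # \<pi>)"
    by (rule good_include[OF g lx(2,3) _ tY]) (use nl in auto)
  have ZY: "Z ?Y (?z # x # \<pi>) = Z1 @ rev (LX ?Y ?z)"
    using Z_remove[OF gd(2) lx(2), of \<pi>] xp lx(1,3) by (simp add: Z_Cons Z1_def)
  have LXY: "LX ?Y y = LX X y" if "y < n" "y \<noteq> x" "y \<noteq> ?z" for y
    using that lx(3) A(9) by (intro LX_cong) auto
  have x0: "?P0 x \<noteq> 0" using x vs by (auto simp: vs_def)
  \<comment> \<open>In the search from the extended tree \<open>?z\<close> is marked from the
    beginning; \<open>dfs_premark\<close> applies because the search on \<open>Z1\<close> does not
    meet \<open>?z\<close>.\<close>
  have P1': "dfs k ?Y Z1 (?P0(?z := e)) = P1(?z := e)"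
    unfolding P1_def
  proof (rule dfs_premark[OF gd(2) Z1X(1)])
    fix y assume y: "y < n" "?P0 y = 0" "y \<noteq> ?z"
    then have "y \<noteq> x" using x0 by metis
    then show "LX ?Y y = LX X y" using LXY y by blast
  qed (use ck z0 A in \<open>simp_all add: P1_def\<close>)
  have "P = dfs k X (rev (LX X ?z)) (P1(?z := e))"
    using Pd k z0 A by simp
  \<comment> \<open>The two lists differ in \<open>tw e\<close> only, which leads back to the known
    vertex \<open>x\<close> and is skipped.\<close>
  also have "\<dots> = dfs k X (rev (LX ?Y ?z)) (P1(?z := e))"
  proof -
    have "tw e \<in> set (LX X ?z)" using set_LX[OF gd(2) A(4)] twclD(2)[OF gd(2) lx(2)] A(9) by simp
    then obtain us ws where uw: "LX X ?z = us @ tw e # ws" by (auto dest: split_list)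
    have du: "distinct (us @ tw e # ws)" using distinct_LX[OF A(4), of X] uw by simp
    have eu: "e \<notin> set (us @ tw e # ws)"
      using set_LX[OF gd(2) A(4)] uw A(5) by (metis (mono_tags, lifting) mem_Collect_eq)
    have LY: "LX ?Y ?z = filter (\<lambda>a. a \<noteq> e \<and> a \<noteq> tw e) (LX X ?z)"
      by (simp add: LX_def conj_commute)
    have "LX ?Y ?z = us @ ws"
    proof -
      have "filter (\<lambda>a. a \<noteq> e \<and> a \<noteq> tw e) us = us" "filter (\<lambda>a. a \<noteq> e \<and> a \<noteq> tw e) ws = ws"
        using du eu by (auto intro!: filter_True)
      then show ?thesis by (simp add: LY uw)
    qed
    moreover have "(P1(?z := e)) (tgt (tw e)) \<noteq> 0"
      using A(10,12) x sub lx(3) by (auto simp: vs_def)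
    ultimately show ?thesis
      using dfs_skip[of "P1(?z := e)" "tw e" k X "rev ws" "rev us"] uw by simp
  qed
  also have "\<dots> = dfs k ?Y (rev (LX ?Y ?z)) (P1(?z := e))"
  proof (rule dfs_change_arcs[symmetric])
    fix y assume y: "y < n" "(P1(?z := e)) y = 0"
    then have "y \<noteq> ?z" using A(12) by auto
    moreover have "y \<noteq> x" using y x sub \<open>y \<noteq> ?z\<close> by (auto simp: vs_def)
    ultimately show "LX ?Y y = LX X y" using LXY y by blast
  qed
  also have "\<dots> = dfs k ?Y (Z ?Y (?z # x # \<pi>)) (PA r (e # TA))"
    unfolding ZY dfs_append by (simp add: P1')
  finally show "dfs k ?Y (Z ?Y (?z # x # \<pi>)) (PA r (e # TA)) = P" by simp
qed

section \<open>Charging the inspected arcs to solutions\<close>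

text \<open>Among the arcs towards the larger vertex no two have the same edge, and likewise in the
  other direction.\<close>

lemma card_arcs_le: "A \<subseteq> AR \<Longrightarrow> card A \<le> 2 * card (ed ` A)"
proof -
  assume A: "A \<subseteq> AR"
  let ?U = "{a \<in> A. src a < tgt a}" and ?D = "{a \<in> A. tgt a < src a}"
  have fin: "finite A" using A finite_AR finite_subset by blast
  have "inj_on ed ?U" "inj_on ed ?D"
    using A ed_eq ARD(9,10) by (auto simp: inj_on_def subset_iff)
  then have "card ?U = card (ed ` ?U)" "card ?D = card (ed ` ?D)" by (simp_all add: card_image)
  moreover have "card (ed ` ?U) \<le> card (ed ` A)" "card (ed ` ?D) \<le> card (ed ` A)"
    using fin by (auto intro!: card_mono)
  moreover have "A = ?U \<union> ?D" using A ARD(5) by fastforce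
  then have "card A \<le> card ?U + card ?D" by (metis card_Un_le)
  ultimately show ?thesis by linarith
qed

definition inside :: "nat set \<Rightarrow> nat set \<Rightarrow> nat set" where
  "inside X V = {a \<in> X. src a \<in> V \<and> tgt a \<in> V}"

lemma ed_inside: "twcl X \<Longrightarrow> ed ` inside X V = {f \<in> ed ` X. f \<subseteq> V}"
  by (auto simp: inside_def ed_def)

lemma ed_pair: "a \<in> AR \<Longrightarrow> \<exists>u v. u \<noteq> v \<and> ed a = {u, v}"
  using ARD(5) by (auto simp: ed_def)

text \<open>Pays for a search whose forced edges complete the tree. No branching follows then, but
  the state has a single solution, which makes the bound O(k).\<close>

lemma count_inside:
  assumes g: "good k r X TA \<pi>" "length TA + 1 < k" "2 \<le> k"
    and P: "P = dfs k X (Z X \<pi>) (PA r TA)" and full: "card (vs P) = k"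
  shows "card (inside X (vs P)) \<le> 2 * (card (sol k r X TA) + k)"
proof -
  note gd = goodD[OF g(1)]
  obtain qs where qs: "growth (SS r TA) (map pr qs)" "set qs \<subseteq> X"
    "vs P = SS r TA \<union> tgt ` set qs" "length TA + 1 + length qs = k"
    using dfs_sol[OF gd(1-4) set_Z[OF g(1)] g(3) _ P full] g(2) by auto
  have "card {f \<in> ed ` X. f \<subseteq> SS r TA \<union> heads (map pr qs) \<or> (map pr qs \<noteq> [] \<and> f \<inter> SS r TA \<noteq> {})}
    \<le> card (sols (ed ` AR) k (SS r TA) (ed ` set TA) (ed ` X)) + length (map pr qs)"
  proof (rule count_exchanges[OF _ tree_TA[OF gd(1,3,4)] _ _ qs(1)])
    show "\<And>f. f \<in> ed ` X \<Longrightarrow> \<not> f \<subseteq> SS r TA" using gd(9) g(2) by (auto simp: ed_def)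
  qed (use gd qs g card_SS[OF gd(1,3,4)] ed_pair twclD[OF gd(2)] in
      \<open>auto simp: finite_AR edge_set_pr twcl_def\<close>)
  moreover have "card (ed ` inside X (vs P)) \<le>
    card {f \<in> ed ` X. f \<subseteq> SS r TA \<union> heads (map pr qs) \<or> (map pr qs \<noteq> [] \<and> f \<inter> SS r TA \<noteq> {})}"
    unfolding ed_inside[OF gd(2)] heads_pr using twclD(3)[OF gd(2)] qs(3)
    by (intro card_mono) auto
  moreover have "card (inside X (vs P)) \<le> 2 * card (ed ` inside X (vs P))"
    using gd(2) by (intro card_arcs_le) (auto simp: inside_def twcl_def)
  ultimately show ?thesis using qs(4) by (simp add: sol_def)
qed

text \<open>Since \<open>e\<close> has not discovered its end, the search exhibits a solution
  without \<open>e\<close>, and \<open>count_branch\<close> derives from it the solutions with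
  \<open>e\<close>. The last two estimates pay for the search and for scanning the new vertex. The
  former has doubled constants because \<open>inside\<close> contains both arcs of an edge.\<close>

lemma branch:
  assumes g: "good k r X TA (x # \<pi>)" "length TA + 1 < k" "2 \<le> k"
    and P: "P = dfs k X (Z X (x # \<pi>)) (PA r TA)" and full: "card (vs P) = k"
    and l: "LX X x = e # l" and Pe: "P (tgt e) \<noteq> e"
    and Y: "Y = drop_loops (SS r (e # TA)) (X - {e, tw e})"
  shows "sol k r (X - {e, tw e}) TA \<noteq> {}"
    and "sol k r Y (e # TA) \<noteq> {}"
    and "sol k r (X - {e, tw e}) (e # TA) = sol k r Y (e # TA)"
    and "good k r (X - {e, tw e}) TA (x # \<pi>)"
    and "good k r Y (e # TA) (tgt e # x # \<pi>)"
    and "card (inside X (vs P)) \<le> 2 * card (sol k r Y (e # TA)) + 4 * k"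
    and "length TA + 2 < k \<Longrightarrow> card {a \<in> X. src a = tgt e} \<le> card (sol k r Y (e # TA)) + 2 * k"
proof -
  note gd = goodD[OF g(1)]
  let ?S = "SS r TA" and ?z = "tgt e" and ?W = "X - {e, tw e}"
  have Sn: "?S \<subseteq> {..<n}" by (rule SS_less[OF gd(1,3,4)])
  have x: "x \<in> ?S" "x < n" using gd(7) Sn by auto
  note lx = LX_remove[OF gd(2) l x(2)]
  have eA: "e \<in> AR" using twclD(1)[OF gd(2) lx(2)] .
  note A = ARD[OF eA]
  have new: "?z \<notin> ?S" using gd(9)[OF lx(2) g(2)] lx(3) x by auto
  note tW = twcl_remove[OF gd(2) lx(2)]
  obtain qs where qs: "growth ?S (map pr qs)" "set qs \<subseteq> X" "\<forall>q\<in>set qs. P (tgt q) = q"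
    "vs P = ?S \<union> tgt ` set qs" "length TA + 1 + length qs = k"
    using dfs_sol[OF gd(1-4) set_Z[OF g(1)] g(3) _ P full] g(2) by auto
  have "e \<notin> set qs" using qs(3) Pe by auto
  moreover have "tw e \<notin> set qs"
    using growth_heads[OF qs(1)] x lx(3) A(10) unfolding heads_pr by (metis IntI emptyE imageI)
  ultimately have eq: "ed e \<notin> ed ` set qs"
    using ed_eq[OF eA] qs(2) twclD(1)[OF gd(2)] by auto
  have ede: "ed e = {x, ?z}" using lx(3) by (simp add: ed_def)
  have fp: "\<And>f. f \<in> ed ` X \<Longrightarrow> \<exists>a b. a \<noteq> b \<and> f = {a, b}" using ed_pair twclD(1)[OF gd(2)] by blast
  have fl: "\<And>f. f \<in> ed ` X \<Longrightarrow> \<not> f \<subseteq> ?S" using gd(9) g(2) by (auto simp: ed_def)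
  have AR: "finite (ed ` AR)" "ed ` set TA \<subseteq> ed ` AR" "ed ` X \<subseteq> ed ` AR"
    using gd(2,3) finite_AR by (auto simp: twcl_def)
  have qX: "edge_set (map pr qs) \<subseteq> ed ` X" "card ?S + length (map pr qs) = k" "card ?S < k"
    using qs card_SS[OF gd(1,3,4)] g(2) by (auto simp: edge_set_pr)
  have "?W \<subseteq> AR" using tW by (simp add: twcl_def)
  have YE: "ed ` Y = {f \<in> ed ` X - {{x, ?z}}. \<not> f \<subseteq> insert ?z ?S}"
    unfolding Y drop_loops_def ede[symmetric] ed_remove[OF gd(2) lx(2), symmetric]
    by (auto simp: ed_def)
  have solY: "sol k r Y (e # TA) = sols (ed ` AR) k (insert ?z ?S) (insert {x, ?z} (ed ` set TA)) (ed ` Y)"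
    by (simp add: sol_def ede)
  have xz: "{x, ?z} \<in> ed ` X" "{x, ?z} \<notin> edge_set (map pr qs)"
    using eq lx(2) ede by (auto simp: edge_set_pr)
  note cb = count_branch[OF AR(1) tree_TA[OF gd(1,3,4)] AR(2,3) qs(1) qX(1,2) g(3) qX(3) fp fl x(1)
      new xz YE]
  show ne: "sol k r Y (e # TA) \<noteq> {}" unfolding solY by (rule cb(1))
  have "ed ` set TA \<union> edge_set (map pr qs) \<in> sols (ed ` AR) k ?S (ed ` set TA) (ed ` ?W)"
  proof (rule growth_sols[OF tree_TA[OF gd(1,3,4)] AR(2) _ qs(1) _ qX(2) g(3)])
    show "ed ` ?W \<subseteq> ed ` AR" using AR(3) by blast
    show "edge_set (map pr qs) \<subseteq> ed ` ?W"
      unfolding ed_remove[OF gd(2) lx(2)] using qX(1) xz(2) ede by auto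
  qed
  then show "sol k r ?W TA \<noteq> {}" by (auto simp: sol_def)
  show "good k r ?W TA (x # \<pi>)" by (rule good_exclude[OF g(1) lx(2)])
  have "twcl Y" unfolding Y by (rule twcl_drop_loops[OF tW])
  then show gY: "good k r Y (e # TA) (?z # x # \<pi>)"
    by (rule good_include[OF g(1,2) lx(2,3), rotated]) (auto simp: Y drop_loops_def)
  note gYd = goodD[OF gY]
  show "sol k r ?W (e # TA) = sol k r Y (e # TA)"
    using sol_drop_loops[OF gd(1) gYd(3,4) g(3)] Y by simp
  have "card (inside X (vs P)) \<le> 2 * card (ed ` inside X (vs P))"
    using gd(2) by (intro card_arcs_le) (auto simp: inside_def twcl_def)
  also have "ed ` inside X (vs P) = {f \<in> ed ` X. f \<subseteq> ?S \<union> heads (map pr qs)}"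
    unfolding ed_inside[OF gd(2)] heads_pr qs(4) ..
  finally show "card (inside X (vs P)) \<le> 2 * card (sol k r Y (e # TA)) + 4 * k"
    using cb(2) unfolding solY by linarith
  assume "length TA + 2 < k"
  then have "card {f \<in> ed ` X. ?z \<in> f} \<le> card (sol k r Y (e # TA)) + 2 * k"
    using cb(3) card_SS[OF gd(1,3,4)] unfolding solY by simp
  moreover have "inj_on ed {a \<in> X. src a = ?z}"
    using twclD(1)[OF gd(2)] ed_eq ARD(5,9) by (intro inj_onI) (metis (mono_tags, lifting) mem_Collect_eq)
  then have "card {a \<in> X. src a = ?z} = card (ed ` {a \<in> X. src a = ?z})" by (simp add: card_image)
  moreover have "card (ed ` {a \<in> X. src a = ?z}) \<le> card {f \<in> ed ` X. ?z \<in> f}"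
  proof (intro card_mono)
    have "?z \<in> ed a" if "src a = ?z" for a using that by (simp add: ed_def)
    then show "ed ` {a \<in> X. src a = ?z} \<subseteq> {f \<in> ed ` X. ?z \<in> f}" by blast
  qed (use twclD(3)[OF gd(2)] in simp)
  ultimately show "card {a \<in> X. src a = ?z} \<le> card (sol k r Y (e # TA)) + 2 * k" by linarith
qed

end

section \<open>The program\<close>

definition del_arc :: "reg \<Rightarrow> com" where
  "del_arc r = B (Get RT1 APrev r) ;; B (Get RT2 ANext r) ;; B (Put ANext RT1 RT2) ;;
     B (Put APrev RT2 RT1)"

definition del_edge :: "reg \<Rightarrow> com" where
  "del_edge r = del_arc r ;; B (Get RT3 ATwin r) ;; del_arc RT3"

text \<open>Deletion leaves the two pointers of the removed arc intact, and they tell where to put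
  it back, provided that deletions are undone in reverse order.\<close>

definition undel_arc :: "reg \<Rightarrow> com" where
  "undel_arc r = B (Get RT1 APrev r) ;; B (Get RT2 ANext r) ;; B (Put ANext RT1 r) ;;
     B (Put APrev RT2 r)"

definition undel_edge :: "reg \<Rightarrow> com" where
  "undel_edge r = B (Get RT3 ATwin r) ;; undel_arc RT3 ;; undel_arc r"

text \<open>The log records the deleted edges. The kind of an entry is 0 for an excluded edge or a
  deleted chord, 1 for a tree edge without alternative, and 2 for a tree edge whose exclusion
  remains to be explored.\<close>

definition push_log :: "reg \<Rightarrow> nat \<Rightarrow> com" where
  "push_log r kd = B (Cst RT4 kd) ;; B (Put ALogE RLp r) ;; B (Put ALogK RLp RT4) ;; B (Inc RLp)"

text \<open>\<open>RSz\<close> counts vertices, so the next free place for a tree edge has index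
  \<open>RSz - 1\<close>.\<close>

definition add_edge :: "nat \<Rightarrow> com" where
  "add_edge kd = del_edge RE ;; push_log RE kd ;; B (Mov RT1 RSz) ;; B (Dec RT1) ;;
     B (Put ATree RT1 RE) ;; B (Inc RSz) ;; B (Mov RCur RZ)"

definition init_loop :: com where
  "init_loop = While (Neq RU RRoot) (B (Get RT1 APrev RU) ;; B (Put AStk RSp RT1) ;; B (Inc RSp) ;;
     B (Get RT1 APar RU) ;; B (Get RT1 ATwin RT1) ;; B (Get RU AHead RT1))"

text \<open>The stack holds one pointer per vertex, to the last arc of its list that is not yet
  scanned, instead of whole lists. Climbing from the current vertex to the root leaves the current
  vertex at the bottom, which realizes the order of \<open>Z\<close>.\<close>

definition search_init :: com where
  "search_init = B (Mov RCnt RSz) ;; B (Cst RVp 0) ;; B (Cst RSp 0) ;; B (Mov RU RCur) ;;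
     init_loop ;; B (Get RT1 APrev RU) ;; B (Put AStk RSp RT1) ;; B (Inc RSp)"

text \<open>A popped value below \<open>n\<close> is a list head, so this list is exhausted.
  Otherwise the predecessor of the popped arc takes its place before the list of a discovered vertex
  is put on top.\<close>

definition search_loop :: com where
  "search_loop = While (Lt RCnt RK)
     (B (Dec RSp) ;; B (Get RA AStk RSp) ;;
      If (Lt RA RN) Skip
       (B (Get RT1 APrev RA) ;; B (Put AStk RSp RT1) ;; B (Inc RSp) ;;
        B (Get RT2 AHead RA) ;; B (Get RT3 APar RT2) ;;
        If (Pos RT3) Skip
         (B (Put APar RT2 RA) ;; B (Put AVis RVp RT2) ;; B (Inc RVp) ;; B (Inc RCnt) ;;
          B (Get RT1 APrev RT2) ;; B (Put AStk RSp RT1) ;; B (Inc RSp))))"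

text \<open>The marks of the search are still in place, so an edge is forced exactly if it is the
  mark of its end. An empty list at the current vertex sends the walk to the parent, the head of the
  twin of the parent arc.\<close>

definition forward_body :: com where
  "forward_body = If (Lt RSz RK)
     (B (Get RE ANext RCur) ;;
      If (Lt RE RN)
       (B (Get RT1 APar RCur) ;; B (Get RT1 ATwin RT1) ;; B (Get RCur AHead RT1))
       (B (Get RZ AHead RE) ;; B (Get RT1 APar RZ) ;;
        If (Neq RT1 RE) (B (Cst RX 0)) (add_edge 1)))
     (B (Cst RX 0))"

definition forward_loop :: com where
  "forward_loop = While (Pos RX) forward_body"

definition clear_loop :: com where
  "clear_loop = While (Lt RI RVp) (B (Get RT1 AVis RI) ;; B (Put APar RT1 Zero) ;; B (Inc RI))"

definition mark_loop :: com where
  "mark_loop = While (Lt RI RSz) (B (Mov RT1 RI) ;; B (Dec RT1) ;; B (Get RT2 ATree RT1) ;;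
     B (Get RT1 AHead RT2) ;; B (Put APar RT1 RT2) ;; B (Inc RI))"

text \<open>Through \<open>AVis\<close> only the discovered vertices are touched, so the reset costs
  O(k). The tree vertices are marked again because some of the discovered ones have become tree
  vertices by forced edges.\<close>

definition clear_marks :: com where
  "clear_marks = B (Cst RI 0) ;; clear_loop ;; B (Cst RI 1) ;; mark_loop"

definition print_loop :: com where
  "print_loop = While (Lt RI RSz) (B (Mov RT1 RI) ;; B (Dec RT1) ;; B (Get RT2 ATree RT1) ;;
     B (Get RT1 ATwin RT2) ;; B (Get RT1 AHead RT1) ;; B (Pr RT1) ;;
     B (Get RT1 AHead RT2) ;; B (Pr RT1) ;; B (Inc RI))"

definition chord_loop :: com where
  "chord_loop = While (Neq RA RZ)
     (B (Get RB ANext RA) ;; B (Get RT1 AHead RA) ;; B (Get RT1 APar RT1) ;;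
      If (Pos RT1) (del_edge RA ;; push_log RA 0) Skip ;; B (Mov RA RB))"

definition branch_edge :: com where
  "branch_edge = add_edge 2 ;; B (Put APar RZ RE) ;;
     If (Lt RSz RK) (B (Get RA ANext RZ) ;; chord_loop) Skip"

definition descend :: com where
  "descend =
     If (Lt RSz RK) (search_init ;; search_loop ;; B (Cst RX 1) ;; forward_loop ;; clear_marks) Skip ;;
     If (Lt RSz RK) branch_edge (B (Cst RI 1) ;; print_loop ;; B (Cst RMode 2))"

text \<open>The kind is counted down: a positive kind takes the edge out of the tree, and if it is
  still positive after the decrement, which happens for kind 2, the edge is deleted again with kind
  0 and the exploration goes on without it.\<close>

definition backtrack :: com where
  "backtrack =
     If (Pos RLp)
       (B (Dec RLp) ;; B (Get RE ALogE RLp) ;; B (Get RT4 ALogK RLp) ;; undel_edge RE ;;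
        If (Pos RT4)
          (B (Get RZ AHead RE) ;; B (Put APar RZ Zero) ;; B (Dec RSz) ;; B (Get RT1 ATwin RE) ;;
           B (Get RCur AHead RT1) ;; B (Dec RT4) ;;
           If (Pos RT4) (del_edge RE ;; push_log RE 0 ;; B (Cst RMode 1)) Skip)
          Skip)
       (B (Cst RMode 0))"

text \<open>\<open>RMode\<close> is 1 while descending, 2 while undoing the log, and 0 at the
  end.\<close>

definition enum_body :: com where
  "enum_body = B (Mov RT1 RMode) ;; B (Dec RT1) ;; If (Pos RT1) backtrack descend"

definition enum_loop :: com where
  "enum_loop = While (Pos RMode) enum_body"

section \<open>Doubly linked lists with undo\<close>

definition arrl :: "(nat \<Rightarrow> nat) \<Rightarrow> nat list \<Rightarrow> bool" where
  "arrl f xs \<longleftrightarrow> (\<forall>i<length xs. f i = xs ! i)"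

lemma arrl_Nil [simp]: "arrl f []"
  by (simp add: arrl_def)

lemma arrl_push [simp]:
  "arrl f xs \<Longrightarrow> i = length xs \<Longrightarrow> arrl (f(i := x)) (xs @ [x])"
  "arrl f xs \<Longrightarrow> i = length xs \<Longrightarrow> arrl (\<lambda>a. if a = i then x else f a) (xs @ [x])"
  by (auto simp: arrl_def nth_append less_Suc_eq)

lemma arrl_pop: "arrl f (xs @ [x]) \<longleftrightarrow> arrl f xs \<and> f (length xs) = x"
  by (auto simp: arrl_def nth_append less_Suc_eq)

type_synonym links = "(nat \<Rightarrow> nat) \<times> (nat \<Rightarrow> nat)"

text \<open>For \<open>v # LX X v @ [v]\<close> this describes a circular list with the vertex
  \<open>v\<close> as sentinel, so deletion needs no special case at either end.\<close>

fun chain :: "links \<Rightarrow> nat list \<Rightarrow> bool" where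
  "chain np (x # y # xs) \<longleftrightarrow> fst np x = y \<and> snd np y = x \<and> chain np (y # xs)"
| "chain np _ \<longleftrightarrow> True"

lemma chain_append: "chain np (xs @ y # zs) \<longleftrightarrow> chain np (xs @ [y]) \<and> chain np (y # zs)"
proof (induction xs)
  case (Cons a xs)
  then show ?case by (cases xs) auto
qed simp

lemma chain_cong:
  "(\<And>x. x \<in> set (butlast xs) \<Longrightarrow> fst np x = fst np' x) \<Longrightarrow>
   (\<And>x. x \<in> set (tl xs) \<Longrightarrow> snd np x = snd np' x) \<Longrightarrow> chain np xs \<Longrightarrow> chain np' xs"
proof (induction np xs rule: chain.induct)
  case (1 np x y xs)
  have "snd np y = snd np' y" "fst np x = fst np' x" using 1 by simp_all
  moreover have "chain np' (y # xs)"
  proof (rule "1.IH")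
    show "fst np z = fst np' z" if "z \<in> set (butlast (y # xs))" for z using that 1(2) by auto
    show "snd np z = snd np' z" if "z \<in> set (tl (y # xs))" for z using that 1(3) by auto
    show "chain np (y # xs)" using 1(4) by simp
  qed
  ultimately show ?case using 1(4) by simp
qed auto

definition del1 :: "nat \<Rightarrow> links \<Rightarrow> links" where
  "del1 a np = ((fst np)(snd np a := fst np a), (snd np)(fst np a := snd np a))"

definition und1 :: "nat \<Rightarrow> links \<Rightarrow> links" where
  "und1 a np = ((fst np)(snd np a := a), (snd np)(fst np a := a))"

context arcs
begin

definition del2 :: "nat \<Rightarrow> links \<Rightarrow> links" where
  "del2 a np = del1 (tw a) (del1 a np)"

definition und2 :: "nat \<Rightarrow> links \<Rightarrow> links" where
  "und2 a np = und1 a (und1 (tw a) np)"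

definition links :: "links \<Rightarrow> nat set \<Rightarrow> bool" where
  "links np X \<longleftrightarrow> X \<subseteq> AR \<and> (\<forall>v<n. chain np (v # LX X v @ [v]))"

lemma LX_mem: "v < n \<Longrightarrow> a \<in> set (LX X v) \<longleftrightarrow> a \<in> X \<and> a \<in> AR \<and> src a = v"
  unfolding LX_def using tgt_tw ARD(8) by (auto simp: src_def AR_def)

text \<open>The neighbours \<open>p\<close> and \<open>q\<close> of \<open>a\<close> may be the
  sentinel, even both of them, so the cyclic list is split around them without asking what they are.
  As \<open>a\<close> keeps its pointers, \<open>und1\<close> restores the links exactly, not only
  up to the represented lists.\<close>

lemma links_del1:
  assumes l: "links np X" and a: "a \<in> X"
  shows "links (del1 a np) (X - {a})" "und1 a (del1 a np) = np"
proof -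
  have X: "X \<subseteq> AR" using l by (simp add: links_def)
  note A = ARD[OF subsetD[OF X a]]
  let ?v = "src a"
  have "a \<in> set (LX X ?v)" using LX_mem[OF A(3)] a subsetD[OF X a] by simp
  then obtain us ws where uw: "LX X ?v = us @ a # ws" by (auto dest: split_list)
  have d: "distinct (us @ a # ws)" using distinct_LX[OF A(3), of X] uw by simp
  have nv: "?v \<notin> set (us @ a # ws)" using LX_mem[OF A(3)] uw ARD(1) A(3)
    by (metis leD)
  obtain A' p where p: "?v # us = A' @ [p]" by (metis list.distinct(1) rev_exhaust)
  obtain q B' where q: "ws @ [?v] = q # B'" by (cases ws) auto
  have ch: "chain np (A' @ p # a # q # B')"
  proof -
    have "?v # LX X ?v @ [?v] = A' @ p # a # q # B'" using uw p q by (metis append.assoc append_Cons append_Nil)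
    then show ?thesis using l A(3) unfolding links_def by metis
  qed
  then have np: "fst np p = a" "snd np a = p" "fst np a = q" "snd np q = a"
    "chain np (A' @ [p])" "chain np (q # B')"
    using chain_append[of np A' p "a # q # B'"] by auto
  have pin: "p \<in> insert ?v (set us)" using p by (metis in_set_conv_decomp list.set(2))
  have qin: "q \<in> insert ?v (set ws)" using q by (metis list.set_intros(1) Un_insert_right insert_iff list.set(2) set_append sup_bot_right empty_set)
  have pa: "p \<noteq> a" "q \<noteq> a" using pin qin d nv by auto
  let ?d = "del1 a np"
  have dd: "fst ?d = (fst np)(p := q)" "snd ?d = (snd np)(q := p)" by (simp_all add: del1_def np)
  show "und1 a ?d = np"
    unfolding und1_def dd using np pa by (auto simp: prod_eq_iff)
  have "chain ?d (v # LX (X - {a}) v @ [v])" if v: "v < n" for v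
  proof (cases "v = ?v")
    case True
    have "LX (X - {a}) ?v = us @ ws"
    proof -
      have "LX (X - {a}) ?v = filter (\<lambda>b. b \<noteq> a) (LX X ?v)"
        by (simp add: LX_def conj_commute)
      moreover have "filter (\<lambda>b. b \<noteq> a) us = us" "filter (\<lambda>b. b \<noteq> a) ws = ws"
        using d by (auto intro!: filter_True)
      ultimately have "LX (X - {a}) ?v = us @ ws" by (simp add: uw)
      then show ?thesis .
    qed
    then have eq: "?v # LX (X - {a}) ?v @ [?v] = A' @ p # q # B'" using p q
      by (metis append.assoc append_Cons append_Nil)
    have du: "distinct (?v # us)" "distinct (?v # ws)" "set us \<inter> set ws = {}" using d nv by auto
    have A'p: "p \<notin> set A'" "set (tl (A' @ [p])) \<subseteq> set us"
    proof -
      show "p \<notin> set A'" using du(1) p by simp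
      have "tl (A' @ [p]) = us" using p[symmetric] by simp
      then show "set (tl (A' @ [p])) \<subseteq> set us" by simp
    qed
    have "q \<notin> set us" using qin du nv by auto
    then have 1: "chain ?d (A' @ [p])"
      using A'p by (intro chain_cong[OF _ _ np(5)]) (auto simp: dd)
    have B': "q \<notin> set B'" "p \<notin> set (butlast (q # B'))"
    proof -
      have "distinct (ws @ [?v])" using du by simp
      then show "q \<notin> set B'" using q by simp
      have "butlast (q # B') = ws" using q[symmetric] by simp
      then show "p \<notin> set (butlast (q # B'))" using pin du by auto
    qed
    have 2: "chain ?d (q # B')"
      using B' by (intro chain_cong[OF _ _ np(6)]) (auto simp: dd)
    have "chain ?d (A' @ p # q # B')"
      using 1 2 chain_append[of ?d A' p "q # B'"] by (simp add: dd)
    then show ?thesis using True eq by metis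
  next
    case False
    have "LX (X - {a}) v = LX X v" using False v by (intro LX_cong) auto
    moreover have "chain np (v # LX X v @ [v])" using l v by (simp add: links_def)
    moreover have "x \<noteq> p \<and> x \<noteq> q" if "x \<in> set (v # LX X v @ [v])" for x
    proof -
      have "set us \<union> set ws \<subseteq> set (LX X ?v)" using uw by auto
      then have pq: "p = ?v \<or> (p \<in> AR \<and> src p = ?v)" "q = ?v \<or> (q \<in> AR \<and> src q = ?v)"
        using pin qin LX_mem[OF A(3), of _ X] by blast+
      have "x = v \<or> (x \<in> AR \<and> src x = v)" using that LX_mem[OF v] by auto
      then show ?thesis using pq False v A(3) ARD(1)[of x] ARD(1)[of p] ARD(1)[of q] by auto
    qed
    ultimately show ?thesis
      by (metis (no_types, lifting) chain_cong[of "v # LX X v @ [v]" np ?d] dd fun_upd_other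
          in_set_butlastD list.set_sel(2) list.distinct(1))
  qed
  then show "links ?d (X - {a})" using X unfolding links_def by auto
qed

lemma links_del2:
  assumes l: "links np X" and X: "twcl X" "a \<in> X"
  shows "links (del2 a np) (X - {a, tw a})" "und2 a (del2 a np) = np"
proof -
  have t: "tw a \<in> X - {a}" using twclD(2)[OF X] ARD(11)[OF twclD(1)[OF X]] by simp
  note 1 = links_del1[OF l X(2)]
  note 2 = links_del1[OF 1(1) t]
  have "X - {a} - {tw a} = X - {a, tw a}" by auto
  then show "links (del2 a np) (X - {a, tw a})" using 2(1) by (simp add: del2_def)
  show "und2 a (del2 a np) = np" by (simp add: del2_def und2_def 1(2) 2(2))
qed

lemma links_bounds:
  assumes "links np X"
  shows "v < n \<Longrightarrow> fst np v < n + 2 * m" "v < n \<Longrightarrow> snd np v < n + 2 * m"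
    "a \<in> X \<Longrightarrow> fst np a < n + 2 * m" "a \<in> X \<Longrightarrow> snd np a < n + 2 * m"
proof -
  have ch: "chain np xs \<Longrightarrow> \<forall>x\<in>set xs. x < n + 2 * m \<Longrightarrow>
    (\<forall>x\<in>set (butlast xs). fst np x < n + 2 * m) \<and> (\<forall>x\<in>set (tl xs). snd np x < n + 2 * m)" for xs
    by (induction np xs rule: chain.induct) auto
  have X: "X \<subseteq> AR" using assms by (simp add: links_def)
  have all: "(\<forall>x\<in>insert v (set (LX X v)). fst np x < n + 2 * m) \<and>
    (\<forall>x\<in>insert v (set (LX X v)). snd np x < n + 2 * m)" if "v < n" for v
  proof -
    have "\<forall>x\<in>set (v # LX X v @ [v]). x < n + 2 * m"
      using LX_mem[OF that, of _ X] ARD(2) that by auto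
    from ch[OF _ this] show ?thesis using assms that by (auto simp: links_def butlast_append)
  qed
  then show "v < n \<Longrightarrow> fst np v < n + 2 * m" "v < n \<Longrightarrow> snd np v < n + 2 * m" by auto
  assume a: "a \<in> X"
  then have "a \<in> set (LX X (src a))" "src a < n" using LX_mem[of "src a"] ARD(3) X by auto
  then show "fst np a < n + 2 * m" "snd np a < n + 2 * m" using all by blast+
qed

lemma links_first: "links np X \<Longrightarrow> v < n \<Longrightarrow> fst np v = hd (LX X v @ [v])"
  unfolding links_def by (cases "LX X v") (metis append_Nil chain.simps(1) list.sel(1), metis append_Cons chain.simps(1) list.sel(1))

lemma links_next:
  assumes "links np X" "v < n" "LX X v = us @ a # ws"
  shows "fst np a = hd (ws @ [v])"
proof -
  have "chain np ((v # us) @ a # ws @ [v])" using assms unfolding links_def by auto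
  then have "chain np (a # ws @ [v])" using chain_append by blast
  then show ?thesis by (cases ws) auto
qed

text \<open>\<open>sg pv p w\<close>: following the previous-pointers from \<open>p\<close> visits the arcs in \<open>w\<close> and then the
  head of the list.\<close>

fun sg :: "(nat \<Rightarrow> nat) \<Rightarrow> nat \<Rightarrow> nat list \<Rightarrow> bool" where
  "sg pv p [] \<longleftrightarrow> p < n"
| "sg pv p (a # w) \<longleftrightarrow> p = a \<and> n \<le> a \<and> sg pv (pv a) w"

lemma chain_sg: "chain np (x # xs @ [y]) \<Longrightarrow> x < n \<Longrightarrow> \<forall>a\<in>set xs. n \<le> a \<Longrightarrow>
    sg (snd np) (snd np y) (rev xs)"
proof (induction xs arbitrary: y rule: rev_induct)
  case (snoc b xs)
  have "chain np ((x # xs) @ b # [y])" using snoc(2) by simp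
  then have "chain np (x # xs @ [b])" "snd np y = b" using chain_append[of np "x # xs" b "[y]"] by auto
  then show ?case using snoc by auto
qed simp

lemma links_sg: "links np X \<Longrightarrow> v < n \<Longrightarrow> sg (snd np) (snd np v) (rev (LX X v))"
  using chain_sg[of np v "LX X v" v] LX_mem[of v _ X] ARD(1) by (auto simp: links_def)

end

section \<open>Verification of the search\<close>

lemma arrl_push2:
  "arrl f xs \<Longrightarrow> i = length xs \<Longrightarrow>
   arrl (\<lambda>x. if x = Suc i then b else if x = i then a else f x) (xs @ [a, b])"
  by (auto simp: arrl_def nth_append nth_Cons' less_Suc_eq)

context arcs
begin

text \<open>What the enumeration keeps invariant except for the marks: \<open>lg\<close> is the log (latest entry
  first), and the outer loop has its counter in \<open>RJ\<close> and its array in \<open>AOrd\<close>.\<close>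

definition core ::
  "nat \<Rightarrow> nat \<Rightarrow> nat \<Rightarrow> (nat \<Rightarrow> nat) \<Rightarrow> st \<Rightarrow> links \<Rightarrow> nat set \<Rightarrow> nat list \<Rightarrow> (nat \<times> nat) list \<Rightarrow> bool" where
  "core k r j od s np X TA lg \<longleftrightarrow>
     rg s Zero = 0 \<and> rg s RN = n \<and> rg s RK = k \<and> rg s RRoot = r \<and> rg s RJ = j \<and>
     rg s RSz = Suc (length TA) \<and> rg s RLp = length lg \<and>
     ar s ANext = fst np \<and> ar s APrev = snd np \<and> ar s AHead = tgt \<and> ar s ATwin = tw \<and>
     ar s AOrd = od \<and> arrl (ar s ALogE) (map fst (rev lg)) \<and> arrl (ar s ALogK) (map snd (rev lg)) \<and>
     arrl (ar s ATree) (rev TA) \<and> links np X \<and> twcl X \<and> card X + 2 * length lg \<le> 2 * m"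

lemma coreD:
  assumes "core k r j od s np X TA lg"
  shows "rg s Zero = 0" "rg s RN = n" "rg s RK = k" "rg s RRoot = r" "rg s RJ = j"
     "rg s RSz = Suc (length TA)" "rg s RLp = length lg"
     "ar s ANext = fst np" "ar s APrev = snd np" "ar s AHead = tgt" "ar s ATwin = tw"
     "ar s AOrd = od" "arrl (ar s ALogE) (map fst (rev lg))" "arrl (ar s ALogK) (map snd (rev lg))"
     "arrl (ar s ATree) (rev TA)" "links np X" "twcl X" "card X + 2 * length lg \<le> 2 * m"
  using assms by (simp_all add: core_def)

definition core_regs :: "reg set" where
  "core_regs = {Zero, RN, RK, RRoot, RJ, RSz, RLp}"

definition core_arrs :: "arr set" where
  "core_arrs = {ANext, APrev, AHead, ATwin, AOrd, ALogE, ALogK, ATree}"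

text \<open>The frame rule for code that leaves the tree, the links and the log alone; marks, stack
  and visited list do not belong to \<open>core\<close>.\<close>

lemma core_cong:
  assumes "core k r j od s np X TA lg" "\<And>R. R \<in> core_regs \<Longrightarrow> rg s' R = rg s R"
    "\<And>A. A \<in> core_arrs \<Longrightarrow> ar s' A = ar s A"
  shows "core k r j od s' np X TA lg"
  using assms by (simp add: core_def core_regs_def core_arrs_def)

lemma PA_AR: "r < n \<Longrightarrow> set TA \<subseteq> AR \<Longrightarrow> growth {r} (map pr (rev TA)) \<Longrightarrow> v \<in> SS r TA \<Longrightarrow>
    v \<noteq> r \<Longrightarrow> PA r TA v \<in> set TA \<and> tgt (PA r TA v) = v"
  using PA_tree by (auto simp: SS_def)

lemma wp_init_loop:
  assumes "pth r P \<pi>" "set \<pi> \<subseteq> {..<n}" "\<forall>v\<in>set \<pi>. v \<noteq> r \<longrightarrow> P v \<in> AR" "n + 2 * m \<le> N"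
    "rg s RU = hd \<pi>" "rg s RRoot = r" "ar s APar = P" "ar s APrev = pv" "ar s AHead = tgt"
    "ar s ATwin = tw" "rg s RSp = length qs" "arrl (ar s AStk) qs" "length qs + length \<pi> \<le> n"
  shows "wp N init_loop (\<lambda>s'. rg s' RU = r \<and> (\<forall>R. R \<notin> {RU, RSp, RT1} \<longrightarrow> rg s' R = rg s R) \<and>
    (\<forall>A. A \<noteq> AStk \<longrightarrow> ar s' A = ar s A) \<and> ip s' = ip s \<and> op s' = op s \<and>
    arrl (ar s' AStk) (qs @ map pv (butlast \<pi>)) \<and> rg s' RSp = length qs + length \<pi> - 1 \<and>
    tm s' \<le> tm s + 7 * length \<pi>) s"
  using assms
proof (induction r P \<pi> arbitrary: s qs rule: pth.induct)
  case (2 r P v)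
  then show ?case unfolding init_loop_def by (subst wp_While) simp
next
  case (3 r P v u \<pi>)
  let ?s = "s\<lparr>rg := (rg s)(RU := u, RSp := Suc (length qs), RT1 := tw (P v)),
    ar := (ar s)(AStk := (ar s AStk)(length qs := pv v)), tm := tm s + 7\<rparr>"
  have v: "v \<noteq> r" "P v \<in> AR" "src (P v) = u" "pth r P (u # \<pi>)" using 3(2,4) by auto
  note A = ARD[OF v(2)]
  have IH: "wp N init_loop (\<lambda>s'. rg s' RU = r \<and> (\<forall>R. R \<notin> {RU, RSp, RT1} \<longrightarrow> rg s' R = rg ?s R) \<and>
    (\<forall>A. A \<noteq> AStk \<longrightarrow> ar s' A = ar ?s A) \<and> ip s' = ip ?s \<and> op s' = op ?s \<and>
    arrl (ar s' AStk) ((qs @ [pv v]) @ map pv (butlast (u # \<pi>))) \<and>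
    rg s' RSp = length (qs @ [pv v]) + length (u # \<pi>) - 1 \<and>
    tm s' \<le> tm ?s + 7 * length (u # \<pi>)) ?s"
    by (rule "3.IH") (use v 3 in simp_all)
  have upd: "(rg s)(RT1 := a, RSp := b, RT1 := c, RT1 := d, RU := e) =
    (rg s)(RU := e, RSp := b, RT1 := d)" for a b c d e
    by auto
  have body: "wp N (B (Get RT1 APrev RU) ;; B (Put AStk RSp RT1) ;; B (Inc RSp) ;;
     B (Get RT1 APar RU) ;; B (Get RT1 ATwin RT1) ;; B (Get RU AHead RT1)) Q (tick s) \<longleftrightarrow> Q ?s" for Q
  proof -
    have b: "v < N" "length qs < N" "P v < N" "tw (P v) < N" using 3(3,5,14) A(2) ARD(2)[OF A(6)] by auto
    show ?thesis using 3(6-13) v(3) b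
      by (simp add: src_def) (intro arg_cong[of _ _ Q] st.equality; auto)
  qed
  have "holds (Neq RU RRoot) s" using 3 v by simp
  then show ?case
    unfolding init_loop_def
    apply (subst wp_While)
    apply (simp only: if_True body)
    apply (rule wp_mono[OF IH[unfolded init_loop_def]])
    apply auto
    done
qed simp

lemma path_bounds:
  assumes "good k r X TA \<pi>"
  shows "set \<pi> \<subseteq> {..<n}" "\<forall>v\<in>set \<pi>. v \<noteq> r \<longrightarrow> PA r TA v \<in> AR" "length \<pi> \<le> Suc (length TA)" "\<pi> \<noteq> []"
    "last \<pi> = r"
proof -
  note g = goodD[OF assms]
  show 1: "set \<pi> \<subseteq> {..<n}" using g(7) SS_less[OF g(1,3,4)] by blast
  show "\<forall>v\<in>set \<pi>. v \<noteq> r \<longrightarrow> PA r TA v \<in> AR"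
    using PA_AR[OF g(1,3,4)] g(3,7) by blast
  have "card (set \<pi>) \<le> card (SS r TA)"
    using g(7) by (intro card_mono) (auto simp: SS_def)
  then show "length \<pi> \<le> Suc (length TA)"
    using distinct_card[OF g(6)] card_SS[OF g(1,3,4)] by simp
  show "\<pi> \<noteq> []" using g(5) by auto
  have "pth r P \<pi> \<Longrightarrow> last \<pi> = r" for P by (induction r P \<pi> rule: pth.induct) auto
  then show "last \<pi> = r" using g(5) by blast
qed

lemma wp_search_init:
  assumes c: "core k r j od s np X TA lg" and g: "good k r X TA \<pi>" and k: "Suc (length TA) \<le> n"
    and s: "ar s APar = PA r TA" "rg s RCur = hd \<pi>" "n + 2 * m \<le> N"
  shows "wp N search_init (\<lambda>s'. (\<forall>R. R \<notin> {RU, RSp, RT1, RCnt, RVp} \<longrightarrow> rg s' R = rg s R) \<and>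
    (\<forall>A. A \<noteq> AStk \<longrightarrow> ar s' A = ar s A) \<and> ip s' = ip s \<and> op s' = op s \<and>
    rg s' RCnt = Suc (length TA) \<and> rg s' RVp = 0 \<and> rg s' RSp = length \<pi> \<and>
    arrl (ar s' AStk) (map (snd np) \<pi>) \<and> tm s' \<le> tm s + 7 * length \<pi> + 7) s" (is "wp N _ ?Q s")
proof -
  note pb = path_bounds[OF g] and cd = coreD[OF c] and gd = goodD[OF g]
  let ?s = "s\<lparr>rg := (rg s)(RCnt := Suc (length TA), RVp := 0, RSp := 0, RU := hd \<pi>), tm := tm s + 4\<rparr>"
  have 1: "wp N init_loop (\<lambda>s'. rg s' RU = r \<and> (\<forall>R. R \<notin> {RU, RSp, RT1} \<longrightarrow> rg s' R = rg ?s R) \<and>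
    (\<forall>A. A \<noteq> AStk \<longrightarrow> ar s' A = ar ?s A) \<and> ip s' = ip ?s \<and> op s' = op ?s \<and>
    arrl (ar s' AStk) ([] @ map (snd np) (butlast \<pi>)) \<and> rg s' RSp = length ([] :: nat list) + length \<pi> - 1 \<and>
    tm s' \<le> tm ?s + 7 * length \<pi>) ?s"
    by (rule wp_init_loop[OF gd(5) pb(1,2) s(3)]) (use s cd k pb(3) in simp_all)
  obtain \<rho> where \<pi>: "\<pi> = \<rho> @ [r]" using pb(4,5) by (metis append_butlast_last_id)
  have "Suc (length \<rho>) \<le> n" using pb(3) k \<pi> by simp
  then have 2: "wp N (B (Get RT1 APrev RU) ;; B (Put AStk RSp RT1) ;; B (Inc RSp)) ?Q s'"
    if "rg s' RU = r \<and> (\<forall>R. R \<notin> {RU, RSp, RT1} \<longrightarrow> rg s' R = rg ?s R) \<and>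
    (\<forall>A. A \<noteq> AStk \<longrightarrow> ar s' A = ar ?s A) \<and> ip s' = ip ?s \<and> op s' = op ?s \<and>
    arrl (ar s' AStk) ([] @ map (snd np) (butlast \<pi>)) \<and> rg s' RSp = length ([] :: nat list) + length \<pi> - 1 \<and>
    tm s' \<le> tm ?s + 7 * length \<pi>" for s'
    using that cd s(3) gd(1) \<pi> by auto
  have eq: "wp N search_init Q s \<longleftrightarrow>
    wp N init_loop (wp N (B (Get RT1 APrev RU) ;; B (Put AStk RSp RT1) ;; B (Inc RSp)) Q) ?s" for Q
    unfolding search_init_def using cd s(2) by (simp add: eval_nat_numeral)
  show ?thesis unfolding eq by (rule wp_mono[OF 1 2])
qed

text \<open>\<open>sc\<close> is the list of the arcs scanned so far, and \<open>qs\<close> that of the discovering arcs.\<close>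

definition search_inv ::
  "nat \<Rightarrow> nat set \<Rightarrow> nat list \<Rightarrow> (nat \<Rightarrow> nat) \<Rightarrow> nat list \<Rightarrow> nat list \<Rightarrow> nat list \<Rightarrow> bool" where
  "search_inv r X TA P qs sc w \<longleftrightarrow> growth (SS r TA) (map pr qs) \<and> set qs \<subseteq> X \<and>
     (\<forall>q\<in>set qs. P (tgt q) = q) \<and> (\<forall>v. v \<notin> tgt ` set qs \<longrightarrow> P v = PA r TA v) \<and>
     vs P = SS r TA \<union> tgt ` set qs \<and> distinct (sc @ w) \<and> set (sc @ w) = {a \<in> X. src a \<in> vs P} \<and>
     (\<forall>a\<in>set sc. tgt a \<in> vs P)"

lemma search_inv_skip:
  assumes "search_inv r X TA P qs sc (a # w)" "twcl X" "P (tgt a) \<noteq> 0"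
  shows "search_inv r X TA P qs (sc @ [a]) w"
proof -
  have "a \<in> X" using assms(1) unfolding search_inv_def by auto
  then have "tgt a \<in> vs P" using assms(3) ARD(4)[OF twclD(1)[OF assms(2)]] by (simp add: vs_def)
  moreover have "(sc @ [a]) @ w = sc @ a # w" by simp
  moreover have "set (sc @ [a]) = insert a (set sc)" by simp
  ultimately show ?thesis using assms(1) unfolding search_inv_def by (metis insertE)
qed

lemma search_inv_discover:
  assumes i: "search_inv r X TA P qs sc (a # w)" and X: "twcl X" and z: "P (tgt a) = 0"
  shows "search_inv r X TA (P(tgt a := a)) (qs @ [a]) (sc @ [a]) (rev (LX X (tgt a)) @ w)"
proof -
  note d = i[unfolded search_inv_def]
  have "a \<in> {a \<in> X. src a \<in> vs P}" using d by (metis in_set_conv_decomp)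
  then have a: "a \<in> X" "src a \<in> vs P" "a \<in> AR" using twclD(1)[OF X] by auto
  note A = ARD[OF a(3)]
  have vs: "vs (P(tgt a := a)) = insert (tgt a) (vs P)" using A by (simp add: vs_upd)
  have new: "tgt a \<notin> vs P" using z by (simp add: vs_def)
  have g: "growth (SS r TA) (map pr (qs @ [a]))"
  proof -
    have "SS r TA \<union> heads (map pr qs) = vs P" using d unfolding heads_pr by simp
    moreover have "pr a = (src a, tgt a)" by (simp add: pr_def)
    ultimately show ?thesis using d a new by (simp add: growth_append)
  qed
  have L: "set (LX X (tgt a)) = {b \<in> X. src b = tgt a}" by (rule set_LX[OF X A(4)])
  have dist: "distinct ((sc @ [a]) @ rev (LX X (tgt a)) @ w)"
  proof -
    have "b \<notin> set (sc @ a # w)" if "b \<in> set (LX X (tgt a))" for b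
      using that L d new by (metis (mono_tags, lifting) mem_Collect_eq)
    then have "set (LX X (tgt a)) \<inter> set (sc @ a # w) = {}" by blast
    then show ?thesis using d distinct_LX[OF A(4), of X] by auto
  qed
  have st: "set ((sc @ [a]) @ rev (LX X (tgt a)) @ w) = {b \<in> X. src b \<in> vs (P(tgt a := a))}"
  proof -
    have "set ((sc @ [a]) @ rev (LX X (tgt a)) @ w) = set (sc @ a # w) \<union> {b \<in> X. src b = tgt a}"
      using L by auto
    also have "\<dots> = {b \<in> X. src b \<in> vs (P(tgt a := a))}" using d vs by auto
    finally show ?thesis .
  qed
  have tq: "tgt q \<noteq> tgt a" if "q \<in> set qs" for q using that d new by (metis UnI2 imageI)
  show ?thesis
    unfolding search_inv_def
  proof (intro conjI)
    show "set (qs @ [a]) \<subseteq> X" using d a(1) by simp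
    show "\<forall>q\<in>set (qs @ [a]). (P(tgt a := a)) (tgt q) = q" using d tq by simp
    show "\<forall>v. v \<notin> tgt ` set (qs @ [a]) \<longrightarrow> (P(tgt a := a)) v = PA r TA v" using d by simp
    show "vs (P(tgt a := a)) = SS r TA \<union> tgt ` set (qs @ [a])" using d vs by simp
    show "\<forall>b\<in>set (sc @ [a]). tgt b \<in> vs (P(tgt a := a))" using d vs by auto
  qed (fact g dist st)+
qed

lemma search_inv_start:
  assumes "good k r X TA \<pi>"
  shows "search_inv r X TA (PA r TA) [] [] (Z X \<pi>)"
proof -
  note g = goodD[OF assms]
  have n: "set \<pi> \<subseteq> {..<n}" by (rule path_bounds[OF assms])
  have "distinct (Z X \<pi>)"
  proof -
    have "distinct \<rho> \<Longrightarrow> set \<rho> \<subseteq> {..<n} \<Longrightarrow> distinct (Z X \<rho>) \<and> set (Z X \<rho>) = {a \<in> X. src a \<in> set \<rho>}" for \<rho>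
    proof (induction \<rho>)
      case (Cons v \<rho>)
      then show ?case using set_LX[OF g(2), of v] distinct_LX[of v X] by (auto simp: Z_Cons)
    qed (simp add: Z_def)
    then show ?thesis using g(6) n by blast
  qed
  then show ?thesis
    using set_Z[OF assms] vs_PA[OF g(1,3,4)] by (simp add: search_inv_def)
qed

text \<open>A scanned arc has both ends visited and is scanned only once; this ties the running time
  of the search to \<open>inside\<close>.\<close>

lemma search_inv_inside:
  assumes "search_inv r X TA P qs sc w" "twcl X"
  shows "length sc \<le> card (inside X (vs P))"
proof -
  have "set sc \<subseteq> inside X (vs P)" "distinct sc"
    using assms(1) unfolding search_inv_def inside_def by auto
  then show ?thesis
    using card_mono[of "inside X (vs P)" "set sc"] twclD(3)[OF assms(2)]
    by (simp add: distinct_card inside_def)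
qed

lemma search_inv_card:
  assumes "search_inv r X TA P qs sc w" "r < n" "set TA \<subseteq> AR" "growth {r} (map pr (rev TA))"
  shows "card (vs P) = Suc (length TA) + length qs"
proof -
  have "SS r TA \<union> heads (map pr qs) = vs P" "growth (SS r TA) (map pr qs)"
    using assms(1) unfolding search_inv_def heads_pr by auto
  then show ?thesis
    using growth_card[of "SS r TA" "map pr qs"] card_SS[OF assms(2-4)] by (simp add: SS_def)
qed

text \<open>The stack is described by the lists \<open>ws\<close> it stands for, and the invariant
  says that the abstract search on \<open>concat ws\<close> with the present marks still ends in
  \<open>P\<close>. In the time bound, popping an exhausted list is paid when the list is pushed, so
  18 ticks are due for each scanned arc, each vertex of the initial path and each discovered
  vertex.\<close>

lemma wp_search_loop:
  assumes c: "core k r j od s0 np X TA lg" and g: "good k r X TA \<pi>" and N: "n + 2 * m \<le> N"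
    and k: "Suc (length TA) \<le> k" "k \<le> n"
    and s0: "ar s0 APar = PA r TA" "rg s0 RCnt = Suc (length TA)" "rg s0 RVp = 0"
      "rg s0 RSp = length \<pi>" "arrl (ar s0 AStk) (map (snd np) \<pi>)"
    and P: "P = dfs k X (Z X \<pi>) (PA r TA)" and full: "card (vs P) = k"
  shows "wp N search_loop (\<lambda>s. (\<forall>R. R \<notin> {RCnt, RVp, RSp, RA, RT1, RT2, RT3} \<longrightarrow> rg s R = rg s0 R) \<and>
    (\<forall>A. A \<notin> {AStk, APar, AVis} \<longrightarrow> ar s A = ar s0 A) \<and> ip s = ip s0 \<and> op s = op s0 \<and>
    ar s APar = P \<and>
    (\<exists>qs. growth (SS r TA) (map pr qs) \<and> set qs \<subseteq> X \<and> (\<forall>v. v \<notin> tgt ` set qs \<longrightarrow> P v = PA r TA v) \<and>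
      Suc (length TA) + length qs = k \<and> vs P = SS r TA \<union> tgt ` set qs \<and>
      rg s RVp = length qs \<and> arrl (ar s AVis) (map tgt qs)) \<and>
    tm s \<le> tm s0 + 18 * (card (inside X (vs P)) + 2 * k) + 1) s0"
proof -
  note cd = coreD[OF c] and gd = goodD[OF g]
  let ?S = "SS r TA"
  define J where "J s ps ws qs sc \<longleftrightarrow> list_all2 (sg (snd np)) ps ws \<and> rg s RSp = length ps \<and>
      arrl (ar s AStk) (rev ps) \<and> rg s RCnt = card (vs (ar s APar)) \<and> rg s RVp = length qs \<and>
      arrl (ar s AVis) (map tgt qs) \<and> dfs k X (concat ws) (ar s APar) = P \<and>
      search_inv r X TA (ar s APar) qs sc (concat ws) \<and> length ps \<le> rg s RCnt \<and> rg s RCnt \<le> k \<and>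
      tm s + 18 * length ps \<le> tm s0 + 18 * (length sc + length \<pi> + length qs)" for s :: st and ps ws qs sc
  define I where "I s \<longleftrightarrow> (\<forall>R. R \<notin> {RCnt, RVp, RSp, RA, RT1, RT2, RT3} \<longrightarrow> rg s R = rg s0 R) \<and>
    (\<forall>A. A \<notin> {AStk, APar, AVis} \<longrightarrow> ar s A = ar s0 A) \<and> ip s = ip s0 \<and> op s = op s0 \<and>
    (\<exists>ps ws qs sc. J s ps ws qs sc)" for s :: st
  have len: "length sc \<le> card (inside X (vs P)) \<and> card (vs Q) = Suc (length TA) + length qs"
    if i: "search_inv r X TA Q qs sc w" and d: "dfs k X w Q = P" for Q qs sc w
  proof -
    have "inside X (vs Q) \<subseteq> inside X (vs P)" using vs_dfs[of Q k X w] d by (auto simp: inside_def)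
    then have "card (inside X (vs Q)) \<le> card (inside X (vs P))"
      using twclD(3)[OF gd(2)] by (intro card_mono) (auto simp: inside_def)
    then show ?thesis using search_inv_inside[OF i gd(2)] search_inv_card[OF i gd(1,3,4)] by simp
  qed
  define M where "M = tm s0 + 18 * (card (inside X (vs P)) + 2 * k) + 1"
  have pi: "length \<pi> \<le> Suc (length TA)" by (rule path_bounds[OF g])
  have bound: "tm s < M" if Is: "I s" for s
  proof -
    obtain ps ws qs sc where "J s ps ws qs sc" using Is unfolding I_def by blast
    note * = this[unfolded J_def]
    have "search_inv r X TA (ar s APar) qs sc (concat ws)" "dfs k X (concat ws) (ar s APar) = P"
      using * by simp_all
    from len[OF this] * pi k show ?thesis by (auto simp: M_def)
  qed
  show ?thesis
    unfolding search_loop_def M_def[symmetric]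
  proof (rule wp_while_inv[where I = I and f = "\<lambda>s. M - tm s"])
    have "concat (map (\<lambda>v. rev (LX X v)) (rev \<pi>)) = Z X \<pi>" by (simp add: Z_def)
    moreover have "list_all2 (sg (snd np)) (map (snd np) (rev \<pi>)) (map (\<lambda>v. rev (LX X v)) (rev \<pi>))"
      using links_sg[OF cd(16)] path_bounds(1)[OF g]
      by (auto simp: list_all2_map1 list_all2_map2 list_all2_same)
    ultimately have "J s0 (map (snd np) (rev \<pi>)) (map (\<lambda>v. rev (LX X v)) (rev \<pi>)) [] []"
      unfolding J_def
      using s0 P pi k search_inv_start[OF g] vs_PA[OF gd(1,3,4)] card_SS[OF gd(1,3,4)]
      by (simp add: rev_map)
    then show "I s0" unfolding I_def by blast
  next
    fix s assume I: "I s" and stop: "\<not> holds (Lt RCnt RK) s"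
    obtain ps ws qs sc where J: "J s ps ws qs sc" using I unfolding I_def by blast
    have *: "search_inv r X TA (ar s APar) qs sc (concat ws)"
      "dfs k X (concat ws) (ar s APar) = P" "rg s RCnt = card (vs (ar s APar))" "rg s RCnt \<le> k"
      "rg s RVp = length qs" "arrl (ar s AVis) (map tgt qs)"
      using J unfolding J_def by simp_all
    have "rg s RK = k" using I cd(3) unfolding I_def by simp
    then have "k \<le> card (vs (ar s APar))" using stop *(3) by simp
    then have eq: "ar s APar = P" using dfs_stop *(2) by metis
    show "(\<forall>R. R \<notin> {RCnt, RVp, RSp, RA, RT1, RT2, RT3} \<longrightarrow> rg (tick s) R = rg s0 R) \<and>
    (\<forall>A. A \<notin> {AStk, APar, AVis} \<longrightarrow> ar (tick s) A = ar s0 A) \<and> ip (tick s) = ip s0 \<and> op (tick s) = op s0 \<and>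
    ar (tick s) APar = P \<and>
    (\<exists>qs. growth (SS r TA) (map pr qs) \<and> set qs \<subseteq> X \<and> (\<forall>v. v \<notin> tgt ` set qs \<longrightarrow> P v = PA r TA v) \<and>
      Suc (length TA) + length qs = k \<and> vs P = SS r TA \<union> tgt ` set qs \<and>
      rg (tick s) RVp = length qs \<and> arrl (ar (tick s) AVis) (map tgt qs)) \<and>
    tm (tick s) \<le> M"
      using I eq * bound[OF I] len[OF *(1,2)] full unfolding I_def search_inv_def
      by (auto intro!: exI[of _ qs])
  next
    fix s assume I: "I s" and go: "holds (Lt RCnt RK) s"
    obtain ps ws qs sc where J: "J s ps ws qs sc" using I unfolding I_def by blast
    have *: "list_all2 (sg (snd np)) ps ws" "rg s RSp = length ps"
      "arrl (ar s AStk) (rev ps)" "rg s RCnt = card (vs (ar s APar))" "rg s RVp = length qs"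
      "arrl (ar s AVis) (map tgt qs)" "dfs k X (concat ws) (ar s APar) = P"
      "search_inv r X TA (ar s APar) qs sc (concat ws)" "length ps \<le> rg s RCnt" "rg s RCnt \<le> k"
      "tm s + 18 * length ps \<le> tm s0 + 18 * (length sc + length \<pi> + length qs)"
      using J unfolding J_def by simp_all
    have fr: "\<And>R. R \<notin> {RCnt, RVp, RSp, RA, RT1, RT2, RT3} \<Longrightarrow> rg s R = rg s0 R"
      "\<And>A. A \<notin> {AStk, APar, AVis} \<Longrightarrow> ar s A = ar s0 A" "ip s = ip s0" "op s = op s0"
      using I unfolding I_def by auto
    have lt: "card (vs (ar s APar)) < k" using go fr(1)[of RK] cd(3) *(4) by simp
    \<comment> \<open>With an empty stack the search would be over with the present marks, but
      \<open>P\<close> has \<open>k\<close> vertices.\<close>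
    have "ps \<noteq> []"
    proof
      assume "ps = []"
      then have "ar s APar = P" using *(1,7) by simp
      then show False using lt full by simp
    qed
    then obtain p ps' w0 ws' where pw: "ps = p # ps'" "ws = w0 # ws'" "sg (snd np) p w0"
      "list_all2 (sg (snd np)) ps' ws'"
      using *(1) by (cases ps; cases ws) auto
    have stk: "arrl (ar s AStk) (rev ps')" "ar s AStk (length ps') = p"
      using *(3) pw(1) by (simp_all add: arrl_pop)
    have bnds: "length ps' < N" "Suc (length ps') < N" "length ps' < k"
      using pw(1) *(9) lt *(4) k N by auto
    have lenq: "card (vs (ar s APar)) = Suc (length TA) + length qs"
      using search_inv_card[OF *(8) gd(1,3,4)] .
    note bM = bound[OF I]
    have IJ: "I s'" if "J s' ps ws qs sc" "(\<forall>R. R \<notin> {RCnt, RVp, RSp, RA, RT1, RT2, RT3} \<longrightarrow> rg s' R = rg s0 R) \<and>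
      (\<forall>A. A \<notin> {AStk, APar, AVis} \<longrightarrow> ar s' A = ar s0 A) \<and> ip s' = ip s0 \<and> op s' = op s0"
      for s' ps ws qs sc using that unfolding I_def by blast
    show "wp N (B (Dec RSp) ;; B (Get RA AStk RSp) ;;
      If (Lt RA RN) Skip
       (B (Get RT1 APrev RA) ;; B (Put AStk RSp RT1) ;; B (Inc RSp) ;;
        B (Get RT2 AHead RA) ;; B (Get RT3 APar RT2) ;;
        If (Pos RT3) Skip
         (B (Put APar RT2 RA) ;; B (Put AVis RVp RT2) ;; B (Inc RVp) ;; B (Inc RCnt) ;;
          B (Get RT1 APrev RT2) ;; B (Put AStk RSp RT1) ;; B (Inc RSp))))
      (\<lambda>s'. I s' \<and> M - tm s' < M - tm s) (tick s)"
    proof (cases w0)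
      case Nil
      then have "p < n" using pw(3) by simp
      then show ?thesis
        using stk bnds *(2) pw(1) fr(1)[of RN] cd(2)
        apply simp
        apply (rule conjI)
         prefer 2
         subgoal using bM by arith
        apply (rule IJ[of _ ps' ws' qs sc])
           apply (unfold J_def)
        using * pw fr Nil apply simp_all
        done
    next
      case (Cons a w1)
      have p: "p = a" "n \<le> a" "sg (snd np) (snd np a) w1" using pw(3) Cons by auto
      have cw: "concat ws = a # w1 @ concat ws'" using Cons pw(2) by simp
      have aX: "a \<in> X" using *(8) cw unfolding search_inv_def by auto
      note A = ARD[OF twclD(1)[OF gd(2) aX]]
      have aN: "a < N" "tgt a < N" using A N by auto
      show ?thesis
      proof (cases "ar s APar (tgt a) = 0")
        case False
        have i: "search_inv r X TA (ar s APar) qs (sc @ [a]) (w1 @ concat ws')"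
          using search_inv_skip[OF *(8)[unfolded cw] gd(2) False] .
        have d: "dfs k X (w1 @ concat ws') (ar s APar) = P"
          using *(7) lt False unfolding cw by simp
        show ?thesis
          using stk bnds *(2) pw(1) fr(1)[of RN] fr(2)[of APrev] fr(2)[of AHead] cd p aN False
          apply simp
          apply (rule conjI)
           prefer 2
           subgoal using bM by arith
          apply (rule IJ[of _ "snd np a # ps'" "w1 # ws'" qs "sc @ [a]"])
           apply (unfold J_def)
          using * pw fr i d apply (simp_all)
          done
      next
        case True
        have i: "search_inv r X TA ((ar s APar)(tgt a := a)) (qs @ [a]) (sc @ [a])
          (rev (LX X (tgt a)) @ w1 @ concat ws')"
          using search_inv_discover[OF *(8)[unfolded cw] gd(2) True] .
        have d: "dfs k X (rev (LX X (tgt a)) @ w1 @ concat ws') ((ar s APar)(tgt a := a)) = P"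
          using *(7) lt True A unfolding cw by simp
        have cv: "card (vs ((ar s APar)(tgt a := a))) = Suc (card (vs (ar s APar)))"
          using True A by (simp add: vs_upd) (simp add: vs_def)
        have sgz: "sg (snd np) (snd np (tgt a)) (rev (LX X (tgt a)))"
          by (rule links_sg[OF cd(16) A(4)])
        have qN: "length qs < N" "card (vs (ar s APar)) < N" using lenq lt k N by auto
        show ?thesis
          using stk bnds *(2,4,5) pw(1) fr(1)[of RN] fr(2)[of APrev] fr(2)[of AHead] cd p aN True qN
          apply simp
          apply (rule conjI)
           prefer 2
           subgoal using bM by arith
          apply (rule IJ[of _ "snd np (tgt a) # snd np a # ps'" "rev (LX X (tgt a)) # w1 # ws'" "qs @ [a]" "sc @ [a]"])
           apply (unfold J_def)
          using * pw fr i d cv sgz lt apply (simp_all add: fun_upd_def arrl_push2)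
          done
      qed
    qed
  qed
qed

end

section \<open>Verification of the enumeration steps\<close>

context arcs
begin

lemma wp_del_arc:
  assumes "links np X" "a \<in> X" "rg s R = a" "R \<notin> {RT1, RT2}" "ar s ANext = fst np"
    "ar s APrev = snd np" "n + 2 * m \<le> N"
  shows "wp N (del_arc R) (\<lambda>s'. (\<forall>Q. Q \<notin> {RT1, RT2} \<longrightarrow> rg s' Q = rg s Q) \<and>
    (\<forall>A. A \<notin> {ANext, APrev} \<longrightarrow> ar s' A = ar s A) \<and> ar s' ANext = fst (del1 a np) \<and>
    ar s' APrev = snd (del1 a np) \<and> ip s' = ip s \<and> op s' = op s \<and> tm s' = tm s + 4) s"
proof -
  have "a < N" "fst np a < N" "snd np a < N"
    using links_bounds(3,4)[OF assms(1,2)] assms(1,2,7) ARD(2)[of a] by (auto simp: links_def)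
  then show ?thesis using assms by (auto simp: del_arc_def del1_def)
qed

lemma wp_del_edge:
  assumes "links np X" "twcl X" "a \<in> X" "rg s R = a" "R \<notin> {RT1, RT2, RT3}" "ar s ANext = fst np"
    "ar s APrev = snd np" "ar s ATwin = tw" "n + 2 * m \<le> N"
  shows "wp N (del_edge R) (\<lambda>s'. (\<forall>Q. Q \<notin> {RT1, RT2, RT3} \<longrightarrow> rg s' Q = rg s Q) \<and>
    (\<forall>A. A \<notin> {ANext, APrev} \<longrightarrow> ar s' A = ar s A) \<and> ar s' ANext = fst (del2 a np) \<and>
    ar s' APrev = snd (del2 a np) \<and> ip s' = ip s \<and> op s' = op s \<and> tm s' = tm s + 9) s"
proof -
  note 1 = links_del1(1)[OF assms(1,3)]
  have t: "tw a \<in> X - {a}" using twclD(2)[OF assms(2,3)] ARD(11)[OF twclD(1)[OF assms(2,3)]] by simp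
  have aN: "a < N" using ARD(2)[OF twclD(1)[OF assms(2,3)]] assms(9) by simp
  show ?thesis
    unfolding del_edge_def wp_Seq
  proof (rule wp_mono[OF wp_del_arc[OF assms(1,3,4)]])
    fix s1 :: st
    assume s1: "(\<forall>Q. Q \<notin> {RT1, RT2} \<longrightarrow> rg s1 Q = rg s Q) \<and>
      (\<forall>A. A \<notin> {ANext, APrev} \<longrightarrow> ar s1 A = ar s A) \<and> ar s1 ANext = fst (del1 a np) \<and>
      ar s1 APrev = snd (del1 a np) \<and> ip s1 = ip s \<and> op s1 = op s \<and> tm s1 = tm s + 4"
    let ?s = "s1\<lparr>rg := (rg s1)(RT3 := tw a), tm := Suc (tm s1)\<rparr>"
    have "wp N (B (Get RT3 ATwin R)) (wp N (del_arc RT3) Q) s1 \<longleftrightarrow> wp N (del_arc RT3) Q ?s" for Q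
      using s1 assms aN by simp
    moreover have "wp N (del_arc RT3) (\<lambda>s'. (\<forall>Q. Q \<notin> {RT1, RT2, RT3} \<longrightarrow> rg s' Q = rg s Q) \<and>
    (\<forall>A. A \<notin> {ANext, APrev} \<longrightarrow> ar s' A = ar s A) \<and> ar s' ANext = fst (del2 a np) \<and>
    ar s' APrev = snd (del2 a np) \<and> ip s' = ip s \<and> op s' = op s \<and> tm s' = tm s + 9) ?s"
      by (rule wp_mono[OF wp_del_arc[OF 1 t]]) (use s1 assms in \<open>auto simp: del2_def\<close>)
    ultimately show "wp N (B (Get RT3 ATwin R)) (wp N (del_arc RT3)
     (\<lambda>s'. (\<forall>Q. Q \<notin> {RT1, RT2, RT3} \<longrightarrow> rg s' Q = rg s Q) \<and>
    (\<forall>A. A \<notin> {ANext, APrev} \<longrightarrow> ar s' A = ar s A) \<and> ar s' ANext = fst (del2 a np) \<and>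
    ar s' APrev = snd (del2 a np) \<and> ip s' = ip s \<and> op s' = op s \<and> tm s' = tm s + 9)) s1"
      by simp
  qed (use assms in auto)
qed

lemma card_remove:
  assumes "twcl X" "e \<in> X"
  shows "card (X - {e, tw e}) + 2 = card X"
proof -
  have "{e, tw e} \<subseteq> X" "card {e, tw e} = 2"
    using assms twclD(2)[OF assms] ARD(11)[OF twclD(1)[OF assms]] by auto
  then show ?thesis
    using card_Diff_subset[of "{e, tw e}" X] card_mono[of X "{e, tw e}"] twclD(3)[OF assms(1)] by simp
qed

lemma wp_del_log:
  assumes c: "core k r j od s np X TA lg" and e: "e \<in> X" "rg s R = e"
    and R: "R \<notin> {RT1, RT2, RT3, RT4, RLp}" and N: "n + 2 * m \<le> N" and kd: "kd < 64"
  shows "wp N (del_edge R ;; push_log R kd) (\<lambda>s'.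
    core k r j od s' (del2 e np) (X - {e, tw e}) TA ((e, kd) # lg) \<and>
    (\<forall>Q. Q \<notin> {RT1, RT2, RT3, RT4, RLp} \<longrightarrow> rg s' Q = rg s Q) \<and>
    (\<forall>A. A \<notin> {ANext, APrev, ALogE, ALogK} \<longrightarrow> ar s' A = ar s A) \<and>
    ip s' = ip s \<and> op s' = op s \<and> tm s' = tm s + 13) s"
proof -
  note cd = coreD[OF c]
  \<comment> \<open>Each log entry accounts for two deleted arcs, so the log never has more than
    \<open>m\<close> entries and its index stays below \<open>N\<close>.\<close>
  have lg: "length lg < N" "card (X - {e, tw e}) + 2 * Suc (length lg) \<le> 2 * m"
    using card_remove[OF cd(17) e(1)] cd(18) N by auto
  note l = links_del2(1)[OF cd(16,17) e(1)] twcl_remove[OF cd(17) e(1)]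
  show ?thesis
    unfolding wp_Seq
    by (rule wp_mono[OF wp_del_edge[OF cd(16,17) e]])
      (use cd e R N kd lg l in \<open>simp_all add: push_log_def core_def\<close>)
qed

lemma wp_add_edge:
  assumes c: "core k r j od s np X TA lg" and e: "e \<in> X" "rg s RE = e"
    and N: "n + 2 * m \<le> N" and kd: "kd < 64" and l: "length TA + 1 < n"
  shows "wp N (add_edge kd) (\<lambda>s'.
    core k r j od s' (del2 e np) (X - {e, tw e}) (e # TA) ((e, kd) # lg) \<and> rg s' RCur = rg s RZ \<and>
    (\<forall>Q. Q \<notin> {RT1, RT2, RT3, RT4, RLp, RSz, RCur} \<longrightarrow> rg s' Q = rg s Q) \<and>
    (\<forall>A. A \<notin> {ANext, APrev, ALogE, ALogK, ATree} \<longrightarrow> ar s' A = ar s A) \<and>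
    ip s' = ip s \<and> op s' = op s \<and> tm s' = tm s + 18) s"
proof -
  have eq: "wp N (add_edge kd) Q s \<longleftrightarrow> wp N (del_edge RE ;; push_log RE kd)
    (wp N (B (Mov RT1 RSz) ;; B (Dec RT1) ;; B (Put ATree RT1 RE) ;; B (Inc RSz) ;; B (Mov RCur RZ)) Q) s"
    for Q by (simp add: add_edge_def)
  show ?thesis
    unfolding eq
    by (rule wp_mono[OF wp_del_log[OF c e _ N kd]]) (use c e N l in \<open>simp_all add: core_def\<close>)
qed

text \<open>\<open>ext r i\<close> relates a configuration to one with \<open>i\<close> more log entries, none of them of kind 2.\<close>

inductive ext :: "nat \<Rightarrow> nat \<Rightarrow> links \<times> nat set \<times> nat list \<times> (nat \<times> nat) list \<Rightarrow>
    links \<times> nat set \<times> nat list \<times> (nat \<times> nat) list \<Rightarrow> bool" for r where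
  ext_0: "ext r 0 c c"
| ext_Suc: "ext r i c (np, X, TA, lg) \<Longrightarrow> links np X \<Longrightarrow> twcl X \<Longrightarrow> e \<in> X \<Longrightarrow>
    kd = 0 \<and> TA' = TA \<or> kd = 1 \<and> TA' = e # TA \<and> PA r TA (tgt e) = 0 \<Longrightarrow>
    ext r (Suc i) c (del2 e np, X - {e, tw e}, TA', (e, kd) # lg)"

lemma core_tick: "core k r j od (tick s) np X TA lg \<longleftrightarrow> core k r j od s np X TA lg"
  by (simp add: core_def)

text \<open>By \<open>forced\<close>, adding a forced edge does not change the outcome
  \<open>P\<close>, so the marks of one search stay valid during the whole run. An iteration either
  shortens the path or adds a forced edge, which lengthens the path by one; hence the bound in
  \<open>length \<pi> + 2 * i\<close>. A forced edge takes only two arcs away from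
  \<open>inside\<close>, so the search can still be charged to the branching at the end of the
  run.\<close>

lemma wp_forward_loop:
  assumes c: "core k r j od s0 np X TA lg" and g: "good k r X TA \<pi>" and N: "n + 2 * m \<le> N"
    and k: "length TA + 1 < k" "k \<le> n"
    and s0: "ar s0 APar = P" "rg s0 RCur = hd \<pi>" "rg s0 RX = 1"
    and P: "P = dfs k X (Z X \<pi>) (PA r TA)" and full: "card (vs P) = k"
  shows "wp N forward_loop (\<lambda>s. (\<forall>R. R \<notin> {RT1, RT2, RT3, RT4, RLp, RSz, RCur, RE, RZ, RX} \<longrightarrow> rg s R = rg s0 R) \<and>
    (\<forall>A. A \<notin> {ANext, APrev, ALogE, ALogK, ATree} \<longrightarrow> ar s A = ar s0 A) \<and> ip s = ip s0 \<and> op s = op s0 \<and>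
    (\<exists>i np' X' TA' \<pi>' lg'. core k r j od s np' X' TA' lg' \<and> ext r i (np, X, TA, lg) (np', X', TA', lg') \<and>
      good k r X' TA' \<pi>' \<and> rg s RCur = hd \<pi>' \<and> sol k r X TA = sol k r X' TA' \<and>
      length TA' = length TA + i \<and> SS r TA \<subseteq> SS r TA' \<and> length TA' + 1 \<le> k \<and>
      card (inside X (vs P)) \<le> card (inside X' (vs P)) + 2 * i \<and>
      tm s \<le> tm s0 + 30 * (length \<pi> + 2 * i) + 1 \<and>
      (length TA' + 1 < k \<longrightarrow> P = dfs k X' (Z X' \<pi>') (PA r TA') \<and>
        (\<exists>x \<rho> e l. \<pi>' = x # \<rho> \<and> LX X' x = e # l \<and> P (tgt e) \<noteq> e \<and> rg s RE = e \<and> rg s RZ = tgt e)))) s0" (is "wp N _ ?Q s0")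
proof -
  define J where "J s i np' X' TA' \<pi>' lg' \<longleftrightarrow> core k r j od s np' X' TA' lg' \<and>
      ext r i (np, X, TA, lg) (np', X', TA', lg') \<and>
      good k r X' TA' \<pi>' \<and> rg s RCur = hd \<pi>' \<and> sol k r X TA = sol k r X' TA' \<and>
      length TA' = length TA + i \<and> SS r TA \<subseteq> SS r TA' \<and> length TA' + 1 \<le> k \<and>
      card (inside X (vs P)) \<le> card (inside X' (vs P)) + 2 * i \<and>
      dfs k X' (Z X' \<pi>') (PA r TA') = P" for s :: st and i np' X' TA' \<pi>' lg'
  define F where "F s \<longleftrightarrow> (\<forall>R. R \<notin> {RT1, RT2, RT3, RT4, RLp, RSz, RCur, RE, RZ, RX} \<longrightarrow> rg s R = rg s0 R) \<and>
    (\<forall>A. A \<notin> {ANext, APrev, ALogE, ALogK, ATree} \<longrightarrow> ar s A = ar s0 A) \<and> ip s = ip s0 \<and> op s = op s0"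
    for s :: st
  define D where "D s k X' TA' \<pi>' \<longleftrightarrow> (length TA' + 1 < k \<longrightarrow>
        (\<exists>x \<rho> e l. \<pi>' = x # \<rho> \<and> LX X' x = e # l \<and> P (tgt e) \<noteq> e \<and> rg s RE = e \<and> rg s RZ = tgt e))"
    for s :: st and k X' and TA' :: "nat list" and \<pi>'
  define I where "I s \<longleftrightarrow> F s \<and> (\<exists>i np' X' TA' \<pi>' lg'. J s i np' X' TA' \<pi>' lg' \<and>
     (rg s RX = 1 \<and> tm s + 30 * length \<pi>' \<le> tm s0 + 30 * (length \<pi> + 2 * i) \<or>
      rg s RX = 0 \<and> tm s \<le> tm s0 + 30 * (length \<pi> + 2 * i) \<and> D s k X' TA' \<pi>'))" for s :: st
  define M where "M = tm s0 + 30 * (length \<pi> + 2 * k) + 1"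
  have bound: "tm s < M" if "I s" for s
  proof -
    obtain i np' X' TA' \<pi>' lg' where a: "J s i np' X' TA' \<pi>' lg'"
      "tm s \<le> tm s0 + 30 * (length \<pi> + 2 * i)"
      using \<open>I s\<close> unfolding I_def by fastforce
    have "length TA' = length TA + i" "length TA' + 1 \<le> k" using a(1) unfolding J_def by blast+
    then show ?thesis using a(2) by (simp add: M_def)
  qed
  have "wp N forward_loop (\<lambda>s. F s \<and> (\<exists>i np' X' TA' \<pi>' lg'. J s i np' X' TA' \<pi>' lg' \<and>
     tm s \<le> tm s0 + 30 * (length \<pi> + 2 * i) + 1 \<and> D s k X' TA' \<pi>')) s0"
    unfolding forward_loop_def
  proof (rule wp_while_inv[where I = I and f = "\<lambda>s. M - tm s"])
    have "J s0 0 np X TA \<pi> lg" unfolding J_def using c g k s0 P by (simp add: ext_0)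
    moreover have "F s0" by (simp add: F_def)
    ultimately show "I s0" unfolding I_def using s0 by fastforce
  next
    fix s assume I: "I s" "\<not> holds (Pos RX) s"
    then obtain i np' X' TA' \<pi>' lg' where *: "J s i np' X' TA' \<pi>' lg'" "F s"
      "tm s \<le> tm s0 + 30 * (length \<pi> + 2 * i)" "D s k X' TA' \<pi>'"
      unfolding I_def by fastforce
    have "J (tick s) i np' X' TA' \<pi>' lg'" using *(1) unfolding J_def core_tick tick_sel .
    moreover have "F (tick s)" using *(2) unfolding F_def tick_sel .
    moreover have "D (tick s) k X' TA' \<pi>'" using *(4) unfolding D_def tick_sel .
    ultimately show "F (tick s) \<and> (\<exists>i np' X' TA' \<pi>' lg'. J (tick s) i np' X' TA' \<pi>' lg' \<and>
     tm (tick s) \<le> tm s0 + 30 * (length \<pi> + 2 * i) + 1 \<and> D (tick s) k X' TA' \<pi>')"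
      using *(3) by fastforce
  next
    fix s assume I: "I s" and go: "holds (Pos RX) s"
    obtain i np' X' TA' \<pi>' lg' where Js: "J s i np' X' TA' \<pi>' lg'" and Fs: "F s"
      and RX: "rg s RX = 1" and t: "tm s + 30 * length \<pi>' \<le> tm s0 + 30 * (length \<pi> + 2 * i)"
      using I go unfolding I_def by fastforce
    have *: "core k r j od s np' X' TA' lg'"
      "ext r i (np, X, TA, lg) (np', X', TA', lg')"
      "good k r X' TA' \<pi>'" "rg s RCur = hd \<pi>'" "sol k r X TA = sol k r X' TA'"
      "length TA' = length TA + i" "SS r TA \<subseteq> SS r TA'" "length TA' + 1 \<le> k"
      "card (inside X (vs P)) \<le> card (inside X' (vs P)) + 2 * i"
      "dfs k X' (Z X' \<pi>') (PA r TA') = P" using Js unfolding J_def by - (elim conjE, assumption)+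
    note cd = coreD[OF *(1)] and gd = goodD[OF *(3)]
    note bM = bound[OF I]
    have IJ: "I s'" if "J s' i np' X' TA' \<pi>' lg'" "F s'"
      "(rg s' RX = 1 \<and> tm s' + 30 * length \<pi>' \<le> tm s0 + 30 * (length \<pi> + 2 * i) \<or>
      rg s' RX = 0 \<and> tm s' \<le> tm s0 + 30 * (length \<pi> + 2 * i) \<and> D s' k X' TA' \<pi>')"
      for s' i np' X' TA' \<pi>' lg'
      using that unfolding I_def by blast
    obtain x \<rho> where \<pi>': "\<pi>' = x # \<rho>" using path_bounds(4)[OF *(3)] by (cases \<pi>') auto
    have xS: "x \<in> SS r TA'" "x < n" using gd(7) \<pi>' SS_less[OF gd(1,3,4)] by auto
    have ParS: "ar s APar = P" using Fs s0(1) unfolding F_def by simp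
    show "wp N forward_body (\<lambda>s'. I s' \<and> M - tm s' < M - tm s) (tick s)"
    proof (cases "length TA' + 1 < k")
      case False
      show ?thesis
        using False cd(3,6)
        apply (simp add: forward_body_def)
        apply (rule conjI[OF IJ[of _ i np' X' TA' \<pi>' lg']])
        subgoal using Js by (simp add: J_def core_def)
        subgoal using Fs by (simp add: F_def)
        subgoal using t \<pi>' False by (simp add: D_def)
        subgoal using bM by arith
        done
    next
      case lt: True
      show ?thesis
      proof (cases "LX X' x")
        case Nil
        \<comment> \<open>At the root with an empty list the search would have had no arcs to scan,
          but it has found \<open>k\<close> vertices while the tree has fewer.\<close>
        have "\<rho> \<noteq> []"
        proof
          assume "\<rho> = []"
          then have "Z X' \<pi>' = []" using \<pi>' Nil by (simp add: Z_def)
          then have "P = PA r TA'" using *(10) by simp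
          then show False
            using full lt vs_PA[OF gd(1,3,4)] card_SS[OF gd(1,3,4)] by simp
        qed
        then obtain y \<tau> where \<rho>: "\<rho> = y # \<tau>" by (cases \<rho>) auto
        have fx: "fst np' x = x" using links_first[OF cd(16) xS(2)] Nil by simp
        have xr: "x \<noteq> r" "src (PA r TA' x) = y" using gd(5) \<pi>' \<rho> by auto
        have PAx: "PA r TA' x \<in> AR" using PA_AR[OF gd(1,3,4) xS(1) xr(1)] gd(3) by auto
        then have Px: "P x = PA r TA' x"
          using *(10) dfs_keeps[of "PA r TA'" x k X' "Z X' \<pi>'"] ARD(12) by simp
        have b: "P x < N" "tw (P x) < N" "x < N" "tgt (tw (P x)) = y"
          using Px ARD(2)[OF PAx] ARD(2)[OF ARD(6)[OF PAx]] xS N xr(2) by (auto simp: src_def)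
        have g': "good k r X' TA' (y # \<tau>)" using good_tl *(3) \<pi>' \<rho> Nil by metis
        have "Z X' (y # \<tau>) = Z X' \<pi>'" using \<pi>' \<rho> Nil by (simp add: Z_Cons)
        then have P': "dfs k X' (Z X' (y # \<tau>)) (PA r TA') = P" using *(10) by simp
        show ?thesis
          using lt cd(2,3,6,8,10,11) b fx xS(2) ParS *(4) \<pi>'
          apply (simp add: forward_body_def)
          apply (rule conjI[OF IJ[of _ i np' X' TA' "y # \<tau>" lg']])
          subgoal using * g' P' by (simp add: J_def core_def)
          subgoal using Fs by (simp add: F_def)
          subgoal using t \<pi>' \<rho> RX by simp
          subgoal using bM by arith
          done
      next
        case (Cons e l)
        note lx = LX_remove[OF gd(2) Cons xS(2)]
        have eA: "e \<in> AR" using twclD(1)[OF gd(2) lx(2)] .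
        note A = ARD[OF eA]
        have fx: "fst np' x = e" using links_first[OF cd(16) xS(2)] Cons by simp
        have b: "e < N" "tgt e < N" "x < N" "\<not> e < n" using A N xS by auto
        show ?thesis
        proof (cases "P (tgt e) = e")
          case False
          show ?thesis
            using lt cd(2,3,6,8,10,11) b fx xS(2) ParS *(4) \<pi>' False
            apply (simp add: forward_body_def)
            apply (rule conjI[OF IJ[of _ i np' X' TA' \<pi>' lg']])
            subgoal using Js by (simp add: J_def core_def)
            subgoal using Fs by (simp add: F_def)
            subgoal using t \<pi>' False Cons by (simp add: D_def)
            subgoal using bM by arith
            done
        next
          case True
          let ?Y = "X' - {e, tw e}"
          note f = forced[OF *(3)[unfolded \<pi>'] lt *(10)[symmetric, unfolded \<pi>'] Cons True]
          have solY: "sol k r X' TA' = sol k r ?Y (e # TA')"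
            using sol_split(1)[OF *(3) lt lx(2)] f(1) lx(3) xS(1) by simp
          have new: "tgt e \<notin> SS r TA'" using gd(9)[OF lx(2) lt] lx(3) xS(1) by simp
          have ext': "ext r (Suc i) (np, X, TA, lg) (del2 e np', ?Y, e # TA', (e, 1) # lg')"
            by (rule ext_Suc[OF *(2) cd(16,17) lx(2)]) (use PA_outside[OF new] in simp)
          have ins: "card (inside X (vs P)) \<le> card (inside ?Y (vs P)) + 2 * Suc i"
          proof -
            have "inside X' (vs P) \<subseteq> inside ?Y (vs P) \<union> {e, tw e}" by (auto simp: inside_def)
            then have "card (inside X' (vs P)) \<le> card (inside ?Y (vs P) \<union> {e, tw e})"
              using twclD(3)[OF gd(2)] by (intro card_mono) (auto simp: inside_def)
            also have "\<dots> \<le> card (inside ?Y (vs P)) + card {e, tw e}" by (rule card_Un_le)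
            also have "card {e, tw e} \<le> 2" by (rule card_insert_le_m1) auto
            finally show ?thesis using *(9) by simp
          qed
          let ?s = "(tick s)\<lparr>rg := (rg s)(RE := e, RZ := tgt e, RT1 := e), tm := tm s + 7\<rparr>"
          have cs: "core k r j od ?s np' X' TA' lg'" using *(1) by (simp add: core_def)
          have "wp N (add_edge 1) (\<lambda>s'. I s' \<and> M - tm s' < M - tm s) ?s"
          proof (rule wp_mono[OF wp_add_edge[OF cs lx(2) _ N]])
            fix s'
            assume s': "core k r j od s' (del2 e np') ?Y (e # TA') ((e, 1) # lg') \<and> rg s' RCur = rg ?s RZ \<and>
              (\<forall>Q. Q \<notin> {RT1, RT2, RT3, RT4, RLp, RSz, RCur} \<longrightarrow> rg s' Q = rg ?s Q) \<and>
              (\<forall>A. A \<notin> {ANext, APrev, ALogE, ALogK, ATree} \<longrightarrow> ar s' A = ar ?s A) \<and>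
              ip s' = ip ?s \<and> op s' = op ?s \<and> tm s' = tm ?s + 18"
            show "I s' \<and> M - tm s' < M - tm s"
            proof (rule conjI, rule IJ[of s' "Suc i" "del2 e np'" ?Y "e # TA'" "tgt e # x # \<rho>" "(e, 1) # lg'"])
              show "J s' (Suc i) (del2 e np') ?Y (e # TA') (tgt e # x # \<rho>) ((e, 1) # lg')"
                unfolding J_def using s' ext' f(2,3) solY *(5,6,7) ins lt by auto
              show "F s'" using s' Fs unfolding F_def by simp
              show "M - tm s' < M - tm s" using s' bM by simp
            qed (use s' t RX \<pi>' in auto)
          qed (use lt k in auto)
          then show ?thesis
            using lt cd(2,3,6,8,10,11) b fx xS(2) ParS *(4) \<pi>' True
            by (simp add: forward_body_def tick_def fun_upd_twist eval_nat_numeral)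
        qed
      qed
    qed
  qed
  then show ?thesis
  proof (rule wp_mono)
    fix s
    assume "F s \<and> (\<exists>i np' X' TA' \<pi>' lg'. J s i np' X' TA' \<pi>' lg' \<and>
     tm s \<le> tm s0 + 30 * (length \<pi> + 2 * i) + 1 \<and> D s k X' TA' \<pi>')"
    then obtain i np' X' TA' \<pi>' lg' where *: "F s" "J s i np' X' TA' \<pi>' lg'"
      "tm s \<le> tm s0 + 30 * (length \<pi> + 2 * i) + 1" "D s k X' TA' \<pi>'" by blast
    show "?Q s"
    proof (intro conjI)
      have b: "length TA' + 1 < k \<longrightarrow> P = dfs k X' (Z X' \<pi>') (PA r TA') \<and>
        (\<exists>x \<rho> e l. \<pi>' = x # \<rho> \<and> LX X' x = e # l \<and> P (tgt e) \<noteq> e \<and> rg s RE = e \<and> rg s RZ = tgt e)"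
        using *(2,4) unfolding J_def D_def by blast
      show "\<exists>i np' X' TA' \<pi>' lg'. core k r j od s np' X' TA' lg' \<and> ext r i (np, X, TA, lg) (np', X', TA', lg') \<and>
      good k r X' TA' \<pi>' \<and> rg s RCur = hd \<pi>' \<and> sol k r X TA = sol k r X' TA' \<and>
      length TA' = length TA + i \<and> SS r TA \<subseteq> SS r TA' \<and> length TA' + 1 \<le> k \<and>
      card (inside X (vs P)) \<le> card (inside X' (vs P)) + 2 * i \<and>
      tm s \<le> tm s0 + 30 * (length \<pi> + 2 * i) + 1 \<and>
      (length TA' + 1 < k \<longrightarrow> P = dfs k X' (Z X' \<pi>') (PA r TA') \<and>
        (\<exists>x \<rho> e l. \<pi>' = x # \<rho> \<and> LX X' x = e # l \<and> P (tgt e) \<noteq> e \<and> rg s RE = e \<and> rg s RZ = tgt e))"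
        apply (rule exI[of _ i], rule exI[of _ np'], rule exI[of _ X'], rule exI[of _ TA'],
            rule exI[of _ \<pi>'], rule exI[of _ lg'])
        using *(2)[unfolded J_def] *(3) b
        apply (elim conjE)
        apply (intro conjI)
        apply assumption+
        done
    qed (use *(1) in \<open>simp_all add: F_def\<close>)
  qed
qed


lemma wp_clear_loop:
  assumes s0: "rg s0 RI = 0" "rg s0 Zero = 0" "rg s0 RVp = length vl" "arrl (ar s0 AVis) vl"
    and vl: "set vl \<subseteq> {..<N}" "length vl \<le> N"
  shows "wp N clear_loop (\<lambda>s. (\<forall>R. R \<notin> {RI, RT1} \<longrightarrow> rg s R = rg s0 R) \<and>
    (\<forall>A. A \<noteq> APar \<longrightarrow> ar s A = ar s0 A) \<and> ip s = ip s0 \<and> op s = op s0 \<and>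
    ar s APar = (\<lambda>v. if v \<in> set vl then 0 else ar s0 APar v) \<and> tm s = tm s0 + 4 * length vl + 1) s0" (is "wp N _ ?Q s0")
proof -
  define I where "I s \<longleftrightarrow> (\<forall>R. R \<notin> {RI, RT1} \<longrightarrow> rg s R = rg s0 R) \<and>
    (\<forall>A. A \<noteq> APar \<longrightarrow> ar s A = ar s0 A) \<and> ip s = ip s0 \<and> op s = op s0 \<and> rg s RI \<le> length vl \<and>
    ar s APar = (\<lambda>v. if v \<in> set (take (rg s RI) vl) then 0 else ar s0 APar v) \<and>
    tm s = tm s0 + 4 * rg s RI" for s :: st
  show ?thesis unfolding clear_loop_def
  proof (rule wp_while_inv[where I = I and f = "\<lambda>s. length vl - rg s RI"])
    show "I s0" using s0 by (simp add: I_def)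
  next
    fix s assume "I s" "\<not> holds (Lt RI RVp) s"
    moreover from this have "rg s RI = length vl" using s0 unfolding I_def by simp
    ultimately show "?Q (tick s)"
      by (simp add: I_def)
  next
    fix s assume I: "I s" and go: "holds (Lt RI RVp) s"
    then have lt: "rg s RI < length vl" using s0 unfolding I_def by simp
    have st: "set (take (Suc (rg s RI)) vl) = insert (vl ! rg s RI) (set (take (rg s RI) vl))"
      using lt by (simp add: take_Suc_conv_app_nth)
    have "vl ! rg s RI \<in> {..<N}" using vl(1) nth_mem[OF lt] by blast
    then have "vl ! rg s RI < N" "ar s0 AVis (rg s RI) = vl ! rg s RI" "rg s RI < N"
      using vl lt s0(4) by (auto simp: arrl_def)
    then show "wp N (B (Get RT1 AVis RI) ;; B (Put APar RT1 Zero) ;; B (Inc RI))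
      (\<lambda>s'. I s' \<and> length vl - rg s' RI < length vl - rg s RI) (tick s)"
      using I lt s0(2) st by (auto simp: I_def fun_eq_iff)
  qed
qed

lemma wp_mark_loop:
  assumes s0: "rg s0 RI = 1" "rg s0 RSz = Suc (length TA)" "arrl (ar s0 ATree) (rev TA)"
    "ar s0 AHead = tgt"
    and TA: "r < n" "set TA \<subseteq> AR" "growth {r} (map pr (rev TA))" "length TA < n" and N: "n + 2 * m \<le> N"
  shows "wp N mark_loop (\<lambda>s. (\<forall>R. R \<notin> {RI, RT1, RT2} \<longrightarrow> rg s R = rg s0 R) \<and>
    (\<forall>A. A \<noteq> APar \<longrightarrow> ar s A = ar s0 A) \<and> ip s = ip s0 \<and> op s = op s0 \<and>
    ar s APar = (\<lambda>v. if v \<in> tgt ` set TA then PA r TA v else ar s0 APar v) \<and>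
    tm s = tm s0 + 7 * length TA + 1) s0" (is "wp N _ ?Q s0")
proof -
  define I where "I s \<longleftrightarrow> (\<forall>R. R \<notin> {RI, RT1, RT2} \<longrightarrow> rg s R = rg s0 R) \<and>
    (\<forall>A. A \<noteq> APar \<longrightarrow> ar s A = ar s0 A) \<and> ip s = ip s0 \<and> op s = op s0 \<and>
    1 \<le> rg s RI \<and> rg s RI \<le> Suc (length TA) \<and>
    ar s APar = (\<lambda>v. if v \<in> tgt ` set (take (rg s RI - 1) (rev TA)) then PA r TA v else ar s0 APar v) \<and>
    tm s + 7 = tm s0 + 7 * rg s RI" for s :: st
  show ?thesis unfolding mark_loop_def
  proof (rule wp_while_inv[where I = I and f = "\<lambda>s. Suc (length TA) - rg s RI"])
    show "I s0" using s0 by (simp add: I_def)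
  next
    fix s assume I: "I s" "\<not> holds (Lt RI RSz) s"
    then have "rg s RI = Suc (length TA)" using s0 unfolding I_def by simp
    with I show "?Q (tick s)"
      by (simp add: I_def)
  next
    fix s assume I: "I s" and go: "holds (Lt RI RSz) s"
    then have RSz: "rg s RSz = Suc (length TA)" using s0 unfolding I_def by simp
    obtain i where i: "rg s RI = Suc i" using I unfolding I_def by (cases "rg s RI") auto
    then have lt: "i < length TA" using go RSz by simp
    let ?a = "rev TA ! i"
    have st: "set (take (Suc i) (rev TA)) = insert ?a (set (take i (rev TA)))"
      using lt by (simp add: take_Suc_conv_app_nth)
    have "?a \<in> set (rev TA)" using lt by (intro nth_mem) simp
    then have a: "?a \<in> set TA" "?a \<in> AR" using TA(2) by auto
    note A = ARD[OF a(2)]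
    have b: "?a < N" "tgt ?a < N" "i < N" "Suc i < N" "ar s0 ATree i = ?a" "PA r TA (tgt ?a) = ?a"
      using A N lt s0(3) TA(4) PA_tree[OF TA(1-3) a(1)] by (auto simp: arrl_def)
    show "wp N (B (Mov RT1 RI) ;; B (Dec RT1) ;; B (Get RT2 ATree RT1) ;;
     B (Get RT1 AHead RT2) ;; B (Put APar RT1 RT2) ;; B (Inc RI))
      (\<lambda>s'. I s' \<and> Suc (length TA) - rg s' RI < Suc (length TA) - rg s RI) (tick s)"
      using I lt s0(4) st b i unfolding I_def by (auto simp: fun_eq_iff)
  qed
qed

lemma wp_clear_marks:
  assumes s0: "rg s0 Zero = 0" "rg s0 RVp = length vl" "arrl (ar s0 AVis) vl"
    "rg s0 RSz = Suc (length TA')" "arrl (ar s0 ATree) (rev TA')" "ar s0 AHead = tgt"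
    and TA: "r < n" "set TA' \<subseteq> AR" "growth {r} (map pr (rev TA'))" "length TA' < n" and N: "n + 2 * m \<le> N"
    and vl: "set vl \<subseteq> {..<n}" "length vl \<le> n" "SS r TA \<inter> set vl = {}" "SS r TA \<subseteq> SS r TA'"
      "\<And>v. v \<notin> set vl \<Longrightarrow> ar s0 APar v = PA r TA v" "PA r TA r = 1"
  shows "wp N clear_marks (\<lambda>s. (\<forall>R. R \<notin> {RI, RT1, RT2} \<longrightarrow> rg s R = rg s0 R) \<and>
    (\<forall>A. A \<noteq> APar \<longrightarrow> ar s A = ar s0 A) \<and> ip s = ip s0 \<and> op s = op s0 \<and>
    ar s APar = PA r TA' \<and> tm s = tm s0 + 4 * length vl + 7 * length TA' + 4) s0" (is "wp N _ ?Q s0")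
proof -
  let ?s = "s0\<lparr>rg := (rg s0)(RI := 0), tm := Suc (tm s0)\<rparr>"
  have vN: "set vl \<subseteq> {..<N}" "length vl \<le> N" using vl N by auto
  have eq: "wp N clear_marks Q s0 \<longleftrightarrow> wp N clear_loop (wp N (B (Cst RI 1) ;; mark_loop) Q) ?s" for Q
    by (simp add: clear_marks_def)
  have c: "wp N clear_loop (\<lambda>s. (\<forall>R. R \<notin> {RI, RT1} \<longrightarrow> rg s R = rg ?s R) \<and>
    (\<forall>A. A \<noteq> APar \<longrightarrow> ar s A = ar ?s A) \<and> ip s = ip ?s \<and> op s = op ?s \<and>
    ar s APar = (\<lambda>v. if v \<in> set vl then 0 else ar ?s APar v) \<and> tm s = tm ?s + 4 * length vl + 1) ?s"
    by (rule wp_clear_loop) (use s0 vN in simp_all)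
  show ?thesis
    unfolding eq
  proof (rule wp_mono[OF c])
    fix s1 :: st
    assume s1: "(\<forall>R. R \<notin> {RI, RT1} \<longrightarrow> rg s1 R = rg ?s R) \<and>
    (\<forall>A. A \<noteq> APar \<longrightarrow> ar s1 A = ar ?s A) \<and> ip s1 = ip ?s \<and> op s1 = op ?s \<and>
    ar s1 APar = (\<lambda>v. if v \<in> set vl then 0 else ar ?s APar v) \<and> tm s1 = tm ?s + 4 * length vl + 1"
    let ?s1 = "s1\<lparr>rg := (rg s1)(RI := 1), tm := Suc (tm s1)\<rparr>"
    have eq1: "wp N (B (Cst RI 1) ;; mark_loop) Q s1 \<longleftrightarrow> wp N mark_loop Q ?s1" for Q by simp
    have final: "(\<lambda>v. if v \<in> tgt ` set TA' then PA r TA' v else ar s1 APar v) = PA r TA'"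
    proof
      fix v
      consider "v \<in> tgt ` set TA'" | "v = r" "v \<notin> tgt ` set TA'" | "v \<notin> SS r TA'"
        by (auto simp: SS_def)
      then show "(if v \<in> tgt ` set TA' then PA r TA' v else ar s1 APar v) = PA r TA' v"
      proof cases
        case 2
        have "r \<in> SS r TA" by (simp add: SS_def)
        then have "r \<notin> set vl" using vl(3) by auto
        then show ?thesis using 2 s1 vl(5,6) PA_root[OF TA(1-3)] by simp
      next
        case 3
        then have "v \<notin> SS r TA" "v \<notin> tgt ` set TA'" using vl(4) by (auto simp: SS_def)
        then show ?thesis using s1 vl(5)[of v] PA_outside[of v] 3 by simp
      qed simp
    qed
    show "wp N (B (Cst RI 1) ;; mark_loop) ?Q s1"
      unfolding eq1
    proof (rule wp_mono[OF wp_mark_loop[OF _ _ _ _ TA N]])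
      fix s2 :: st
      assume s2: "(\<forall>R. R \<notin> {RI, RT1, RT2} \<longrightarrow> rg s2 R = rg ?s1 R) \<and>
    (\<forall>A. A \<noteq> APar \<longrightarrow> ar s2 A = ar ?s1 A) \<and> ip s2 = ip ?s1 \<and> op s2 = op ?s1 \<and>
    ar s2 APar = (\<lambda>v. if v \<in> tgt ` set TA' then PA r TA' v else ar ?s1 APar v) \<and>
    tm s2 = tm ?s1 + 7 * length TA' + 1"
      have p: "ar ?s1 APar = ar s1 APar" by simp
      have "ar s2 APar = (\<lambda>v. if v \<in> tgt ` set TA' then PA r TA' v else ar ?s1 APar v)"
        using s2 by (elim conjE)
      then have "ar s2 APar = PA r TA'" unfolding p final .
      then show "?Q s2"
        using s1 s2 by simp
    qed (use s0 s1 in simp_all)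
  qed
qed

lemma wp_print_loop:
  assumes s0: "rg s0 RI = 1" "rg s0 RSz = Suc (length TA)" "arrl (ar s0 ATree) (rev TA)"
    "ar s0 AHead = tgt" "ar s0 ATwin = tw"
    and TA: "set TA \<subseteq> AR" "length TA < n" and N: "n + 2 * m \<le> N"
  shows "wp N print_loop (\<lambda>s. (\<forall>R. R \<notin> {RI, RT1, RT2} \<longrightarrow> rg s R = rg s0 R) \<and>
    ar s = ar s0 \<and> ip s = ip s0 \<and> op s = op s0 @ concat (map (\<lambda>a. [src a, tgt a]) (rev TA)) \<and>
    tm s = tm s0 + 10 * length TA + 1) s0" (is "wp N _ ?Q s0")
proof -
  define I where "I s \<longleftrightarrow> (\<forall>R. R \<notin> {RI, RT1, RT2} \<longrightarrow> rg s R = rg s0 R) \<and>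
    ar s = ar s0 \<and> ip s = ip s0 \<and> 1 \<le> rg s RI \<and> rg s RI \<le> Suc (length TA) \<and>
    op s = op s0 @ concat (map (\<lambda>a. [src a, tgt a]) (take (rg s RI - 1) (rev TA))) \<and>
    tm s + 10 = tm s0 + 10 * rg s RI" for s :: st
  show ?thesis unfolding print_loop_def
  proof (rule wp_while_inv[where I = I and f = "\<lambda>s. Suc (length TA) - rg s RI"])
    show "I s0" using s0 by (simp add: I_def)
  next
    fix s assume I: "I s" "\<not> holds (Lt RI RSz) s"
    then have "rg s RI = Suc (length TA)" using s0 unfolding I_def by simp
    with I show "?Q (tick s)"
      by (simp add: I_def)
  next
    fix s assume I: "I s" and go: "holds (Lt RI RSz) s"
    then have RSz: "rg s RSz = Suc (length TA)" using s0 unfolding I_def by simp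
    obtain i where i: "rg s RI = Suc i" using I unfolding I_def by (cases "rg s RI") auto
    then have lt: "i < length TA" using go RSz by simp
    let ?a = "rev TA ! i"
    have st: "take (Suc i) (rev TA) = take i (rev TA) @ [?a]"
      using lt by (simp add: take_Suc_conv_app_nth)
    have "?a \<in> set (rev TA)" using lt by (intro nth_mem) simp
    then have a: "?a \<in> set TA" "?a \<in> AR" using TA(1) by auto
    note A = ARD[OF a(2)]
    have b: "?a < N" "tw ?a < N" "i < N" "Suc i < N" "ar s0 ATree i = ?a"
      using A ARD(2)[OF A(6)] N lt s0(3) TA(2) by (auto simp: arrl_def)
    show "wp N (B (Mov RT1 RI) ;; B (Dec RT1) ;; B (Get RT2 ATree RT1) ;;
     B (Get RT1 ATwin RT2) ;; B (Get RT1 AHead RT1) ;; B (Pr RT1) ;;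
     B (Get RT1 AHead RT2) ;; B (Pr RT1) ;; B (Inc RI))
      (\<lambda>s'. I s' \<and> Suc (length TA) - rg s' RI < Suc (length TA) - rg s RI) (tick s)"
      using I lt s0(4,5) st b i unfolding I_def by (auto simp: src_def)
  qed
qed

lemma wp_undel_arc:
  assumes "rg s R = a" "R \<notin> {RT1, RT2}" "ar s ANext = fst np" "ar s APrev = snd np"
    "a < N" "fst np a < N" "snd np a < N"
  shows "wp N (undel_arc R) (\<lambda>s'. (\<forall>Q. Q \<notin> {RT1, RT2} \<longrightarrow> rg s' Q = rg s Q) \<and>
    (\<forall>A. A \<notin> {ANext, APrev} \<longrightarrow> ar s' A = ar s A) \<and> ar s' ANext = fst (und1 a np) \<and>
    ar s' APrev = snd (und1 a np) \<and> ip s' = ip s \<and> op s' = op s \<and> tm s' = tm s + 4) s"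
  using assms by (auto simp: undel_arc_def und1_def)

lemma wp_undel_edge:
  assumes l: "links np X" "twcl X" "e \<in> X" and s: "rg s R = e" "R \<notin> {RT1, RT2, RT3}"
    "ar s ANext = fst (del2 e np)" "ar s APrev = snd (del2 e np)" "ar s ATwin = tw" "n + 2 * m \<le> N"
  shows "wp N (undel_edge R) (\<lambda>s'. (\<forall>Q. Q \<notin> {RT1, RT2, RT3} \<longrightarrow> rg s' Q = rg s Q) \<and>
    (\<forall>A. A \<notin> {ANext, APrev} \<longrightarrow> ar s' A = ar s A) \<and> ar s' ANext = fst np \<and>
    ar s' APrev = snd np \<and> ip s' = ip s \<and> op s' = op s \<and> tm s' = tm s + 9) s"
proof -
  have eA: "e \<in> AR" using twclD(1)[OF l(2,3)] .
  have t: "tw e \<in> X" "tw e \<in> X - {e}" using twclD(2)[OF l(2,3)] ARD(11)[OF eA] by auto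
  have eN: "e < N" "tw e < N" using ARD(2)[OF eA] ARD(2)[OF ARD(6)[OF eA]] s(6) by auto
  have bd: "fst (del1 a q) x < N \<and> snd (del1 a q) x < N"
    if "\<forall>x\<in>X. fst q x < N \<and> snd q x < N" "a \<in> X" "x \<in> X" for q a x
    using that by (auto simp: del1_def)
  have b0: "\<forall>x\<in>X. fst np x < N \<and> snd np x < N" using links_bounds(3,4)[OF l(1)] s(6) by fastforce
  then have b1: "\<forall>x\<in>X. fst (del1 e np) x < N \<and> snd (del1 e np) x < N" using bd l(3) by blast
  then have b2: "\<forall>x\<in>X. fst (del2 e np) x < N \<and> snd (del2 e np) x < N"
    unfolding del2_def using bd t(1) by blast
  have u1: "und1 (tw e) (del2 e np) = del1 e np"
    unfolding del2_def using links_del1(2)[OF links_del1(1)[OF l(1,3)] t(2)] .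
  have u2: "und1 e (del1 e np) = np" using links_del1(2)[OF l(1,3)] .
  let ?s = "s\<lparr>rg := (rg s)(RT3 := tw e), tm := Suc (tm s)\<rparr>"
  have eq: "wp N (undel_edge R) Q s \<longleftrightarrow> wp N (undel_arc RT3) (wp N (undel_arc R) Q) ?s" for Q
    using s eN by (simp add: undel_edge_def)
  have w1: "wp N (undel_arc RT3) (\<lambda>s'. (\<forall>Q. Q \<notin> {RT1, RT2} \<longrightarrow> rg s' Q = rg ?s Q) \<and>
    (\<forall>A. A \<notin> {ANext, APrev} \<longrightarrow> ar s' A = ar ?s A) \<and> ar s' ANext = fst (und1 (tw e) (del2 e np)) \<and>
    ar s' APrev = snd (und1 (tw e) (del2 e np)) \<and> ip s' = ip ?s \<and> op s' = op ?s \<and> tm s' = tm ?s + 4) ?s"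
    by (rule wp_undel_arc) (use s eN b2 t in simp_all)
  show ?thesis
    unfolding eq
  proof (rule wp_mono[OF w1])
    fix s1 :: st
    assume s1: "(\<forall>Q. Q \<notin> {RT1, RT2} \<longrightarrow> rg s1 Q = rg ?s Q) \<and>
    (\<forall>A. A \<notin> {ANext, APrev} \<longrightarrow> ar s1 A = ar ?s A) \<and> ar s1 ANext = fst (und1 (tw e) (del2 e np)) \<and>
    ar s1 APrev = snd (und1 (tw e) (del2 e np)) \<and> ip s1 = ip ?s \<and> op s1 = op ?s \<and> tm s1 = tm ?s + 4"
    show "wp N (undel_arc R) (\<lambda>s'. (\<forall>Q. Q \<notin> {RT1, RT2, RT3} \<longrightarrow> rg s' Q = rg s Q) \<and>
    (\<forall>A. A \<notin> {ANext, APrev} \<longrightarrow> ar s' A = ar s A) \<and> ar s' ANext = fst np \<and>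
    ar s' APrev = snd np \<and> ip s' = ip s \<and> op s' = op s \<and> tm s' = tm s + 9) s1"
    proof (rule wp_mono[OF wp_undel_arc[where np = "del1 e np" and a = e]])
      fix s2 :: st
      assume "(\<forall>Q. Q \<notin> {RT1, RT2} \<longrightarrow> rg s2 Q = rg s1 Q) \<and>
    (\<forall>A. A \<notin> {ANext, APrev} \<longrightarrow> ar s2 A = ar s1 A) \<and> ar s2 ANext = fst (und1 e (del1 e np)) \<and>
    ar s2 APrev = snd (und1 e (del1 e np)) \<and> ip s2 = ip s1 \<and> op s2 = op s1 \<and> tm s2 = tm s1 + 4"
      then show "(\<forall>Q. Q \<notin> {RT1, RT2, RT3} \<longrightarrow> rg s2 Q = rg s Q) \<and>
    (\<forall>A. A \<notin> {ANext, APrev} \<longrightarrow> ar s2 A = ar s A) \<and> ar s2 ANext = fst np \<and>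
    ar s2 APrev = snd np \<and> ip s2 = ip s \<and> op s2 = op s \<and> tm s2 = tm s + 9"
        using s1 u2 by simp
    qed (use s s1 eN b1 u1 l in simp_all)
  qed
qed

lemma wp_backtrack:
  assumes c: "core k r j od s (del2 e np) (X - {e, tw e}) TA' ((e, kd) # lg)"
    and l: "links np X" "twcl X" "e \<in> X" and N: "n + 2 * m \<le> N" and ne: "length lg < N"
    and k: "kd = 0 \<and> TA' = TA \<or> (kd = 1 \<or> kd = 2) \<and> TA' = e # TA \<and> PA r TA (tgt e) = 0"
    and par: "ar s APar = PA r TA'"
  shows "wp N backtrack (\<lambda>s'. ip s' = ip s \<and> op s' = op s \<and> ar s' APar = PA r TA \<and> tm s' \<le> tm s + 35 \<and>
    (if kd = 2 then core k r j od s' (del2 e np) (X - {e, tw e}) TA ((e, 0) # lg) \<and> rg s' RMode = 1 \<and>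
       rg s' RCur = src e
     else core k r j od s' np X TA lg \<and> rg s' RMode = rg s RMode)) s"
    (is "wp N backtrack ?Q s")
proof -
  note cd = coreD[OF c]
  have eA: "e \<in> AR" using twclD(1)[OF l(2,3)] .
  note A = ARD[OF eA]
  have eN: "e < N" "tw e < N" "tgt e < N" using A ARD(2)[OF A(6)] N by auto
  have lg: "ar s ALogE (length lg) = e" "ar s ALogK (length lg) = kd"
    "arrl (ar s ALogE) (map fst (rev lg))" "arrl (ar s ALogK) (map snd (rev lg))"
    using cd(13,14) by (simp_all add: arrl_pop)
  have cX: "card X + 2 * length lg \<le> 2 * m" using card_remove[OF l(2,3)] cd(18) by simp
  let ?rest = "If (Pos RT4)
          (B (Get RZ AHead RE) ;; B (Put APar RZ Zero) ;; B (Dec RSz) ;; B (Get RT1 ATwin RE) ;;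
           B (Get RCur AHead RT1) ;; B (Dec RT4) ;;
           If (Pos RT4) (del_edge RE ;; push_log RE 0 ;; B (Cst RMode 1)) Skip)
          Skip"
  let ?s = "s\<lparr>rg := (rg s)(RLp := length lg, RE := e, RT4 := kd), tm := tm s + 4\<rparr>"
  have eq: "wp N backtrack Q s \<longleftrightarrow> wp N (undel_edge RE) (wp N ?rest Q) ?s" for Q
    unfolding backtrack_def using cd(7) lg ne by (simp add: tick_def eval_nat_numeral)
  have w: "wp N (undel_edge RE) (\<lambda>s'. (\<forall>Q. Q \<notin> {RT1, RT2, RT3} \<longrightarrow> rg s' Q = rg ?s Q) \<and>
    (\<forall>A. A \<notin> {ANext, APrev} \<longrightarrow> ar s' A = ar ?s A) \<and> ar s' ANext = fst np \<and>
    ar s' APrev = snd np \<and> ip s' = ip ?s \<and> op s' = op ?s \<and> tm s' = tm ?s + 9) ?s"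
    by (rule wp_undel_edge[OF l]) (use cd N in simp_all)
  show ?thesis
    unfolding eq
  proof (rule wp_mono[OF w])
    fix s1 :: st
    assume s1: "(\<forall>Q. Q \<notin> {RT1, RT2, RT3} \<longrightarrow> rg s1 Q = rg ?s Q) \<and>
    (\<forall>A. A \<notin> {ANext, APrev} \<longrightarrow> ar s1 A = ar ?s A) \<and> ar s1 ANext = fst np \<and>
    ar s1 APrev = snd np \<and> ip s1 = ip ?s \<and> op s1 = op ?s \<and> tm s1 = tm ?s + 9"
    show "wp N ?rest ?Q s1"
    proof (cases "kd = 0")
      case True
      have "core k r j od (tick s1) np X TA lg"
        using s1 cd(1-6,10-12,15) lg l cX True k by (simp add: core_def)
      then show ?thesis using True s1 k par by simp
    next
      case False
      then have kd: "TA' = e # TA" "PA r TA (tgt e) = 0" "kd = 1 \<or> kd = 2" using k by auto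
      have tr: "arrl (ar s ATree) (rev TA)" using cd(15) kd(1) by (simp add: arrl_pop)
      have par1: "(PA r TA')(tgt e := 0) = PA r TA" using kd by auto
      let ?s2 = "s1\<lparr>ar := (ar s1)(APar := PA r TA),
        rg := (rg s1)(RZ := tgt e, RSz := Suc (length TA), RT1 := tw e, RCur := src e, RT4 := kd - 1),
        tm := tm s1 + 7\<rparr>"
      have c2: "core k r j od ?s2 np X TA lg"
        using s1 cd(1-5,10-12) lg l cX tr by (simp add: core_def)
      have eq2: "wp N ?rest Q s1 \<longleftrightarrow> wp N (If (Pos RT4) (del_edge RE ;; push_log RE 0 ;; B (Cst RMode 1)) Skip) Q ?s2"
        for Q
        using s1 cd(1,6,10,11) kd eN par par1 False
        by (simp add: tick_def src_def eval_nat_numeral)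
      show ?thesis
      proof (cases "kd = 2")
        case True
        let ?s3 = "tick ?s2"
        have c3: "core k r j od ?s3 np X TA lg" using c2 by (simp add: core_tick)
        have eq3: "wp N (If (Pos RT4) (del_edge RE ;; push_log RE 0 ;; B (Cst RMode 1)) Skip) Q ?s2 \<longleftrightarrow>
          wp N (del_edge RE ;; push_log RE 0) (wp N (B (Cst RMode 1)) Q) ?s3" for Q
          using True by simp
        show ?thesis
          unfolding eq2 eq3
          by (rule wp_mono[OF wp_del_log[OF c3 l(3)]])
            (use s1 N True tr in \<open>simp_all add: core_def\<close>)
      next
        case F: False
        then have "kd = 1" using kd(3) by simp
        moreover have "core k r j od (tick ?s2) np X TA lg" using c2 by (simp add: core_tick)
        ultimately show ?thesis unfolding eq2 using s1 by simp
      qed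
    qed
  qed
qed

lemma ext_step0:
  "ext r i c (np, X, TA, lg) \<Longrightarrow> links np X \<Longrightarrow> twcl X \<Longrightarrow> e \<in> X \<Longrightarrow>
    ext r (Suc i) c (del2 e np, X - {e, tw e}, TA, (e, 0) # lg)"
  by (rule ext_Suc) auto

text \<open>The chords are the arcs from the new vertex \<open>z\<close> back into the tree.\<close>

lemma wp_chord_loop:
  assumes c: "core k r j od s0 np X TA lg" and z: "z < n" "rg s0 RZ = z" "rg s0 RA = fst np z"
    and S: "S = vs (ar s0 APar)" and N: "n + 2 * m \<le> N"
    and nl: "\<And>a. a \<in> X \<Longrightarrow> src a \<in> S \<Longrightarrow> tgt a \<in> S \<Longrightarrow> src a = z \<or> tgt a = z" "z \<in> S"
  shows "wp N chord_loop (\<lambda>s. (\<forall>R. R \<notin> {RT1, RT2, RT3, RT4, RLp, RA, RB} \<longrightarrow> rg s R = rg s0 R) \<and>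
    (\<forall>A. A \<notin> {ANext, APrev, ALogE, ALogK} \<longrightarrow> ar s A = ar s0 A) \<and> ip s = ip s0 \<and> op s = op s0 \<and>
    (\<exists>i np' lg'. core k r j od s np' (drop_loops S X) TA lg' \<and>
      ext r i (np, X, TA, lg) (np', drop_loops S X, TA, lg') \<and> i \<le> card {a \<in> X. src a = z}) \<and>
    tm s \<le> tm s0 + 20 * card {a \<in> X. src a = z} + 1) s0"
proof -
  note cd0 = coreD[OF c]
  let ?d = "card {a \<in> X. src a = z}"
  define F where "F s \<longleftrightarrow> (\<forall>R. R \<notin> {RT1, RT2, RT3, RT4, RLp, RA, RB} \<longrightarrow> rg s R = rg s0 R) \<and>
    (\<forall>A. A \<notin> {ANext, APrev, ALogE, ALogK} \<longrightarrow> ar s A = ar s0 A) \<and> ip s = ip s0 \<and> op s = op s0"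
    for s :: st
  \<comment> \<open>\<open>XX us\<close> is what remains after the arcs \<open>us\<close> of
    \<open>z\<close> have been examined; the chords among them are gone, with their twins.\<close>
  define XX where "XX us = X - {a. a \<in> set us \<and> tgt a \<in> S} - {tw a | a. a \<in> set us \<and> tgt a \<in> S}" for us
  define J where "J s i np' lg' us ws \<longleftrightarrow> LX X z = us @ ws \<and> rg s RA = hd (ws @ [z]) \<and>
    core k r j od s np' (XX us) TA lg' \<and> ext r i (np, X, TA, lg) (np', XX us, TA, lg') \<and>
    i \<le> length us \<and> tm s \<le> tm s0 + 20 * length us" for s :: st and i np' lg' us ws
  define I where "I s \<longleftrightarrow> F s \<and> (\<exists>i np' lg' us ws. J s i np' lg' us ws)" for s :: st
  have len: "length (LX X z) = ?d"
    using distinct_card[OF distinct_LX[OF z(1), of X]] set_LX[OF cd0(17) z(1)] by simp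
  have LXD: "a \<in> X \<and> a \<in> AR \<and> src a = z" if "a \<in> set (LX X z)" for a
    using that set_LX[OF cd0(17) z(1)] twclD(1)[OF cd0(17)] by auto
  define M where "M = tm s0 + 20 * ?d + 1"
  have bound: "tm s < M" if "J s i np' lg' us ws" for s i np' lg' us ws
  proof -
    have "length us \<le> ?d" using that len unfolding J_def by (metis le_add1 length_append)
    then show ?thesis using that unfolding J_def M_def by auto
  qed
  have "wp N chord_loop (\<lambda>s. F s \<and> (\<exists>i np' lg'. core k r j od s np' (drop_loops S X) TA lg' \<and>
      ext r i (np, X, TA, lg) (np', drop_loops S X, TA, lg') \<and> i \<le> ?d) \<and> tm s \<le> M) s0"
    unfolding chord_loop_def
  proof (rule wp_while_inv[where I = I and f = "\<lambda>s. M - tm s"])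
    have "J s0 0 np lg [] (LX X z)"
      unfolding J_def XX_def using c z(3) links_first[OF cd0(16) z(1)] by (simp add: ext_0)
    then show "I s0" unfolding I_def F_def by blast
  next
    fix s assume I: "I s" "\<not> holds (Neq RA RZ) s"
    then obtain i np' lg' us ws where J: "J s i np' lg' us ws" "F s" unfolding I_def by blast
    have RA: "rg s RA = z" using I(2) J(2) z(2) unfolding F_def by simp
    have ws: "ws = []"
    proof (cases ws)
      case (Cons a ws')
      then have "a \<in> set (LX X z)" "a = z" using J(1) RA unfolding J_def by auto
      then show ?thesis using LXD ARD(1) z(1) by force
    qed simp
    have us: "set us = {a \<in> X. src a = z}"
      using J(1) ws set_LX[OF cd0(17) z(1)] unfolding J_def by auto
    have eq: "XX us = drop_loops S X"
    proof (intro set_eqI iffI)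
      fix a assume a: "a \<in> XX us"
      then have aX: "a \<in> X" by (simp add: XX_def)
      have A: "a \<in> AR" using twclD(1)[OF cd0(17) aX] .
      have "\<not> (src a \<in> S \<and> tgt a \<in> S)"
      proof
        assume s: "src a \<in> S \<and> tgt a \<in> S"
        then consider "src a = z" | "tgt a = z" using nl(1)[OF aX] by blast
        then show False
        proof cases
          case 1
          then show ?thesis using a aX s us by (simp add: XX_def)
        next
          case 2
          then have "tw a \<in> set us" using us twclD(2)[OF cd0(17) aX] ARD(9)[OF A] by simp
          moreover have "tgt (tw a) \<in> S" "a = tw (tw a)" using s ARD[OF A] by auto
          ultimately show ?thesis using a unfolding XX_def by blast
        qed
      qed
      then show "a \<in> drop_loops S X" using aX by (simp add: drop_loops_def)
    next
      fix a assume "a \<in> drop_loops S X"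
      then have a: "a \<in> X" "\<not> (src a \<in> S \<and> tgt a \<in> S)" by (auto simp: drop_loops_def)
      have "a \<noteq> tw b" if "b \<in> set us" "tgt b \<in> S" for b
        using that us a nl(2) ARD(9,10)[OF twclD(1)[OF cd0(17)], of b] by auto
      then show "a \<in> XX us" using a us nl(2) by (auto simp: XX_def)
    qed
    have "i \<le> ?d" using J(1) ws len unfolding J_def by simp
    moreover have "core k r j od (tick s) np' (drop_loops S X) TA lg'"
      "ext r i (np, X, TA, lg) (np', drop_loops S X, TA, lg')"
      using J(1) eq unfolding J_def core_tick by simp_all
    moreover have "F (tick s)" using J(2) unfolding F_def tick_sel .
    moreover have "tm (tick s) \<le> M" using bound[OF J(1)] by simp
    ultimately show "F (tick s) \<and> (\<exists>i np' lg'. core k r j od (tick s) np' (drop_loops S X) TA lg' \<and>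
      ext r i (np, X, TA, lg) (np', drop_loops S X, TA, lg') \<and> i \<le> ?d) \<and> tm (tick s) \<le> M" by blast
  next
    fix s assume I: "I s" and go: "holds (Neq RA RZ) s"
    then obtain i np' lg' us ws where J: "J s i np' lg' us ws" and F: "F s" unfolding I_def by blast
    have RA: "rg s RA \<noteq> z" using go F z(2) unfolding F_def by simp
    have *: "LX X z = us @ ws" "rg s RA = hd (ws @ [z])" "core k r j od s np' (XX us) TA lg'"
      "ext r i (np, X, TA, lg) (np', XX us, TA, lg')" "i \<le> length us" "tm s \<le> tm s0 + 20 * length us"
      using J unfolding J_def by blast+
    note cd = coreD[OF *(3)]
    obtain a ws' where ws: "ws = a # ws'" using RA *(2) by (cases ws) auto
    have a: "a \<in> X" "a \<in> AR" "src a = z" using LXD[of a] *(1) ws by auto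
    note A = ARD[OF a(2)]
    have usz: "b \<in> X \<and> b \<in> AR \<and> src b = z" if "b \<in> set us" for b using LXD[of b] *(1) that by auto
    have dist: "distinct (us @ a # ws')" using distinct_LX[OF z(1), of X] *(1) ws by simp
    \<comment> \<open>The twin of an arc that leaves \<open>z\<close> does not itself leave
      \<open>z\<close>, so deleting it does not affect the part of the list still to be
      examined.\<close>
    have keep: "b \<in> XX us" if "b \<in> set (a # ws')" for b
    proof -
      have b: "b \<in> X" "src b = z" "b \<notin> set us" using LXD[of b] *(1) ws that dist by auto
      have "b \<noteq> tw c" if "c \<in> set us" for c
        using usz[OF that] b(2) ARD(5,9)[of c] by auto
      then show ?thesis using b by (auto simp: XX_def)
    qed
    have aXX: "a \<in> XX us" using keep by simp
    have "LX (XX us) z = filter (\<lambda>b. b \<in> XX us) (LX X z)"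
    proof -
      have "XX us \<subseteq> X" by (auto simp: XX_def)
      then show ?thesis unfolding LX_def by (auto intro!: filter_cong)
    qed
    also have "\<dots> = filter (\<lambda>b. b \<in> XX us) us @ a # ws'"
      using *(1) ws keep by (simp add: filter_id_conv)
    finally have nx: "fst np' a = hd (ws' @ [z])" using links_next[OF cd(16) z(1)] by blast
    have bM: "tm s < M" by (rule bound[OF J])
    have par: "ar s APar = ar s0 APar" using F unfolding F_def by simp
    have b: "a < N" "tgt a < N" using A N by auto
    have RAa: "rg s RA = a" using *(2) ws by simp
    let ?s = "(tick s)\<lparr>rg := (rg s)(RB := hd (ws' @ [z]), RT1 := ar s0 APar (tgt a)), tm := tm s + 5\<rparr>"
    have eq: "wp N (B (Get RB ANext RA) ;; B (Get RT1 AHead RA) ;; B (Get RT1 APar RT1) ;;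
      If (Pos RT1) (del_edge RA ;; push_log RA 0) Skip ;; B (Mov RA RB)) Q (tick s) \<longleftrightarrow>
      (if tgt a \<in> S then wp N (del_edge RA ;; push_log RA 0) (wp N (B (Mov RA RB)) Q) ?s
       else wp N (B (Mov RA RB)) Q ?s)" for Q
      using RAa b cd(8,10) nx par S A(4)
      by (simp add: vs_def tick_def eval_nat_numeral)
    have F': "F ?s" using F unfolding F_def by simp
    show "wp N (B (Get RB ANext RA) ;; B (Get RT1 AHead RA) ;; B (Get RT1 APar RT1) ;;
      If (Pos RT1) (del_edge RA ;; push_log RA 0) Skip ;; B (Mov RA RB)) (\<lambda>s'. I s' \<and> M - tm s' < M - tm s) (tick s)"
    proof (cases "tgt a \<in> S")
      case False
      have XX': "XX (us @ [a]) = XX us" using False by (auto simp: XX_def)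
      have "J (upd (Mov RA RB) ?s) i np' lg' (us @ [a]) ws'"
        unfolding J_def XX' using * ws by (simp add: core_def)
      moreover have "F (upd (Mov RA RB) ?s)" using F unfolding F_def by simp
      ultimately have "I (upd (Mov RA RB) ?s)" unfolding I_def by blast
      then show ?thesis unfolding eq using False bM by (simp only: if_False wp_B okb.simps) simp
    next
      case True
      have XX': "XX (us @ [a]) = XX us - {a, tw a}" using True by (auto simp: XX_def)
      have cs: "core k r j od ?s np' (XX us) TA lg'" using *(3) by (simp add: core_def)
      have "wp N (del_edge RA ;; push_log RA 0) (wp N (B (Mov RA RB)) (\<lambda>s'. I s' \<and> M - tm s' < M - tm s)) ?s"
      proof (rule wp_mono[OF wp_del_log[OF cs aXX _ _ N]])
        fix s1
        assume s1: "core k r j od s1 (del2 a np') (XX us - {a, tw a}) TA ((a, 0) # lg') \<and>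
          (\<forall>Q. Q \<notin> {RT1, RT2, RT3, RT4, RLp} \<longrightarrow> rg s1 Q = rg ?s Q) \<and>
          (\<forall>A. A \<notin> {ANext, APrev, ALogE, ALogK} \<longrightarrow> ar s1 A = ar ?s A) \<and>
          ip s1 = ip ?s \<and> op s1 = op ?s \<and> tm s1 = tm ?s + 13"
        have "core k r j od (upd (Mov RA RB) s1) (del2 a np') (XX us - {a, tw a}) TA ((a, 0) # lg')"
          using conjunct1[OF s1] by (simp add: core_def)
        moreover have "ext r (Suc i) (np, X, TA, lg) (del2 a np', XX us - {a, tw a}, TA, (a, 0) # lg')"
          by (rule ext_step0[OF *(4) cd(16,17) aXX])
        ultimately have "J (upd (Mov RA RB) s1) (Suc i) (del2 a np') ((a, 0) # lg') (us @ [a]) ws'"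
          unfolding J_def XX' using * ws s1 by simp
        moreover have "F (upd (Mov RA RB) s1)" using F s1 unfolding F_def by simp
        ultimately have "I (upd (Mov RA RB) s1)" unfolding I_def by blast
        then show "wp N (B (Mov RA RB)) (\<lambda>s'. I s' \<and> M - tm s' < M - tm s) s1"
          using s1 bM by simp
      qed (use RAa in simp_all)
      then show ?thesis unfolding eq using True by simp
    qed
  qed
  then show ?thesis
    by (rule wp_mono) (simp add: F_def M_def)
qed


text \<open>When the new edge completes the tree, the scan for chords is omitted:
  \<open>branch\<close> can charge the degree of the new vertex only while a vertex is missing.
  \<open>Y\<close> and \<open>D\<close> unify the two cases.\<close>

lemma wp_branch_edge:
  assumes c: "core k r j od s np X TA lg" and g: "good k r X TA (x # \<pi>)" and N: "n + 2 * m \<le> N"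
    and k: "length TA + 1 < k" "k \<le> n" and l: "LX X x = e # l"
    and s: "rg s RE = e" "rg s RZ = tgt e" "ar s APar = PA r TA"
    and Y: "Y = (if length TA + 2 < k then drop_loops (SS r (e # TA)) (X - {e, tw e}) else X - {e, tw e})"
    and D: "D = (if length TA + 2 < k then card {a \<in> X. src a = tgt e} else 0)"
  shows "wp N branch_edge (\<lambda>s'. ip s' = ip s \<and> op s' = op s \<and> rg s' RMode = rg s RMode \<and>
    ar s' APar = PA r (e # TA) \<and> rg s' RCur = tgt e \<and> tm s' \<le> tm s + 22 + 20 * D \<and>
    (\<exists>i np' lg'. core k r j od s' np' Y (e # TA) lg' \<and> i \<le> D \<and>
      ext r i (del2 e np, X - {e, tw e}, e # TA, (e, 2) # lg) (np', Y, e # TA, lg'))) s"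
proof -
  note gd = goodD[OF g] and cd = coreD[OF c]
  let ?z = "tgt e" and ?W = "X - {e, tw e}"
  have Sn: "SS r TA \<subseteq> {..<n}" by (rule SS_less[OF gd(1,3,4)])
  have x: "x \<in> SS r TA" "x < n" using gd(7) Sn by auto
  note lx = LX_remove[OF gd(2) l x(2)]
  have eA: "e \<in> AR" using twclD(1)[OF gd(2) lx(2)] .
  note A = ARD[OF eA]
  have zN: "?z < N" "e < N" using A N by auto
  have gW: "good k r ?W (e # TA) (?z # x # \<pi>)" if "\<not> length TA + 2 < k"
    by (rule good_include[OF g k(1) lx(2,3) _ twcl_remove[OF gd(2) lx(2)]]) (use that in auto)
  have gr: "growth {r} (map pr (rev (e # TA)))" "set (e # TA) \<subseteq> AR"
  proof -
    have "good k r (drop_loops (SS r (e # TA)) ?W) (e # TA) (?z # x # \<pi>)"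
      by (rule good_include[OF g k(1) lx(2,3) _ twcl_drop_loops[OF twcl_remove[OF gd(2) lx(2)]]])
        (auto simp: drop_loops_def)
    then show "growth {r} (map pr (rev (e # TA)))" "set (e # TA) \<subseteq> AR" using goodD(3,4) by blast+
  qed
  let ?rest = "B (Put APar RZ RE) ;; If (Lt RSz RK) (B (Get RA ANext RZ) ;; chord_loop) Skip"
  have eq: "wp N branch_edge Q s \<longleftrightarrow> wp N (add_edge 2) (wp N ?rest Q) s" for Q
    by (simp add: branch_edge_def)
  show ?thesis
    unfolding eq
  proof (rule wp_mono[OF wp_add_edge[OF c lx(2) s(1) N]])
    fix s1 :: st
    assume s1: "core k r j od s1 (del2 e np) ?W (e # TA) ((e, 2) # lg) \<and> rg s1 RCur = rg s RZ \<and>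
      (\<forall>Q. Q \<notin> {RT1, RT2, RT3, RT4, RLp, RSz, RCur} \<longrightarrow> rg s1 Q = rg s Q) \<and>
      (\<forall>A. A \<notin> {ANext, APrev, ALogE, ALogK, ATree} \<longrightarrow> ar s1 A = ar s A) \<and>
      ip s1 = ip s \<and> op s1 = op s \<and> tm s1 = tm s + 18"
    note cd1 = coreD[OF conjunct1[OF s1]]
    let ?s2 = "s1\<lparr>ar := (ar s1)(APar := PA r (e # TA)), tm := tm s1 + 2\<rparr>"
    have c2: "core k r j od ?s2 (del2 e np) ?W (e # TA) ((e, 2) # lg)"
      using conjunct1[OF s1] by (simp add: core_def)
    have PAe: "(ar s1 APar)(?z := e) = PA r (e # TA)" using s1 s(3) by simp
    show "wp N ?rest (\<lambda>s'. ip s' = ip s \<and> op s' = op s \<and> rg s' RMode = rg s RMode \<and>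
    ar s' APar = PA r (e # TA) \<and> rg s' RCur = tgt e \<and> tm s' \<le> tm s + 22 + 20 * D \<and>
    (\<exists>i np' lg'. core k r j od s' np' Y (e # TA) lg' \<and> i \<le> D \<and>
      ext r i (del2 e np, ?W, e # TA, (e, 2) # lg) (np', Y, e # TA, lg'))) s1"
    proof (cases "length TA + 2 < k")
      case False
      have q: "wp N ?rest Q s1 \<longleftrightarrow> Q ?s2" for Q
        using s1 s zN cd1(3,6) False PAe
        by (simp add: tick_def eval_nat_numeral del: PA.simps)
      have YW: "Y = ?W" using Y False by simp
      have "core k r j od ?s2 (del2 e np) Y (e # TA) ((e, 2) # lg) \<and> 0 \<le> D \<and>
        ext r 0 (del2 e np, ?W, e # TA, (e, 2) # lg) (del2 e np, Y, e # TA, (e, 2) # lg)"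
        unfolding YW using c2 ext_0 by blast
      then have ex: "\<exists>i np' lg'. core k r j od ?s2 np' Y (e # TA) lg' \<and> i \<le> D \<and>
        ext r i (del2 e np, ?W, e # TA, (e, 2) # lg) (np', Y, e # TA, lg')" by blast
      show ?thesis unfolding q
        by (intro conjI) (use s1 s ex in \<open>simp_all only: st.simps, simp_all\<close>)
    next
      case True
      let ?s3 = "?s2\<lparr>rg := (rg s1)(RA := fst (del2 e np) ?z), tm := tm s1 + 3\<rparr>"
      have c3: "core k r j od ?s3 (del2 e np) ?W (e # TA) ((e, 2) # lg)"
        using c2 by (simp add: core_def del: PA.simps)
      have eq3: "wp N ?rest Q s1 \<longleftrightarrow> wp N chord_loop Q ?s3" for Q
        using s1 s zN cd1(3,6,8) True PAe
        by (simp add: tick_def eval_nat_numeral del: PA.simps)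
      have S: "SS r (e # TA) = vs (ar ?s3 APar)"
        using vs_PA[OF gd(1) gr(2,1)] by simp
      have nl: "src a = ?z \<or> tgt a = ?z"
        if "a \<in> ?W" "src a \<in> SS r (e # TA)" "tgt a \<in> SS r (e # TA)" for a
        using that gd(9)[of a] k(1) by auto
      have Dle: "card {a \<in> ?W. src a = ?z} \<le> D"
        unfolding D using True twclD(3)[OF gd(2)] by (auto intro!: card_mono)
      have YW: "Y = drop_loops (SS r (e # TA)) ?W" using Y True by simp
      have zS: "?z \<in> SS r (e # TA)" by simp
      have cl: "rg ?s3 RZ = ?z" "rg ?s3 RA = fst (del2 e np) ?z" using s1 s(2) by simp_all
      note w = wp_chord_loop[OF c3 A(4) cl S N]
      show ?thesis
        unfolding eq3
      proof (rule wp_mono[OF w], goal_cases)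
        case (1 a)
        then show ?case by (rule nl)
      next
        case 2
        then show ?case by (rule zS)
      next
        case (3 s')
        then obtain i np' lg' where i: "core k r j od s' np' Y (e # TA) lg'"
          "ext r i (del2 e np, ?W, e # TA, (e, 2) # lg) (np', Y, e # TA, lg')"
          "i \<le> card {a \<in> ?W. src a = ?z}" unfolding YW by blast
        have "i \<le> D" using i(3) Dle by simp
        moreover have "tm s' \<le> tm s + 22 + 20 * D" using 3 Dle s1 by simp
        moreover have "ip s' = ip s" "op s' = op s" "rg s' RMode = rg s RMode"
          "ar s' APar = PA r (e # TA)" "rg s' RCur = ?z"
          using 3 s1 s(2) by (simp_all del: PA.simps)
        ultimately show ?case using i(1,2) by blast
      qed
    qed
  qed (use k in auto)
qed

text \<open>The coefficient 150 of \<open>k\<close> covers 7 for loading the stack, 36 for the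
  search besides its scanned arcs, 90 for the run of forced edges and 11 for resetting the
  marks.\<close>

lemma wp_search_phase:
  assumes c: "core k r j od s np X TA lg" and g: "good k r X TA \<pi>" and N: "n + 2 * m \<le> N"
    and k: "2 \<le> k" "length TA + 1 < k" "k \<le> n"
    and s: "ar s APar = PA r TA" "rg s RCur = hd \<pi>"
    and P: "P = dfs k X (Z X \<pi>) (PA r TA)" and ne: "sol k r X TA \<noteq> {}"
  shows "wp N (search_init ;; search_loop ;; B (Cst RX 1) ;; forward_loop ;; clear_marks)
    (\<lambda>s'. ip s' = ip s \<and> op s' = op s \<and> rg s' RMode = rg s RMode \<and>
    (\<exists>i np' X' TA' \<pi>' lg'. core k r j od s' np' X' TA' lg' \<and> ext r i (np, X, TA, lg) (np', X', TA', lg') \<and>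
      good k r X' TA' \<pi>' \<and> rg s' RCur = hd \<pi>' \<and> sol k r X TA = sol k r X' TA' \<and>
      length TA' = length TA + i \<and> length TA' + 1 \<le> k \<and> ar s' APar = PA r TA' \<and>
      card (inside X (vs P)) \<le> card (inside X' (vs P)) + 2 * i \<and>
      tm s' \<le> tm s + 18 * card (inside X (vs P)) + 150 * k + 20 \<and>
      (length TA' + 1 < k \<longrightarrow> P = dfs k X' (Z X' \<pi>') (PA r TA') \<and>
        (\<exists>x \<rho> e l. \<pi>' = x # \<rho> \<and> LX X' x = e # l \<and> P (tgt e) \<noteq> e \<and> rg s' RE = e \<and> rg s' RZ = tgt e)))) s" (is "wp N _ ?Q s")
proof -
  note gd = goodD[OF g] and cd = coreD[OF c]
  have full: "card (vs P) = k"
    using dfs_large[OF gd(1-4) set_Z[OF g] k(1) _ P] k(2) ne by simp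
  have kn: "Suc (length TA) \<le> n" "Suc (length TA) \<le> k" using k by auto
  have plen: "length \<pi> \<le> k" using path_bounds(3)[OF g] k(2) by simp
  show ?thesis
    unfolding wp_Seq
  proof (rule wp_mono[OF wp_search_init[OF c g kn(1) s N]])
    fix s1 :: st
    assume s1: "(\<forall>R. R \<notin> {RU, RSp, RT1, RCnt, RVp} \<longrightarrow> rg s1 R = rg s R) \<and>
    (\<forall>A. A \<noteq> AStk \<longrightarrow> ar s1 A = ar s A) \<and> ip s1 = ip s \<and> op s1 = op s \<and>
    rg s1 RCnt = Suc (length TA) \<and> rg s1 RVp = 0 \<and> rg s1 RSp = length \<pi> \<and>
    arrl (ar s1 AStk) (map (snd np) \<pi>) \<and> tm s1 \<le> tm s + 7 * length \<pi> + 7"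
    have c1: "core k r j od s1 np X TA lg"
      by (rule core_cong[OF c]) (use s1 in \<open>auto simp: core_regs_def core_arrs_def\<close>)
    show "wp N search_loop (wp N (B (Cst RX 1)) (wp N forward_loop (wp N clear_marks ?Q))) s1"
    proof (rule wp_mono[OF wp_search_loop[OF c1 g N kn(2) k(3) _ _ _ _ _ P full]])
      fix s2 :: st
      assume s2: "(\<forall>R. R \<notin> {RCnt, RVp, RSp, RA, RT1, RT2, RT3} \<longrightarrow> rg s2 R = rg s1 R) \<and>
    (\<forall>A. A \<notin> {AStk, APar, AVis} \<longrightarrow> ar s2 A = ar s1 A) \<and> ip s2 = ip s1 \<and> op s2 = op s1 \<and>
    ar s2 APar = P \<and>
    (\<exists>qs. growth (SS r TA) (map pr qs) \<and> set qs \<subseteq> X \<and> (\<forall>v. v \<notin> tgt ` set qs \<longrightarrow> P v = PA r TA v) \<and>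
      Suc (length TA) + length qs = k \<and> vs P = SS r TA \<union> tgt ` set qs \<and>
      rg s2 RVp = length qs \<and> arrl (ar s2 AVis) (map tgt qs)) \<and>
    tm s2 \<le> tm s1 + 18 * (card (inside X (vs P)) + 2 * k) + 1"
      then obtain qs where qs: "growth (SS r TA) (map pr qs)" "set qs \<subseteq> X"
        "\<And>v. v \<notin> tgt ` set qs \<Longrightarrow> P v = PA r TA v" "Suc (length TA) + length qs = k"
        "rg s2 RVp = length qs" "arrl (ar s2 AVis) (map tgt qs)" by blast
      let ?s2 = "s2\<lparr>rg := (rg s2)(RX := 1), tm := Suc (tm s2)\<rparr>"
      have c2: "core k r j od ?s2 np X TA lg"
        by (rule core_cong[OF c1]) (use s2 in \<open>auto simp: core_regs_def core_arrs_def\<close>)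
      have par2: "ar ?s2 APar = P" using s2 by simp
      have cur2: "rg ?s2 RCur = hd \<pi>" using s1 s2 s(2) by simp
      have F: "wp N clear_marks ?Q s3"
        if s3: "(\<forall>R. R \<notin> {RT1, RT2, RT3, RT4, RLp, RSz, RCur, RE, RZ, RX} \<longrightarrow> rg s3 R = rg ?s2 R) \<and>
    (\<forall>A. A \<notin> {ANext, APrev, ALogE, ALogK, ATree} \<longrightarrow> ar s3 A = ar ?s2 A) \<and> ip s3 = ip ?s2 \<and> op s3 = op ?s2 \<and>
    (\<exists>i np' X' TA' \<pi>' lg'. core k r j od s3 np' X' TA' lg' \<and> ext r i (np, X, TA, lg) (np', X', TA', lg') \<and>
      good k r X' TA' \<pi>' \<and> rg s3 RCur = hd \<pi>' \<and> sol k r X TA = sol k r X' TA' \<and>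
      length TA' = length TA + i \<and> SS r TA \<subseteq> SS r TA' \<and> length TA' + 1 \<le> k \<and>
      card (inside X (vs P)) \<le> card (inside X' (vs P)) + 2 * i \<and>
      tm s3 \<le> tm ?s2 + 30 * (length \<pi> + 2 * i) + 1 \<and>
      (length TA' + 1 < k \<longrightarrow> P = dfs k X' (Z X' \<pi>') (PA r TA') \<and>
        (\<exists>x \<rho> e l. \<pi>' = x # \<rho> \<and> LX X' x = e # l \<and> P (tgt e) \<noteq> e \<and> rg s3 RE = e \<and> rg s3 RZ = tgt e)))"
        for s3 :: st
      proof -
        from s3 obtain i np' X' TA' \<pi>' lg' where *: "core k r j od s3 np' X' TA' lg'"
          "ext r i (np, X, TA, lg) (np', X', TA', lg')"
          "good k r X' TA' \<pi>'" "rg s3 RCur = hd \<pi>'" "sol k r X TA = sol k r X' TA'"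
          "length TA' = length TA + i" "SS r TA \<subseteq> SS r TA'" "length TA' + 1 \<le> k"
          "card (inside X (vs P)) \<le> card (inside X' (vs P)) + 2 * i"
          "tm s3 \<le> tm ?s2 + 30 * (length \<pi> + 2 * i) + 1"
          "length TA' + 1 < k \<longrightarrow> P = dfs k X' (Z X' \<pi>') (PA r TA') \<and>
          (\<exists>x \<rho> e l. \<pi>' = x # \<rho> \<and> LX X' x = e # l \<and> P (tgt e) \<noteq> e \<and> rg s3 RE = e \<and> rg s3 RZ = tgt e)"
          by blast
        note c3 = coreD[OF *(1)] and g3 = goodD[OF *(3)]
        have vl: "set (map tgt qs) \<subseteq> {..<n}" "length (map tgt qs) \<le> n" "SS r TA \<inter> set (map tgt qs) = {}"
          using qs(2,4) ARD(4) twclD(1)[OF gd(2)] k(3) growth_heads[OF qs(1)] unfolding heads_pr by auto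
        have fr: "rg s3 RVp = length (map tgt qs)" "arrl (ar s3 AVis) (map tgt qs)" "ar s3 APar = P"
          using s3 s2 qs(5,6) by auto
        have l': "length TA' < n" using *(8) k(3) by simp
        show ?thesis
        proof (rule wp_mono[OF wp_clear_marks[where TA = TA and TA' = TA' and r = r and vl = "map tgt qs"]])
          fix s4 :: st
          assume s4: "(\<forall>R. R \<notin> {RI, RT1, RT2} \<longrightarrow> rg s4 R = rg s3 R) \<and>
            (\<forall>A. A \<noteq> APar \<longrightarrow> ar s4 A = ar s3 A) \<and> ip s4 = ip s3 \<and> op s4 = op s3 \<and>
            ar s4 APar = PA r TA' \<and> tm s4 = tm s3 + 4 * length (map tgt qs) + 7 * length TA' + 4"
          have c4: "core k r j od s4 np' X' TA' lg'"
            by (rule core_cong[OF *(1)]) (use s4 in \<open>auto simp: core_regs_def core_arrs_def\<close>)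
          have tm4: "tm s4 \<le> tm s + 18 * card (inside X (vs P)) + 150 * k + 20"
            using s1 s2 s4 *(6,8,10) qs(4) plen by simp
          have 5: "ip s4 = ip s" "op s4 = op s" "rg s4 RMode = rg s RMode" "rg s4 RCur = hd \<pi>'"
            "ar s4 APar = PA r TA'" "rg s4 RE = rg s3 RE" "rg s4 RZ = rg s3 RZ"
            using s1 s2 s3 s4 *(4) by simp_all
          have last: "length TA' + 1 < k \<longrightarrow> P = dfs k X' (Z X' \<pi>') (PA r TA') \<and>
            (\<exists>x \<rho> e l. \<pi>' = x # \<rho> \<and> LX X' x = e # l \<and> P (tgt e) \<noteq> e \<and> rg s4 RE = e \<and> rg s4 RZ = tgt e)"
            using *(11) unfolding 5 .
          show "?Q s4"
            apply (rule conjI[OF 5(1)], rule conjI[OF 5(2)], rule conjI[OF 5(3)])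
            apply (rule exI[of _ i], rule exI[of _ np'], rule exI[of _ X'], rule exI[of _ TA'],
              rule exI[of _ \<pi>'], rule exI[of _ lg'])
            apply (intro conjI)
            apply (fact c4 *(2) *(3) 5(4) *(5) *(6) *(8) 5(5) *(9) tm4 last)+
            done
        qed (use c3 g3 fr vl l' N *(7) qs(3) PA_root[OF gd(1,3,4)] in simp_all)
      qed
      show "wp N (B (Cst RX 1)) (wp N forward_loop (wp N clear_marks ?Q)) s2"
        using wp_mono[OF wp_forward_loop[OF c2 g N k(2,3) par2 cur2 _ P full] F] by (simp del: One_nat_def)
    qed (use s1 s cd in simp_all)
  qed
qed

end

section \<open>The recursion behind the main loop\<close>

text \<open>Reachability between the loop heads of the main loop. It allows the flat loop to be cut
  where a recursive call would begin and end; \<open>rch_wp\<close> joins the pieces again.\<close>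

inductive rch :: "nat \<Rightarrow> st \<Rightarrow> st \<Rightarrow> bool" for N where
  rch_refl: "rch N s s"
| rch_step: "holds (Pos RMode) s \<Longrightarrow> run N enum_body (tick s) s1 \<Longrightarrow> rch N s1 s2 \<Longrightarrow> rch N s s2"

lemma rch_trans: "rch N s s1 \<Longrightarrow> rch N s1 s2 \<Longrightarrow> rch N s s2"
  by (induction rule: rch.induct) (auto intro: rch_step)

lemma rch_wp: "rch N s s1 \<Longrightarrow> wp N enum_loop Q s1 \<Longrightarrow> wp N enum_loop Q s"
proof (induction rule: rch.induct)
  case (rch_step s s1 s2)
  then have "wp N enum_body (wp N enum_loop Q) (tick s)"
    by (subst wp_def) blast
  then show ?case unfolding enum_loop_def using rch_step(1) by (subst wp_While) simp
qed

lemma rch_body: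
  "0 < rg s RMode \<Longrightarrow> wp N enum_body Q (tick s) \<Longrightarrow> \<exists>s1. rch N s s1 \<and> Q s1"
proof -
  assume a: "0 < rg s RMode" "wp N enum_body Q (tick s)"
  then obtain s1 where "run N enum_body (tick s) s1" "Q s1" by (auto simp: wp_def)
  moreover have "holds (Pos RMode) s" using a(1) by simp
  ultimately show ?thesis using rch_step[OF _ _ rch_refl] by blast
qed

lemma encode_output_append: "encode_output (xs @ ys) = encode_output xs @ encode_output ys"
  by (simp add: encode_output_def)

context arcs
begin

text \<open>\<open>seg\<close> and \<open>bck\<close> are the interface of the hidden recursion: a
  call begins in a \<open>seg\<close> configuration and returns in a \<open>bck\<close>
  configuration with the same links, live arcs, tree and log.\<close>

definition bck where
  "bck k r j od s np X TA lg \<longleftrightarrow> core k r j od s np X TA lg \<and> ar s APar = PA r TA \<and> rg s RMode = 2"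

definition seg where
  "seg k r j od s np X TA lg \<pi> \<longleftrightarrow> core k r j od s np X TA lg \<and> good k r X TA \<pi> \<and>
     ar s APar = PA r TA \<and> rg s RCur = hd \<pi> \<and> rg s RMode = 1"

lemma pop_entry:
  assumes c: "core k r j od s (del2 e np) (X - {e, tw e}) TA' ((e, kd) # lg)" "ar s APar = PA r TA'"
    "rg s RMode = 2"
    and l: "links np X" "twcl X" "e \<in> X" and N: "n + 2 * m \<le> N"
    and k: "kd = 0 \<and> TA' = TA \<or> (kd = 1 \<or> kd = 2) \<and> TA' = e # TA \<and> PA r TA (tgt e) = 0"
  shows "\<exists>s'. rch N s s' \<and> ip s' = ip s \<and> op s' = op s \<and> ar s' APar = PA r TA \<and> tm s' \<le> tm s + 39 \<and>
    (if kd = 2 then core k r j od s' (del2 e np) (X - {e, tw e}) TA ((e, 0) # lg) \<and> rg s' RMode = 1 \<and>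
       rg s' RCur = src e
     else core k r j od s' np X TA lg \<and> rg s' RMode = 2)"
proof -
  let ?s = "(tick s)\<lparr>rg := (rg s)(RT1 := 1), tm := tm s + 4\<rparr>"
  have c': "core k r j od ?s (del2 e np) (X - {e, tw e}) TA' ((e, kd) # lg)"
    by (rule core_cong[OF c(1)]) (auto simp: core_regs_def)
  have eq: "wp N enum_body Q (tick s) \<longleftrightarrow> wp N backtrack Q ?s" for Q
    using c(3) by (simp add: enum_body_def tick_def eval_nat_numeral)
  have "length lg < N" using coreD(18)[OF c(1)] N by simp
  note w = wp_backtrack[OF c' l N this k]
  have "wp N enum_body (\<lambda>s'. ip s' = ip s \<and> op s' = op s \<and> ar s' APar = PA r TA \<and> tm s' \<le> tm s + 39 \<and>
    (if kd = 2 then core k r j od s' (del2 e np) (X - {e, tw e}) TA ((e, 0) # lg) \<and> rg s' RMode = 1 \<and>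
       rg s' RCur = src e
     else core k r j od s' np X TA lg \<and> rg s' RMode = 2)) (tick s)"
    unfolding eq by (rule wp_mono[OF w]) (use c(2,3) in \<open>auto split: if_splits\<close>)
  from rch_body[OF _ this] c(3) show ?thesis by simp
qed

text \<open>The entries of an extension have kind 0 or 1 and leave nothing to explore, so all of
  them are undone at 39 ticks each without any output.\<close>

lemma pop_ext:
  assumes "ext r i c c'" "c = (np, X, TA, lg)" "c' = (np', X', TA', lg')"
    "bck k r j od s np' X' TA' lg'" "n + 2 * m \<le> N"
  shows "\<exists>s'. rch N s s' \<and> ip s' = ip s \<and> op s' = op s \<and> bck k r j od s' np X TA lg \<and> tm s' \<le> tm s + 39 * i"
  using assms
proof (induction arbitrary: s np' X' TA' lg' rule: ext.induct)
  case (ext_0 c)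
  then show ?case using rch_refl[of N s] by (intro exI[of _ s]) simp
next
  case (ext_Suc i c np1 X1 TA1 lg1 e kd TA2)
  have b: "core k r j od s (del2 e np1) (X1 - {e, tw e}) TA2 ((e, kd) # lg1)" "ar s APar = PA r TA2"
    "rg s RMode = 2" using ext_Suc.prems(2,3) by (auto simp: bck_def)
  have kd: "kd = 0 \<and> TA2 = TA1 \<or> (kd = 1 \<or> kd = 2) \<and> TA2 = e # TA1 \<and> PA r TA1 (tgt e) = 0" "kd \<noteq> 2"
    using ext_Suc.hyps(5) by auto
  from pop_entry[OF b ext_Suc.hyps(2-4) assms(5) kd(1)] kd(2)
  obtain s1 where s1: "rch N s s1" "ip s1 = ip s" "op s1 = op s" "bck k r j od s1 np1 X1 TA1 lg1"
    "tm s1 \<le> tm s + 39" unfolding bck_def by auto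
  from ext_Suc.IH[OF ext_Suc.prems(1) refl s1(4) assms(5)]
  obtain s2 where s2: "rch N s1 s2" "ip s2 = ip s1" "op s2 = op s1" "bck k r j od s2 np X TA lg"
    "tm s2 \<le> tm s1 + 39 * i" by blast
  have "tm s2 \<le> tm s + 39 * Suc i" using s1(5) s2(5) by simp
  then show ?case using rch_trans[OF s1(1) s2(1)] s1 s2 by auto
qed

lemma wp_leaf:
  assumes c: "core k r j od s np X TA lg" and k: "length TA + 1 = k" "k \<le> n" and TA: "set TA \<subseteq> AR"
    and N: "n + 2 * m \<le> N"
  shows "wp N (If (Lt RSz RK) branch_edge (B (Cst RI 1) ;; print_loop ;; B (Cst RMode 2)))
    (\<lambda>s'. core k r j od s' np X TA lg \<and> ar s' APar = ar s APar \<and> rg s' RMode = 2 \<and> ip s' = ip s \<and>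
      op s' = op s @ encode_output [map pr (rev TA)] \<and> tm s' \<le> tm s + 10 * k + 4) s"
proof -
  note cd = coreD[OF c]
  let ?s = "(tick s)\<lparr>rg := (rg s)(RI := 1), tm := tm s + 2\<rparr>"
  have eq: "wp N (If (Lt RSz RK) branch_edge (B (Cst RI 1) ;; print_loop ;; B (Cst RMode 2))) Q s \<longleftrightarrow>
    wp N print_loop (wp N (B (Cst RMode 2)) Q) ?s" for Q
    using cd(3,6) k(1) by (simp add: tick_def eval_nat_numeral)
  have enc: "concat (map (\<lambda>a. [src a, tgt a]) (rev TA)) = encode_output [map pr (rev TA)]"
    by (simp add: encode_output_def pr_def o_def)
  have l: "length TA < n" using k by simp
  show ?thesis
    unfolding eq
  proof (rule wp_mono[OF wp_print_loop[OF _ _ _ _ _ TA l N]], goal_cases)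
    case (6 s')
    have "core k r j od (upd (Cst RMode 2) s') np X TA lg"
      by (rule core_cong[OF c]) (use 6 in \<open>auto simp: core_regs_def\<close>)
    then show ?case using 6 k enc by simp
  qed (use cd in simp_all)
qed

text \<open>What a run of forced edges achieves, independently of whether it ends in a complete tree
  or in a branching.\<close>

definition phase where
  "phase k r s s' np X TA lg i np' X' TA' lg' \<longleftrightarrow> ip s' = ip s \<and> ext r i (np, X, TA, lg) (np', X', TA', lg') \<and> i \<le> k \<and>
    sol k r X TA = sol k r X' TA' \<and> length TA \<le> length TA' \<and> set TA' \<subseteq> AR \<and> growth {r} (map pr (rev TA')) \<and>
    card X' \<le> card X"

text \<open>In \<open>s'\<close> the side with \<open>e\<close> has already been entered.
  \<open>j'\<close> is the number of chords deleted on the way; its bound pays for restoring them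
  later.\<close>

definition fork where
  "fork k r j od s s' np' X' TA' lg' x \<rho> e j' np1 Y lg1 \<longleftrightarrow> e \<in> X' \<and> src e = x \<and> PA r TA' (tgt e) = 0 \<and>
       sol k r X' TA' = sol k r Y (e # TA') \<union> sol k r (X' - {e, tw e}) TA' \<and>
       sol k r Y (e # TA') \<inter> sol k r (X' - {e, tw e}) TA' = {} \<and>
       sol k r Y (e # TA') \<noteq> {} \<and> sol k r (X' - {e, tw e}) TA' \<noteq> {} \<and>
       good k r (X' - {e, tw e}) TA' (x # \<rho>) \<and> card Y < card X' \<and>
       ext r j' (del2 e np', X' - {e, tw e}, e # TA', (e, 2) # lg') (np1, Y, e # TA', lg1) \<and>
       seg k r j od s' np1 Y (e # TA') lg1 (tgt e # x # \<rho>) \<and>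
       j' \<le> card (sol k r Y (e # TA')) + 2 * k \<and>
       tm s' \<le> tm s + 400 * (card (sol k r Y (e # TA')) + k)"

text \<open>One iteration of the main loop in the downward mode either completes a solution, or finds an edge
  \<open>e\<close> such that there are solutions with and without \<open>e\<close>. In the second case its cost is charged to
  the solutions with \<open>e\<close>.\<close>

lemma descend_step:
  assumes s: "seg k r j od s np X TA lg \<pi>" and N: "n + 2 * m \<le> N" and k: "2 \<le> k" "k \<le> n" "length TA + 1 \<le> k"
    and ne: "sol k r X TA \<noteq> {}"
  shows "\<exists>s'. rch N s s' \<and> (\<exists>i np' X' TA' lg'. phase k r s s' np X TA lg i np' X' TA' lg' \<and>
    (length TA' + 1 = k \<and> bck k r j od s' np' X' TA' lg' \<and>
       op s' = op s @ encode_output [map pr (rev TA')] \<and> tm s' \<le> tm s + 300 * k \<or>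
     length TA' + 1 < k \<and> op s' = op s \<and> links np' X' \<and> twcl X' \<and>
     (\<exists>x \<rho> e j' np1 Y lg1. fork k r j od s s' np' X' TA' lg' x \<rho> e j' np1 Y lg1)))"
proof -
  have c: "core k r j od s np X TA lg" and g: "good k r X TA \<pi>" and par: "ar s APar = PA r TA"
    and cur: "rg s RCur = hd \<pi>" and mode: "rg s RMode = 1" using s by (auto simp: seg_def)
  note cd = coreD[OF c] and gd = goodD[OF g]
  let ?s = "(tick s)\<lparr>rg := (rg s)(RT1 := 0), tm := tm s + 4\<rparr>"
  have cs: "core k r j od (tick ?s) np X TA lg"
    by (rule core_cong[OF c]) (auto simp: core_regs_def)
  let ?leaf = "If (Lt RSz RK) branch_edge (B (Cst RI 1) ;; print_loop ;; B (Cst RMode 2))"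
  let ?ph = "search_init ;; search_loop ;; B (Cst RX 1) ;; forward_loop ;; clear_marks"
  have eq: "wp N enum_body Q (tick s) \<longleftrightarrow>
    (if length TA + 1 < k then wp N ?ph (wp N ?leaf Q) (tick ?s) else wp N ?leaf Q (tick ?s))" for Q
    using mode cd(3,6) by (simp add: enum_body_def descend_def tick_def eval_nat_numeral)
  define Post where "Post s' \<longleftrightarrow> (\<exists>i np' X' TA' lg'. phase k r s s' np X TA lg i np' X' TA' lg' \<and>
    (length TA' + 1 = k \<and> bck k r j od s' np' X' TA' lg' \<and>
       op s' = op s @ encode_output [map pr (rev TA')] \<and> tm s' \<le> tm s + 300 * k \<or>
     length TA' + 1 < k \<and> op s' = op s \<and> links np' X' \<and> twcl X' \<and>
     (\<exists>x \<rho> e j' np1 Y lg1. fork k r j od s s' np' X' TA' lg' x \<rho> e j' np1 Y lg1)))" for s'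
  have "wp N enum_body Post (tick s)"
  proof (cases "length TA + 1 < k")
    case False
    then have l: "length TA + 1 = k" using k(3) by simp
    have "wp N ?leaf Post (tick ?s)"
    proof (rule wp_mono[OF wp_leaf[OF cs l k(2) gd(3) N]])
      fix s'
      assume s': "core k r j od s' np X TA lg \<and> ar s' APar = ar (tick ?s) APar \<and> rg s' RMode = 2 \<and>
        ip s' = ip (tick ?s) \<and> op s' = op (tick ?s) @ encode_output [map pr (rev TA)] \<and>
        tm s' \<le> tm (tick ?s) + 10 * k + 4"
      then have "bck k r j od s' np X TA lg" "ip s' = ip s" "op s' = op s @ encode_output [map pr (rev TA)]"
        "tm s' \<le> tm s + 300 * k"
        using par k(1) by (simp_all add: bck_def)
      moreover have "phase k r s s' np X TA lg 0 np X TA lg"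
        unfolding phase_def using \<open>ip s' = ip s\<close> gd(3,4) ext_0[of r "(np, X, TA, lg)"] by simp
      ultimately show "Post s'"
        unfolding Post_def using l by blast
    qed
    then show ?thesis unfolding eq using False by simp
  next
    case lt: True
    define P where "P = dfs k X (Z X \<pi>) (PA r TA)"
    have full: "card (vs P) = k"
      using dfs_large[OF gd(1-4) set_Z[OF g] k(1) _ P_def] k(3) ne by simp
    have par': "ar (tick ?s) APar = PA r TA" "rg (tick ?s) RCur = hd \<pi>" using par cur by simp_all
    have "wp N ?ph (wp N ?leaf Post) (tick ?s)"
    proof (rule wp_mono[OF wp_search_phase[OF cs g N k(1) lt k(2) par' P_def ne]])
      fix s4
      assume s4: "ip s4 = ip (tick ?s) \<and> op s4 = op (tick ?s) \<and> rg s4 RMode = rg (tick ?s) RMode \<and>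
        (\<exists>i np' X' TA' \<pi>' lg'. core k r j od s4 np' X' TA' lg' \<and> ext r i (np, X, TA, lg) (np', X', TA', lg') \<and>
      good k r X' TA' \<pi>' \<and> rg s4 RCur = hd \<pi>' \<and> sol k r X TA = sol k r X' TA' \<and>
      length TA' = length TA + i \<and> length TA' + 1 \<le> k \<and> ar s4 APar = PA r TA' \<and>
      card (inside X (vs P)) \<le> card (inside X' (vs P)) + 2 * i \<and>
      tm s4 \<le> tm (tick ?s) + 18 * card (inside X (vs P)) + 150 * k + 20 \<and>
      (length TA' + 1 < k \<longrightarrow> P = dfs k X' (Z X' \<pi>') (PA r TA') \<and>
        (\<exists>x \<rho> e l. \<pi>' = x # \<rho> \<and> LX X' x = e # l \<and> P (tgt e) \<noteq> e \<and> rg s4 RE = e \<and> rg s4 RZ = tgt e)))"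
      then obtain i np' X' TA' \<pi>' lg' where *: "core k r j od s4 np' X' TA' lg'"
        "ext r i (np, X, TA, lg) (np', X', TA', lg')"
        "good k r X' TA' \<pi>'" "rg s4 RCur = hd \<pi>'" "sol k r X TA = sol k r X' TA'"
        "length TA' = length TA + i" "length TA' + 1 \<le> k" "ar s4 APar = PA r TA'"
        "card (inside X (vs P)) \<le> card (inside X' (vs P)) + 2 * i"
        "tm s4 \<le> tm (tick ?s) + 18 * card (inside X (vs P)) + 150 * k + 20"
        "length TA' + 1 < k \<longrightarrow> P = dfs k X' (Z X' \<pi>') (PA r TA') \<and>
        (\<exists>x \<rho> e l. \<pi>' = x # \<rho> \<and> LX X' x = e # l \<and> P (tgt e) \<noteq> e \<and> rg s4 RE = e \<and> rg s4 RZ = tgt e)"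
        by blast
      note g' = goodD[OF *(3)] and cd' = coreD[OF *(1)]
      have fr: "ip s4 = ip s" "op s4 = op s" "rg s4 RMode = 1" using s4 mode by simp_all
      have tm4: "tm s4 \<le> tm s + 18 * card (inside X (vs P)) + 150 * k + 25" using *(10) by simp
      have ik: "i \<le> k" "length TA \<le> length TA'" using *(6,7) by auto
      have "card X' \<le> card X"
      proof -
        have "ext r i c c' \<Longrightarrow> finite (fst (snd c)) \<Longrightarrow> fst (snd c') \<subseteq> fst (snd c)" for i c c'
          by (induction rule: ext.induct) auto
        from this[OF *(2)] show ?thesis using twclD(3)[OF gd(2)] by (auto intro: card_mono)
      qed
      then have common: "phase k r s s' np X TA lg i np' X' TA' lg'" if "ip s' = ip s" for s' :: st
        unfolding phase_def using that *(2,5) ik g'(3,4) by simp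
      show "wp N ?leaf Post s4"
      proof (cases "length TA' + 1 < k")
        case False
        then have l: "length TA' + 1 = k" using *(7) by simp
        have "card (sol k r X TA) = 1"
          using sol_full[OF gd(1) g'(3,4) l, of X'] ne unfolding *(5) by simp
        then have ins: "card (inside X (vs P)) \<le> 2 * (1 + k)"
          using count_inside[OF g lt k(1) P_def full] by simp
        show ?thesis
        proof (rule wp_mono[OF wp_leaf[OF *(1) l k(2) g'(3) N]])
          fix s'
          assume s': "core k r j od s' np' X' TA' lg' \<and> ar s' APar = ar s4 APar \<and> rg s' RMode = 2 \<and>
            ip s' = ip s4 \<and> op s' = op s4 @ encode_output [map pr (rev TA')] \<and> tm s' \<le> tm s4 + 10 * k + 4"
          have "tm s' \<le> tm s + 300 * k" using s' tm4 ins k(1) by simp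
          moreover have "bck k r j od s' np' X' TA' lg'" "ip s' = ip s"
            "op s' = op s @ encode_output [map pr (rev TA')]"
            using s' fr *(8) by (simp_all add: bck_def)
          ultimately show "Post s'" unfolding Post_def using common l by blast
        qed
      next
        case lt': True
        then obtain x \<rho> e l where x: "\<pi>' = x # \<rho>" "LX X' x = e # l" "P (tgt e) \<noteq> e" "rg s4 RE = e"
          "rg s4 RZ = tgt e" and P': "P = dfs k X' (Z X' (x # \<rho>)) (PA r TA')"
          using *(11) by blast
        define YY where "YY = drop_loops (SS r (e # TA')) (X' - {e, tw e})"
        note b = branch[OF *(3)[unfolded x(1)] lt' k(1) P' full x(2,3) YY_def]
        have xS: "x \<in> SS r TA'" "x < n" using g'(7) x(1) SS_less[OF g'(1,3,4)] by auto
        note lx = LX_remove[OF g'(2) x(2) xS(2)]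
        have new: "PA r TA' (tgt e) = 0"
          using PA_outside g'(9)[OF lx(2) lt'] lx(3) xS(1) by blast
        note split = sol_split[OF *(3) lt' lx(2)]
        define Y where "Y = (if length TA' + 2 < k then YY else X' - {e, tw e})"
        define D where "D = (if length TA' + 2 < k then card {a \<in> X'. src a = tgt e} else 0)"
        have solY: "sol k r Y (e # TA') = sol k r YY (e # TA')" using b(3) by (simp add: Y_def)
        have gY: "good k r Y (e # TA') (tgt e # x # \<rho>)"
        proof (cases "length TA' + 2 < k")
          case True
          then show ?thesis using b(5) by (simp add: Y_def)
        next
          case False
          then show ?thesis unfolding Y_def
            using good_include[OF *(3)[unfolded x(1)] lt' lx(2,3) _ twcl_remove[OF g'(2) lx(2)]] by auto
        qed
        have Dle: "D \<le> card (sol k r Y (e # TA')) + 2 * k"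
          using b(7) solY by (auto simp: D_def)
        have cY: "card Y < card X'"
        proof (rule psubset_card_mono)
          show "finite X'" by (rule twclD(3)[OF g'(2)])
          have "Y \<subseteq> X' - {e, tw e}" by (auto simp: Y_def YY_def drop_loops_def)
          then show "Y \<subset> X'" using lx(2) by blast
        qed
        have c5: "core k r j od (tick s4) np' X' TA' lg'" using *(1) by (simp add: core_tick)
        have s5: "rg (tick s4) RE = e" "rg (tick s4) RZ = tgt e" "ar (tick s4) APar = PA r TA'"
          using x *(8) by simp_all
        have eq4: "wp N ?leaf Post s4 \<longleftrightarrow> wp N branch_edge Post (tick s4)"
          using cd'(3,6) lt' by simp
        show ?thesis
          unfolding eq4
        proof (rule wp_mono[OF wp_branch_edge[OF c5 *(3)[unfolded x(1)] N lt' k(2) x(2) s5 Y_def[unfolded YY_def] D_def]])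
          fix s'
          assume s': "ip s' = ip (tick s4) \<and> op s' = op (tick s4) \<and> rg s' RMode = rg (tick s4) RMode \<and>
            ar s' APar = PA r (e # TA') \<and> rg s' RCur = tgt e \<and> tm s' \<le> tm (tick s4) + 22 + 20 * D \<and>
            (\<exists>i np1 lg1. core k r j od s' np1 Y (e # TA') lg1 \<and> i \<le> D \<and>
            ext r i (del2 e np', X' - {e, tw e}, e # TA', (e, 2) # lg') (np1, Y, e # TA', lg1))"
          then obtain j' np1 lg1 where j': "core k r j od s' np1 Y (e # TA') lg1" "j' \<le> D"
            "ext r j' (del2 e np', X' - {e, tw e}, e # TA', (e, 2) # lg') (np1, Y, e # TA', lg1)" by blast
          have sg: "seg k r j od s' np1 Y (e # TA') lg1 (tgt e # x # \<rho>)"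
            unfolding seg_def using j'(1) gY s' fr by (simp del: PA.simps)
          \<comment> \<open>With \<open>N\<close> solutions that include \<open>e\<close>, at most
            \<open>2 * N + 6 * k\<close> arcs cost 18 ticks each and at most
            \<open>N + 2 * k\<close> arcs cost 20 each; together with \<open>150 * k\<close> and
            constants, which are absorbed by \<open>k \<ge> 2\<close>, this is below 400 per
            unit.\<close>
          have t: "tm s' \<le> tm s + 400 * (card (sol k r Y (e # TA')) + k)"
            using s' tm4 *(9) b(6)[folded solY] ik(1) Dle k(1) by simp
          have sp: "sol k r X' TA' = sol k r Y (e # TA') \<union> sol k r (X' - {e, tw e}) TA'"
            "sol k r Y (e # TA') \<inter> sol k r (X' - {e, tw e}) TA' = {}"
            using split lx(3) xS(1) b(3) solY by auto
          have neY: "sol k r Y (e # TA') \<noteq> {}" using b(2) solY by simp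
          have ex: "\<exists>x \<rho> e j' np1 Y lg1. fork k r j od s s' np' X' TA' lg' x \<rho> e j' np1 Y lg1"
            apply (rule exI[of _ x], rule exI[of _ \<rho>], rule exI[of _ e], rule exI[of _ j'],
              rule exI[of _ np1], rule exI[of _ Y], rule exI[of _ lg1])
            apply (unfold fork_def)
            apply (intro conjI)
            apply (fact lx(2,3) new sp neY b(1,4) cY j'(3) sg order.trans[OF j'(2) Dle] t)+
            done
          have io: "ip s' = ip s" "op s' = op s" using s' fr by simp_all
          show "Post s'"
            unfolding Post_def using common[OF io(1)] lt' io(2) cd'(16,17) ex by blast
        qed
      qed
    qed
    then show ?thesis unfolding eq using lt by simp
  qed
  from rch_body[OF _ this] mode obtain s' where "rch N s s'" "Post s'" by auto
  then show ?thesis unfolding Post_def by (intro exI[of _ s'] conjI)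
qed


definition lists_sol :: "nat \<Rightarrow> nat \<Rightarrow> nat set \<Rightarrow> nat list \<Rightarrow> (nat \<times> nat) list list \<Rightarrow> bool" where
  "lists_sol k r X TA Ts \<longleftrightarrow> (\<forall>T\<in>set Ts. length T = k - 1) \<and> distinct (map edge_set Ts) \<and>
     set (map edge_set Ts) = sol k r X TA"

text \<open>In the time bound, a solution pays \<open>1000 * k\<close> once, and 500 for each tree edge that was added in
  a branching; the negative term absorbs the cost of the branchings that depends on \<open>k\<close>.\<close>

lemma enum_rec:
  assumes "seg k r j od s np X TA lg \<pi>" "n + 2 * m \<le> N" "2 \<le> k" "k \<le> n" "length TA + 1 \<le> k"
    "sol k r X TA \<noteq> {}"
  shows "\<exists>s' Ts. rch N s s' \<and> bck k r j od s' np X TA lg \<and> ip s' = ip s \<and>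
    op s' = op s @ encode_output Ts \<and> lists_sol k r X TA Ts \<and>
    tm s' + 600 * k \<le> tm s + (1000 * k + 500 * (k - length TA)) * card (sol k r X TA)"
  using assms
proof (induction "card X" arbitrary: s np X TA lg \<pi> rule: less_induct)
  case less
  note N = less.prems(2) and k = less.prems(3-5) and ne = less.prems(6)
  from descend_step[OF less.prems]
  obtain s1 i np' X' TA' lg' where rch1: "rch N s s1" and ph: "phase k r s s1 np X TA lg i np' X' TA' lg'" and
    alt: "length TA' + 1 = k \<and> bck k r j od s1 np' X' TA' lg' \<and>
       op s1 = op s @ encode_output [map pr (rev TA')] \<and> tm s1 \<le> tm s + 300 * k \<or>
     length TA' + 1 < k \<and> op s1 = op s \<and> links np' X' \<and> twcl X' \<and>
     (\<exists>x \<rho> e j' np1 Y lg1. fork k r j od s s1 np' X' TA' lg' x \<rho> e j' np1 Y lg1)"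
    by blast
  have 1: "rch N s s1" "ip s1 = ip s"
    "ext r i (np, X, TA, lg) (np', X', TA', lg')" "i \<le> k"
    "sol k r X TA = sol k r X' TA'" "length TA \<le> length TA'" "set TA' \<subseteq> AR"
    "growth {r} (map pr (rev TA'))" "card X' \<le> card X"
    using rch1 ph unfolding phase_def by blast+
  have r: "r < n" using less.prems(1) by (simp add: seg_def good_def)
  from alt show ?case
  proof (elim disjE)
    assume a: "length TA' + 1 = k \<and> bck k r j od s1 np' X' TA' lg' \<and>
       op s1 = op s @ encode_output [map pr (rev TA')] \<and> tm s1 \<le> tm s + 300 * k"
    then have l: "length TA' + 1 = k" and b: "bck k r j od s1 np' X' TA' lg'" by blast+
    from pop_ext[OF 1(3) refl refl b N] obtain s2 where s2: "rch N s1 s2" "ip s2 = ip s1"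
      "op s2 = op s1" "bck k r j od s2 np X TA lg" "tm s2 \<le> tm s1 + 39 * i" by blast
    have sol: "sol k r X TA = {ed ` set TA'}"
      using sol_full[OF r 1(7,8) l, of X'] ne unfolding 1(5) by simp
    have "lists_sol k r X TA [map pr (rev TA')]"
      unfolding lists_sol_def sol using l by (simp add: edge_set_pr del: set_map)
    \<comment> \<open>Completing the tree takes \<open>300 * k\<close> and undoing the run
      \<open>39 * k\<close>; even with the surplus of \<open>600 * k\<close> this is within the
      \<open>1000 * k\<close> of the one solution.\<close>
    moreover have "tm s2 + 600 * k \<le> tm s + (1000 * k + 500 * (k - length TA)) * card (sol k r X TA)"
      using s2(5) a 1(4) sol by simp
    ultimately show ?case
      using rch_trans[OF 1(1) s2(1)] s2(2,3,4) a 1(2)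
      by (intro exI[of _ s2] exI[of _ "[map pr (rev TA')]"]) simp
  next
    assume a: "length TA' + 1 < k \<and> op s1 = op s \<and> links np' X' \<and> twcl X' \<and>
     (\<exists>x \<rho> e j' np1 Y lg1. fork k r j od s s1 np' X' TA' lg' x \<rho> e j' np1 Y lg1)"
    then have lt: "length TA' + 1 < k" and op1: "op s1 = op s" and lk: "links np' X'" "twcl X'" by blast+
    from a obtain x \<rho> e j' np1 Y lg1 where
      fork: "fork k r j od s s1 np' X' TA' lg' x \<rho> e j' np1 Y lg1" by blast
    have e: "e \<in> X'" "src e = x" "PA r TA' (tgt e) = 0"
      and sp: "sol k r X' TA' = sol k r Y (e # TA') \<union> sol k r (X' - {e, tw e}) TA'"
       "sol k r Y (e # TA') \<inter> sol k r (X' - {e, tw e}) TA' = {}"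
      and neI: "sol k r Y (e # TA') \<noteq> {}" and neX: "sol k r (X' - {e, tw e}) TA' \<noteq> {}"
      and gX: "good k r (X' - {e, tw e}) TA' (x # \<rho>)" and cY: "card Y < card X'"
      and ex: "ext r j' (del2 e np', X' - {e, tw e}, e # TA', (e, 2) # lg') (np1, Y, e # TA', lg1)"
      and sg: "seg k r j od s1 np1 Y (e # TA') lg1 (tgt e # x # \<rho>)"
      and j': "j' \<le> card (sol k r Y (e # TA')) + 2 * k"
      and t1: "tm s1 \<le> tm s + 400 * (card (sol k r Y (e # TA')) + k)"
      using fork unfolding fork_def by - (elim conjE, assumption)+
    let ?W = "X' - {e, tw e}"
    let ?NI = "card (sol k r Y (e # TA'))" and ?NX = "card (sol k r ?W TA')"
    have cW: "card ?W < card X'" using card_remove[OF lk(2) e(1)] by simp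
    have "length (e # TA') + 1 \<le> k" using lt by simp
    from less.hyps[OF _ sg N k(1,2) this neI] cY 1(9)
    obtain s2 Ts1 where s2: "rch N s1 s2" "bck k r j od s2 np1 Y (e # TA') lg1" "ip s2 = ip s1"
      "op s2 = op s1 @ encode_output Ts1" "lists_sol k r Y (e # TA') Ts1"
      "tm s2 + 600 * k \<le> tm s1 + (1000 * k + 500 * (k - length (e # TA'))) * ?NI" by auto
    from pop_ext[OF ex refl refl s2(2) N] obtain s3 where s3: "rch N s2 s3" "ip s3 = ip s2"
      "op s3 = op s2" "bck k r j od s3 (del2 e np') ?W (e # TA') ((e, 2) # lg')"
      "tm s3 \<le> tm s2 + 39 * j'" by blast
    have b3: "core k r j od s3 (del2 e np') ?W (e # TA') ((e, 2) # lg')" "ar s3 APar = PA r (e # TA')"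
      "rg s3 RMode = 2" using s3(4) by (simp_all add: bck_def del: PA.simps)
    have kd: "(2::nat) = 0 \<and> e # TA' = TA' \<or> ((2::nat) = 1 \<or> (2::nat) = 2) \<and> e # TA' = e # TA' \<and> PA r TA' (tgt e) = 0"
      using e(3) by simp
    \<comment> \<open>The entry of kind 2 is replaced by one of kind 0, and the call without
      \<open>e\<close> begins.\<close>
    from pop_entry[OF b3 lk e(1) N kd]
    obtain s4 where s4: "rch N s3 s4" "ip s4 = ip s3" "op s4 = op s3" "ar s4 APar = PA r TA'"
      "tm s4 \<le> tm s3 + 39" "core k r j od s4 (del2 e np') ?W TA' ((e, 0) # lg')" "rg s4 RMode = 1"
      "rg s4 RCur = src e" by auto
    have sg4: "seg k r j od s4 (del2 e np') ?W TA' ((e, 0) # lg') (x # \<rho>)"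
      unfolding seg_def using s4 gX e(2) by simp
    have "length TA' + 1 \<le> k" using lt by simp
    from less.hyps[OF _ sg4 N k(1,2) this neX] cW 1(9)
    obtain s5 Ts2 where s5: "rch N s4 s5" "bck k r j od s5 (del2 e np') ?W TA' ((e, 0) # lg')" "ip s5 = ip s4"
      "op s5 = op s4 @ encode_output Ts2" "lists_sol k r ?W TA' Ts2"
      "tm s5 + 600 * k \<le> tm s4 + (1000 * k + 500 * (k - length TA')) * ?NX" by auto
    have b5: "core k r j od s5 (del2 e np') ?W TA' ((e, 0) # lg')" "ar s5 APar = PA r TA'"
      "rg s5 RMode = 2" using s5(2) by (simp_all add: bck_def)
    from pop_entry[OF b5 lk e(1) N, of TA']
    obtain s6 where s6: "rch N s5 s6" "ip s6 = ip s5" "op s6 = op s5" "bck k r j od s6 np' X' TA' lg'"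
      "tm s6 \<le> tm s5 + 39" unfolding bck_def by auto
    from pop_ext[OF 1(3) refl refl s6(4) N] obtain s7 where s7: "rch N s6 s7" "ip s7 = ip s6"
      "op s7 = op s6" "bck k r j od s7 np X TA lg" "tm s7 \<le> tm s6 + 39 * i" by blast
    have reach: "rch N s s7"
      by (rule rch_trans[OF 1(1) rch_trans[OF s2(1) rch_trans[OF s3(1) rch_trans[OF s4(1)
        rch_trans[OF s5(1) rch_trans[OF s6(1) s7(1)]]]]]])
    have out: "op s7 = op s @ encode_output (Ts1 @ Ts2)"
      using s2(4) s3(3) s4(3) s5(4) s6(3) s7(3) op1 by (simp add: encode_output_append)
    have inp: "ip s7 = ip s" using 1(2) s2(3) s3(2) s4(2) s5(3) s6(2) s7(2) by simp
    have ls: "lists_sol k r X TA (Ts1 @ Ts2)"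
      using s2(5) s5(5) sp unfolding lists_sol_def 1(5) by auto
    have card: "card (sol k r X TA) = ?NI + ?NX"
      unfolding 1(5) sp(1) using sp(2) finite_sol by (intro card_Un_disjoint) auto
    define a where "a = k - length TA"
    have "k - length (e # TA') + 1 \<le> a" "k - length TA' \<le> a" using 1(6) lt by (auto simp: a_def)
    then have "(1000 * k + 500 * (k - length (e # TA'))) * ?NI + 500 * ?NI \<le> (1000 * k + 500 * a) * ?NI"
      "(1000 * k + 500 * (k - length TA')) * ?NX \<le> (1000 * k + 500 * a) * ?NX"
    proof -
      assume h: "k - length (e # TA') + 1 \<le> a" "k - length TA' \<le> a"
      have "(1000 * k + 500 * (k - length (e # TA'))) * ?NI + 500 * ?NI =
        (1000 * k + 500 * (k - length (e # TA') + 1)) * ?NI" by (simp add: algebra_simps)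
      also have "\<dots> \<le> (1000 * k + 500 * a) * ?NI" using h(1) by (intro mult_right_mono) auto
      finally show "(1000 * k + 500 * (k - length (e # TA'))) * ?NI + 500 * ?NI \<le> (1000 * k + 500 * a) * ?NI" .
      show "(1000 * k + 500 * (k - length TA')) * ?NX \<le> (1000 * k + 500 * a) * ?NX"
        using h(2) by (intro mult_right_mono) auto
    qed
    note h = this
    \<comment> \<open>Both calls return a surplus of \<open>600 * k\<close>. One is passed on; the
      other pays \<open>400 * k\<close> for the branching, \<open>78 * k\<close> for restoring
      chords, \<open>39 * k\<close> for the forced edges and 78 for the two entries of
      \<open>e\<close>. The \<open>439 * NI\<close> ticks proportional to the solutions with
      \<open>e\<close> fit into the 500 that each of them releases because its tree is
      longer.\<close>
    have "t7 + 600 * k \<le> t + qI + qX"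
      if "pI + 500 * NI \<le> qI" "pX \<le> qX" "t1 \<le> t + 400 * (NI + k)" "t2 + 600 * k \<le> t1 + pI"
        "t3 \<le> t2 + 39 * j'" "t4 \<le> t3 + 39" "t5 + 600 * k \<le> t4 + pX" "t6 \<le> t5 + 39" "t7 \<le> t6 + 39 * i"
        "i \<le> k" "j' \<le> NI + 2 * k" for pI qI pX qX NI t t1 t2 t3 t4 t5 t6 t7 :: nat
    proof -
      have "t3 \<le> t2 + 39 * NI + 78 * k" using that(5,11) by simp
      then have "t4 + 600 * k \<le> t + pI + 439 * NI + 478 * k + 39" using that(3,4,6) by simp
      then have "t4 + 122 * k \<le> t + qI + 39" using that(1) by simp
      then have "t6 + 722 * k \<le> t + qI + qX + 78" using that(2,7,8) by simp
      then show ?thesis using that(9,10) k(1) by simp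
    qed
    from this[OF h t1 s2(6) s3(5) s4(5) s5(6) s6(5) s7(5) 1(4) j']
    have "tm s7 + 600 * k \<le> tm s + (1000 * k + 500 * a) * ?NI + (1000 * k + 500 * a) * ?NX" .
    then have "tm s7 + 600 * k \<le> tm s + (1000 * k + 500 * (k - length TA)) * card (sol k r X TA)"
      unfolding card a_def by (simp add: algebra_simps)
    then show ?case using reach s7(4) inp out ls by blast
  qed
qed

end

section \<open>The loop over the roots\<close>

definition clear_root :: com where
  "clear_root = B (Get RA ANext RRoot) ;;
     While (Neq RA RRoot) (del_edge RA ;; B (Get RA ANext RRoot))"

text \<open>When \<open>i\<close> vertices are left, \<open>RJ\<close> is \<open>i + 1\<close>; the loop stops when fewer than \<open>k\<close> vertices are left.\<close>

definition root_loop :: com where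
  "root_loop = While (Lt RK RJ)
     (B (Dec RJ) ;; B (Mov RX RJ) ;; B (Dec RX) ;; B (Get RRoot AOrd RX) ;;
      B (Cst RT1 1) ;; B (Put APar RRoot RT1) ;; B (Cst RSz 1) ;; B (Cst RLp 0) ;; B (Mov RCur RRoot) ;;
      B (Cst RMode 1) ;; enum_loop ;; B (Put APar RRoot Zero) ;; clear_root)"

context arcs
begin

text \<open>At the tree without edges, the price of a solution is \<open>1000 * k + 500 * k\<close>.
  The surplus of \<open>enum_rec\<close> pays for the last iteration, which finds the log
  empty.\<close>

lemma wp_enum_loop:
  assumes s: "seg k r j od s np X [] [] [r]" and N: "n + 2 * m \<le> N" and k: "2 \<le> k" "k \<le> n"
    and ne: "sol k r X [] \<noteq> {}"
  shows "wp N enum_loop (\<lambda>s'. core k r j od s' np X [] [] \<and> ar s' APar = PA r [] \<and> ip s' = ip s \<and>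
    (\<exists>Ts. op s' = op s @ encode_output Ts \<and> lists_sol k r X [] Ts) \<and>
    tm s' \<le> tm s + 1500 * k * card (sol k r X [])) s" (is "wp N _ ?Q s")
proof -
  have "length ([] :: nat list) + 1 \<le> k" using k by simp
  from enum_rec[OF s N k this ne] obtain s1 Ts where s1: "rch N s s1" "bck k r j od s1 np X [] []"
    "ip s1 = ip s" "op s1 = op s @ encode_output Ts" "lists_sol k r X [] Ts"
    "tm s1 + 600 * k \<le> tm s + (1000 * k + 500 * (k - length ([] :: nat list))) * card (sol k r X [])" by blast
  have b: "core k r j od s1 np X [] []" "ar s1 APar = PA r []" "rg s1 RMode = 2"
    using s1(2) by (auto simp: bck_def)
  let ?s2 = "(tick (tick s1))\<lparr>rg := (rg s1)(RT1 := 1, RMode := 0), tm := tm s1 + 6\<rparr>"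
  have eq: "wp N enum_body Q (tick s1) \<longleftrightarrow> Q ?s2" for Q
    using b(3) coreD(7)[OF b(1)]
    by (simp add: enum_body_def backtrack_def tick_def eval_nat_numeral)
  have c2: "core k r j od (tick ?s2) np X [] []"
    by (rule core_cong[OF b(1)]) (auto simp: core_regs_def)
  have "wp N enum_loop ?Q s1"
    unfolding enum_loop_def
    apply (subst wp_While)
    using b(3)
    apply (simp only: holds.simps if_True eq)
    apply (subst wp_While)
    using c2 b(2) s1(3-6) k(1)
    apply (auto simp: algebra_simps)
    done
  then show ?thesis by (rule rch_wp[OF s1(1)])
qed

text \<open>The cardinality on the left makes the bound a potential: arcs removed with a root never
  return, so all roots together spend O(m) here.\<close>

lemma wp_clear_root:
  assumes r: "r < n" "rg s0 RRoot = r" and l: "links np0 X0" "twcl X0"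
    and s0: "ar s0 ANext = fst np0" "ar s0 APrev = snd np0" "ar s0 ATwin = tw" and N: "n + 2 * m \<le> N"
  shows "wp N clear_root (\<lambda>s. (\<forall>R. R \<notin> {RA, RT1, RT2, RT3} \<longrightarrow> rg s R = rg s0 R) \<and>
    (\<forall>A. A \<notin> {ANext, APrev} \<longrightarrow> ar s A = ar s0 A) \<and> ip s = ip s0 \<and> op s = op s0 \<and>
    links (ar s ANext, ar s APrev) {a \<in> X0. src a \<noteq> r \<and> tgt a \<noteq> r} \<and>
    twcl {a \<in> X0. src a \<noteq> r \<and> tgt a \<noteq> r} \<and>
    tm s + 20 * card {a \<in> X0. src a \<noteq> r \<and> tgt a \<noteq> r} \<le> tm s0 + 20 * card X0 + 2) s0"
proof -
  define F where "F s \<longleftrightarrow> (\<forall>R. R \<notin> {RA, RT1, RT2, RT3} \<longrightarrow> rg s R = rg s0 R) \<and>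
    (\<forall>A. A \<notin> {ANext, APrev} \<longrightarrow> ar s A = ar s0 A) \<and> ip s = ip s0 \<and> op s = op s0" for s :: st
  define J where "J s X \<longleftrightarrow> X \<subseteq> X0 \<and> (\<forall>a\<in>X0 - X. src a = r \<or> tgt a = r) \<and> twcl X \<and>
    links (ar s ANext, ar s APrev) X \<and> rg s RA = ar s ANext r \<and> tm s + 20 * card X \<le> tm s0 + 20 * card X0 + 1"
    for s :: st and X
  define M where "M = tm s0 + 20 * card X0 + 2"
  let ?s = "s0\<lparr>rg := (rg s0)(RA := ar s0 ANext r), tm := Suc (tm s0)\<rparr>"
  have eq: "wp N clear_root Q s0 \<longleftrightarrow> wp N (While (Neq RA RRoot) (del_edge RA ;; B (Get RA ANext RRoot))) Q ?s" for Q
    unfolding clear_root_def using r N by simp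
  have "wp N (While (Neq RA RRoot) (del_edge RA ;; B (Get RA ANext RRoot)))
    (\<lambda>s. F s \<and> links (ar s ANext, ar s APrev) {a \<in> X0. src a \<noteq> r \<and> tgt a \<noteq> r} \<and>
    twcl {a \<in> X0. src a \<noteq> r \<and> tgt a \<noteq> r} \<and>
    tm s + 20 * card {a \<in> X0. src a \<noteq> r \<and> tgt a \<noteq> r} \<le> tm s0 + 20 * card X0 + 2) ?s"
  proof (rule wp_while_inv[where I = "\<lambda>s. F s \<and> (\<exists>X. J s X)" and f = "\<lambda>s. M - tm s"])
    have "J ?s X0" using l s0 by (simp add: J_def)
    then show "F ?s \<and> (\<exists>X. J ?s X)" by (auto simp: F_def)
  next
    fix s assume "F s \<and> (\<exists>X. J s X)" and stop: "\<not> holds (Neq RA RRoot) s"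
    then obtain X where F: "F s" and J: "J s X" by blast
    have "rg s RRoot = r" using F r(2) by (simp add: F_def)
    then have "ar s ANext r = r" using J stop by (simp add: J_def)
    then have nil: "LX X r = []"
      using J links_first[of "(ar s ANext, ar s APrev)" X r] r(1) LX_mem[OF r(1), of _ X] ARD(1)
      unfolding J_def by (cases "LX X r") (auto, force)
    have tX: "twcl X" using J by (simp add: J_def)
    have none: "src a \<noteq> r" if "a \<in> X" for a
      using that set_LX[OF tX r(1)] nil by auto
    have none2: "tgt a \<noteq> r" if "a \<in> X" for a
      using none[OF twclD(2)[OF tX that]] ARD(9)[OF twclD(1)[OF tX that]] by simp
    have XX: "X = {a \<in> X0. src a \<noteq> r \<and> tgt a \<noteq> r}"
      using J none none2 unfolding J_def by blast
    show "F (tick s) \<and> links (ar (tick s) ANext, ar (tick s) APrev) {a \<in> X0. src a \<noteq> r \<and> tgt a \<noteq> r} \<and>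
    twcl {a \<in> X0. src a \<noteq> r \<and> tgt a \<noteq> r} \<and>
    tm (tick s) + 20 * card {a \<in> X0. src a \<noteq> r \<and> tgt a \<noteq> r} \<le> tm s0 + 20 * card X0 + 2"
      unfolding XX[symmetric] using F J by (simp add: F_def J_def)
  next
    fix s assume "F s \<and> (\<exists>X. J s X)" and go: "holds (Neq RA RRoot) s"
    then obtain X where F: "F s" and J: "J s X" by blast
    let ?np = "(ar s ANext, ar s APrev)"
    have lk: "links ?np X" "twcl X" "rg s RA = ar s ANext r" using J by (auto simp: J_def)
    have RR: "rg s RRoot = r" using F r(2) by (simp add: F_def)
    obtain a l where al: "LX X r = a # l"
      using links_first[OF lk(1) r(1)] go RR lk(3) by (cases "LX X r") auto
    have a: "a \<in> X" "src a = r" "rg s RA = a"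
      using al set_LX[OF lk(2) r(1)] links_first[OF lk(1) r(1)] lk(3) by auto
    have rN: "r < N" using r N by simp
    have tw': "ar s ATwin = tw" using F s0(3) by (simp add: F_def)
    have "wp N (del_edge RA) (wp N (B (Get RA ANext RRoot)) (\<lambda>s'. (F s' \<and> (\<exists>X. J s' X)) \<and> M - tm s' < M - tm s)) (tick s)"
    proof (rule wp_mono[OF wp_del_edge[OF lk(1,2) a(1)]])
      fix s1 :: st
      assume s1: "(\<forall>Q. Q \<notin> {RT1, RT2, RT3} \<longrightarrow> rg s1 Q = rg (tick s) Q) \<and>
        (\<forall>A. A \<notin> {ANext, APrev} \<longrightarrow> ar s1 A = ar (tick s) A) \<and> ar s1 ANext = fst (del2 a ?np) \<and>
        ar s1 APrev = snd (del2 a ?np) \<and> ip s1 = ip (tick s) \<and> op s1 = op (tick s) \<and> tm s1 = tm (tick s) + 9"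
      let ?s2 = "upd (Get RA ANext RRoot) s1"
      have "J ?s2 (X - {a, tw a})"
        unfolding J_def
        using J s1 RR a links_del2(1)[OF lk(1,2) a(1)] twcl_remove[OF lk(2) a(1)] card_remove[OF lk(2) a(1)]
          ARD(10)[OF twclD(1)[OF lk(2) a(1)]]
        by (auto simp: J_def)
      moreover have "F ?s2" using F s1 by (simp add: F_def)
      moreover have "tm s < M" using J by (simp add: J_def M_def)
      ultimately show "wp N (B (Get RA ANext RRoot)) (\<lambda>s'. (F s' \<and> (\<exists>X. J s' X)) \<and> M - tm s' < M - tm s) s1"
        using s1 RR rN by auto
    qed (use a tw' N in simp_all)
    then show "wp N (del_edge RA ;; B (Get RA ANext RRoot))
      (\<lambda>s'. (F s' \<and> (\<exists>X. J s' X)) \<and> M - tm s' < M - tm s) (tick s)" by simp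
  qed
  then show ?thesis unfolding eq
    by (rule wp_mono) (simp add: F_def)
qed

section \<open>The order of the roots\<close>

definition order_list :: "nat list \<Rightarrow> nat list" where
  "order_list qs = 0 # map tgt qs"

lemma order_props:
  assumes g: "growth {0} (map pr qs)" and q: "set qs \<subseteq> AR" "length qs = n - 1"
  shows "distinct (order_list qs)" "set (order_list qs) = {..<n}" "length (order_list qs) = n"
    and "\<And>j. Suc j < n \<Longrightarrow> src (qs ! j) \<in> set (take (Suc j) (order_list qs)) \<and> tgt (qs ! j) = order_list qs ! Suc j \<and> qs ! j \<in> AR"
proof -
  let ?os = "order_list qs"
  show len: "length ?os = n" using q n_pos by (simp add: order_list_def)
  have set_os: "set ?os = {0} \<union> heads (map pr qs)" unfolding heads_pr by (simp add: order_list_def)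
  have "card (set ?os) = length ?os"
    unfolding set_os using growth_card[OF g] by (simp add: order_list_def)
  then show "distinct ?os" by (rule card_distinct)
  have "set ?os \<subseteq> {..<n}" using q(1) ARD(4) n_pos by (auto simp: order_list_def)
  then show "set ?os = {..<n}"
    using card_subset_eq[of "{..<n}" "set ?os"] \<open>card (set ?os) = length ?os\<close> len by simp
  fix j assume j: "Suc j < n"
  then have jq: "j < length qs" using q by simp
  have "qs = take j qs @ qs ! j # drop (Suc j) qs" using jq by (simp add: id_take_nth_drop)
  then have "growth {0} (map pr (take j qs @ qs ! j # drop (Suc j) qs))" using g by simp
  then have "growth ({0} \<union> heads (map pr (take j qs))) (pr (qs ! j) # map pr (drop (Suc j) qs))"
    by (simp add: growth_append del: set_map)
  moreover have "pr (qs ! j) = (src (qs ! j), tgt (qs ! j))" by (simp add: pr_def)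
  ultimately have "src (qs ! j) \<in> {0} \<union> heads (map pr (take j qs))" by simp
  then have "src (qs ! j) \<in> set (take (Suc j) ?os)"
    unfolding heads_pr by (auto simp: order_list_def take_map)
  then show "src (qs ! j) \<in> set (take (Suc j) ?os) \<and> tgt (qs ! j) = ?os ! Suc j \<and> qs ! j \<in> AR"
    using jq q(1) nth_mem[OF jq] by (auto simp: order_list_def)
qed

text \<open>The parent of a vertex precedes it in the order of discovery, so every prefix of the
  order is connected. A closed set that contains the last vertex of the prefix climbs along twins of
  discovering arcs to vertex 0 (\<open>down\<close>) and from there covers the prefix
  (\<open>all\<close>).\<close>

lemma root_sol_nonempty:
  assumes g: "growth {0} (map pr qs)" "set qs \<subseteq> AR" "length qs = n - 1" and i: "2 \<le> k" "k \<le> i" "i \<le> n"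
  shows "sol k (order_list qs ! (i - 1)) (inside AR (set (take i (order_list qs)))) [] \<noteq> {}"
proof (rule sol_nonempty)
  let ?os = "order_list qs" let ?V = "set (take i ?os)" let ?X = "inside AR ?V"
  note o = order_props[OF g]
  show "?os ! (i - 1) < n" using o(2,3) i nth_mem[of "i - 1" ?os] by auto
  show "twcl ?X" using ARD by (auto simp: twcl_def inside_def)
  fix C assume C: "SS (?os ! (i - 1)) [] \<subseteq> C" "\<And>a. a \<in> ?X \<Longrightarrow> src a \<in> C \<Longrightarrow> tgt a \<in> C" "finite C"
  have q: "qs ! j \<in> ?X \<and> tw (qs ! j) \<in> ?X" if "Suc j < i" for j
  proof -
    have "src (qs ! j) \<in> set (take (Suc j) ?os)" "tgt (qs ! j) = ?os ! Suc j" and A: "qs ! j \<in> AR"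
      using o(4)[of j] that i(3) by auto
    moreover have "set (take (Suc j) ?os) \<subseteq> ?V" using that by (intro set_take_subset_set_take) simp
    moreover have "?os ! Suc j \<in> ?V" using that i(3) o(3) by (auto simp: in_set_conv_nth)
    ultimately show ?thesis using ARD[OF A] by (auto simp: inside_def)
  qed
  have down: "?os ! j \<in> C \<Longrightarrow> j < i \<Longrightarrow> ?os ! 0 \<in> C" for j
  proof (induction j rule: less_induct)
    case (less j)
    show ?case
    proof (cases j)
      case (Suc j')
      have A: "qs ! j' \<in> AR" and s: "src (qs ! j') \<in> set (take (Suc j') ?os)" and t: "tgt (qs ! j') = ?os ! j"
        using o(4)[of j'] less.prems(2) i(3) Suc by auto
      have "src (qs ! j') \<in> C"
        using C(2)[of "tw (qs ! j')"] q[of j'] less.prems Suc t ARD(9,10)[OF A] by auto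
      moreover obtain j'' where "j'' < Suc j'" "src (qs ! j') = ?os ! j''"
        using s by (auto simp: in_set_conv_nth)
      ultimately show ?thesis using less.IH[of j''] Suc less.prems(2) by auto
    qed (use less in simp)
  qed
  have "?os ! (i - 1) \<in> C" using C(1) by (simp add: SS_def)
  then have zero: "?os ! 0 \<in> C" using down[of "i - 1"] i by simp
  have all: "j < i \<Longrightarrow> ?os ! j \<in> C" for j
  proof (induction j rule: less_induct)
    case (less j)
    show ?case
    proof (cases j)
      case (Suc j')
      have s: "src (qs ! j') \<in> set (take (Suc j') ?os)" and t: "tgt (qs ! j') = ?os ! j"
        using o(4)[of j'] less.prems i(3) Suc by auto
      obtain j'' where "j'' < Suc j'" "src (qs ! j') = ?os ! j''"
        using s by (auto simp: in_set_conv_nth)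
      then have "src (qs ! j') \<in> C" using less.IH[of j''] Suc less.prems by auto
      then show ?thesis using C(2)[of "qs ! j'"] q[of j'] less.prems Suc t by auto
    qed (use zero in simp)
  qed
  have "?V \<subseteq> C" using all by (auto simp: in_set_conv_nth)
  then have "card ?V \<le> card C" using C(3) by (rule card_mono[rotated])
  moreover have "card ?V = i" using o(1,3) i(3) by (simp add: distinct_card)
  ultimately show "k \<le> card C" using i(2) by simp
qed (use i in simp_all)

lemma sol_root:
  assumes "V \<subseteq> {..<n}"
  shows "sol k r (inside AR V) [] = {T \<in> k_subtrees (ed ` AR) k. \<Union>T \<subseteq> V \<and> r \<in> \<Union>T}"
proof -
  have "ed ` inside AR V = {f \<in> ed ` AR. f \<subseteq> V}"
    by (rule ed_inside) (simp add: twcl_def ARD(6))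
  then have "T \<subseteq> ed ` inside AR V \<longleftrightarrow> \<Union>T \<subseteq> V" if "T \<in> k_subtrees (ed ` AR) k" for T
    using that by (auto simp: k_subtrees_def)
  then show ?thesis unfolding sol_def sols_def SS_def by auto
qed

lemma wp_root_loop:
  assumes g: "growth {0} (map pr qs)" "set qs \<subseteq> AR" "length qs = n - 1" and k: "2 \<le> k" "k \<le> n"
    and N: "n + 2 * m \<le> N"
    and od: "\<And>i. i < n \<Longrightarrow> od i = order_list qs ! i"
    and s0: "rg s0 Zero = 0" "rg s0 RN = n" "rg s0 RK = k" "rg s0 RJ = Suc n"
      "links (ar s0 ANext, ar s0 APrev) AR" "ar s0 AHead = tgt" "ar s0 ATwin = tw" "ar s0 AOrd = od"
      "ar s0 APar = (\<lambda>_. 0)"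
  shows "wp N root_loop (\<lambda>s. \<exists>Ts. op s = op s0 @ encode_output Ts \<and>
    (\<forall>T\<in>set Ts. length T = k - 1) \<and> distinct (map edge_set Ts) \<and>
    set (map edge_set Ts) = k_subtrees (ed ` AR) k \<and>
    tm s \<le> tm s0 + 20 * card AR + 20 * n + 1500 * k * card (k_subtrees (ed ` AR) k) + 1) s0" (is "wp N _ ?Q s0")
proof -
  let ?os = "order_list qs"
  note o = order_props[OF g]
  define V where "V i = set (take i ?os)" for i
  have Vn: "V i \<subseteq> {..<n}" for i unfolding V_def using o(2) set_take_subset[of i ?os] by auto
  define X where "X i = inside AR (V i)" for i
  have tX: "twcl (X i)" for i using ARD by (auto simp: X_def twcl_def inside_def)
  \<comment> \<open>A subtree is listed at the root that comes last in the order among its vertices.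
    So when \<open>i\<close> vertices are left, exactly the subtrees not contained in the first
    \<open>i\<close> vertices have been listed.\<close>
  define K where "K i = {T \<in> k_subtrees (ed ` AR) k. \<not> \<Union>T \<subseteq> V i}" for i
  have finK: "finite (K i)" for i
    unfolding K_def using finite_k_subtrees[of "ed ` AR" k] finite_AR by auto
  define Ls where "Ls i Ts \<longleftrightarrow> (\<forall>T\<in>set Ts. length T = k - 1) \<and> distinct (map edge_set Ts) \<and>
    set (map edge_set Ts) = K i" for i Ts
  define J where "J s i Ts \<longleftrightarrow> rg s Zero = 0 \<and> rg s RN = n \<and> rg s RK = k \<and> rg s RJ = Suc i \<and>
      links (ar s ANext, ar s APrev) (X i) \<and> ar s AHead = tgt \<and> ar s ATwin = tw \<and> ar s AOrd = od \<and>
      ar s APar = (\<lambda>_. 0) \<and> k - 1 \<le> i \<and> i \<le> n \<and> op s = op s0 @ encode_output Ts \<and> Ls i Ts \<and>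
      tm s + 20 * card (X i) + 20 * i \<le> tm s0 + 20 * card AR + 20 * n + 1500 * k * card (K i)"
    for s :: st and i Ts
  have Kfinal: "K (k - 1) = k_subtrees (ed ` AR) k"
  proof -
    have "\<not> \<Union>T \<subseteq> V (k - 1)" if "T \<in> k_subtrees (ed ` AR) k" for T
    proof
      assume "\<Union>T \<subseteq> V (k - 1)"
      then have "card (\<Union>T) \<le> card (V (k - 1))" by (intro card_mono) (auto simp: V_def)
      also have "\<dots> \<le> k - 1" unfolding V_def using card_length[of "take (k - 1) ?os"] by simp
      finally show False using that k(1) by (auto simp: k_subtrees_def)
    qed
    then show ?thesis by (auto simp: K_def)
  qed
  show ?thesis
    unfolding root_loop_def
  proof (rule wp_while_inv[where I = "\<lambda>s. \<exists>i Ts. J s i Ts" and f = "\<lambda>s. rg s RJ"])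
    have "X n = AR"
    proof -
      have "V n = {..<n}" using o(2,3) by (simp add: V_def)
      then show ?thesis using ARD(3,4) by (auto simp: X_def inside_def)
    qed
    moreover have "K n = {}"
    proof -
      have "\<Union>T \<subseteq> V n" if "T \<in> k_subtrees (ed ` AR) k" for T
      proof -
        have "T \<subseteq> ed ` AR" using that by (simp add: k_subtrees_def)
        then have "\<Union>T \<subseteq> {..<n}" using ARD(3,4) by (fastforce simp: ed_def)
        then show ?thesis using o(2,3) by (simp add: V_def)
      qed
      then show ?thesis by (auto simp: K_def)
    qed
    ultimately have "J s0 n []" using s0 k by (simp add: J_def Ls_def encode_output_def)
    then show "\<exists>i Ts. J s0 i Ts" by blast
  next
    fix s assume "\<exists>i Ts. J s i Ts" and stop: "\<not> holds (Lt RK RJ) s"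
    then obtain i Ts where J: "J s i Ts" by blast
    have "i = k - 1" using J stop k by (auto simp: J_def)
    then show "?Q (tick s)"
      using J Kfinal by (intro exI[of _ Ts]) (simp add: J_def Ls_def)
  next
    fix s assume "\<exists>i Ts. J s i Ts" and go: "holds (Lt RK RJ) s"
    then obtain i0 Ts where J: "J s i0 Ts" by blast
    note j = J[unfolded J_def]
    obtain i where i: "i0 = Suc i" using j go k by (cases i0) auto
    have ik: "k \<le> Suc i" "Suc i \<le> n" using j go i by auto
    define r where "r = ?os ! i"
    have r: "od i = r" "r < n" using od[of i] ik o(2,3) nth_mem[of i ?os] by (auto simp: r_def)
    have Vs: "V (Suc i) = insert r (V i)" "r \<notin> V i"
    proof -
      show "V (Suc i) = insert r (V i)"
        using ik o(3) by (simp add: V_def r_def take_Suc_conv_app_nth)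
      have "distinct (take i ?os @ [r])"
        using distinct_take[OF o(1), of "Suc i"] ik o(3) by (simp add: r_def take_Suc_conv_app_nth)
      then show "r \<notin> V i" by (simp add: V_def)
    qed
    have ne: "sol k r (X (Suc i)) [] \<noteq> {}"
      using root_sol_nonempty[OF g k(1) ik] by (simp add: X_def V_def r_def)
    have sol: "sol k r (X (Suc i)) [] = {T \<in> k_subtrees (ed ` AR) k. \<Union>T \<subseteq> V (Suc i) \<and> r \<in> \<Union>T}"
      unfolding X_def by (rule sol_root[OF Vn])
    have Ksplit: "K i = K (Suc i) \<union> sol k r (X (Suc i)) []" "K (Suc i) \<inter> sol k r (X (Suc i)) [] = {}"
      unfolding sol K_def Vs(1) using Vs(2) by auto
    have Kcard: "card (K i) = card (K (Suc i)) + card (sol k r (X (Suc i)) [])"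
      unfolding Ksplit(1) using Ksplit(2) finK finite_sol by (intro card_Un_disjoint) auto
    have Xi: "{a \<in> X (Suc i). src a \<noteq> r \<and> tgt a \<noteq> r} = X i"
      unfolding X_def inside_def Vs(1) using Vs(2) by auto
    let ?np = "(ar s ANext, ar s APrev)"
    let ?s = "(tick s)\<lparr>rg := (rg s)(RJ := Suc i, RX := i, RT1 := 1, RRoot := r, RSz := 1, RLp := 0, RCur := r, RMode := 1),
      ar := (ar s)(APar := PA r []), tm := tm s + 11\<rparr>"
    have rN: "r < N" "i < N" using r ik N by auto
    have body: "wp N (B (Dec RJ) ;; B (Mov RX RJ) ;; B (Dec RX) ;; B (Get RRoot AOrd RX) ;;
      B (Cst RT1 1) ;; B (Put APar RRoot RT1) ;; B (Cst RSz 1) ;; B (Cst RLp 0) ;; B (Mov RCur RRoot) ;;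
      B (Cst RMode 1) ;; enum_loop ;; B (Put APar RRoot Zero) ;; clear_root) Q (tick s) \<longleftrightarrow>
      wp N enum_loop (wp N (B (Put APar RRoot Zero)) (wp N clear_root Q)) ?s" for Q
    proof -
      have "(rg s)(RJ := Suc i, RX := i, RRoot := r, RT1 := 1, RSz := 1, RLp := 0, RCur := r, RMode := 1) =
        (rg s)(RJ := Suc i, RX := i, RT1 := 1, RRoot := r, RSz := 1, RLp := 0, RCur := r, RMode := 1)"
        by (simp add: fun_upd_twist)
      then show ?thesis
        using j i rN r(1) by (simp add: tick_def eval_nat_numeral) (intro arg_cong[of _ _ "wp N enum_loop _"] st.equality; auto)
    qed
    have c: "core k r (Suc i) od ?s ?np (X (Suc i)) [] []"
    proof -
      have "card (X (Suc i)) \<le> 2 * m"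
        using card_mono[OF finite_AR, of "X (Suc i)"] card_AR tX[of "Suc i"] by (simp add: twcl_def)
      then show ?thesis using j i tX by (simp add: core_def)
    qed
    have gd: "good k r (X (Suc i)) [] [r]"
    proof -
      have "tgt a \<noteq> src a" if "a \<in> X (Suc i)" for a using ARD(5)[OF twclD(1)[OF tX that]] .
      then show ?thesis using r(2) tX by (auto simp: good_def SS_def)
    qed
    have sg: "seg k r (Suc i) od ?s ?np (X (Suc i)) [] [] [r]"
      unfolding seg_def using c gd by simp
    have "wp N enum_loop (wp N (B (Put APar RRoot Zero)) (wp N clear_root
      (\<lambda>s'. (\<exists>i Ts. J s' i Ts) \<and> rg s' RJ < rg s RJ))) ?s"
    proof (rule wp_mono[OF wp_enum_loop[OF sg N k ne]])
      fix s1 :: st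
      assume s1: "core k r (Suc i) od s1 ?np (X (Suc i)) [] [] \<and> ar s1 APar = PA r [] \<and> ip s1 = ip ?s \<and>
        (\<exists>Ts. op s1 = op ?s @ encode_output Ts \<and> lists_sol k r (X (Suc i)) [] Ts) \<and>
        tm s1 \<le> tm ?s + 1500 * k * card (sol k r (X (Suc i)) [])"
      note cd = coreD[OF conjunct1[OF s1]]
      obtain Ts1 where Ts1: "op s1 = op ?s @ encode_output Ts1" "lists_sol k r (X (Suc i)) [] Ts1" using s1 by blast
      let ?s2 = "s1\<lparr>ar := (ar s1)(APar := \<lambda>_. 0), tm := Suc (tm s1)\<rparr>"
      have PA0: "(PA r [])(r := 0) = (\<lambda>_. 0)" by auto
      have eq: "wp N (B (Put APar RRoot Zero)) Q s1 \<longleftrightarrow> Q ?s2" for Q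
        using cd(1,4) rN s1 PA0 by (simp del: PA.simps)
      have l2: "links (fst ?np, snd ?np) (X (Suc i))" using cd(16) by simp
      have ls: "Ls i (Ts @ Ts1)"
        using j i Ts1(2) Ksplit unfolding Ls_def lists_sol_def by auto
      show "wp N (B (Put APar RRoot Zero)) (wp N clear_root (\<lambda>s'. (\<exists>i Ts. J s' i Ts) \<and> rg s' RJ < rg s RJ)) s1"
        unfolding eq
      proof (rule wp_mono[OF wp_clear_root[OF r(2) _ cd(16) tX _ _ _ N]])
        fix s3 :: st
        assume s3: "(\<forall>R. R \<notin> {RA, RT1, RT2, RT3} \<longrightarrow> rg s3 R = rg ?s2 R) \<and>
          (\<forall>A. A \<notin> {ANext, APrev} \<longrightarrow> ar s3 A = ar ?s2 A) \<and> ip s3 = ip ?s2 \<and> op s3 = op ?s2 \<and>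
          links (ar s3 ANext, ar s3 APrev) {a \<in> X (Suc i). src a \<noteq> r \<and> tgt a \<noteq> r} \<and>
          twcl {a \<in> X (Suc i). src a \<noteq> r \<and> tgt a \<noteq> r} \<and>
          tm s3 + 20 * card {a \<in> X (Suc i). src a \<noteq> r \<and> tgt a \<noteq> r} \<le> tm ?s2 + 20 * card (X (Suc i)) + 2"
        have t: "tm s3 + 20 * card (X i) + 20 * i \<le> tm s0 + 20 * card AR + 20 * n + 1500 * k * card (K i)"
          using s3 s1 j i unfolding Xi Kcard by (simp add: algebra_simps)
        have "J s3 i (Ts @ Ts1)"
          unfolding J_def using s3 cd(1-5,10-12) ik j i Ts1(1) ls t unfolding Xi
          by (simp add: encode_output_append)
        moreover have "rg s3 RJ < rg s RJ" using s3 cd(5) j i by simp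
        ultimately show "(\<exists>i Ts. J s3 i Ts) \<and> rg s3 RJ < rg s RJ" by blast
      qed (use cd in simp_all)
    qed
    then show "wp N (B (Dec RJ) ;; B (Mov RX RJ) ;; B (Dec RX) ;; B (Get RRoot AOrd RX) ;;
      B (Cst RT1 1) ;; B (Put APar RRoot RT1) ;; B (Cst RSz 1) ;; B (Cst RLp 0) ;; B (Mov RCur RRoot) ;;
      B (Cst RMode 1) ;; enum_loop ;; B (Put APar RRoot Zero) ;; clear_root)
      (\<lambda>s'. (\<exists>i Ts. J s' i Ts) \<and> rg s' RJ < rg s RJ) (tick s)"
      unfolding body .
  qed
qed

end

text \<open>Entry 0 of \<open>AOrd\<close> keeps its initial value 0, which is the start vertex; the
  discovered vertices follow from entry 1 on. Their marks are reset on the way.\<close>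

definition order_loop :: com where
  "order_loop = While (Lt RI RVp)
     (B (Get RT1 AVis RI) ;; B (Put APar RT1 Zero) ;; B (Inc RI) ;; B (Put AOrd RI RT1))"

text \<open>The order of the roots comes from the same search code with \<open>RK\<close> set to
  \<open>n\<close>, while \<open>k\<close> waits in \<open>RL\<close>.\<close>

definition run_prog :: com where
  "run_prog = B (Mov RK RN) ;; B (Cst RRoot 0) ;; B (Cst RSz 1) ;; B (Cst RLp 0) ;; B (Cst RCur 0) ;;
     B (Cst RT1 1) ;; B (Put APar RRoot RT1) ;; search_init ;; search_loop ;;
     B (Cst RI 0) ;; order_loop ;; B (Put APar RRoot Zero) ;;
     B (Mov RK RL) ;; B (Mov RJ RN) ;; B (Inc RJ) ;; root_loop"

lemma wp_order_loop:
  assumes s0: "rg s0 RI = 0" "rg s0 Zero = 0" "rg s0 RVp = length vl" "arrl (ar s0 AVis) vl"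
    "ar s0 AOrd = (\<lambda>_. 0)"
    and vl: "set vl \<subseteq> {..<N}" "length vl < N"
  shows "wp N order_loop (\<lambda>s. (\<forall>R. R \<notin> {RI, RT1} \<longrightarrow> rg s R = rg s0 R) \<and>
    (\<forall>A. A \<notin> {APar, AOrd} \<longrightarrow> ar s A = ar s0 A) \<and> ip s = ip s0 \<and> op s = op s0 \<and>
    ar s APar = (\<lambda>v. if v \<in> set vl then 0 else ar s0 APar v) \<and>
    ar s AOrd = (\<lambda>j. if 1 \<le> j \<and> j \<le> length vl then vl ! (j - 1) else 0) \<and>
    tm s = tm s0 + 5 * length vl + 1) s0" (is "wp N _ ?Q s0")
proof -
  define I where "I s \<longleftrightarrow> (\<forall>R. R \<notin> {RI, RT1} \<longrightarrow> rg s R = rg s0 R) \<and>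
    (\<forall>A. A \<notin> {APar, AOrd} \<longrightarrow> ar s A = ar s0 A) \<and> ip s = ip s0 \<and> op s = op s0 \<and> rg s RI \<le> length vl \<and>
    ar s APar = (\<lambda>v. if v \<in> set (take (rg s RI) vl) then 0 else ar s0 APar v) \<and>
    ar s AOrd = (\<lambda>j. if 1 \<le> j \<and> j \<le> rg s RI then vl ! (j - 1) else 0) \<and>
    tm s = tm s0 + 5 * rg s RI" for s :: st
  show ?thesis unfolding order_loop_def
  proof (rule wp_while_inv[where I = I and f = "\<lambda>s. length vl - rg s RI"])
    show "I s0" using s0 by (auto simp: I_def fun_eq_iff)
  next
    fix s assume I: "I s" "\<not> holds (Lt RI RVp) s"
    moreover from this have "rg s RI = length vl" using s0 unfolding I_def by simp
    ultimately show "?Q (tick s)"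
      by (simp add: I_def)
  next
    fix s assume I: "I s" and go: "holds (Lt RI RVp) s"
    then have lt: "rg s RI < length vl" using s0 unfolding I_def by simp
    have st: "set (take (Suc (rg s RI)) vl) = insert (vl ! rg s RI) (set (take (rg s RI) vl))"
      using lt by (simp add: take_Suc_conv_app_nth)
    have "vl ! rg s RI \<in> {..<N}" using vl(1) nth_mem[OF lt] by blast
    then have b: "vl ! rg s RI < N" "ar s0 AVis (rg s RI) = vl ! rg s RI" "Suc (rg s RI) < N"
      using vl lt s0(4) by (auto simp: arrl_def)
    let ?s = "(tick s)\<lparr>rg := (rg s)(RT1 := vl ! rg s RI, RI := Suc (rg s RI)),
      ar := (ar s)(APar := (ar s APar)(vl ! rg s RI := 0), AOrd := (ar s AOrd)(Suc (rg s RI) := vl ! rg s RI)),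
      tm := tm s + 5\<rparr>"
    have eq: "wp N (B (Get RT1 AVis RI) ;; B (Put APar RT1 Zero) ;; B (Inc RI) ;; B (Put AOrd RI RT1)) Q (tick s) \<longleftrightarrow> Q ?s"
      for Q
      using I b s0(2) unfolding I_def
      by (simp add: eval_nat_numeral)
    have "I ?s"
      unfolding I_def
    proof (intro conjI)
      show "ar ?s APar = (\<lambda>v. if v \<in> set (take (rg ?s RI) vl) then 0 else ar s0 APar v)"
        using I st unfolding I_def by (auto simp: fun_eq_iff)
      show "ar ?s AOrd = (\<lambda>j. if 1 \<le> j \<and> j \<le> rg ?s RI then vl ! (j - 1) else 0)"
        using I unfolding I_def by (auto simp: fun_eq_iff le_Suc_eq)
    qed (use I lt in \<open>simp_all add: I_def\<close>)
    then show "wp N (B (Get RT1 AVis RI) ;; B (Put APar RT1 Zero) ;; B (Inc RI) ;; B (Put AOrd RI RT1))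
      (\<lambda>s'. I s' \<and> length vl - rg s' RI < length vl - rg s RI) (tick s)"
      unfolding eq using lt by simp
  qed
qed

context arcs
begin

section \<open>Bounding the number of edges by the solutions\<close>

lemma closed_all:
  assumes con: "\<And>u v. u < n \<Longrightarrow> v < n \<Longrightarrow> (u, v) \<in> walks (ed ` AR)"
    and C: "r \<in> C" "r < n" "\<And>a. a \<in> AR \<Longrightarrow> src a \<in> C \<Longrightarrow> tgt a \<in> C"
  shows "{..<n} \<subseteq> C"
proof
  fix v assume "v \<in> {..<n}"
  then have "(r, v) \<in> walks (ed ` AR)" using con C(2) by simp
  moreover have "y \<in> C" if xy: "{x, y} \<in> ed ` AR" "x \<in> C" for x y
  proof -
    obtain a where a: "a \<in> AR" "{x, y} = {src a, tgt a}" using xy(1) by (auto simp: ed_def)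
    then have "x = src a \<and> y = tgt a \<or> x = tgt a \<and> y = src a" by (auto simp: doubleton_eq_iff)
    then show ?thesis using C(3)[OF a(1)] C(3)[OF ARD(6)[OF a(1)]] xy(2) ARD(9,10)[OF a(1)] by auto
  qed
  ultimately show "v \<in> C" using C(1) walks_closed by metis
qed

text \<open>By connectedness, every edge taken as a tree with two vertices extends to a
  \<open>k\<close>-subtree. The subtrees thus cover all edges, with fewer than \<open>k\<close>
  edges each.\<close>

lemma edges_le_solutions:
  assumes con: "\<And>u v. u < n \<Longrightarrow> v < n \<Longrightarrow> (u, v) \<in> walks (ed ` AR)" and k: "2 \<le> k" "k \<le> n"
  shows "card (ed ` AR) \<le> card (k_subtrees (ed ` AR) k) * k"
proof -
  let ?K = "k_subtrees (ed ` AR) k"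
  have finK: "finite ?K" using finite_k_subtrees[of "ed ` AR" k] finite_AR by simp
  have "\<exists>T\<in>?K. ed a \<in> T" if a: "a \<in> AR" for a
  proof -
    note A = ARD[OF a]
    have tAR: "twcl AR" using ARD(6) by (simp add: twcl_def)
    have "pr a = (src a, tgt a)" by (simp add: pr_def)
    then have g: "growth {src a} (map pr (rev [a]))" using A by simp
    have "sol k (src a) (AR - {a, tw a}) [a] \<noteq> {}"
    proof (rule sol_nonempty[OF A(3) twcl_remove[OF tAR a] _ g k(1)])
      fix C assume C: "SS (src a) [a] \<subseteq> C" "\<And>b. b \<in> AR - {a, tw a} \<Longrightarrow> src b \<in> C \<Longrightarrow> tgt b \<in> C" "finite C"
      have c: "src a \<in> C" "tgt a \<in> C" using C(1) by (auto simp: SS_def)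
      have "tgt b \<in> C" if "b \<in> AR" "src b \<in> C" for b
        using C(2)[of b] that c A(10) by (cases "b \<in> {a, tw a}") auto
      then have "{..<n} \<subseteq> C" using closed_all[OF con c(1) A(3)] by blast
      then have "card {..<n} \<le> card C" using C(3) by (rule card_mono[rotated])
      then show "k \<le> card C" using k(2) by simp
    qed (use a k in auto)
    then obtain T where T: "T \<in> sol k (src a) (AR - {a, tw a}) [a]" by blast
    from solD(1,2)[OF T] show ?thesis by auto
  qed
  then have "ed ` AR \<subseteq> \<Union>?K" by blast
  moreover have finT: "finite T" if "T \<in> ?K" for T
    using that finite_AR finite_subset[of T "ed ` AR"] by (auto simp: k_subtrees_def)
  ultimately have "card (ed ` AR) \<le> card (\<Union>?K)" using finK by (intro card_mono) auto
  also have "\<dots> \<le> sum card ?K" by (rule card_Union_le_sum_card)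
  also have "\<dots> \<le> card ?K * k"
    using sum_bounded_above[of ?K card k] by (auto simp: k_subtrees_def)
  finally show ?thesis .
qed

lemma wp_run_prog:
  assumes con: "\<And>u v. u < n \<Longrightarrow> v < n \<Longrightarrow> (u, v) \<in> walks (ed ` AR)" and k: "2 \<le> k" "k \<le> n"
    and N: "n + 2 * m \<le> N" "n < N"
    and s0: "rg s0 Zero = 0" "rg s0 RN = n" "rg s0 RL = k"
      "links (ar s0 ANext, ar s0 APrev) AR" "ar s0 AHead = tgt" "ar s0 ATwin = tw"
      "ar s0 APar = (\<lambda>_. 0)" "ar s0 AOrd = (\<lambda>_. 0)"
  shows "wp N run_prog (\<lambda>s. \<exists>Ts. op s = op s0 @ encode_output Ts \<and>
    (\<forall>T\<in>set Ts. length T = k - 1) \<and> distinct (map edge_set Ts) \<and>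
    set (map edge_set Ts) = k_subtrees (ed ` AR) k \<and>
    tm s \<le> tm s0 + 80 * m + 70 * n + 60 + 1500 * k * card (k_subtrees (ed ` AR) k)) s0" (is "wp N _ ?Q s0")
proof -
  let ?np = "(ar s0 ANext, ar s0 APrev)"
  let ?s1 = "s0\<lparr>rg := (rg s0)(RK := n, RRoot := 0, RSz := 1, RLp := 0, RCur := 0, RT1 := 1),
    ar := (ar s0)(APar := PA 0 []), tm := tm s0 + 7\<rparr>"
  let ?rest1 = "search_loop ;; B (Cst RI 0) ;; order_loop ;; B (Put APar RRoot Zero) ;;
     B (Mov RK RL) ;; B (Mov RJ RN) ;; B (Inc RJ) ;; root_loop"
  have n0: "0 < n" "0 < N" using n_pos N by auto
  have eq1: "wp N run_prog Q s0 \<longleftrightarrow> wp N search_init (wp N ?rest1 Q) ?s1" for Q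
    using s0 n0 by (simp add: run_prog_def eval_nat_numeral)
  have tAR: "twcl AR" using ARD(6) by (simp add: twcl_def)
  have c1: "core n 0 (rg s0 RJ) (\<lambda>_. 0) ?s1 ?np AR [] []"
    using s0 tAR card_AR by (simp add: core_def)
  have g1: "good n 0 AR [] [0]"
  proof -
    have "tgt a \<noteq> 0" if "a \<in> AR" "src a = 0" for a using ARD(5)[OF that(1)] that(2) by simp
    then show ?thesis using n0 tAR by (auto simp: good_def SS_def)
  qed
  have par1: "ar ?s1 APar = PA 0 []" and cur1: "rg ?s1 RCur = hd [0]" by simp_all
  have len1: "Suc (length ([] :: nat list)) \<le> n" using n_pos by simp
  define P where "P = dfs n AR (Z AR [0]) (PA 0 [])"
  have "sol n 0 AR [] \<noteq> {}"
  proof (rule sol_nonempty)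
    fix C assume C: "SS 0 [] \<subseteq> C" "\<And>a. a \<in> AR \<Longrightarrow> src a \<in> C \<Longrightarrow> tgt a \<in> C" "finite C"
    have "0 \<in> C" using C(1) by (simp add: SS_def)
    then have "{..<n} \<subseteq> C" using closed_all[OF con _ n0(1)] C(2) by blast
    then have "card {..<n} \<le> card C" using C(3) by (rule card_mono[rotated])
    then show "n \<le> card C" by simp
  qed (use n0 tAR n_pos in simp_all)
  then have full: "card (vs P) = n"
    using dfs_large[OF goodD(1-4)[OF g1] set_Z[OF g1] n_pos _ P_def] n_pos by simp
  show ?thesis
    unfolding eq1
  proof (rule wp_mono[OF wp_search_init[OF c1 g1 len1 par1 cur1 N(1)]])
    fix s2 :: st
    assume s2: "(\<forall>R. R \<notin> {RU, RSp, RT1, RCnt, RVp} \<longrightarrow> rg s2 R = rg ?s1 R) \<and>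
    (\<forall>A. A \<noteq> AStk \<longrightarrow> ar s2 A = ar ?s1 A) \<and> ip s2 = ip ?s1 \<and> op s2 = op ?s1 \<and>
    rg s2 RCnt = Suc (length ([] :: nat list)) \<and> rg s2 RVp = 0 \<and> rg s2 RSp = length [0::nat] \<and>
    arrl (ar s2 AStk) (map (snd ?np) [0]) \<and> tm s2 \<le> tm ?s1 + 7 * length [0::nat] + 7"
    have c2: "core n 0 (rg s0 RJ) (\<lambda>_. 0) s2 ?np AR [] []"
      by (rule core_cong[OF c1]) (use s2 in \<open>auto simp: core_regs_def core_arrs_def\<close>)
    let ?rest2 = "B (Cst RI 0) ;; order_loop ;; B (Put APar RRoot Zero) ;;
     B (Mov RK RL) ;; B (Mov RJ RN) ;; B (Inc RJ) ;; root_loop"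
    have "wp N search_loop (wp N ?rest2 ?Q) s2"
    proof (rule wp_mono[OF wp_search_loop[OF c2 g1 N(1) len1 _ _ _ _ _ _ P_def full]])
      fix s3 :: st
      assume s3: "(\<forall>R. R \<notin> {RCnt, RVp, RSp, RA, RT1, RT2, RT3} \<longrightarrow> rg s3 R = rg s2 R) \<and>
    (\<forall>A. A \<notin> {AStk, APar, AVis} \<longrightarrow> ar s3 A = ar s2 A) \<and> ip s3 = ip s2 \<and> op s3 = op s2 \<and>
    ar s3 APar = P \<and>
    (\<exists>qs. growth (SS 0 []) (map pr qs) \<and> set qs \<subseteq> AR \<and> (\<forall>v. v \<notin> tgt ` set qs \<longrightarrow> P v = PA 0 [] v) \<and>
      Suc (length ([] :: nat list)) + length qs = n \<and> vs P = SS 0 [] \<union> tgt ` set qs \<and>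
      rg s3 RVp = length qs \<and> arrl (ar s3 AVis) (map tgt qs)) \<and>
    tm s3 \<le> tm s2 + 18 * (card (inside AR (vs P)) + 2 * n) + 1"
      then obtain qs where qs: "growth {0} (map pr qs)" "set qs \<subseteq> AR"
        "\<And>v. v \<notin> tgt ` set qs \<Longrightarrow> P v = PA 0 [] v" "length qs = n - 1"
        "rg s3 RVp = length (map tgt qs)" "arrl (ar s3 AVis) (map tgt qs)" by (auto simp: SS_def)
      let ?s3 = "s3\<lparr>rg := (rg s3)(RI := 0), tm := Suc (tm s3)\<rparr>"
      let ?rest3 = "B (Put APar RRoot Zero) ;; B (Mov RK RL) ;; B (Mov RJ RN) ;; B (Inc RJ) ;; root_loop"
      have eq3: "wp N ?rest2 Q s3 \<longleftrightarrow> wp N order_loop (wp N ?rest3 Q) ?s3" for Q by simp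
      have vl: "set (map tgt qs) \<subseteq> {..<N}" "length (map tgt qs) < N"
        using qs(2,4) ARD(4) N by fastforce+
      show "wp N ?rest2 ?Q s3"
        unfolding eq3
      proof (rule wp_mono[OF wp_order_loop[OF _ _ _ _ _ vl]])
        fix s4 :: st
        assume s4: "(\<forall>R. R \<notin> {RI, RT1} \<longrightarrow> rg s4 R = rg ?s3 R) \<and>
          (\<forall>A. A \<notin> {APar, AOrd} \<longrightarrow> ar s4 A = ar ?s3 A) \<and> ip s4 = ip ?s3 \<and> op s4 = op ?s3 \<and>
          ar s4 APar = (\<lambda>v. if v \<in> set (map tgt qs) then 0 else ar ?s3 APar v) \<and>
          ar s4 AOrd = (\<lambda>j. if 1 \<le> j \<and> j \<le> length (map tgt qs) then map tgt qs ! (j - 1) else 0) \<and>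
          tm s4 = tm ?s3 + 5 * length (map tgt qs) + 1"
        have par4: "(ar s4 APar)(0 := 0) = (\<lambda>_. 0)"
          using s4 s3 qs(3) by (auto simp: fun_eq_iff)
        define od where "od = ar s4 AOrd"
        let ?s5 = "s4\<lparr>ar := (ar s4)(APar := \<lambda>_. 0), rg := (rg s4)(RK := k, RJ := Suc n), tm := tm s4 + 4\<rparr>"
        have eq4: "wp N ?rest3 Q s4 \<longleftrightarrow> wp N root_loop Q ?s5" for Q
          using s4 s3 s2 s0 par4 n0 N(2) by (simp add: eval_nat_numeral)
        have od: "od i = order_list qs ! i" if "i < n" for i
          using that s4 qs(4) by (cases i) (auto simp: od_def order_list_def)
        have ins: "inside AR (vs P) \<subseteq> AR" by (auto simp: inside_def)
        then have insc: "card (inside AR (vs P)) \<le> 2 * m"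
          using card_mono[OF finite_AR ins] card_AR by simp
        show "wp N ?rest3 ?Q s4"
          unfolding eq4
        proof (rule wp_mono[OF wp_root_loop[OF qs(1,2,4) k N(1) od]])
          fix s6 :: st
          assume "\<exists>Ts. op s6 = op ?s5 @ encode_output Ts \<and>
            (\<forall>T\<in>set Ts. length T = k - 1) \<and> distinct (map edge_set Ts) \<and>
            set (map edge_set Ts) = k_subtrees (ed ` AR) k \<and>
            tm s6 \<le> tm ?s5 + 20 * card AR + 20 * n + 1500 * k * card (k_subtrees (ed ` AR) k) + 1"
          moreover have "op ?s5 = op s0" using s4 s3 s2 by simp
          moreover have "tm ?s5 + 20 * card AR + 20 * n + 1 \<le> tm s0 + 80 * m + 70 * n + 60"
          proof -
            have "tm s4 = tm s3 + 5 * length qs + 2" using s4 by simp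
            moreover have "tm s3 \<le> tm s2 + 18 * (card (inside AR (vs P)) + 2 * n) + 1"
              using s3 by (elim conjE)
            then have "tm s3 \<le> tm s2 + 18 * card (inside AR (vs P)) + 36 * n + 1" by simp
            moreover have "tm s2 \<le> tm s0 + 21" using s2 by simp
            moreover have "length qs \<le> n" using qs(4) by simp
            ultimately have "tm s4 + 4 + 20 * card AR + 20 * n + 1 \<le> tm s0 + 80 * m + 70 * n + 60"
              using insc card_AR by linarith
            then show ?thesis by simp
          qed
          ultimately show "?Q s6" by auto
        qed (use s4 s3 s2 s0 in \<open>simp_all add: od_def\<close>)
      qed (use s3 s2 s0 qs in simp_all)
    qed (use s2 s0 in simp_all)
    then show "wp N ?rest1 ?Q s2" by simp
  qed
qed

end

section \<open>Reading the graph\<close>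

definition link_arc :: "reg \<Rightarrow> reg \<Rightarrow> com" where
  "link_arc a v = B (Get RT1 APrev v) ;; B (Put ANext RT1 a) ;; B (Put APrev a RT1) ;;
     B (Put ANext a v) ;; B (Put APrev v a)"

definition add_arcs :: com where
  "add_arcs = B (Mov RE RA) ;; B (Inc RA) ;; B (Mov RZ RA) ;; B (Inc RA) ;;
     B (Put AHead RE RU) ;; B (Put AHead RZ RI) ;; B (Put ATwin RE RZ) ;; B (Put ATwin RZ RE) ;;
     link_arc RE RI ;; link_arc RZ RU"

text \<open>Each edge occurs in two adjacency lists; only the occurrence in the list of its larger
  end creates the two arcs.\<close>

definition read_list :: com where
  "read_list = While (Lt RJ RB) (B (Rd RU) ;; If (Lt RU RI) add_arcs Skip ;; B (Inc RJ))"

definition read_graph :: com where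
  "read_graph = While (Lt RI RN) (B (Rd RB) ;; B (Cst RJ 0) ;; read_list ;; B (Inc RI))"

definition init_heads :: com where
  "init_heads = While (Lt RI RN) (B (Put ANext RI RI) ;; B (Put APrev RI RI) ;; B (Inc RI))"

definition main :: com where
  "main = B (Rd RN) ;; B (Rd RL) ;; init_heads ;; B (Mov RA RN) ;; B (Cst RI 0) ;; read_graph ;;
     run_prog"

definition ins1 :: "nat \<Rightarrow> nat \<Rightarrow> links \<Rightarrow> links" where
  "ins1 a w np = ((fst np)(snd np w := a, a := w), (snd np)(a := snd np w, w := a))"

text \<open>The insertion takes place just before the sentinel and changes pointers of
  \<open>w\<close>, of the last arc of its list and of \<open>a\<close>. The function
  \<open>\<sigma>\<close> names the list to which an arc belongs, which keeps these cells apart from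
  all other lists.\<close>

lemma chain_ins1:
  assumes ch: "\<And>v. v < n \<Longrightarrow> chain np (v # L v @ [v])"
    and L: "\<And>v x. v < n \<Longrightarrow> x \<in> set (L v) \<Longrightarrow> n \<le> x \<and> \<sigma> x = v \<and> x \<noteq> a"
    and d: "distinct (L w)" and a: "n \<le> a" and w: "w < n" and v: "v < n"
  shows "chain (ins1 a w np) (v # (if v = w then L v @ [a] else L v) @ [v])"
    and "snd np w = w \<or> snd np w \<in> set (L w)"
proof -
  let ?np = "ins1 a w np"
  obtain A p where p: "w # L w = A @ [p]" by (metis list.distinct(1) rev_exhaust)
  have "chain np (A @ p # [w])" using ch[OF w] p by (metis append.assoc append_Cons append_Nil)
  then have c: "chain np (A @ [p])" "snd np w = p" using chain_append[of np A p "[w]"] by simp_all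
  have pin: "p \<in> insert w (set (L w))" using p by (metis in_set_conv_decomp list.set(2))
  then show "snd np w = w \<or> snd np w \<in> set (L w)" using c(2) by simp
  have pa: "p \<noteq> a" "w \<noteq> a" using pin L[OF w] a w by auto
  have f: "fst ?np = (fst np)(p := a, a := w)" "snd ?np = (snd np)(a := p, w := a)"
    using c(2) by (simp_all add: ins1_def)
  show "chain ?np (v # (if v = w then L v @ [a] else L v) @ [v])"
  proof (cases "v = w")
    case True
    have wL: "w \<notin> set (L w)" using L[OF w, of w] w by auto
    then have dA: "distinct (A @ [p])" using d p[symmetric] by simp
    have tlA: "tl (A @ [p]) = L w" using p[symmetric] by simp
    have "set (A @ [p]) = insert w (set (L w))" using p by (metis list.set(2))
    then have "set A \<subseteq> insert w (set (L w))" by auto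
    then have aA: "a \<notin> set A" using L[OF w, of a] pa(2) by blast
    have 1: "chain ?np (A @ [p])"
    proof (rule chain_cong[OF _ _ c(1)])
      show "fst np x = fst ?np x" if "x \<in> set (butlast (A @ [p]))" for x
        using that dA aA by (auto simp: f)
      show "snd np x = snd ?np x" if "x \<in> set (tl (A @ [p]))" for x
        using that tlA wL L[OF w] by (auto simp: f)
    qed
    have "chain ?np (A @ p # [a, w])"
      using 1 pa chain_append[of ?np A p "[a, w]"] by (simp add: f)
    moreover have "w # (L w @ [a]) @ [w] = (w # L w) @ [a, w]" by simp
    then have "w # (L w @ [a]) @ [w] = A @ p # [a, w]" unfolding p by simp
    ultimately have "chain ?np (w # (L w @ [a]) @ [w])" by (simp only:)
    then show ?thesis using True by simp
  next
    case False
    have pv: "p \<noteq> v" "p \<notin> set (L v)" using pin False L[OF w, of p] L[OF v, of p] v w by auto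
    have wv: "w \<noteq> v" "w \<notin> set (L v)" "a \<noteq> v" "a \<notin> set (L v)"
      using False L[OF v, of w] L[OF v, of a] v w a by auto
    have "chain ?np (v # L v @ [v])"
    proof (rule chain_cong[OF _ _ ch[OF v]])
      show "fst np x = fst ?np x" if "x \<in> set (butlast (v # L v @ [v]))" for x
        using that pv wv by (auto simp: f butlast_append)
      show "snd np x = snd ?np x" if "x \<in> set (tl (v # L v @ [v]))" for x
        using that wv by (auto simp: f)
    qed
    then show ?thesis using False by simp
  qed
qed

text \<open>The \<open>q\<close>-th edge \<open>(v, u)\<close> of \<open>es\<close> gets the arcs \<open>n + 2 * q\<close> from \<open>v\<close> to \<open>u\<close> and
  \<open>n + 2 * q + 1\<close> from \<open>u\<close> to \<open>v\<close>.\<close>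

definition src_f :: "nat \<Rightarrow> (nat \<times> nat) list \<Rightarrow> nat \<Rightarrow> nat" where
  "src_f n es a = (let e = es ! ((a - n) div 2) in if even (a - n) then fst e else snd e)"

definition tgt_f :: "nat \<Rightarrow> (nat \<times> nat) list \<Rightarrow> nat \<Rightarrow> nat" where
  "tgt_f n es a = (let e = es ! ((a - n) div 2) in if even (a - n) then snd e else fst e)"

definition tw_f :: "nat \<Rightarrow> nat \<Rightarrow> nat" where
  "tw_f n a = (if even (a - n) then Suc a else a - 1)"

text \<open>Insertion at the end keeps each list in increasing order of arc numbers, so the lists in
  memory are determined by \<open>es\<close> alone.\<close>

definition Ls :: "nat \<Rightarrow> (nat \<times> nat) list \<Rightarrow> nat \<Rightarrow> nat list" where
  "Ls n es v = filter (\<lambda>a. src_f n es a = v) [n..<n + 2 * length es]"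

lemma arc_cases:
  assumes "n \<le> a" "a < n + 2 * j"
  obtains q where "q < j" "a = n + 2 * q" | q where "q < j" "a = Suc (n + 2 * q)"
proof (cases "even (a - n)")
  case True
  then obtain q where "a - n = 2 * q" by (elim evenE)
  then show ?thesis using that(1)[of q] assms by simp
next
  case False
  then obtain q where "a - n = 2 * q + 1" by (elim oddE)
  then show ?thesis using that(2)[of q] assms by simp
qed

lemma arc_f [simp]:
  "src_f n es (n + 2 * q) = fst (es ! q)" "src_f n es (Suc (n + 2 * q)) = snd (es ! q)"
  "tgt_f n es (n + 2 * q) = snd (es ! q)" "tgt_f n es (Suc (n + 2 * q)) = fst (es ! q)"
  "tw_f n (n + 2 * q) = Suc (n + 2 * q)" "tw_f n (Suc (n + 2 * q)) = n + 2 * q"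
  by (simp_all add: src_f_def tgt_f_def tw_f_def Suc_diff_le)

lemma arc_f_append:
  assumes "n \<le> a" "a < n + 2 * length es"
  shows "src_f n (es @ fs) a = src_f n es a" "tgt_f n (es @ fs) a = tgt_f n es a"
  using assms by (auto elim!: arc_cases simp: nth_append)

lemma Ls_mem: "a \<in> set (Ls n es v) \<longleftrightarrow> n \<le> a \<and> a < n + 2 * length es \<and> src_f n es a = v"
  by (auto simp: Ls_def)

lemma Ls_append1:
  assumes "u \<noteq> v"
  shows "Ls n (es @ [(v, u)]) w = Ls n es w @
    (if w = v then [n + 2 * length es] else if w = u then [Suc (n + 2 * length es)] else [])"
proof -
  let ?e = "n + 2 * length es"
  have s: "src_f n (es @ [(v, u)]) ?e = v" "src_f n (es @ [(v, u)]) (Suc ?e) = u"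
    by (simp_all only: arc_f) simp_all
  have "[n..<n + 2 * length (es @ [(v, u)])] = [n..<?e] @ [?e, Suc ?e]"
    by (simp add: upt_rec[of ?e] upt_rec[of "Suc ?e"])
  moreover have "filter (\<lambda>a. src_f n (es @ [(v, u)]) a = w) [n..<?e] = Ls n es w"
    unfolding Ls_def by (intro filter_cong) (auto simp: arc_f_append)
  ultimately show ?thesis using assms s by (auto simp: Ls_def)
qed

definition graph_read :: "nat \<Rightarrow> nat \<Rightarrow> (nat \<times> nat) list \<Rightarrow> st \<Rightarrow> bool" where
  "graph_read n k es s \<longleftrightarrow> rg s Zero = 0 \<and> rg s RN = n \<and> rg s RL = k \<and>
     rg s RA = n + 2 * length es \<and>
     (\<forall>a. n \<le> a \<and> a < n + 2 * length es \<longrightarrow> ar s AHead a = tgt_f n es a \<and> ar s ATwin a = tw_f n a) \<and>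
     (\<forall>v<n. chain (ar s ANext, ar s APrev) (v # Ls n es v @ [v])) \<and>
     ar s APar = (\<lambda>_. 0) \<and> ar s AOrd = (\<lambda>_. 0) \<and> op s = []"

lemma graph_read_cong:
  "graph_read n k es s \<Longrightarrow> \<forall>R\<in>{Zero, RN, RL, RA}. rg s' R = rg s R \<Longrightarrow> ar s' = ar s \<Longrightarrow>
   op s' = op s \<Longrightarrow> graph_read n k es s'"
  by (simp add: graph_read_def)

lemma wp_add_arcs:
  assumes g: "graph_read n k es s" and vu: "rg s RI = v" "rg s RU = u" "u < v" "v < n"
    and N: "n + 2 * Suc (length es) \<le> N"
  shows "wp N add_arcs (\<lambda>s'. graph_read n k (es @ [(v, u)]) s' \<and>
    (\<forall>R. R \<notin> {RE, RZ, RA, RT1} \<longrightarrow> rg s' R = rg s R) \<and> ip s' = ip s \<and> tm s' = tm s + 18) s"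
proof -
  let ?np = "(ar s ANext, ar s APrev)"
  let ?e = "n + 2 * length es"
  let ?es = "es @ [(v, u)]"
  let ?np1 = "ins1 ?e v ?np"
  let ?np2 = "ins1 (Suc ?e) u ?np1"
  let ?L1 = "\<lambda>w. if w = v then Ls n es w @ [?e] else Ls n es w"
  have RA: "rg s RA = ?e" using g by (simp add: graph_read_def)
  have ch: "chain ?np (w # Ls n es w @ [w])" if "w < n" for w
    using g that by (simp add: graph_read_def)
  have L0: "n \<le> x \<and> src_f n ?es x = w \<and> x \<noteq> ?e" if "w < n" "x \<in> set (Ls n es w)" for w x
    using that by (auto simp: Ls_mem arc_f_append)
  have d: "distinct (Ls n es w)" for w by (simp add: Ls_def)
  note c1 = chain_ins1[where L = "Ls n es" and \<sigma> = "src_f n ?es", OF ch L0 d _ vu(4)]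
  have srce: "src_f n ?es ?e = v" by (simp only: arc_f) simp
  have L1: "n \<le> x \<and> src_f n ?es x = w \<and> x \<noteq> Suc ?e" if "w < n" "x \<in> set (?L1 w)" for w x
    using that srce by (auto simp: Ls_mem arc_f_append split: if_splits)
  have un: "u < n" using vu by simp
  have ch1: "chain ?np1 (w # ?L1 w @ [w])" if "w < n" for w
    using c1(1)[of w] that by simp
  have d1: "distinct (?L1 u)" using d vu by simp
  note c2 = chain_ins1[where L = ?L1 and \<sigma> = "src_f n ?es", OF ch1 L1 d1 _ un]
  have ch2: "chain ?np2 (w # Ls n ?es w @ [w])" if "w < n" for w
  proof -
    have "Ls n ?es w = (if w = u then ?L1 w @ [Suc ?e] else ?L1 w)"
      using Ls_append1[of u v n es w] vu by auto
    then show ?thesis using c2(1)[of w] that by simp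
  qed
  have p1: "ar s APrev v < N" using c1(2)[of v] vu N by (auto simp: Ls_mem)
  have p2: "snd ?np1 u < N" using c2(2)[of u] vu N un by (auto simp: Ls_mem split: if_splits)
  have p2': "ar s APrev u < N" using p2 vu un by (simp add: ins1_def)
  let ?s = "s\<lparr>rg := (rg s)(RE := ?e, RZ := Suc ?e, RA := Suc (Suc ?e), RT1 := snd ?np1 u),
    ar := (ar s)(AHead := (ar s AHead)(?e := u, Suc ?e := v), ATwin := (ar s ATwin)(?e := Suc ?e, Suc ?e := ?e),
      ANext := fst ?np2, APrev := snd ?np2), tm := tm s + 18\<rparr>"
  have eq: "wp N add_arcs Q s \<longleftrightarrow> Q ?s" for Q
    using RA vu un N p1 p2' unfolding add_arcs_def link_arc_def
    by (simp add: ins1_def eval_nat_numeral)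
  have "graph_read n k ?es ?s"
    unfolding graph_read_def
  proof (intro conjI allI impI)
    fix a assume a: "n \<le> a \<and> a < n + 2 * length ?es"
    consider "a < ?e" | "a = ?e" | "a = Suc ?e" using a by fastforce
    then show "ar ?s AHead a = tgt_f n ?es a" "ar ?s ATwin a = tw_f n a"
    proof (atomize(full), cases)
      case 1
      then show "ar ?s AHead a = tgt_f n ?es a \<and> ar ?s ATwin a = tw_f n a"
        using g a arc_f_append[of n a es "[(v, u)]"] by (simp add: graph_read_def)
    qed (simp_all only: arc_f, simp_all)
  next
    fix w assume "w < n"
    then show "chain (ar ?s ANext, ar ?s APrev) (w # Ls n ?es w @ [w])" using ch2[of w] by simp
  qed (use g in \<open>simp_all add: graph_read_def\<close>)
  then show ?thesis unfolding eq by simp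
qed

definition pend :: "nat \<Rightarrow> nat list \<Rightarrow> (nat \<times> nat) list" where
  "pend v l = map (Pair v) (filter (\<lambda>u. u < v) l)"

lemma wp_read_list:
  assumes "graph_read n k es s" "rg s RI = v" "v < n" "set l \<subseteq> {..<n}" "n < N"
    "rg s RJ + length l = rg s RB" "rg s RB \<le> N" "n + 2 * length (es @ pend v l) \<le> N" "ip s = l @ rest"
  shows "wp N read_list (\<lambda>s'. graph_read n k (es @ pend v l) s' \<and> rg s' RI = v \<and> ip s' = rest \<and>
    tm s' \<le> tm s + 22 * length l + 1) s"
  using assms
proof (induction l arbitrary: es s)
  case Nil
  then show ?case
    by (simp add: read_list_def pend_def wp_While) (rule graph_read_cong; simp)
next
  case (Cons u l)
  let ?Q = "\<lambda>s'. graph_read n k (es @ pend v (u # l)) s' \<and> rg s' RI = v \<and> ip s' = rest \<and>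
    tm s' \<le> tm s + 22 * length (u # l) + 1"
  let ?s1 = "s\<lparr>rg := (rg s)(RU := u), ip := l @ rest, tm := tm s + 2\<rparr>"
  have "wp N read_list ?Q s \<longleftrightarrow>
    wp N (B (Rd RU) ;; If (Lt RU RI) add_arcs Skip ;; B (Inc RJ)) (wp N read_list ?Q) (tick s)"
    unfolding read_list_def using Cons.prems(6) by (subst wp_While) simp
  also have "\<dots> \<longleftrightarrow> wp N (If (Lt RU RI) add_arcs Skip) (wp N (B (Inc RJ)) (wp N read_list ?Q)) ?s1"
    using Cons.prems(4,5,9) by (simp add: eval_nat_numeral tick_def)
  finally have eq: "wp N read_list ?Q s \<longleftrightarrow>
    wp N (If (Lt RU RI) add_arcs Skip) (wp N (B (Inc RJ)) (wp N read_list ?Q)) ?s1" .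
  have rest: "wp N (B (Inc RJ)) (wp N read_list ?Q) s2"
    if s2: "graph_read n k es' s2" "es' @ pend v l = es @ pend v (u # l)" "rg s2 RI = v"
      "rg s2 RJ = rg s RJ" "rg s2 RB = rg s RB" "ip s2 = l @ rest" "tm s2 \<le> tm s + 21" for s2 es'
  proof -
    let ?s3 = "upd (Inc RJ) s2"
    have "wp N read_list (\<lambda>s'. graph_read n k (es' @ pend v l) s' \<and> rg s' RI = v \<and> ip s' = rest \<and>
      tm s' \<le> tm ?s3 + 22 * length l + 1) ?s3"
    proof (rule Cons.IH)
      show "graph_read n k es' ?s3" by (rule graph_read_cong[OF s2(1)]) simp_all
      show "n + 2 * length (es' @ pend v l) \<le> N" using Cons.prems(8) unfolding s2(2) .
    qed (use s2 Cons.prems in auto)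
    then have "wp N read_list ?Q ?s3"
      by (rule wp_mono) (use s2(2,7) in auto)
    then show ?thesis using s2 Cons.prems(6,7) by simp
  qed
  have g1: "graph_read n k es ?s1" by (rule graph_read_cong[OF Cons.prems(1)]) simp_all
  show ?case
  proof (cases "u < v")
    case True
    have p: "pend v (u # l) = (v, u) # pend v l" using True by (simp add: pend_def)
    have "wp N add_arcs (\<lambda>s'. graph_read n k (es @ [(v, u)]) s' \<and>
      (\<forall>R. R \<notin> {RE, RZ, RA, RT1} \<longrightarrow> rg s' R = rg (tick ?s1) R) \<and> ip s' = ip (tick ?s1) \<and>
      tm s' = tm (tick ?s1) + 18) (tick ?s1)"
    proof (rule wp_add_arcs)
      show "graph_read n k es (tick ?s1)" by (rule graph_read_cong[OF g1]) simp_all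
      show "n + 2 * Suc (length es) \<le> N" using Cons.prems(8) p by simp
    qed (use Cons.prems True in simp_all)
    then have "wp N add_arcs (wp N (B (Inc RJ)) (wp N read_list ?Q)) (tick ?s1)"
      by (rule wp_mono) (rule rest[of "es @ [(v, u)]"]; use p Cons.prems in simp)
    then show ?thesis unfolding eq using True Cons.prems(2) by simp
  next
    case False
    have "wp N (B (Inc RJ)) (wp N read_list ?Q) (tick ?s1)"
    proof (rule rest)
      show "graph_read n k es (tick ?s1)" by (rule graph_read_cong[OF g1]) simp_all
    qed (use False Cons.prems in \<open>simp_all add: pend_def\<close>)
    then show ?thesis unfolding eq using False Cons.prems(2) by simp
  qed
qed


definition es_upto :: "nat list list \<Rightarrow> nat \<Rightarrow> (nat \<times> nat) list" where
  "es_upto adj i = concat (map (\<lambda>v. pend v (adj ! v)) [0..<i])"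

lemma es_upto_simps [simp]: "es_upto adj 0 = []"
  "es_upto adj (Suc i) = es_upto adj i @ pend i (adj ! i)"
  by (simp_all add: es_upto_def)

lemma length_es_upto_mono: "i \<le> j \<Longrightarrow> length (es_upto adj i) \<le> length (es_upto adj j)"
  by (induction rule: dec_induct) auto

lemma set_es_upto: "set (es_upto adj i) = {(v, u). v < i \<and> u < v \<and> u \<in> set (adj ! v)}"
  by (auto simp: es_upto_def pend_def)

lemma distinct_es_upto: "\<forall>v<i. distinct (adj ! v) \<Longrightarrow> distinct (es_upto adj i)"
  by (induction i) (auto simp: set_es_upto pend_def distinct_map inj_on_def)

lemma wp_read_graph:
  assumes s0: "graph_read n k [] s0" "rg s0 RI = 0" "ip s0 = concat (map (\<lambda>l. length l # l) adj)"
    and adj: "length adj = n" "\<And>v. v < n \<Longrightarrow> set (adj ! v) \<subseteq> {..<n} \<and> length (adj ! v) \<le> N"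
    and N: "n < N" "n + 2 * length (es_upto adj n) \<le> N"
  shows "wp N read_graph (\<lambda>s. graph_read n k (es_upto adj n) s \<and>
    tm s \<le> tm s0 + 22 * (\<Sum>v<n. length (adj ! v)) + 5 * n + 1) s0"
proof -
  define I where "I s \<longleftrightarrow> rg s RI \<le> n \<and> graph_read n k (es_upto adj (rg s RI)) s \<and>
    ip s = concat (map (\<lambda>l. length l # l) (drop (rg s RI) adj)) \<and>
    tm s \<le> tm s0 + 22 * (\<Sum>v<rg s RI. length (adj ! v)) + 5 * rg s RI" for s :: st
  have RN: "rg s RN = n" if "I s" for s using that by (simp add: I_def graph_read_def)
  show ?thesis
    unfolding read_graph_def
  proof (rule wp_while_inv[where I = I and f = "\<lambda>s. n - rg s RI"])
    show "I s0" using s0 by (simp add: I_def)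
  next
    fix s assume I: "I s" "\<not> holds (Lt RI RN) s"
    then have i: "rg s RI = n" using RN[OF I(1)] by (simp add: I_def)
    have "graph_read n k (es_upto adj n) (tick s)"
      by (rule graph_read_cong[of _ _ _ s]) (use I(1) i in \<open>simp_all add: I_def\<close>)
    then show "graph_read n k (es_upto adj n) (tick s) \<and>
      tm (tick s) \<le> tm s0 + 22 * (\<Sum>v<n. length (adj ! v)) + 5 * n + 1"
      using I(1) i by (simp add: I_def)
  next
    fix s assume I: "I s" and go: "holds (Lt RI RN) s"
    let ?i = "rg s RI" let ?l = "adj ! ?i" and ?rest = "concat (map (\<lambda>l. length l # l) (drop (Suc (rg s RI)) adj))"
    have i: "?i < n" using go RN[OF I] by simp
    then have ip: "ip s = length ?l # ?l @ ?rest"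
      using I adj(1) by (simp add: I_def Cons_nth_drop_Suc[symmetric])
    let ?s = "s\<lparr>ip := ?l @ ?rest, rg := (rg s)(RB := length ?l, RJ := 0), tm := tm s + 3\<rparr>"
    let ?Q = "\<lambda>s'. I s' \<and> n - rg s' RI < n - rg s RI"
    have "length ?l \<le> N" using adj(2)[OF i] by blast
    then have eq: "wp N (B (Rd RB) ;; B (Cst RJ 0) ;; read_list ;; B (Inc RI)) ?Q (tick s) \<longleftrightarrow>
      wp N read_list (wp N (B (Inc RI)) ?Q) ?s"
      using ip by (simp add: eval_nat_numeral tick_def)
    have "wp N read_list (\<lambda>s'. graph_read n k (es_upto adj ?i @ pend ?i ?l) s' \<and> rg s' RI = ?i \<and>
      ip s' = ?rest \<and> tm s' \<le> tm ?s + 22 * length ?l + 1) ?s"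
    proof (rule wp_read_list)
      show "graph_read n k (es_upto adj ?i) ?s"
        by (rule graph_read_cong[of _ _ _ s]) (use I in \<open>simp_all add: I_def\<close>)
      show "set ?l \<subseteq> {..<n}" using adj(2)[OF i] by blast
      have "length (es_upto adj (Suc ?i)) \<le> length (es_upto adj n)"
        by (rule length_es_upto_mono) (use i in simp)
      then show "n + 2 * length (es_upto adj ?i @ pend ?i ?l) \<le> N" using N(2) by simp
    qed (use i N adj(2)[OF i] in simp_all)
    then have "wp N read_list (wp N (B (Inc RI)) ?Q) ?s"
    proof (rule wp_mono)
      fix s2 assume s2: "graph_read n k (es_upto adj ?i @ pend ?i ?l) s2 \<and> rg s2 RI = ?i \<and>
        ip s2 = ?rest \<and> tm s2 \<le> tm ?s + 22 * length ?l + 1"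
      let ?s3 = "upd (Inc RI) s2"
      have "graph_read n k (es_upto adj (Suc ?i)) ?s3"
        by (rule graph_read_cong[of _ _ _ s2]) (use s2 in simp_all)
      then have "I ?s3" using s2 i I by (simp add: I_def)
      then show "wp N (B (Inc RI)) ?Q s2" using s2 i N by simp
    qed
    then show "wp N (B (Rd RB) ;; B (Cst RJ 0) ;; read_list ;; B (Inc RI)) ?Q (tick s)"
      unfolding eq .
  qed
qed

lemma wp_init_heads:
  assumes "rg s0 RI = 0" "rg s0 RN = n" "n < N"
  shows "wp N init_heads (\<lambda>s. (\<forall>R. R \<noteq> RI \<longrightarrow> rg s R = rg s0 R) \<and>
    (\<forall>A. A \<notin> {ANext, APrev} \<longrightarrow> ar s A = ar s0 A) \<and>
    (\<forall>v<n. ar s ANext v = v \<and> ar s APrev v = v) \<and> ip s = ip s0 \<and> op s = op s0 \<and>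
    tm s = tm s0 + 4 * n + 1) s0" (is "wp N _ ?Q s0")
proof -
  define I where "I s \<longleftrightarrow> rg s RI \<le> n \<and> (\<forall>R. R \<noteq> RI \<longrightarrow> rg s R = rg s0 R) \<and>
    (\<forall>A. A \<notin> {ANext, APrev} \<longrightarrow> ar s A = ar s0 A) \<and>
    (\<forall>v<rg s RI. ar s ANext v = v \<and> ar s APrev v = v) \<and> ip s = ip s0 \<and> op s = op s0 \<and>
    tm s = tm s0 + 4 * rg s RI" for s :: st
  show ?thesis
    unfolding init_heads_def
  proof (rule wp_while_inv[where I = I and f = "\<lambda>s. n - rg s RI"])
    show "I s0" using assms by (simp add: I_def)
  next
    fix s assume "I s" "\<not> holds (Lt RI RN) s"
    moreover from this have "rg s RI = n" using assms by (simp add: I_def)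
    ultimately show "?Q (tick s)" by (simp add: I_def)
  next
    fix s assume "I s" "holds (Lt RI RN) s"
    then show "wp N (B (Put ANext RI RI) ;; B (Put APrev RI RI) ;; B (Inc RI))
      (\<lambda>s'. I s' \<and> n - rg s' RI < n - rg s RI) (tick s)"
      using assms by (auto simp: I_def less_Suc_eq)
  qed
qed

text \<open>Entries of \<open>es\<close> are oriented from the larger to the smaller vertex and are
  distinct, so arcs with the same ends in the same order are equal. This is how simplicity of the
  graph reaches the locale.\<close>

lemma arcs_Ls:
  assumes n: "2 \<le> n" and es: "distinct es" "\<And>v u. (v, u) \<in> set es \<Longrightarrow> u < v \<and> v < n"
    and s: "graph_read n k es s"
  shows "arcs n (length es) (ar s AHead) (ar s ATwin) (Ls n es)"
    and "arcs.AR n (Ls n es) = {n..<n + 2 * length es}"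
    and "arcs.ed (ar s AHead) (ar s ATwin) ` {n..<n + 2 * length es} = (\<lambda>(x, y). {x, y}) ` set es"
    and "arcs.links n (Ls n es) (ar s ANext, ar s APrev) {n..<n + 2 * length es}"
proof -
  let ?m = "length es" and ?t = "ar s AHead" and ?w = "ar s ATwin"
  have tw: "?t a = tgt_f n es a" "?w a = tw_f n a" if "n \<le> a" "a < n + 2 * ?m" for a
    using s that by (auto simp: graph_read_def)
  have b: "snd (es ! q) < fst (es ! q)" "fst (es ! q) < n" if "q < ?m" for q
    using es(2)[of "fst (es ! q)" "snd (es ! q)"] nth_mem[OF that] by simp_all
  have A: "tgt_f n es a < n \<and> src_f n es a < n \<and> tgt_f n es a \<noteq> src_f n es a \<and>
      n \<le> tw_f n a \<and> tw_f n a < n + 2 * ?m \<and> tw_f n (tw_f n a) = a \<and>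
      tgt_f n es (tw_f n a) = src_f n es a \<and> src_f n es (tw_f n a) = tgt_f n es a"
    if a: "n \<le> a" "a < n + 2 * ?m" for a
    using a by (rule arc_cases) (use b in \<open>fastforce dest: b\<close>)+
  have inj: "a = b"
    if ab: "n \<le> a" "a < n + 2 * ?m" "n \<le> b" "b < n + 2 * ?m" "src_f n es a = src_f n es b"
      "tgt_f n es a = tgt_f n es b" for a b
  proof -
    obtain q where q: "q < ?m" "a = n + 2 * q \<or> a = Suc (n + 2 * q)" using ab(1,2) by (rule arc_cases) auto
    obtain q' where q': "q' < ?m" "b = n + 2 * q' \<or> b = Suc (n + 2 * q')" using ab(3,4) by (rule arc_cases) auto
    have "es ! q = es ! q' \<Longrightarrow> q = q'" using es(1) q(1) q'(1) by (simp add: nth_eq_iff_index_eq)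
    then show ?thesis using q q' ab(5,6) b[OF q(1)] b[OF q'(1)] by (auto simp: prod_eq_iff)
  qed
  show arcs: "arcs n ?m ?t ?w (Ls n es)"
  proof
    fix v a assume "v < n" and "a \<in> set (Ls n es v)"
    then have a: "n \<le> a" "a < n + 2 * ?m" "src_f n es a = v" by (auto simp: Ls_mem)
    note Aa = A[OF a(1,2)]
    show "n \<le> a \<and> a < n + 2 * ?m" using a by simp
    show "?t (?w a) = v" using Aa a tw[of a] tw[of "tw_f n a"] by simp
    show "?t a < n \<and> ?t a \<noteq> v \<and> ?w a \<in> set (Ls n es (?t a)) \<and> ?w (?w a) = a"
      using Aa a tw[of a] tw[of "tw_f n a"] by (simp add: Ls_mem)
    fix b assume "b \<in> set (Ls n es v)" "?t a = ?t b"
    then show "a = b" using inj[of a b] a tw[of a] tw[of b] by (simp add: Ls_mem)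
  qed (use n in \<open>simp_all add: Ls_def\<close>)
  then interpret arcs n ?m ?t ?w "Ls n es" .
  show AR: "AR = {n..<n + 2 * ?m}"
    using A by (auto simp: AR_def Ls_mem)
  have ed1: "ed (n + 2 * q) = {fst (es ! q), snd (es ! q)}" "ed (Suc (n + 2 * q)) = {fst (es ! q), snd (es ! q)}"
    if "q < ?m" for q
    using that tw[of "n + 2 * q"] tw[of "Suc (n + 2 * q)"] by (auto simp: ed_def src_def)
  show "ed ` {n..<n + 2 * ?m} = (\<lambda>(x, y). {x, y}) ` set es"
  proof (intro equalityI subsetI)
    fix e assume "e \<in> ed ` {n..<n + 2 * ?m}"
    then obtain a where a: "n \<le> a" "a < n + 2 * ?m" "e = ed a" by auto
    obtain q where "q < ?m" "e = {fst (es ! q), snd (es ! q)}"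
      using a(1,2) by (rule arc_cases) (use ed1 a(3) in auto)
    then show "e \<in> (\<lambda>(x, y). {x, y}) ` set es"
      by (intro image_eqI[of _ _ "es ! q"]) (auto simp: case_prod_beta)
  next
    fix e assume "e \<in> (\<lambda>(x, y). {x, y}) ` set es"
    then obtain q where "q < ?m" "e = {fst (es ! q), snd (es ! q)}"
      by (auto simp: in_set_conv_nth case_prod_beta)
    then show "e \<in> ed ` {n..<n + 2 * ?m}"
      using ed1(1) by (intro image_eqI[of _ _ "n + 2 * q"]) auto
  qed
  have "LX {n..<n + 2 * ?m} v = Ls n es v" for v
    unfolding LX_def by (rule filter_True) (auto simp: Ls_mem)
  then show "links (ar s ANext, ar s APrev) {n..<n + 2 * ?m}"
    using s AR by (simp add: links_def graph_read_def)
qed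

lemma adjacent_order:
  assumes g: "simple_graph {..<n} E" and adj: "adjacency_lists n E adj"
  shows "set (es_upto adj n) = {(v, u). v < n \<and> u < v \<and> {u, v} \<in> E}"
    and "(\<lambda>(x, y). {x, y}) ` set (es_upto adj n) = E"
    and "distinct (es_upto adj n)"
    and "length (es_upto adj n) = card E"
    and "(\<Sum>v<n. length (adj ! v)) \<le> 2 * card E"
    and "v < n \<Longrightarrow> set (adj ! v) \<subseteq> {..<n} \<and> length (adj ! v) \<le> n"
proof -
  let ?es = "es_upto adj n"
  have a: "distinct (adj ! v)" "set (adj ! v) = {u. {u, v} \<in> E}" if "v < n" for v
    using adj that by (auto simp: adjacency_lists_def)
  have E: "u < n \<and> v < n \<and> u \<noteq> v" if "{u, v} \<in> E" for u v
    using g that unfolding simple_graph_def by (fastforce simp: doubleton_eq_iff)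
  show set_es: "set ?es = {(v, u). v < n \<and> u < v \<and> {u, v} \<in> E}"
    using a(2) by (auto simp: set_es_upto)
  show im: "(\<lambda>(x, y). {x, y}) ` set ?es = E"
  proof (intro equalityI subsetI)
    fix e assume "e \<in> (\<lambda>(x, y). {x, y}) ` set ?es"
    then show "e \<in> E" by (auto simp: set_es insert_commute)
  next
    fix e assume e: "e \<in> E"
    then obtain u v where uv: "u < n" "v < n" "u \<noteq> v" "e = {u, v}"
      using g by (auto simp: simple_graph_def)
    then consider "(v, u) \<in> set ?es" | "(u, v) \<in> set ?es"
      using e by (fastforce simp: set_es insert_commute)
    then show "e \<in> (\<lambda>(x, y). {x, y}) ` set ?es"
      by cases (use uv(4) in \<open>force simp: insert_commute\<close>)+
  qed
  show d: "distinct ?es" using a(1) by (intro distinct_es_upto) simp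
  have "inj_on (\<lambda>(x, y). {x, y}) (set ?es)"
    by (auto simp: inj_on_def set_es doubleton_eq_iff)
  then show len: "length ?es = card E"
    using card_image distinct_card[OF d] im by metis
  have sub: "set (adj ! v) \<subseteq> {..<n}" if "v < n" for v using a(2)[OF that] E by auto
  have lc: "length (adj ! v) = card (set (adj ! v))" if "v < n" for v
    using distinct_card[OF a(1)[OF that]] by simp
  then show "v < n \<Longrightarrow> set (adj ! v) \<subseteq> {..<n} \<and> length (adj ! v) \<le> n"
    using sub[of v] card_mono[OF _ sub[of v]] by simp
  have "(\<Sum>v<n. length (adj ! v)) = (\<Sum>v<n. card (set (adj ! v)))" using lc by simp
  also have "\<dots> = card (SIGMA v:{..<n}. set (adj ! v))" by simp
  also have "\<dots> \<le> card (set ?es \<union> prod.swap ` set ?es)"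
  proof (intro card_mono subsetI)
    fix p assume "p \<in> (SIGMA v:{..<n}. set (adj ! v))"
    then obtain v u where p: "p = (v, u)" "v < n" "{u, v} \<in> E" using a(2) by auto
    then have "(v, u) \<in> set ?es \<or> (u, v) \<in> set ?es"
      using E[OF p(3)] by (fastforce simp: set_es insert_commute)
    then show "p \<in> set ?es \<union> prod.swap ` set ?es" using p(1) by force
  qed simp
  also have "\<dots> \<le> card (set ?es) + card (prod.swap ` set ?es)" by (rule card_Un_le)
  also have "\<dots> \<le> 2 * card E" using card_image_le[of "set ?es" prod.swap] distinct_card[OF d] len by simp
  finally show "(\<Sum>v<n. length (adj ! v)) \<le> 2 * card E" .
qed

text \<open>Turns bounds in \<open>n\<close> into bounds in the number of edges, since the claims on
  time and space do not mention \<open>n\<close>.\<close>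

lemma card_vertices_le:
  assumes "simple_graph {..<n} E" "connected_graph {..<n} E"
  shows "n \<le> card E + 1"
proof -
  have fin: "finite E" using assms(1) by (intro finite_subset[of E "Pow {..<n}"]) (auto simp: simple_graph_def)
  obtain T where T: "T \<subseteq> E" "tree {..<n} T"
    using spanning_tree[of "{..<n}" E] assms unfolding connected_graph_def simple_graph_def by fastforce
  then show ?thesis using treeD(5)[OF T(2)] card_mono[OF fin T(1)] by simp
qed

lemma wp_main:
  assumes g: "simple_graph {..<n} E" and con: "connected_graph {..<n} E"
    and adj: "adjacency_lists n E adj" and k: "2 \<le> k" "k \<le> n"
  shows "wp (n + 2 * card E) main (\<lambda>s. \<exists>Ts. op s = encode_output Ts \<and> lists_exactly_once Ts E k \<and>
    tm s \<le> 130 * card E + 80 * n + 70 + 1500 * k * card (k_subtrees E k)) (init_st (encode_input n k adj))"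
    and "card E \<le> card (k_subtrees E k) * k"
proof -
  let ?m = "card E" and ?N = "n + 2 * card E" and ?es = "es_upto adj n"
  let ?Q = "\<lambda>s. \<exists>Ts. op s = encode_output Ts \<and> lists_exactly_once Ts E k \<and>
    tm s \<le> 130 * card E + 80 * n + 70 + 1500 * k * card (k_subtrees E k)"
  let ?xs = "concat (map (\<lambda>l. length l # l) adj)"
  note ao = adjacent_order[OF g adj]
  have n: "2 \<le> n" using k by simp
  have N: "n < ?N" using card_vertices_le[OF g con] n by simp
  have es_lt: "u < v \<and> v < n" if "(v, u) \<in> set ?es" for v u using that ao(1) by auto
  have walks: "(u, v) \<in> walks E" if "u < n" "v < n" for u v
    using con that by (auto simp: connected_graph_def)
  \<comment> \<open>The bound on \<open>?m\<close> concerns the graph only, but its proof lives in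
    the locale, which is entered with the arrays of a state that has read the graph. So it travels
    along in the postcondition.\<close>
  have run: "wp ?N run_prog ?Q s \<and> ?m \<le> card (k_subtrees E k) * k"
    if s: "graph_read n k ?es s" "tm s \<le> 50 * ?m + 10 * n + 10" for s :: st
  proof -
    note A = arcs_Ls[OF n ao(3) es_lt s(1), unfolded ao(2,4)]
    interpret arcs n ?m "ar s AHead" "ar s ATwin" "Ls n ?es" by (rule A(1))
    have ed: "ed ` AR = E" using A(2,3) by simp
    have "wp ?N run_prog (\<lambda>s'. \<exists>Ts. op s' = op s @ encode_output Ts \<and>
      (\<forall>T\<in>set Ts. length T = k - 1) \<and> distinct (map edge_set Ts) \<and>
      set (map edge_set Ts) = k_subtrees E k \<and>
      tm s' \<le> tm s + 80 * ?m + 70 * n + 60 + 1500 * k * card (k_subtrees E k)) s"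
    proof (rule wp_run_prog[unfolded ed])
      show "links (ar s ANext, ar s APrev) AR" using A(2,4) by simp
    qed (use s(1) k N walks in \<open>simp_all add: graph_read_def\<close>)
    then have "wp ?N run_prog ?Q s"
    proof (rule wp_mono)
      fix s' :: st
      assume "\<exists>Ts. op s' = op s @ encode_output Ts \<and>
        (\<forall>T\<in>set Ts. length T = k - 1) \<and> distinct (map edge_set Ts) \<and>
        set (map edge_set Ts) = k_subtrees E k \<and>
        tm s' \<le> tm s + 80 * ?m + 70 * n + 60 + 1500 * k * card (k_subtrees E k)"
      then obtain Ts where Ts: "op s' = op s @ encode_output Ts"
        "\<forall>T\<in>set Ts. length T = k - 1" "distinct (map edge_set Ts)"
        "set (map edge_set Ts) = k_subtrees E k"
        "tm s' \<le> tm s + 80 * ?m + 70 * n + 60 + 1500 * k * card (k_subtrees E k)" by (elim exE conjE)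
      have "op s' = encode_output Ts" using Ts(1) s(1) by (simp add: graph_read_def)
      moreover have "lists_exactly_once Ts E k" using Ts(2-4) by (simp add: lists_exactly_once_def)
      moreover have "tm s' \<le> 130 * ?m + 80 * n + 70 + 1500 * k * card (k_subtrees E k)"
        using Ts(5) s(2) by linarith
      ultimately show "?Q s'" by (intro exI[of _ Ts] conjI)
    qed
    moreover have "?m \<le> card (k_subtrees E k) * k"
      using edges_le_solutions[unfolded ed, OF walks k] .
    ultimately show ?thesis ..
  qed
  let ?s1 = "(init_st (encode_input n k adj))\<lparr>rg := (\<lambda>_. 0)(RN := n, RL := k), ip := ?xs, tm := 2\<rparr>"
  let ?rest = "B (Mov RA RN) ;; B (Cst RI 0) ;; read_graph ;; run_prog"
  have eq: "wp ?N main Q (init_st (encode_input n k adj)) \<longleftrightarrow> wp ?N init_heads (wp ?N ?rest Q) ?s1" for Q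
    using k N by (simp add: main_def init_st_def encode_input_def eval_nat_numeral)
  have rest: "wp ?N ?rest (\<lambda>s. ?Q s \<and> ?m \<le> card (k_subtrees E k) * k) s2"
    if s2: "(\<forall>R. R \<noteq> RI \<longrightarrow> rg s2 R = rg ?s1 R) \<and>
    (\<forall>A. A \<notin> {ANext, APrev} \<longrightarrow> ar s2 A = ar ?s1 A) \<and>
    (\<forall>v<n. ar s2 ANext v = v \<and> ar s2 APrev v = v) \<and> ip s2 = ip ?s1 \<and> op s2 = op ?s1 \<and>
    tm s2 = tm ?s1 + 4 * n + 1" for s2 :: st
  proof -
    let ?s3 = "s2\<lparr>rg := (rg s2)(RA := n, RI := 0), tm := tm s2 + 2\<rparr>"
    have "wp ?N read_graph (\<lambda>s. graph_read n k ?es s \<and>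
      tm s \<le> tm ?s3 + 22 * (\<Sum>v<n. length (adj ! v)) + 5 * n + 1) ?s3"
    proof (rule wp_read_graph)
      show "graph_read n k [] ?s3"
        using s2 by (simp add: graph_read_def Ls_def init_st_def)
      show "n + 2 * length ?es \<le> ?N" using ao(4) by simp
      show "length adj = n" using adj by (simp add: adjacency_lists_def)
      show "set (adj ! v) \<subseteq> {..<n} \<and> length (adj ! v) \<le> ?N" if "v < n" for v
        using ao(6)[OF that] by auto
    qed (use s2 N in simp_all)
    then have "wp ?N read_graph (wp ?N run_prog (\<lambda>s. ?Q s \<and> ?m \<le> card (k_subtrees E k) * k)) ?s3"
    proof (rule wp_mono)
      fix s4 :: st
      assume s4: "graph_read n k ?es s4 \<and>
        tm s4 \<le> tm ?s3 + 22 * (\<Sum>v<n. length (adj ! v)) + 5 * n + 1"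
      have "tm ?s3 = 4 * n + 5" using s2 by simp
      then have "tm s4 \<le> 50 * ?m + 10 * n + 10" using s4 ao(5) by linarith
      with s4 have r: "wp ?N run_prog ?Q s4" "?m \<le> card (k_subtrees E k) * k" using run[of s4] by blast+
      then show "wp ?N run_prog (\<lambda>s. ?Q s \<and> ?m \<le> card (k_subtrees E k) * k) s4" by simp
    qed
    then show ?thesis using s2 by (simp add: eval_nat_numeral)
  qed
  have "wp ?N main (\<lambda>s. ?Q s \<and> ?m \<le> card (k_subtrees E k) * k) (init_st (encode_input n k adj))"
    unfolding eq by (rule wp_mono[OF wp_init_heads rest]) (use N in simp_all)
  then show "wp ?N main ?Q (init_st (encode_input n k adj))" "?m \<le> card (k_subtrees E k) * k"
    by (auto simp: wp_def)
qed

theorem theorem3p3: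
  shows "\<exists>(P :: instr list) (C\<^sub>t :: nat) (C\<^sub>s :: nat) (c :: nat).
    \<forall>(n :: nat) (E :: nat set set) (adj :: nat list list) (k :: nat).
      simple_graph {..<n} E \<longrightarrow> connected_graph {..<n} E \<longrightarrow> adjacency_lists n E adj \<longrightarrow>
      2 \<le> k \<longrightarrow> k \<le> n \<longrightarrow>
      (\<exists>Ts t.
         lists_exactly_once Ts E k \<and>
         ram_computes P (encode_input n k adj) (encode_output Ts) t (C\<^sub>s * card E) (n ^ c) \<and>
         t \<le> C\<^sub>t * (card (k_subtrees E k) * k))"
proof (rule exI[of _ "comp main 0 @ [Halt]"], rule exI[of _ 16000], rule exI[of _ 128],
    rule exI[of _ 9], intro allI impI)
  fix n k :: nat and E :: "nat set set" and adj :: "nat list list"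
  assume g: "simple_graph {..<n} E" and con: "connected_graph {..<n} E"
    and adj: "adjacency_lists n E adj" and k: "2 \<le> k" "k \<le> n"
  let ?m = "card E" and ?s = "card (k_subtrees E k)"
  have nm: "n \<le> ?m + 1" "2 \<le> n" using card_vertices_le[OF g con] k by simp_all
  have m2: "?m \<le> n ^ 2"
  proof -
    have "set (es_upto adj n) \<subseteq> {..<n} \<times> {..<n}" using adjacent_order(1)[OF g adj] by auto
    then have "card (set (es_upto adj n)) \<le> card ({..<n} \<times> {..<n})" by (intro card_mono) simp_all
    then show ?thesis
      using adjacent_order(3,4)[OF g adj] by (simp add: distinct_card power2_eq_square)
  qed
  note w = wp_main[OF g con adj k]
  from w(1) obtain s' Ts where r: "run (n + 2 * ?m) main (init_st (encode_input n k adj)) s'"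
    and Ts: "op s' = encode_output Ts" "lists_exactly_once Ts E k"
      "tm s' \<le> 130 * ?m + 80 * n + 70 + 1500 * k * ?s" by (auto simp: wp_def)
  \<comment> \<open>By \<open>n \<le> ?m + 1\<close> the left side is at most
    \<open>80 + 48 * ?m\<close>, and \<open>?m\<close> is positive. The word bound then uses
    \<open>128 = 2 ^ 7 \<le> n ^ 7\<close> and \<open>?m \<le> n ^ 2\<close>, whence the exponent
    9.\<close>
  have S: "64 + 16 * (n + 2 * ?m) \<le> 128 * ?m" using nm by (simp add: algebra_simps)
  also have "\<dots> \<le> 2 ^ 7 * n ^ 2" using m2 by simp
  also have "\<dots> \<le> n ^ 7 * n ^ 2" using nm(2) by (intro mult_mono power_mono) simp_all
  also have "\<dots> = n ^ 9" by (simp flip: power_add)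
  finally obtain t where t: "ram_computes (comp main 0 @ [Halt]) (encode_input n k adj) (op s') t (128 * ?m) (n ^ 9)"
    "t \<le> 8 * tm s'" using run_ram_computes[OF r S] by blast
  \<comment> \<open>A tick is worth at most 8 instructions, so with \<open>?m \<le> ?s * k\<close>
    the total is at most \<open>8 * 1860 = 14880\<close> times \<open>?s * k\<close>.\<close>
  have "tm s' \<le> 360 * ?m + 1500 * (?s * k)" using Ts(3) nm by (simp add: mult.commute mult.left_commute)
  then have "t \<le> 16000 * (?s * k)" using t(2) w(2) by linarith
  then show "\<exists>Ts t. lists_exactly_once Ts E k \<and>
    ram_computes (comp main 0 @ [Halt]) (encode_input n k adj) (encode_output Ts) t (128 * ?m) (n ^ 9) \<and>
    t \<le> 16000 * (?s * k)"
    using t(1) Ts(1,2) by (intro exI[of _ Ts] exI[of _ t]) simp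
qed

end
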